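(* Let $X$ be a locally compact Hausdorff space. The symmetric monoidal category $\mathbf{Hilb}_{C_0(X)}$ of Hilbert $C_0(X)$-modules and nonexpansive $C_0(X)$-linear maps is locale-based.
   Context: $C_0(X)$ is the commutative C*-algebra of continuous functions $X \to \mathbb{C}$ vanishing at infinity. A Hilbert $C_0(X)$-module is a $C_0(X)$-module $A$ with a map $\langle - \mid - \rangle \colon A \times A \to C_0(X)$ that is $C_0(X)$-linear in the second variable, satisfies $\langle a \mid b\rangle = \langle b \mid a \rangle^*$ and $\langle a \mid a \rangle \ge 0$ with equality only if $a=0$, and makes $A$ complete in the norm $\|a\|_A^2 = \sup_{x} \langle a \mid a \rangle(x)$. A map $f \colon A \to B$ is nonexpansive when $\|f(a)\|_B \le \|a\|_A$ for all $a$. The tensor product $A \otimes B$ is the completion of the algebraic tensor product of $C_0(X)$-modules to a Hilbert module with $\langle a \otimes b \mid a' \otimes b'\rangle = \langle a \mid a'\rangle \langle b \mid b'\rangle$; the tensor unit is $C_0(X)$ with $\langle f \mid g\rangle(x) = f(x)^* g(x)$. Let $\mathbf{C}$ be braided monoidal with tensor unit $I$; an object name also denotes its identity morphism. A subunit is a subobject $s \colon S \rightarrowtail I$ such that $s \otimes S \colon S \otimes S \to I \otimes S$ is an isomorphism; $\mathrm{ISub}(\mathbf{C})$ is the collection of subunits, ordered as subobjects. Coherence isomorphisms are suppressed, so $s \otimes A$ also denotes the map $S \otimes A \to A$. $\mathbf{C}$ is stiff when for all objects $A$ and subunits $s,t$ the square with top $s \otimes T \otimes A \colon S \otimes T \otimes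 A \to T \otimes A$, left $S \otimes t \otimes A \colon S \otimes T \otimes A \to S \otimes A$, right $t \otimes A \colon T \otimes A \to A$ and bottom $s \otimes A \colon S \otimes A \to A$ is a pullback of monomorphisms. In a stiff category subunits form a meet-semilattice with $s \wedge t = \lambda_I \circ (s \otimes t)$. For $U \subseteq \mathrm{ISub}(\mathbf{C})$ and an object $A$, $D(U,A)$ is the diagram of objects $S \otimes A$ for $s \in U$ and all morphisms $f \colon S \otimes A \to T \otimes A$ with $(t \otimes A) \circ f = s \otimes A$. $U$ is idempotent when $U = \{ s \wedge t \mid s,t \in U\}$. $\mathbf{C}$ is locale-based when it is stiff, $\mathrm{ISub}(\mathbf{C})$ is a frame, and the canonical maps $S \otimes A \to (\bigvee U) \otimes A$ form a colimit of $D(U,A)$ for each idempotent $U \subseteq \mathrm{ISub}(\mathbf{C})$ and each object $A$ (here $(\bigvee U) \otimes A$ denotes the domain of the subunit $\bigvee U$ tensored with $A$). *)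

theory Defs
  imports "HOL-Analysis.Analysis" "HOL-Algebra.Group"
begin

section \<open>Braided and symmetric monoidal categories\<close>

text \<open>Composition, identities and the structure maps are total functions on the arrow and object
  types; only their values on objects and (composable) arrows of the category matter.\<close>

record ('o, 'm) braided_cat =
  Obj :: "'o set"
  Arr :: "'m set"
  Dom :: "'m \<Rightarrow> 'o"
  Cod :: "'m \<Rightarrow> 'o"
  Id :: "'o \<Rightarrow> 'm"
  Comp :: "'m \<Rightarrow> 'm \<Rightarrow> 'm"  (infixr "\<cdot>\<index>" 55)
  TenO :: "'o \<Rightarrow> 'o \<Rightarrow> 'o"  (infixr "\<otimes>\<^sub>o\<index>" 70)
  TenA :: "'m \<Rightarrow> 'm \<Rightarrow> 'm"  (infixr "\<otimes>\<^sub>a\<index>" 70)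
  Unit :: "'o"
  Assoc :: "'o \<Rightarrow> 'o \<Rightarrow> 'o \<Rightarrow> 'm"
  LUnit :: "'o \<Rightarrow> 'm"
  RUnit :: "'o \<Rightarrow> 'm"
  Braid :: "'o \<Rightarrow> 'o \<Rightarrow> 'm"

definition homs :: "('o, 'm) braided_cat \<Rightarrow> 'o \<Rightarrow> 'o \<Rightarrow> 'm set" where
  "homs C A B = {f \<in> Arr C. Dom C f = A \<and> Cod C f = B}"

definition is_inverse :: "('o, 'm) braided_cat \<Rightarrow> 'm \<Rightarrow> 'm \<Rightarrow> bool" where
  "is_inverse C f g \<longleftrightarrow> g \<in> homs C (Cod C f) (Dom C f)
     \<and> Comp C g f = Id C (Dom C f) \<and> Comp C f g = Id C (Cod C f)"

definition is_iso :: "('o, 'm) braided_cat \<Rightarrow> 'm \<Rightarrow> bool" where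
  "is_iso C f \<longleftrightarrow> f \<in> Arr C \<and> (\<exists>g. is_inverse C f g)"

definition Inv :: "('o, 'm) braided_cat \<Rightarrow> 'm \<Rightarrow> 'm" where
  "Inv C f = (THE g. is_inverse C f g)"

definition is_mono :: "('o, 'm) braided_cat \<Rightarrow> 'm \<Rightarrow> bool" where
  "is_mono C f \<longleftrightarrow> f \<in> Arr C \<and>
     (\<forall>Z\<in>Obj C. \<forall>g\<in>homs C Z (Dom C f). \<forall>h\<in>homs C Z (Dom C f).
        Comp C f g = Comp C f h \<longrightarrow> g = h)"

locale category =
  fixes C :: "('o, 'm) braided_cat" (structure)
  assumes dom_cod: "f \<in> Arr C \<Longrightarrow> Dom C f \<in> Obj C \<and> Cod C f \<in> Obj C"
    and id_hom: "A \<in> Obj C \<Longrightarrow> Id C A \<in> homs C A A"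
    and comp_hom: "\<lbrakk>f \<in> homs C A B; g \<in> homs C B D\<rbrakk> \<Longrightarrow> g \<cdot> f \<in> homs C A D"
    and id_left: "f \<in> homs C A B \<Longrightarrow> Id C B \<cdot> f = f"
    and id_right: "f \<in> homs C A B \<Longrightarrow> f \<cdot> Id C A = f"
    and comp_assoc: "\<lbrakk>f \<in> homs C A B; g \<in> homs C B D; h \<in> homs C D E\<rbrakk>
      \<Longrightarrow> (h \<cdot> g) \<cdot> f = h \<cdot> (g \<cdot> f)"

locale monoidal_category = category +
  assumes unit_obj: "Unit C \<in> Obj C"
    and ten_obj: "\<lbrakk>A \<in> Obj C; B \<in> Obj C\<rbrakk> \<Longrightarrow> A \<otimes>\<^sub>o B \<in> Obj C"
    and ten_hom: "\<lbrakk>f \<in> homs C A A'; g \<in> homs C B B'\<rbrakk>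
      \<Longrightarrow> f \<otimes>\<^sub>a g \<in> homs C (A \<otimes>\<^sub>o B) (A' \<otimes>\<^sub>o B')"
    and ten_id: "\<lbrakk>A \<in> Obj C; B \<in> Obj C\<rbrakk> \<Longrightarrow> Id C A \<otimes>\<^sub>a Id C B = Id C (A \<otimes>\<^sub>o B)"
    and ten_comp: "\<lbrakk>f \<in> homs C A A'; f' \<in> homs C A' A''; g \<in> homs C B B'; g' \<in> homs C B' B''\<rbrakk>
      \<Longrightarrow> (f' \<cdot> f) \<otimes>\<^sub>a (g' \<cdot> g) = (f' \<otimes>\<^sub>a g') \<cdot> (f \<otimes>\<^sub>a g)"
    and assoc_hom: "\<lbrakk>A \<in> Obj C; B \<in> Obj C; D \<in> Obj C\<rbrakk>
      \<Longrightarrow> Assoc C A B D \<in> homs C ((A \<otimes>\<^sub>o B) \<otimes>\<^sub>o D) (A \<otimes>\<^sub>o (B \<otimes>\<^sub>o D)) \<and> is_iso C (Assoc C A B D)"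
    and assoc_nat: "\<lbrakk>f \<in> homs C A A'; g \<in> homs C B B'; h \<in> homs C D D'\<rbrakk>
      \<Longrightarrow> Assoc C A' B' D' \<cdot> ((f \<otimes>\<^sub>a g) \<otimes>\<^sub>a h) = (f \<otimes>\<^sub>a (g \<otimes>\<^sub>a h)) \<cdot> Assoc C A B D"
    and lunit_hom: "A \<in> Obj C \<Longrightarrow> LUnit C A \<in> homs C (Unit C \<otimes>\<^sub>o A) A \<and> is_iso C (LUnit C A)"
    and lunit_nat: "f \<in> homs C A A'
      \<Longrightarrow> LUnit C A' \<cdot> (Id C (Unit C) \<otimes>\<^sub>a f) = f \<cdot> LUnit C A"
    and runit_hom: "A \<in> Obj C \<Longrightarrow> RUnit C A \<in> homs C (A \<otimes>\<^sub>o Unit C) A \<and> is_iso C (RUnit C A)"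
    and runit_nat: "f \<in> homs C A A'
      \<Longrightarrow> RUnit C A' \<cdot> (f \<otimes>\<^sub>a Id C (Unit C)) = f \<cdot> RUnit C A"
    and pentagon: "\<lbrakk>A \<in> Obj C; B \<in> Obj C; D \<in> Obj C; E \<in> Obj C\<rbrakk>
      \<Longrightarrow> Assoc C A B (D \<otimes>\<^sub>o E) \<cdot> Assoc C (A \<otimes>\<^sub>o B) D E
        = (Id C A \<otimes>\<^sub>a Assoc C B D E) \<cdot> Assoc C A (B \<otimes>\<^sub>o D) E \<cdot> (Assoc C A B D \<otimes>\<^sub>a Id C E)"
    and triangle: "\<lbrakk>A \<in> Obj C; B \<in> Obj C\<rbrakk>
      \<Longrightarrow> (Id C A \<otimes>\<^sub>a LUnit C B) \<cdot> Assoc C A (Unit C) B = RUnit C A \<otimes>\<^sub>a Id C B"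

locale braided_monoidal_category = monoidal_category +
  assumes braid_hom: "\<lbrakk>A \<in> Obj C; B \<in> Obj C\<rbrakk>
      \<Longrightarrow> Braid C A B \<in> homs C (A \<otimes>\<^sub>o B) (B \<otimes>\<^sub>o A) \<and> is_iso C (Braid C A B)"
    and braid_nat: "\<lbrakk>f \<in> homs C A A'; g \<in> homs C B B'\<rbrakk>
      \<Longrightarrow> Braid C A' B' \<cdot> (f \<otimes>\<^sub>a g) = (g \<otimes>\<^sub>a f) \<cdot> Braid C A B"
    and hexagon1: "\<lbrakk>A \<in> Obj C; B \<in> Obj C; D \<in> Obj C\<rbrakk>
      \<Longrightarrow> Assoc C B D A \<cdot> Braid C A (B \<otimes>\<^sub>o D) \<cdot> Assoc C A B D
        = (Id C B \<otimes>\<^sub>a Braid C A D) \<cdot> Assoc C B A D \<cdot> (Braid C A B \<otimes>\<^sub>a Id C D)"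
    and hexagon2: "\<lbrakk>A \<in> Obj C; B \<in> Obj C; D \<in> Obj C\<rbrakk>
      \<Longrightarrow> Inv C (Assoc C D A B) \<cdot> Braid C (A \<otimes>\<^sub>o B) D \<cdot> Inv C (Assoc C A B D)
        = (Braid C A D \<otimes>\<^sub>a Id C B) \<cdot> Inv C (Assoc C A D B) \<cdot> (Id C A \<otimes>\<^sub>a Braid C B D)"

locale symmetric_monoidal_category = braided_monoidal_category +
  assumes braid_sym: "\<lbrakk>A \<in> Obj C; B \<in> Obj C\<rbrakk>
      \<Longrightarrow> Braid C B A \<cdot> Braid C A B = Id C (A \<otimes>\<^sub>o B)"


section \<open>Subunits\<close>

definition sub_le :: "('o, 'm) braided_cat \<Rightarrow> 'm \<Rightarrow> 'm \<Rightarrow> bool" where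
  "sub_le C s t \<longleftrightarrow> (\<exists>m\<in>homs C (Dom C s) (Dom C t). Comp C t m = s)"

definition subobject :: "('o, 'm) braided_cat \<Rightarrow> 'm \<Rightarrow> 'm set" where
  "subobject C s = {t. is_mono C t \<and> Cod C t = Cod C s \<and> sub_le C s t \<and> sub_le C t s}"

text \<open>A monomorphism representing a subunit. The condition only depends on the subobject that
  \<open>s\<close> represents.\<close>

definition subunit :: "('o, 'm) braided_cat \<Rightarrow> 'm \<Rightarrow> bool" where
  "subunit C s \<longleftrightarrow> is_mono C s \<and> Cod C s = Unit C \<and> is_iso C (TenA C s (Id C (Dom C s)))"

definition ISub :: "('o, 'm) braided_cat \<Rightarrow> 'm set set" where
  "ISub C = {subobject C s | s. subunit C s}"

definition rep :: "'m set \<Rightarrow> 'm" where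
  "rep P = (SOME s. s \<in> P)"

definition ISub_order :: "('o, 'm) braided_cat \<Rightarrow> 'm set gorder" where
  "ISub_order C =
     \<lparr>carrier = ISub C, eq = (=), le = (\<lambda>P Q. sub_le C (rep P) (rep Q))\<rparr>"

definition wedge :: "('o, 'm) braided_cat \<Rightarrow> 'm set \<Rightarrow> 'm set \<Rightarrow> 'm set" where
  "wedge C P Q = subobject C (Comp C (LUnit C (Unit C)) (TenA C (rep P) (rep Q)))"

definition idem :: "('o, 'm) braided_cat \<Rightarrow> 'm set set \<Rightarrow> bool" where
  "idem C U \<longleftrightarrow> U = {wedge C P Q | P Q. P \<in> U \<and> Q \<in> U}"

text \<open>The map \<open>s \<otimes> A : S \<otimes> A \<rightarrow> A\<close>, with the coherence isomorphism \<open>I \<otimes> A \<rightarrow> A\<close> made explicit.\<close>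

definition restr :: "('o, 'm) braided_cat \<Rightarrow> 'm \<Rightarrow> 'o \<Rightarrow> 'm" where
  "restr C s A = Comp C (LUnit C A) (TenA C s (Id C A))"


section \<open>Stiff and locale-based categories\<close>

text \<open>The square with top \<open>p\<close>, left \<open>q\<close>, right \<open>f\<close> and bottom \<open>g\<close>.\<close>

definition is_pullback :: "('o, 'm) braided_cat \<Rightarrow> 'm \<Rightarrow> 'm \<Rightarrow> 'm \<Rightarrow> 'm \<Rightarrow> bool" where
  "is_pullback C p q f g \<longleftrightarrow>
     p \<in> homs C (Dom C q) (Dom C f) \<and> q \<in> homs C (Dom C p) (Dom C g) \<and>
     f \<in> homs C (Cod C p) (Cod C g) \<and> g \<in> homs C (Cod C q) (Cod C f) \<and>
     Comp C f p = Comp C g q \<and>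
     (\<forall>Z\<in>Obj C. \<forall>u\<in>homs C Z (Dom C f). \<forall>v\<in>homs C Z (Dom C g). Comp C f u = Comp C g v \<longrightarrow>
        (\<exists>!h. h \<in> homs C Z (Dom C p) \<and> Comp C p h = u \<and> Comp C q h = v))"

definition stiff :: "('o, 'm) braided_cat \<Rightarrow> bool" where
  "stiff C \<longleftrightarrow> (\<forall>A\<in>Obj C. \<forall>s t. subunit C s \<longrightarrow> subunit C t \<longrightarrow>
     (let p = restr C s (TenO C (Dom C t) A);
          q = TenA C (Id C (Dom C s)) (restr C t A);
          f = restr C t A;
          g = restr C s A
      in is_mono C p \<and> is_mono C q \<and> is_mono C f \<and> is_mono C g \<and> is_pullback C p q f g))"

definition frame :: "('a, 'b) gorder_scheme \<Rightarrow> bool" where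
  "frame L \<longleftrightarrow> Complete_Lattice.complete_lattice L \<and>
     (\<forall>x\<in>carrier L. \<forall>U\<subseteq>carrier L.
        x \<sqinter>\<^bsub>L\<^esub> (\<Squnion>\<^bsub>L\<^esub> U) = \<Squnion>\<^bsub>L\<^esub> ((\<lambda>u. x \<sqinter>\<^bsub>L\<^esub> u) ` U))"

text \<open>A diagram is given by an index set \<open>J\<close>, an object \<open>D j\<close> for each index, and sets \<open>E i j\<close> of
  arrows from \<open>D i\<close> to \<open>D j\<close>.\<close>

definition is_cocone :: "('o, 'm) braided_cat \<Rightarrow> 'j set \<Rightarrow> ('j \<Rightarrow> 'o) \<Rightarrow> ('j \<Rightarrow> 'j \<Rightarrow> 'm set)
    \<Rightarrow> 'o \<Rightarrow> ('j \<Rightarrow> 'm) \<Rightarrow> bool" where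
  "is_cocone C J D E Z c \<longleftrightarrow> Z \<in> Obj C \<and> (\<forall>j\<in>J. c j \<in> homs C (D j) Z) \<and>
     (\<forall>i\<in>J. \<forall>j\<in>J. \<forall>f\<in>E i j. Comp C (c j) f = c i)"

definition is_colimit :: "('o, 'm) braided_cat \<Rightarrow> 'j set \<Rightarrow> ('j \<Rightarrow> 'o) \<Rightarrow> ('j \<Rightarrow> 'j \<Rightarrow> 'm set)
    \<Rightarrow> 'o \<Rightarrow> ('j \<Rightarrow> 'm) \<Rightarrow> bool" where
  "is_colimit C J D E K c \<longleftrightarrow> is_cocone C J D E K c \<and>
     (\<forall>Z b. is_cocone C J D E Z b \<longrightarrow>
        (\<exists>!h. h \<in> homs C K Z \<and> (\<forall>j\<in>J. Comp C h (c j) = b j)))"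

text \<open>The diagram \<open>D(U, A)\<close>, indexed by \<open>U\<close>.\<close>

definition D_obj :: "('o, 'm) braided_cat \<Rightarrow> 'o \<Rightarrow> 'm set \<Rightarrow> 'o" where
  "D_obj C A P = TenO C (Dom C (rep P)) A"

definition D_arr :: "('o, 'm) braided_cat \<Rightarrow> 'o \<Rightarrow> 'm set \<Rightarrow> 'm set \<Rightarrow> 'm set" where
  "D_arr C A P Q = {f \<in> homs C (D_obj C A P) (D_obj C A Q).
     Comp C (restr C (rep Q) A) f = restr C (rep P) A}"

text \<open>For \<open>P \<le> Q\<close>, the inclusion of the representing object of \<open>P\<close> in that of \<open>Q\<close>.\<close>

definition sub_incl :: "('o, 'm) braided_cat \<Rightarrow> 'm set \<Rightarrow> 'm set \<Rightarrow> 'm" where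
  "sub_incl C P Q =
     (THE m. m \<in> homs C (Dom C (rep P)) (Dom C (rep Q)) \<and> Comp C (rep Q) m = rep P)"

locale locale_based = braided_monoidal_category +
  assumes is_stiff: "stiff C"
    and is_frame: "frame (ISub_order C)"
    and is_colim: "\<lbrakk>U \<subseteq> ISub C; idem C U; A \<in> Obj C\<rbrakk> \<Longrightarrow>
      is_colimit C U (D_obj C A) (D_arr C A)
        (D_obj C A (\<Squnion>\<^bsub>ISub_order C\<^esub> U))
        (\<lambda>P. sub_incl C P (\<Squnion>\<^bsub>ISub_order C\<^esub> U) \<otimes>\<^sub>a Id C A)"


section \<open>Hilbert modules over \<open>C\<^sub>0(X)\<close>\<close>

text \<open>Functions on the space are represented as functions on the type that are zero off
  \<^term>\<open>topspace X\<close>.\<close>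

definition C0 :: "'x topology \<Rightarrow> ('x \<Rightarrow> complex) set" where
  "C0 X = {f. continuous_map X euclidean f \<and>
              (\<forall>e>0. \<exists>K. compactin X K \<and> (\<forall>x\<in>topspace X - K. norm (f x) < e)) \<and>
              (\<forall>x. x \<notin> topspace X \<longrightarrow> f x = 0)}"

record ('a, 'x) hmod = "'a partial_object" +
  hzero :: 'a
  hadd :: "'a \<Rightarrow> 'a \<Rightarrow> 'a"
  hscale :: "complex \<Rightarrow> 'a \<Rightarrow> 'a"
  hact :: "('x \<Rightarrow> complex) \<Rightarrow> 'a \<Rightarrow> 'a"
  hinner :: "'a \<Rightarrow> 'a \<Rightarrow> 'x \<Rightarrow> complex"

text \<open>The square root of the supremum of a nonnegative function in \<open>C\<^sub>0(X)\<close>. The supremum runs over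
  the whole (nonempty) type; the values off \<^term>\<open>topspace X\<close> are zero, so this also is the right
  value when the space is empty.\<close>

definition sup_root :: "('x \<Rightarrow> complex) \<Rightarrow> real" where
  "sup_root h = sqrt (SUP x. Re (h x))"

definition hnorm :: "('a, 'x) hmod \<Rightarrow> 'a \<Rightarrow> real" where
  "hnorm A a = sup_root (hinner A a a)"

text \<open>The locale \<^locale>\<open>Metric_space\<close> wants a distance that is symmetric on the whole type.\<close>

definition hdist :: "('a, 'x) hmod \<Rightarrow> 'a \<Rightarrow> 'a \<Rightarrow> real" where
  "hdist A a b = (if a \<in> carrier A \<and> b \<in> carrier A
                  then hnorm A (hadd A a (hscale A (-1) b)) else 0)"

text \<open>Modules over the algebra \<open>C\<^sub>0(X)\<close>, which need not have a unit, carry a compatible complex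
  vector space structure.\<close>

locale hilbert_module =
  fixes X :: "'x topology" and A :: "('a, 'x) hmod"
  assumes add_group: "comm_group \<lparr>carrier = carrier A, mult = hadd A, one = hzero A\<rparr>"
    and scale_closed: "a \<in> carrier A \<Longrightarrow> hscale A c a \<in> carrier A"
    and scale_one: "a \<in> carrier A \<Longrightarrow> hscale A 1 a = a"
    and scale_mult: "a \<in> carrier A \<Longrightarrow> hscale A (c * d) a = hscale A c (hscale A d a)"
    and scale_add_left: "a \<in> carrier A
      \<Longrightarrow> hscale A (c + d) a = hadd A (hscale A c a) (hscale A d a)"
    and scale_add_right: "\<lbrakk>a \<in> carrier A; b \<in> carrier A\<rbrakk>
      \<Longrightarrow> hscale A c (hadd A a b) = hadd A (hscale A c a) (hscale A c b)"
    and act_closed: "\<lbrakk>f \<in> C0 X; a \<in> carrier A\<rbrakk> \<Longrightarrow> hact A f a \<in> carrier A"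
    and act_mult: "\<lbrakk>f \<in> C0 X; g \<in> C0 X; a \<in> carrier A\<rbrakk>
      \<Longrightarrow> hact A (\<lambda>x. f x * g x) a = hact A f (hact A g a)"
    and act_add_left: "\<lbrakk>f \<in> C0 X; g \<in> C0 X; a \<in> carrier A\<rbrakk>
      \<Longrightarrow> hact A (\<lambda>x. f x + g x) a = hadd A (hact A f a) (hact A g a)"
    and act_add_right: "\<lbrakk>f \<in> C0 X; a \<in> carrier A; b \<in> carrier A\<rbrakk>
      \<Longrightarrow> hact A f (hadd A a b) = hadd A (hact A f a) (hact A f b)"
    and act_scale_left: "\<lbrakk>f \<in> C0 X; a \<in> carrier A\<rbrakk>
      \<Longrightarrow> hact A (\<lambda>x. c * f x) a = hscale A c (hact A f a)"
    and act_scale_right: "\<lbrakk>f \<in> C0 X; a \<in> carrier A\<rbrakk>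
      \<Longrightarrow> hact A f (hscale A c a) = hscale A c (hact A f a)"
    and inner_closed: "\<lbrakk>a \<in> carrier A; b \<in> carrier A\<rbrakk> \<Longrightarrow> hinner A a b \<in> C0 X"
    and inner_add: "\<lbrakk>a \<in> carrier A; b \<in> carrier A; b' \<in> carrier A\<rbrakk>
      \<Longrightarrow> hinner A a (hadd A b b') = (\<lambda>x. hinner A a b x + hinner A a b' x)"
    and inner_scale: "\<lbrakk>a \<in> carrier A; b \<in> carrier A\<rbrakk>
      \<Longrightarrow> hinner A a (hscale A c b) = (\<lambda>x. c * hinner A a b x)"
    and inner_act: "\<lbrakk>f \<in> C0 X; a \<in> carrier A; b \<in> carrier A\<rbrakk>
      \<Longrightarrow> hinner A a (hact A f b) = (\<lambda>x. f x * hinner A a b x)"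
    and inner_adj: "\<lbrakk>a \<in> carrier A; b \<in> carrier A\<rbrakk>
      \<Longrightarrow> hinner A a b = (\<lambda>x. cnj (hinner A b a x))"
    and inner_nonneg: "a \<in> carrier A \<Longrightarrow> hinner A a a x \<in> \<real>\<^sub>\<ge>\<^sub>0"
    and inner_zero: "\<lbrakk>a \<in> carrier A; hinner A a a = (\<lambda>x. 0)\<rbrakk> \<Longrightarrow> a = hzero A"
    and complete: "Metric_space.mcomplete (carrier A) (hdist A)"


section \<open>The tensor product of Hilbert modules\<close>

text \<open>All modules have to live in one type that is closed under tensor products. The elements of
  the type below are elements of an arbitrary type \<open>'v\<close>, functions on the space (which make up the
  tensor unit) and sequences of formal finite sums of pairs (which make up the completed tensor
  products). Every Hilbert module on a type \<open>'v\<close> has an isomorphic copy with elements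
  \<open>Atom v\<close>.\<close>

datatype ('v, 'x) elt =
    Atom 'v
  | Fun "'x \<Rightarrow> complex"
  | Seq (seq_of: "nat \<Rightarrow> (('v, 'x) elt \<times> ('v, 'x) elt) list")

primrec fun_of :: "('v, 'x) elt \<Rightarrow> 'x \<Rightarrow> complex" where
  "fun_of (Fun f) = f"

type_synonym ('v, 'x) hobj = "(('v, 'x) elt, 'x) hmod"

text \<open>The list \<open>[(a\<^sub>1, b\<^sub>1), \<dots>, (a\<^sub>k, b\<^sub>k)]\<close> stands for the element \<open>\<Sum>\<^sub>i a\<^sub>i \<otimes> b\<^sub>i\<close> of the algebraic
  tensor product. Formal sums that are equal there have distance zero, so that the algebraic tensor
  product and the space of formal sums have the same completion.\<close>

definition fsums :: "('a, 'x) hmod \<Rightarrow> ('b, 'x) hmod \<Rightarrow> ('a \<times> 'b) list set" where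
  "fsums A B = lists (carrier A \<times> carrier B)"

definition fscale :: "('a, 'x) hmod \<Rightarrow> complex \<Rightarrow> ('a \<times> 'b) list \<Rightarrow> ('a \<times> 'b) list" where
  "fscale A c u = map (\<lambda>(a, b). (hscale A c a, b)) u"

definition fact_on :: "('a, 'x) hmod \<Rightarrow> ('x \<Rightarrow> complex) \<Rightarrow> ('a \<times> 'b) list \<Rightarrow> ('a \<times> 'b) list" where
  "fact_on A f u = map (\<lambda>(a, b). (hact A f a, b)) u"

definition finner :: "('a, 'x) hmod \<Rightarrow> ('b, 'x) hmod \<Rightarrow> ('a \<times> 'b) list \<Rightarrow> ('a \<times> 'b) list
    \<Rightarrow> 'x \<Rightarrow> complex" where
  "finner A B u v x =
     (\<Sum>(a, b)\<leftarrow>u. \<Sum>(a', b')\<leftarrow>v. hinner A a a' x * hinner B b b' x)"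

definition fdist :: "('a, 'x) hmod \<Rightarrow> ('b, 'x) hmod \<Rightarrow> ('a \<times> 'b) list \<Rightarrow> ('a \<times> 'b) list \<Rightarrow> real" where
  "fdist A B u v = (let d = u @ fscale A (-1) v in sup_root (finner A B d d))"

definition fcauchy :: "('a, 'x) hmod \<Rightarrow> ('b, 'x) hmod \<Rightarrow> (nat \<Rightarrow> ('a \<times> 'b) list) set" where
  "fcauchy A B = {p. (\<forall>n. p n \<in> fsums A B) \<and>
     (\<forall>e>0. \<exists>N. \<forall>m\<ge>N. \<forall>n\<ge>N. fdist A B (p m) (p n) < e)}"

text \<open>A chosen representative of the class of \<open>p\<close> in the completion.\<close>

definition fcanon :: "('a, 'x) hmod \<Rightarrow> ('b, 'x) hmod \<Rightarrow> (nat \<Rightarrow> ('a \<times> 'b) list)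
    \<Rightarrow> (nat \<Rightarrow> ('a \<times> 'b) list)" where
  "fcanon A B p =
     (SOME q. q \<in> fcauchy A B \<and> (\<lambda>n. fdist A B (p n) (q n)) \<longlonglongrightarrow> 0)"

definition tensor :: "('v, 'x) hobj \<Rightarrow> ('v, 'x) hobj \<Rightarrow> ('v, 'x) hobj" where
  "tensor A B =
    \<lparr>carrier = {Seq (fcanon A B p) | p. p \<in> fcauchy A B},
     hzero = Seq (fcanon A B (\<lambda>n. [])),
     hadd = (\<lambda>z w. Seq (fcanon A B (\<lambda>n. seq_of z n @ seq_of w n))),
     hscale = (\<lambda>c z. Seq (fcanon A B (\<lambda>n. fscale A c (seq_of z n)))),
     hact = (\<lambda>f z. Seq (fcanon A B (\<lambda>n. fact_on A f (seq_of z n)))),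
     hinner = (\<lambda>z w x. lim (\<lambda>n. finner A B (seq_of z n) (seq_of w n) x))\<rparr>"

definition pure :: "('v, 'x) hobj \<Rightarrow> ('v, 'x) hobj \<Rightarrow> ('v, 'x) elt \<Rightarrow> ('v, 'x) elt \<Rightarrow> ('v, 'x) elt" where
  "pure A B a b = Seq (fcanon A B (\<lambda>n. [(a, b)]))"

definition tensor_unit :: "'x topology \<Rightarrow> ('v, 'x) hobj" where
  "tensor_unit X =
    \<lparr>carrier = Fun ` C0 X,
     hzero = Fun (\<lambda>x. 0),
     hadd = (\<lambda>f g. Fun (\<lambda>x. fun_of f x + fun_of g x)),
     hscale = (\<lambda>c f. Fun (\<lambda>x. c * fun_of f x)),
     hact = (\<lambda>h f. Fun (\<lambda>x. h x * fun_of f x)),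
     hinner = (\<lambda>f g x. cnj (fun_of f x) * fun_of g x)\<rparr>"


section \<open>The category of Hilbert modules\<close>

record ('v, 'x) harr =
  hdom :: "('v, 'x) hobj"
  hcod :: "('v, 'x) hobj"
  hmap :: "('v, 'x) elt \<Rightarrow> ('v, 'x) elt"

definition hhom :: "'x topology \<Rightarrow> ('v, 'x) hobj \<Rightarrow> ('v, 'x) hobj \<Rightarrow> ('v, 'x) harr set" where
  "hhom X A B = {F. hdom F = A \<and> hcod F = B \<and>
     hmap F \<in> carrier A \<rightarrow>\<^sub>E carrier B \<and>
     (\<forall>a\<in>carrier A. \<forall>b\<in>carrier A. hmap F (hadd A a b) = hadd B (hmap F a) (hmap F b)) \<and>
     (\<forall>c. \<forall>a\<in>carrier A. hmap F (hscale A c a) = hscale B c (hmap F a)) \<and>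
     (\<forall>f\<in>C0 X. \<forall>a\<in>carrier A. hmap F (hact A f a) = hact B f (hmap F a)) \<and>
     (\<forall>a\<in>carrier A. hnorm B (hmap F a) \<le> hnorm A a)}"

text \<open>The structure maps are the unique morphisms with the following values on pure tensors.\<close>

definition Hilb :: "'x topology \<Rightarrow> (('v, 'x) hobj, ('v, 'x) harr) braided_cat" where
  "Hilb X =
    \<lparr>Obj = {A. hilbert_module X A},
     Arr = {F. hilbert_module X (hdom F) \<and> hilbert_module X (hcod F) \<and> F \<in> hhom X (hdom F) (hcod F)},
     Dom = hdom,
     Cod = hcod,
     Id = (\<lambda>A. \<lparr>hdom = A, hcod = A, hmap = restrict (\<lambda>a. a) (carrier A)\<rparr>),
     Comp = (\<lambda>G F. \<lparr>hdom = hdom F, hcod = hcod G, hmap = compose (carrier (hdom F)) (hmap G) (hmap F)\<rparr>),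
     TenO = tensor,
     TenA = (\<lambda>F G. THE H. H \<in> hhom X (tensor (hdom F) (hdom G)) (tensor (hcod F) (hcod G)) \<and>
       (\<forall>a\<in>carrier (hdom F). \<forall>b\<in>carrier (hdom G).
          hmap H (pure (hdom F) (hdom G) a b) = pure (hcod F) (hcod G) (hmap F a) (hmap G b))),
     Unit = tensor_unit X,
     Assoc = (\<lambda>A B D. THE H. H \<in> hhom X (tensor (tensor A B) D) (tensor A (tensor B D)) \<and>
       (\<forall>a\<in>carrier A. \<forall>b\<in>carrier B. \<forall>d\<in>carrier D.
          hmap H (pure (tensor A B) D (pure A B a b) d) = pure A (tensor B D) a (pure B D b d))),
     LUnit = (\<lambda>A. THE H. H \<in> hhom X (tensor (tensor_unit X) A) A \<and>
       (\<forall>f\<in>C0 X. \<forall>a\<in>carrier A. hmap H (pure (tensor_unit X) A (Fun f) a) = hact A f a)),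
     RUnit = (\<lambda>A. THE H. H \<in> hhom X (tensor A (tensor_unit X)) A \<and>
       (\<forall>a\<in>carrier A. \<forall>f\<in>C0 X. hmap H (pure A (tensor_unit X) a (Fun f)) = hact A f a)),
     Braid = (\<lambda>A B. THE H. H \<in> hhom X (tensor A B) (tensor B A) \<and>
       (\<forall>a\<in>carrier A. \<forall>b\<in>carrier B. hmap H (pure A B a b) = pure B A b a))\<rparr>"

end

theory Submission
  imports Defs
begin

text \<open>
  Monoidal structure, subunits and colimits are all governed by inequalities in the algebra \<open>C\<^sub>0(X)\<close>
  that can be checked pointwise. For an element \<open>a\<close> of a Hilbert module
  let \<open>\<bar>a\<bar>\<close> be the function \<open>x \<mapsto> \<langle>a, a\<rangle>(x)\<^sup>1\<^sup>/\<^sup>2\<close> (\<open>ptnorm\<close>). Two facts reduce the theory to inequalities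
  between such functions. A nonexpansive \<open>C\<^sub>0(X)\<close>-linear map satisfies \<open>\<bar>F a\<bar> \<le> \<bar>a\<bar>\<close> at every point
  (\<open>hhom_ptnorm_le\<close>). Conversely, a submodule of \<open>A \<times> Z\<close> with dense domain on which \<open>\<bar>z\<bar> \<le> \<bar>a\<bar>\<close>
  holds pointwise is the restriction of the graph of a unique morphism (\<open>hhom_extension\<close>).

  \<^bold>\<open>The monoidal structure.\<close> The square norm of a formal sum of pure tensors is the entry sum of the
  entrywise product of two Gram matrices, hence nonnegative by Schur's theorem (\<open>Schur_product\<close>); the
  same theorem shows that the tensor product of contractions is contractive. The completion is again
  a Hilbert module (\<open>hilbert_tensor\<close>). Associator, unitors and braiding match up generating families
  with equal inner products, so they exist and are isomorphisms (\<open>iso_on_generators\<close>). The coherence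
  laws hold because both sides agree on pure tensors.

  \<^bold>\<open>Subunits are closed ideals.\<close> If \<open>s \<otimes> S\<close> is an isomorphism, then comparing \<open>s(a) \<otimes> a\<close> with
  \<open>a \<otimes> a\<close> gives \<open>\<bar>s(a)\<bar> \<bar>a\<bar> = \<bar>a\<bar> \<bar>a\<bar>\<close>, so \<open>s\<close> is isometric and its image \<open>J\<close> is a closed ideal of
  \<open>C\<^sub>0(X)\<close>; every closed ideal arises in this way (\<open>subunit_iff\<close>, \<open>ideal_incl\<close>). The map
  \<open>s \<otimes> A\<close> is then isometric with image \<open>{a. \<langle>a, a\<rangle> \<in> J}\<close> (\<open>img_restr\<close>), since for \<open>v = \<langle>a, a\<rangle> \<in> J\<close>
  the elements \<open>v / (v + d) a\<close> lie in the image and tend to \<open>a\<close> as \<open>d\<close> tends to zero. This description is the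
  heart of the proof:

  \<^item> The stiffness square is a pullback, because an element of \<open>T \<otimes> A\<close> comes from \<open>S \<otimes> T \<otimes> A\<close> if and
    only if its image in \<open>A\<close> comes from \<open>S \<otimes> A\<close>: the inner product with itself does not change.

  \<^item> Subunits are ordered like closed ideals, and \<open>s \<and> t\<close> corresponds to the intersection. Closed
    ideals form a frame, where the Heyting implication is the ideal quotient.

  \<^item> For the colimit, let \<open>U\<close> be idempotent and let \<open>b\<close> be a cocone on \<open>D(U, A)\<close>. The mediating map has
    to send \<open>\<Sum>\<^sub>i a\<^sub>i\<close> to \<open>\<Sum>\<^sub>i b(a\<^sub>i)\<close>, and such sums are dense. It is contractive at the point \<open>x\<close>: if some ideal of
    a \<open>t \<in> U\<close> contains a function \<open>e\<close> with \<open>e(x) \<noteq> 0\<close>, then \<open>e a\<^sub>i\<close> lies in the part of \<open>A\<close> belonging to \<open>s\<^sub>i \<and> t \<in> U\<close>,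
    where \<open>b\<close> may be computed by the single contraction \<open>b\<^sub>t\<close>; otherwise all \<open>\<bar>a\<^sub>i\<bar>\<close> vanish at \<open>x\<close>.
\<close>

section \<open>Functions vanishing at infinity\<close>

lemma C0_continuous: "f \<in> C0 X \<Longrightarrow> continuous_map X euclidean f"
  by (simp add: C0_def)

lemma C0_off: "f \<in> C0 X \<Longrightarrow> x \<notin> topspace X \<Longrightarrow> f x = 0"
  by (simp add: C0_def)

lemma C0_small:
  assumes "f \<in> C0 X" "e > 0"
  obtains K where "compactin X K" "\<And>x. x \<in> topspace X - K \<Longrightarrow> cmod (f x) < e"
  using assms by (auto simp: C0_def)

lemma continuous_map_binary:
  assumes "continuous_map X euclidean f" "continuous_map X euclidean g"
    and "continuous_on UNIV (\<lambda>p. \<phi> (fst p) (snd p))"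
  shows "continuous_map X euclidean (\<lambda>x. \<phi> (f x) (g x))"
proof -
  have "continuous_map X euclidean (\<lambda>x. (f x, g x))"
    using continuous_map_pairedI[OF assms(1,2)] by (simp add: euclidean_product_topology)
  then have "continuous_map X euclidean ((\<lambda>p. \<phi> (fst p) (snd p)) \<circ> (\<lambda>x. (f x, g x)))"
    by (rule continuous_map_compose) (use assms(3) in simp)
  then show ?thesis by (simp add: o_def)
qed

text \<open>Domination by functions of \<open>C\<^sub>0(X)\<close> gives both decay at infinity and vanishing off the space, so that
  membership in \<open>C\<^sub>0(X)\<close> becomes a continuity question.\<close>

lemma C0_dominated:
  assumes f: "f \<in> C0 X" and h: "h \<in> C0 X" and g: "continuous_map X euclidean g"
    and le: "\<And>x. cmod (g x) \<le> C * (cmod (f x) + cmod (h x))"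
  shows "g \<in> C0 X"
  unfolding C0_def
proof (intro CollectI conjI allI impI)
  fix e :: real assume "e > 0"
  define D where "D = \<bar>C\<bar> + 1"
  have D: "D > 0" "C \<le> D" by (auto simp: D_def)
  define d where "d = e / (2 * D)"
  have d: "d > 0" using \<open>e > 0\<close> D by (simp add: d_def)
  obtain K where K: "compactin X K" "\<And>x. x \<in> topspace X - K \<Longrightarrow> cmod (f x) < d"
    using C0_small[OF f d] by blast
  obtain L where L: "compactin X L" "\<And>x. x \<in> topspace X - L \<Longrightarrow> cmod (h x) < d"
    using C0_small[OF h d] by blast
  have "cmod (g x) < e" if x: "x \<in> topspace X - (K \<union> L)" for x
  proof -
    have "C * (cmod (f x) + cmod (h x)) \<le> D * (cmod (f x) + cmod (h x))"
      using D by (intro mult_right_mono) auto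
    also have "\<dots> < D * (d + d)"
      using K(2)[of x] L(2)[of x] x D by (intro mult_strict_left_mono add_strict_mono) auto
    also have "\<dots> = e" using D by (simp add: d_def field_simps)
    finally show ?thesis using le[of x] by linarith
  qed
  moreover have "compactin X (K \<union> L)" using K(1) L(1) by (rule compactin_Un)
  ultimately show "\<exists>K. compactin X K \<and> (\<forall>x\<in>topspace X - K. cmod (g x) < e)" by blast
next
  fix x assume "x \<notin> topspace X"
  then show "g x = 0" using le[of x] C0_off[OF f] C0_off[OF h] by simp
qed (rule g)

lemma C0_bounded:
  assumes "f \<in> C0 X"
  obtains B where "B \<ge> 0" "\<And>x. cmod (f x) \<le> B"
proof -
  obtain K where K: "compactin X K" "\<And>x. x \<in> topspace X - K \<Longrightarrow> cmod (f x) < 1"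
    using C0_small[OF assms, of 1] by auto
  have "compactin euclidean (f ` K)"
    using image_compactin[OF K(1) C0_continuous[OF assms]] .
  then have "bounded (f ` K)" by (simp add: compact_imp_bounded)
  then obtain B where B: "\<And>x. x \<in> K \<Longrightarrow> cmod (f x) \<le> B" by (auto simp: bounded_iff)
  have "cmod (f x) \<le> max B 1" for x
  proof (cases "x \<in> K")
    case True
    then show ?thesis using B[of x] by simp
  next
    case False
    then show ?thesis using K(2)[of x] C0_off[OF assms, of x] by (cases "x \<in> topspace X") auto
  qed
  then show ?thesis by (intro that[of "max B 1"]) auto
qed

lemma C0_zero: "(\<lambda>x. 0) \<in> C0 X"
  unfolding C0_def by (auto intro: exI[of _ "{}"])

lemma C0_binary:
  assumes "f \<in> C0 X" "g \<in> C0 X" and "continuous_on UNIV (\<lambda>p. \<phi> (fst p) (snd p))"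
    and "\<And>z w. cmod (\<phi> z w) \<le> C * (cmod z + cmod w)"
  shows "(\<lambda>x. \<phi> (f x) (g x)) \<in> C0 X"
  using assms(1,2)
proof (rule C0_dominated)
  show "continuous_map X euclidean (\<lambda>x. \<phi> (f x) (g x))"
    by (rule continuous_map_binary[OF C0_continuous[OF assms(1)] C0_continuous[OF assms(2)] assms(3)])
  show "cmod (\<phi> (f x) (g x)) \<le> C * (cmod (f x) + cmod (g x))" for x
    by (rule assms(4))
qed

lemma C0_add: "f \<in> C0 X \<Longrightarrow> g \<in> C0 X \<Longrightarrow> (\<lambda>x. f x + g x) \<in> C0 X"
  by (rule C0_binary[where \<phi> = "(+)" and C = 1])
    (auto intro!: continuous_intros norm_triangle_ineq)

lemma C0_cmult: "f \<in> C0 X \<Longrightarrow> (\<lambda>x. c * f x) \<in> C0 X"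
  by (rule C0_binary[where \<phi> = "\<lambda>z w. c * z" and C = "cmod c" and g = f])
    (auto intro!: continuous_intros mult_left_mono simp: norm_mult)

lemma C0_cnj: "f \<in> C0 X \<Longrightarrow> (\<lambda>x. cnj (f x)) \<in> C0 X"
  by (rule C0_binary[where \<phi> = "\<lambda>z w. cnj z" and C = 1 and g = f])
    (auto intro!: continuous_intros)

lemma C0_diff: "f \<in> C0 X \<Longrightarrow> g \<in> C0 X \<Longrightarrow> (\<lambda>x. f x - g x) \<in> C0 X"
  using C0_add[of f X "\<lambda>x. -1 * g x"] C0_cmult[of g X "-1"] by simp

lemma C0_mult:
  assumes "f \<in> C0 X" "g \<in> C0 X"
  shows "(\<lambda>x. f x * g x) \<in> C0 X"
proof -
  obtain B where B: "B \<ge> 0" "\<And>x. cmod (f x) \<le> B" using C0_bounded[OF assms(1)] by blast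
  show ?thesis
  proof (rule C0_dominated[OF assms(2) assms(2), where C = B])
    show "continuous_map X euclidean (\<lambda>x. f x * g x)"
      by (rule continuous_map_binary[where \<phi> = "(*)"])
        (auto intro!: continuous_intros C0_continuous assms)
    show "cmod (f x * g x) \<le> B * (cmod (g x) + cmod (g x))" for x
    proof -
      have "cmod (f x) * cmod (g x) \<le> B * (cmod (g x) + cmod (g x))"
        using B by (intro mult_mono) auto
      then show ?thesis by (simp add: norm_mult)
    qed
  qed
qed

lemma C0_sum_list: "(\<And>i. i \<in> set l \<Longrightarrow> f i \<in> C0 X) \<Longrightarrow> (\<lambda>x. \<Sum>i\<leftarrow>l. f i x) \<in> C0 X"
  by (induction l) (auto intro!: C0_zero C0_add)

lemma inverse_Suc_small:
  fixes e :: real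
  assumes "e > 0"
  obtains N where "\<And>n. n \<ge> N \<Longrightarrow> 1 / real (Suc n) < e"
proof -
  obtain N where N: "1 / real (Suc N) < e" using assms nat_approx_posE by blast
  have "1 / real (Suc n) < e" if "n \<ge> N" for n
  proof -
    have "1 / real (Suc n) \<le> 1 / real (Suc N)" using that by (intro divide_left_mono) auto
    then show ?thesis using N by linarith
  qed
  then show ?thesis by (rule that)
qed

lemma C0_uniform_limit:
  assumes "\<And>e. e > 0 \<Longrightarrow> \<exists>f\<in>C0 X. \<forall>x. cmod (f x - g x) \<le> e"
  shows "g \<in> C0 X"
  unfolding C0_def
proof (intro CollectI conjI allI impI)
  have "\<exists>f\<in>C0 X. \<forall>x. cmod (f x - g x) \<le> 1 / real (Suc n)" for n
    by (rule assms) simp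
  then obtain f where f: "\<And>n. f n \<in> C0 X" "\<And>n x. cmod (f n x - g x) \<le> 1 / real (Suc n)"
    by metis
  have "continuous_map X Met_TC.mtopology g"
  proof (rule Met_TC.continuous_map_uniform_limit[where F = sequentially and f = f])
    show "\<forall>\<^sub>F n in sequentially. continuous_map X Met_TC.mtopology (f n)"
      by (simp add: C0_continuous[OF f(1)])
    fix e :: real assume "e > 0"
    then obtain N where N: "\<And>n. n \<ge> N \<Longrightarrow> 1 / real (Suc n) < e" by (rule inverse_Suc_small) blast
    have "dist (f n x) (g x) < e" if "n \<ge> N" for n x
      using f(2)[of n x] N[OF that] by (simp add: dist_norm)
    then show "\<forall>\<^sub>F n in sequentially. \<forall>x\<in>topspace X. g x \<in> UNIV \<and> dist (f n x) (g x) < e"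
      by (auto simp: eventually_sequentially)
  qed simp
  then show "continuous_map X euclidean g" by simp
next
  fix e :: real assume e: "e > 0"
  obtain f where f: "f \<in> C0 X" "\<And>x. cmod (f x - g x) \<le> e / 2"
    using assms[of "e / 2"] e by auto
  obtain K where K: "compactin X K" "\<And>x. x \<in> topspace X - K \<Longrightarrow> cmod (f x) < e / 2"
    using C0_small[OF f(1), of "e / 2"] e by auto
  have "cmod (g x) < e" if "x \<in> topspace X - K" for x
    using f(2)[of x] K(2)[OF that] norm_triangle_ineq2[of "g x" "f x"]
    by (simp add: norm_minus_commute)
  then show "\<exists>K. compactin X K \<and> (\<forall>x\<in>topspace X - K. cmod (g x) < e)" using K(1) by blast
next
  fix x assume x: "x \<notin> topspace X"
  show "g x = 0"
  proof (rule ccontr)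
    assume "g x \<noteq> 0"
    then obtain f where "f \<in> C0 X" "cmod (f x - g x) \<le> cmod (g x) / 2"
      using assms[of "cmod (g x) / 2"] by auto
    then show False using C0_off[of f X x] x \<open>g x \<noteq> 0\<close> by simp
  qed
qed

text \<open>Built from \<open>v\<close> by continuous functional calculus, the functions \<open>\<bar>v\<bar> / (\<bar>v\<bar> + d)\<close> form an approximate
  unit for the ideal generated by \<open>v\<close> as \<open>d\<close> tends to zero.\<close>

definition soft_support :: "real \<Rightarrow> ('x \<Rightarrow> complex) \<Rightarrow> 'x \<Rightarrow> complex" where
  "soft_support d v x = of_real (cmod (v x) / (cmod (v x) + d))"

lemma soft_support_C0:
  assumes "d > 0" "v \<in> C0 X"
  shows "soft_support d v \<in> C0 X"
  unfolding soft_support_def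
proof (rule C0_binary[where \<phi> = "\<lambda>z w. of_real (cmod z / (cmod z + d))" and C = "1 / d" and g = v])
  show "continuous_on UNIV (\<lambda>p::complex \<times> complex. complex_of_real (cmod (fst p) / (cmod (fst p) + d)))"
    using \<open>d > 0\<close> by (intro continuous_intros) (metis add_nonneg_pos norm_ge_zero less_irrefl)
  show "cmod (of_real (cmod z / (cmod z + d))) \<le> 1 / d * (cmod z + cmod w)" for z w
  proof -
    have "cmod z / (cmod z + d) \<le> cmod z / d"
      using \<open>d > 0\<close> by (intro divide_left_mono) (auto intro!: add_nonneg_pos mult_pos_pos)
    also have "\<dots> \<le> 1 / d * (cmod z + cmod w)"
      using \<open>d > 0\<close> by (simp add: divide_right_mono)
    finally show ?thesis using \<open>d > 0\<close> by (simp only: norm_of_real) simp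
  qed
qed (use assms in auto)

lemma soft_support_small:
  assumes "d > 0"
  shows "cmod (1 - soft_support d v x) ^ 2 * cmod (v x) \<le> d"
proof -
  let ?t = "cmod (v x)"
  have pos: "?t + d > 0" using assms by (intro add_nonneg_pos) auto
  have "1 - soft_support d v x = of_real (1 - ?t / (?t + d))"
    by (simp add: soft_support_def)
  also have "1 - ?t / (?t + d) = d / (?t + d)" using pos by (simp add: field_simps)
  finally have *: "cmod (1 - soft_support d v x) = d / (?t + d)"
    using assms pos by (simp only: norm_of_real) simp
  have "(d / (?t + d))^2 * ?t = d * (d / (?t + d)) * (?t / (?t + d))"
    by (simp add: power2_eq_square)
  also have "\<dots> \<le> d * 1 * 1"
    using assms pos by (intro mult_mono) auto
  finally show ?thesis using * by simp
qed

section \<open>Semi-inner products with values in functions\<close>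

text \<open>Common ground of Hilbert modules and of the spaces of formal sums from which tensor products are
  completed. Formal sums satisfy the module identities only up to elements of seminorm zero, so none of these
  identities is an axiom here.\<close>

locale premodule =
  fixes X :: "'x topology" and M :: "('a, 'x) hmod"
  assumes zero_closed: "hzero M \<in> carrier M"
    and add_closed: "\<lbrakk>a \<in> carrier M; b \<in> carrier M\<rbrakk> \<Longrightarrow> hadd M a b \<in> carrier M"
    and scale_closed: "a \<in> carrier M \<Longrightarrow> hscale M c a \<in> carrier M"
    and act_closed: "\<lbrakk>f \<in> C0 X; a \<in> carrier M\<rbrakk> \<Longrightarrow> hact M f a \<in> carrier M"
    and ip_C0: "\<lbrakk>a \<in> carrier M; b \<in> carrier M\<rbrakk> \<Longrightarrow> hinner M a b \<in> C0 X"
    and ip_adj: "\<lbrakk>a \<in> carrier M; b \<in> carrier M\<rbrakk> \<Longrightarrow> cnj (hinner M a b x) = hinner M b a x"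
    and ip_zero: "a \<in> carrier M \<Longrightarrow> hinner M a (hzero M) x = 0"
    and ip_add: "\<lbrakk>a \<in> carrier M; b \<in> carrier M; b' \<in> carrier M\<rbrakk>
      \<Longrightarrow> hinner M a (hadd M b b') x = hinner M a b x + hinner M a b' x"
    and ip_scale: "\<lbrakk>a \<in> carrier M; b \<in> carrier M\<rbrakk>
      \<Longrightarrow> hinner M a (hscale M c b) x = c * hinner M a b x"
    and ip_act: "\<lbrakk>f \<in> C0 X; a \<in> carrier M; b \<in> carrier M\<rbrakk>
      \<Longrightarrow> hinner M a (hact M f b) x = f x * hinner M a b x"
    and ip_nonneg: "a \<in> carrier M \<Longrightarrow> hinner M a a x \<in> \<real>\<^sub>\<ge>\<^sub>0"

definition hsub :: "('a, 'x) hmod \<Rightarrow> 'a \<Rightarrow> 'a \<Rightarrow> 'a" where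
  "hsub M a b = hadd M a (hscale M (-1) b)"

definition ptnorm :: "('a, 'x) hmod \<Rightarrow> 'a \<Rightarrow> 'x \<Rightarrow> real" where
  "ptnorm M a x = sqrt (Re (hinner M a a x))"

definition near :: "('a, 'x) hmod \<Rightarrow> real \<Rightarrow> 'a \<Rightarrow> 'a \<Rightarrow> bool" where
  "near M e a b \<longleftrightarrow> (\<forall>x. ptnorm M (hsub M a b) x \<le> e)"

text \<open>This turns bounds on supremum norms into pointwise bounds.\<close>

lemma sup_root_le_iff:
  assumes "\<And>x. 0 \<le> Re (h x)" "\<And>x. Re (h x) \<le> B" "r \<ge> 0"
  shows "sup_root h \<le> r \<longleftrightarrow> (\<forall>x. sqrt (Re (h x)) \<le> r)"
proof -
  have bdd: "bdd_above (range (\<lambda>x. Re (h x)))" by (rule bdd_aboveI2[OF assms(2)])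
  have sq: "sqrt t \<le> r \<longleftrightarrow> t \<le> r^2" if "t \<ge> 0" for t
    using that assms(3) by (metis real_sqrt_abs real_sqrt_le_iff abs_of_nonneg)
  have "0 \<le> (SUP x. Re (h x))"
    by (rule cSUP_upper2[OF bdd, of undefined]) (use assms in auto)
  then have "sup_root h \<le> r \<longleftrightarrow> (SUP x. Re (h x)) \<le> r^2"
    by (simp add: sup_root_def sq)
  also have "\<dots> \<longleftrightarrow> (\<forall>x. Re (h x) \<le> r^2)"
    using bdd by (simp add: cSUP_le_iff)
  finally show ?thesis using assms(1) sq by simp
qed

context premodule
begin

lemma ip_add_left: "\<lbrakk>a \<in> carrier M; b \<in> carrier M; c \<in> carrier M\<rbrakk>
  \<Longrightarrow> hinner M (hadd M b c) a x = hinner M b a x + hinner M c a x"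
  by (metis ip_adj ip_add add_closed complex_cnj_add)

lemma ip_scale_left: "\<lbrakk>a \<in> carrier M; b \<in> carrier M\<rbrakk>
  \<Longrightarrow> hinner M (hscale M k b) a x = cnj k * hinner M b a x"
  by (metis ip_adj ip_scale scale_closed complex_cnj_mult)

lemma ip_act_left: "\<lbrakk>f \<in> C0 X; a \<in> carrier M; b \<in> carrier M\<rbrakk>
  \<Longrightarrow> hinner M (hact M f b) a x = cnj (f x) * hinner M b a x"
  by (metis ip_adj ip_act act_closed complex_cnj_mult)

lemma ip_zero_left: "a \<in> carrier M \<Longrightarrow> hinner M (hzero M) a x = 0"
  by (metis ip_adj ip_zero zero_closed complex_cnj_zero)

lemma sub_closed: "\<lbrakk>a \<in> carrier M; b \<in> carrier M\<rbrakk> \<Longrightarrow> hsub M a b \<in> carrier M"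
  by (simp add: hsub_def add_closed scale_closed)

lemma ip_sub: "\<lbrakk>a \<in> carrier M; b \<in> carrier M; c \<in> carrier M\<rbrakk>
  \<Longrightarrow> hinner M a (hsub M b c) x = hinner M a b x - hinner M a c x"
  by (simp add: hsub_def ip_add ip_scale scale_closed)

lemma ip_sub_left: "\<lbrakk>a \<in> carrier M; b \<in> carrier M; c \<in> carrier M\<rbrakk>
  \<Longrightarrow> hinner M (hsub M b c) a x = hinner M b a x - hinner M c a x"
  by (simp add: hsub_def ip_add_left ip_scale_left scale_closed)

lemmas closed = zero_closed add_closed scale_closed act_closed sub_closed
lemmas ip_simps = ip_zero ip_zero_left ip_add ip_add_left ip_scale ip_scale_left ip_act ip_act_left
  ip_sub ip_sub_left closed

lemma ip_self: "a \<in> carrier M \<Longrightarrow> hinner M a a x = of_real ((ptnorm M a x)^2)"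
  using ip_nonneg[of a x] by (auto simp: ptnorm_def nonneg_Reals_def simp del: of_real_power)

lemma ip_self_Re: "a \<in> carrier M \<Longrightarrow> Re (hinner M a a x) = (ptnorm M a x)^2"
  by (simp add: ip_self)

lemma ptnorm_nonneg: "a \<in> carrier M \<Longrightarrow> ptnorm M a x \<ge> 0"
  using ip_nonneg[of a x] by (auto simp: ptnorm_def nonneg_Reals_def)

lemma ptnorm_eqI: "hinner M a a x = hinner N b b x \<Longrightarrow> ptnorm M a x = ptnorm N b x"
  by (simp add: ptnorm_def)

lemma ptnorm_leI:
  assumes "a \<in> carrier M" "r \<ge> 0" "Re (hinner M a a x) \<le> r^2"
  shows "ptnorm M a x \<le> r"
  using assms power2_le_imp_le[of "ptnorm M a x" r] by (simp add: ip_self)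

lemma ptnorm_zero: "ptnorm M (hzero M) x = 0"
  by (simp add: ptnorm_def ip_simps)

lemma ptnorm_scale:
  assumes "a \<in> carrier M"
  shows "ptnorm M (hscale M k a) x = cmod k * ptnorm M a x"
proof -
  have "hinner M (hscale M k a) (hscale M k a) x = (cnj k * k) * hinner M a a x"
    using assms by (simp add: ip_simps)
  also have "cnj k * k = of_real ((cmod k)^2)" by (subst mult.commute) (rule complex_norm_square[symmetric])
  finally show ?thesis using ptnorm_nonneg[OF assms]
    by (simp add: ptnorm_def real_sqrt_mult flip: of_real_power)
qed

lemma ptnorm_act:
  assumes "f \<in> C0 X" "a \<in> carrier M"
  shows "ptnorm M (hact M f a) x = cmod (f x) * ptnorm M a x"
proof -
  have "hinner M (hact M f a) (hact M f a) x = (cnj (f x) * f x) * hinner M a a x"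
    using assms by (simp add: ip_simps)
  also have "cnj (f x) * f x = of_real ((cmod (f x))^2)" by (subst mult.commute) (rule complex_norm_square[symmetric])
  finally show ?thesis using ptnorm_nonneg[OF assms(2)]
    by (simp add: ptnorm_def real_sqrt_mult flip: of_real_power)
qed

lemma Cauchy_Schwarz:
  assumes a: "a \<in> carrier M" and b: "b \<in> carrier M"
  shows "cmod (hinner M a b x) \<le> ptnorm M a x * ptnorm M b x"
proof -
  let ?p = "ptnorm M a x" and ?q = "ptnorm M b x" and ?z = "hinner M a b x"
  \<comment> \<open>A real parameter suffices after one vector is multiplied by the inner product.\<close>
  have key: "0 \<le> ?p^2 * t^2 - 2 * t * (cmod ?z)^2 + (cmod ?z)^2 * ?q^2" for t :: real
  proof -
    \<comment> \<open>the square norm of \<open>t a - \<langle>b, a\<rangle> b\<close>\<close>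
    let ?v = "hsub M (hscale M (of_real t) a) (hscale M (cnj ?z) b)"
    have "hinner M ?v ?v x = of_real (t^2 * ?p^2) - of_real t * (cnj ?z * ?z) - of_real t * (?z * cnj ?z)
       + (?z * cnj ?z) * of_real (?q^2)"
      using a b ip_adj[OF a b, of x, symmetric] ip_self[OF a, of x] ip_self[OF b, of x]
      by (simp add: ip_simps algebra_simps power2_eq_square)
    also have "?z * cnj ?z = of_real ((cmod ?z)^2)" by (rule complex_norm_square[symmetric])
    also have "cnj ?z * ?z = of_real ((cmod ?z)^2)" by (subst mult.commute) (rule complex_norm_square[symmetric])
    also have "of_real (t^2 * ?p^2) - of_real t * of_real ((cmod ?z)^2) - of_real t * of_real ((cmod ?z)^2)
        + of_real ((cmod ?z)^2) * of_real (?q^2)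
      = complex_of_real (t^2 * ?p^2 - 2 * t * (cmod ?z)^2 + (cmod ?z)^2 * ?q^2)"
      by simp
    finally have "ptnorm M ?v x ^ 2 = t^2 * ?p^2 - 2 * t * (cmod ?z)^2 + (cmod ?z)^2 * ?q^2"
      using ip_self[of ?v x] a b by (metis closed(3) sub_closed of_real_eq_iff)
    then show ?thesis by (metis zero_le_power2 mult.commute)
  qed
  have "(cmod ?z)^2 \<le> (?p * ?q)^2"
  proof (cases "?p = 0 \<or> ?z = 0")
    case True
    moreover have "?z = 0" if "?p = 0"
    proof -
      have "0 \<le> - ((cmod ?z)^2 * (?q^2 + 2))"
        using key[of "?q^2 + 1"] that by (simp add: algebra_simps)
      moreover have "?q^2 + 2 > 0" by (simp add: add_nonneg_pos)
      ultimately have "(cmod ?z)^2 \<le> 0" by (simp add: mult_le_0_iff)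
      then show ?thesis by simp
    qed
    ultimately show ?thesis by auto
  next
    case False
    then have p: "?p^2 > 0" by simp
    have "0 \<le> ?p^2 * ((cmod ?z)^2 / ?p^2)^2 - 2 * ((cmod ?z)^2 / ?p^2) * (cmod ?z)^2 + (cmod ?z)^2 * ?q^2"
      by (rule key)
    also have "\<dots> = (cmod ?z)^2 * (?q^2 - (cmod ?z)^2 / ?p^2)"
      using p by (simp add: field_simps power2_eq_square)
    finally have "?q^2 - (cmod ?z)^2 / ?p^2 \<ge> 0"
      using False by (simp add: zero_le_mult_iff)
    then show ?thesis using p by (simp add: field_simps power_mult_distrib)
  qed
  then show ?thesis
    using ptnorm_nonneg[OF a] ptnorm_nonneg[OF b] by (rule power2_le_imp_le[OF _ mult_nonneg_nonneg])
qed

lemma ptnorm_add: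
  assumes a: "a \<in> carrier M" and b: "b \<in> carrier M"
  shows "ptnorm M (hadd M a b) x \<le> ptnorm M a x + ptnorm M b x"
proof (rule ptnorm_leI)
  have "Re (hinner M (hadd M a b) (hadd M a b) x)
      = (ptnorm M a x)^2 + (ptnorm M b x)^2 + Re (hinner M a b x) + Re (hinner M b a x)"
    using a b by (simp add: ip_simps ip_self_Re[OF a] ip_self_Re[OF b])
  also have "Re (hinner M b a x) = Re (hinner M a b x)"
    using arg_cong[OF ip_adj[OF a b, of x], of Re] by simp
  also have "Re (hinner M a b x) \<le> ptnorm M a x * ptnorm M b x"
    using Cauchy_Schwarz[OF a b, of x] complex_Re_le_cmod[of "hinner M a b x"] by linarith
  finally show "Re (hinner M (hadd M a b) (hadd M a b) x) \<le> (ptnorm M a x + ptnorm M b x)^2"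
    by (simp add: power2_sum)
qed (use a b in \<open>auto simp: closed ptnorm_nonneg\<close>)

text \<open>Subtraction is only determined up to seminorm zero, so its rules come from comparing inner products.\<close>

lemma ptnorm_sub_triangle:
  assumes "a \<in> carrier M" "b \<in> carrier M" "c \<in> carrier M"
  shows "ptnorm M (hsub M a c) x \<le> ptnorm M (hsub M a b) x + ptnorm M (hsub M b c) x"
proof -
  have "ptnorm M (hsub M a c) x = ptnorm M (hadd M (hsub M a b) (hsub M b c)) x"
    using assms by (intro ptnorm_eqI) (simp add: ip_simps)
  then show ?thesis using ptnorm_add[of "hsub M a b" "hsub M b c" x] assms by (simp add: closed)
qed

lemma ptnorm_sub_sym:
  assumes "a \<in> carrier M" "b \<in> carrier M"
  shows "ptnorm M (hsub M a b) x = ptnorm M (hsub M b a) x"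
  using assms by (intro ptnorm_eqI) (simp add: ip_simps)

lemma ptnorm_sub_self: "a \<in> carrier M \<Longrightarrow> ptnorm M (hsub M a a) x = 0"
  by (simp add: ptnorm_def ip_simps)

lemma ptnorm_le_sub:
  assumes "a \<in> carrier M" "b \<in> carrier M"
  shows "ptnorm M a x \<le> ptnorm M b x + ptnorm M (hsub M a b) x"
proof -
  have "ptnorm M a x = ptnorm M (hadd M b (hsub M a b)) x"
    using assms by (intro ptnorm_eqI) (simp add: ip_simps)
  then show ?thesis using ptnorm_add[of b "hsub M a b" x] assms by (simp add: closed)
qed

lemma bounded_ptnorm:
  assumes "a \<in> carrier M"
  obtains B where "B \<ge> 0" "\<And>x. ptnorm M a x \<le> B"
proof -
  obtain B where B: "B \<ge> 0" "\<And>x. cmod (hinner M a a x) \<le> B"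
    using C0_bounded[OF ip_C0[OF assms assms]] by blast
  have "ptnorm M a x \<le> sqrt B" for x
    using B(2)[of x] complex_Re_le_cmod[of "hinner M a a x"] by (simp add: ptnorm_def)
  then show ?thesis using that[of "sqrt B"] B(1) by simp
qed

lemma hnorm_le_iff:
  assumes "a \<in> carrier M" "r \<ge> 0"
  shows "hnorm M a \<le> r \<longleftrightarrow> (\<forall>x. ptnorm M a x \<le> r)"
proof -
  obtain B where B: "B \<ge> 0" "\<And>x. cmod (hinner M a a x) \<le> B"
    using C0_bounded[OF ip_C0[OF assms(1) assms(1)]] by blast
  have "Re (hinner M a a x) \<le> B" "0 \<le> Re (hinner M a a x)" for x
    using B(2)[of x] complex_Re_le_cmod[of "hinner M a a x"] assms by (auto simp: ip_self_Re[OF assms(1)])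
  then show ?thesis
    unfolding hnorm_def ptnorm_def using assms(2) by (intro sup_root_le_iff[of _ B])
qed

lemma ptnorm_le_hnorm: "a \<in> carrier M \<Longrightarrow> ptnorm M a x \<le> hnorm M a"
proof -
  assume a: "a \<in> carrier M"
  have "hnorm M a \<ge> 0"
  proof (rule ccontr)
    assume "\<not> hnorm M a \<ge> 0"
    then have "\<forall>x. ptnorm M a x \<le> 0" using hnorm_le_iff[OF a, of 0] by simp
    then have "\<forall>x. hinner M a a x = 0" using ptnorm_nonneg[OF a] ip_self[OF a]
      by (metis order_antisym of_real_0 zero_power2)
    then have "hnorm M a = 0" by (simp add: hnorm_def sup_root_def)
    then show False using \<open>\<not> hnorm M a \<ge> 0\<close> by simp
  qed
  then show ?thesis using hnorm_le_iff[OF a, of "hnorm M a"] by simp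
qed

lemma hnorm_nonneg: "a \<in> carrier M \<Longrightarrow> hnorm M a \<ge> 0"
  using ptnorm_le_hnorm ptnorm_nonneg order_trans by blast

lemma hdist_le_iff:
  assumes "a \<in> carrier M" "b \<in> carrier M" "r \<ge> 0"
  shows "hdist M a b \<le> r \<longleftrightarrow> near M r a b"
  using assms hnorm_le_iff[of "hsub M a b" r] by (simp add: hdist_def near_def hsub_def closed)

lemma hdist_nonneg: "hdist M a b \<ge> 0"
  using hnorm_nonneg[of "hsub M a b"] by (auto simp: hdist_def hsub_def closed)

lemma near_hdist: "a \<in> carrier M \<Longrightarrow> b \<in> carrier M \<Longrightarrow> near M (hdist M a b) a b"
  using hdist_le_iff[of a b "hdist M a b"] hdist_nonneg by simp

lemma near_refl: "a \<in> carrier M \<Longrightarrow> e \<ge> 0 \<Longrightarrow> near M e a a"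
  by (simp add: near_def ptnorm_sub_self)

lemma near_sym: "a \<in> carrier M \<Longrightarrow> b \<in> carrier M \<Longrightarrow> near M e a b \<Longrightarrow> near M e b a"
  by (simp add: near_def ptnorm_sub_sym[of a b])

lemma near_trans:
  "\<lbrakk>a \<in> carrier M; b \<in> carrier M; c \<in> carrier M; near M e a b; near M d b c\<rbrakk> \<Longrightarrow> near M (e + d) a c"
  unfolding near_def by (meson ptnorm_sub_triangle add_mono order_trans)

lemma near_mono: "near M e a b \<Longrightarrow> e \<le> d \<Longrightarrow> near M d a b"
  unfolding near_def by (meson order_trans)

lemma near_add:
  assumes "a \<in> carrier M" "b \<in> carrier M" "c \<in> carrier M" "d \<in> carrier M" "near M e a b" "near M k c d"
  shows "near M (e + k) (hadd M a c) (hadd M b d)"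
  unfolding near_def
proof
  fix x
  have "ptnorm M (hsub M (hadd M a c) (hadd M b d)) x = ptnorm M (hadd M (hsub M a b) (hsub M c d)) x"
    using assms by (intro ptnorm_eqI) (simp add: ip_simps)
  also have "\<dots> \<le> ptnorm M (hsub M a b) x + ptnorm M (hsub M c d) x"
    using assms by (intro ptnorm_add) (auto simp: closed)
  finally show "ptnorm M (hsub M (hadd M a c) (hadd M b d)) x \<le> e + k"
    using assms(5,6) unfolding near_def by (meson add_mono order_trans)
qed

lemma near_scale:
  assumes "a \<in> carrier M" "b \<in> carrier M" "near M e a b"
  shows "near M (cmod k * e) (hscale M k a) (hscale M k b)"
  unfolding near_def
proof
  fix x
  have "ptnorm M (hsub M (hscale M k a) (hscale M k b)) x = ptnorm M (hscale M k (hsub M a b)) x"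
    using assms by (intro ptnorm_eqI) (simp add: ip_simps algebra_simps)
  then show "ptnorm M (hsub M (hscale M k a) (hscale M k b)) x \<le> cmod k * e"
    using assms by (auto simp: ptnorm_scale closed near_def intro!: mult_left_mono)
qed

lemma near_act:
  assumes "a \<in> carrier M" "b \<in> carrier M" "near M e a b" "f \<in> C0 X" "\<And>x. cmod (f x) \<le> B"
  shows "near M (B * e) (hact M f a) (hact M f b)"
  unfolding near_def
proof
  fix x
  have "ptnorm M (hsub M (hact M f a) (hact M f b)) x = ptnorm M (hact M f (hsub M a b)) x"
    using assms by (intro ptnorm_eqI) (simp add: ip_simps algebra_simps)
  also have "\<dots> = cmod (f x) * ptnorm M (hsub M a b) x" using assms by (simp add: ptnorm_act closed)
  also have "\<dots> \<le> B * e"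
    using assms ptnorm_nonneg[of "hsub M a b" x] order_trans[OF norm_ge_zero assms(5)]
    by (intro mult_mono) (auto simp: near_def closed)
  finally show "ptnorm M (hsub M (hact M f a) (hact M f b)) x \<le> B * e" .
qed

lemma near_ip:
  assumes "a \<in> carrier M" "b \<in> carrier M" "c \<in> carrier M" "near M e a b"
  shows "cmod (hinner M c a x - hinner M c b x) \<le> ptnorm M c x * e"
proof -
  have "hinner M c a x - hinner M c b x = hinner M c (hsub M a b) x"
    using assms by (simp add: ip_simps)
  then show ?thesis
    using assms Cauchy_Schwarz[of c "hsub M a b" x] ptnorm_nonneg[of c x]
    by (simp add: closed near_def) (meson mult_left_mono order_trans)
qed

lemma near_ip_both:
  assumes "a \<in> carrier M" "b \<in> carrier M" "c \<in> carrier M" "d \<in> carrier M"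
    and "near M e a b" "near M k c d"
  shows "cmod (hinner M a c x - hinner M b d x) \<le> ptnorm M c x * e + ptnorm M b x * k"
proof -
  have "hinner M a c x - hinner M b c x = cnj (hinner M c a x - hinner M c b x)"
    using assms by (simp add: ip_adj)
  then have "cmod (hinner M a c x - hinner M b c x) \<le> ptnorm M c x * e"
    using near_ip[of a b c e x] assms by (metis complex_mod_cnj)
  moreover have "cmod (hinner M b c x - hinner M b d x) \<le> ptnorm M b x * k"
    using near_ip[of c d b k x] assms by simp
  ultimately show ?thesis
    using norm_triangle_ineq[of "hinner M a c x - hinner M b c x" "hinner M b c x - hinner M b d x"]
    by simp
qed

end

section \<open>Hilbert modules as complete separated semi-inner product modules\<close>

text \<open>Without group axioms the separation axiom has to speak of differences.\<close>

locale separated_module = premodule +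
  assumes definite: "\<lbrakk>a \<in> carrier M; b \<in> carrier M; \<And>x. hinner M (hsub M a b) (hsub M a b) x = 0\<rbrakk> \<Longrightarrow> a = b"

context separated_module
begin

lemma weak_eqI:
  assumes "a \<in> carrier M" "b \<in> carrier M"
    and "\<And>w x. w \<in> carrier M \<Longrightarrow> hinner M w a x = hinner M w b x"
  shows "a = b"
proof (rule definite)
  show "hinner M (hsub M a b) (hsub M a b) x = 0" for x
    using assms(1,2) assms(3)[OF sub_closed[OF assms(1,2)]] by (simp add: ip_sub closed)
qed (rule assms(1,2))+

lemma eq_if_near: 
  assumes "a \<in> carrier M" "b \<in> carrier M" "\<And>e. e > 0 \<Longrightarrow> near M e a b"
  shows "a = b"
proof (rule definite)
  fix x
  have "ptnorm M (hsub M a b) x \<le> 0"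
    by (rule field_le_epsilon) (use assms(3) in \<open>simp add: near_def\<close>)
  then have "ptnorm M (hsub M a b) x = 0"
    using ptnorm_nonneg[of "hsub M a b" x] assms(1,2) by (simp add: closed)
  then show "hinner M (hsub M a b) (hsub M a b) x = 0"
    using ip_self[of "hsub M a b" x] assms(1,2) by (simp add: closed)
qed (rule assms(1,2))+

sublocale metric: Metric_space "carrier M" "hdist M"
proof
  show "0 \<le> hdist M a b" for a b by (rule hdist_nonneg)
  show "hdist M a b = hdist M b a" for a b
  proof (cases "a \<in> carrier M \<and> b \<in> carrier M")
    case True
    then have "hdist M a b \<le> hdist M b a" "hdist M b a \<le> hdist M a b"
      by (auto simp: hdist_le_iff hdist_nonneg intro!: near_sym near_hdist)
    then show ?thesis by simp
  qed (auto simp: hdist_def)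
  show "hdist M a b = 0 \<longleftrightarrow> a = b" if "a \<in> carrier M" "b \<in> carrier M" for a b
  proof
    assume "hdist M a b = 0"
    then have "near M 0 a b" using near_hdist[OF that] by simp
    then show "a = b" using that by (intro eq_if_near) (auto elim: near_mono)
  next
    assume "a = b"
    then have "hdist M a b \<le> 0" using that by (simp add: hdist_le_iff near_refl)
    then show "hdist M a b = 0" using hdist_nonneg[of a b] by simp
  qed
  show "hdist M a c \<le> hdist M a b + hdist M b c"
    if "a \<in> carrier M" "b \<in> carrier M" "c \<in> carrier M" for a b c
    using that near_trans[of a b c "hdist M a b" "hdist M b c"]
    by (simp add: hdist_le_iff hdist_nonneg near_hdist)
qed

end

definition hcauchy :: "('a, 'x) hmod \<Rightarrow> (nat \<Rightarrow> 'a) \<Rightarrow> bool" where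
  "hcauchy M s \<longleftrightarrow> (\<forall>e>0. \<exists>N. \<forall>m\<ge>N. \<forall>n\<ge>N. near M e (s m) (s n))"

definition hconv :: "('a, 'x) hmod \<Rightarrow> (nat \<Rightarrow> 'a) \<Rightarrow> 'a \<Rightarrow> bool" where
  "hconv M s a \<longleftrightarrow> (\<forall>e>0. \<exists>N. \<forall>n\<ge>N. near M e (s n) a)"

context premodule
begin

lemma hcauchy_hdist:
  assumes "\<And>n. s n \<in> carrier M"
  shows "hcauchy M s \<longleftrightarrow> (\<forall>e>0. \<exists>N. \<forall>m\<ge>N. \<forall>n\<ge>N. hdist M (s m) (s n) < e)"
proof
  assume L: "hcauchy M s"
  show "\<forall>e>0. \<exists>N. \<forall>m\<ge>N. \<forall>n\<ge>N. hdist M (s m) (s n) < e"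
  proof (intro allI impI)
    fix e :: real assume e: "e > 0"
    then obtain N where N: "\<forall>m\<ge>N. \<forall>n\<ge>N. near M (e/2) (s m) (s n)"
      using L by (metis hcauchy_def half_gt_zero)
    have "hdist M (s m) (s n) < e" if "m \<ge> N" "n \<ge> N" for m n
    proof -
      have "hdist M (s m) (s n) \<le> e/2" using N that e by (intro hdist_le_iff[THEN iffD2] assms) auto
      then show ?thesis using e by simp
    qed
    then show "\<exists>N. \<forall>m\<ge>N. \<forall>n\<ge>N. hdist M (s m) (s n) < e" by blast
  qed
next
  assume R: "\<forall>e>0. \<exists>N. \<forall>m\<ge>N. \<forall>n\<ge>N. hdist M (s m) (s n) < e"
  show "hcauchy M s"
    unfolding hcauchy_def
    using R hdist_le_iff[OF assms assms] by (meson less_imp_le)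
qed

lemma hconv_hdist:
  assumes "\<And>n. s n \<in> carrier M" "a \<in> carrier M"
  shows "hconv M s a \<longleftrightarrow> (\<forall>e>0. \<exists>N. \<forall>n\<ge>N. hdist M (s n) a < e)"
proof
  assume L: "hconv M s a"
  show "\<forall>e>0. \<exists>N. \<forall>n\<ge>N. hdist M (s n) a < e"
  proof (intro allI impI)
    fix e :: real assume e: "e > 0"
    then obtain N where N: "\<forall>n\<ge>N. near M (e/2) (s n) a"
      using L by (metis hconv_def half_gt_zero)
    have "hdist M (s n) a < e" if "n \<ge> N" for n
    proof -
      have "hdist M (s n) a \<le> e/2" using N that e by (intro hdist_le_iff[THEN iffD2] assms) auto
      then show ?thesis using e by simp
    qed
    then show "\<exists>N. \<forall>n\<ge>N. hdist M (s n) a < e" by blast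
  qed
next
  assume R: "\<forall>e>0. \<exists>N. \<forall>n\<ge>N. hdist M (s n) a < e"
  show "hconv M s a"
    unfolding hconv_def
    using R hdist_le_iff[OF assms(1) assms(2)] by (meson less_imp_le)
qed

lemma near_ptnorm:
  "\<lbrakk>a \<in> carrier M; b \<in> carrier M; near M e a b\<rbrakk> \<Longrightarrow> ptnorm M a x \<le> ptnorm M b x + e"
  using ptnorm_le_sub[of a b x] unfolding near_def by (meson add_left_mono order_trans)

lemma hconvD:
  assumes "hconv M s a" "e > 0"
  obtains n where "near M e (s n) a"
  using assms unfolding hconv_def by (meson le_refl)

end

lemma (in separated_module) mcomplete_iff:
  "metric.mcomplete \<longleftrightarrow> (\<forall>s. (\<forall>n. s n \<in> carrier M) \<longrightarrow> hcauchy M s \<longrightarrow> (\<exists>a\<in>carrier M. hconv M s a))"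
proof -
  have "metric.MCauchy s \<longleftrightarrow> (\<forall>n. s n \<in> carrier M) \<and> hcauchy M s" for s
    unfolding metric.MCauchy_def image_subset_iff using hcauchy_hdist[of s] by auto
  moreover have "limitin metric.mtopology s a sequentially \<longleftrightarrow> a \<in> carrier M \<and> hconv M s a"
    if "\<forall>n. s n \<in> carrier M" for s a
    unfolding metric.limit_metric_sequentially using that hconv_hdist[of s a] by auto
  ultimately show ?thesis unfolding metric.mcomplete_def by auto
qed

text \<open>In a separated module every module identity can be checked by inner products, so only
  completeness is left to prove.\<close>

theorem hilbert_moduleI:
  assumes "separated_module X M"
    and complete: "\<And>s. \<lbrakk>\<And>n. s n \<in> carrier M; hcauchy M s\<rbrakk> \<Longrightarrow> \<exists>a\<in>carrier M. hconv M s a"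
  shows "hilbert_module X M"
proof -
  interpret separated_module X M by fact
  have assoc: "hadd M (hadd M a b) c = hadd M a (hadd M b c)"
    if "a \<in> carrier M" "b \<in> carrier M" "c \<in> carrier M" for a b c
    using that by (intro weak_eqI) (auto simp: ip_simps)
  have comm: "hadd M a b = hadd M b a" if "a \<in> carrier M" "b \<in> carrier M" for a b
    using that by (intro weak_eqI) (auto simp: ip_simps)
  have left_zero: "hadd M (hzero M) a = a" if "a \<in> carrier M" for a
    using that by (intro weak_eqI) (auto simp: ip_simps)
  have inverse: "\<exists>b\<in>carrier M. hadd M b a = hzero M" if "a \<in> carrier M" for a
    using that by (intro bexI[of _ "hscale M (-1) a"] weak_eqI) (auto simp: ip_simps)
  show ?thesis
  proof (rule hilbert_module.intro)
    show "comm_group \<lparr>carrier = carrier M, monoid.mult = hadd M, one = hzero M\<rparr>"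
      by (rule comm_groupI) (auto simp: closed assoc left_zero intro: comm inverse)
    show "Metric_space.mcomplete (carrier M) (hdist M)"
      using complete by (simp add: mcomplete_iff)
    show "a = hzero M" if a: "a \<in> carrier M" and 0: "hinner M a a = (\<lambda>x. 0)" for a
      using a 0 by (intro definite) (auto simp: ip_simps)
    show "hinner M a b = (\<lambda>x. cnj (hinner M b a x))" if "a \<in> carrier M" "b \<in> carrier M" for a b
      using that by (simp add: ip_adj)
  qed (auto simp: closed ip_C0 ip_nonneg ip_simps C0_mult C0_add C0_cmult algebra_simps intro!: weak_eqI)
qed

text \<open>The module axioms only separate elements from zero. For differences, one needs that \<open>-1 b\<close> is the
  inverse of \<open>b\<close> in the additive group.\<close>

theorem hilbert_separated:
  assumes "hilbert_module X M"
  shows "separated_module X M"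
proof -
  interpret H: hilbert_module X M by fact
  interpret G: comm_group "\<lparr>carrier = carrier M, monoid.mult = hadd M, one = hzero M\<rparr>"
    by (rule H.add_group)
  have zero: "hzero M \<in> carrier M" using G.one_closed by simp
  have add: "hadd M a b \<in> carrier M" if "a \<in> carrier M" "b \<in> carrier M" for a b
    using G.m_closed that by simp
  have ip_zero: "hinner M a (hzero M) x = 0" if "a \<in> carrier M" for a x
    using H.inner_add[OF that zero zero] G.l_one[of "hzero M"] zero by (auto dest: fun_cong[of _ _ x])
  interpret premodule X M
    by standard
      (auto simp: zero add ip_zero H.scale_closed H.act_closed H.inner_add H.inner_scale H.inner_act
        H.inner_nonneg H.inner_closed, metis H.inner_adj)
  show ?thesis
  proof
    fix a b
    assume a: "a \<in> carrier M" and b: "b \<in> carrier M"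
      and 0: "\<And>x. hinner M (hsub M a b) (hsub M a b) x = 0"
    have sub: "hadd M a (hscale M (-1) b) = hzero M"
      using H.inner_zero[of "hsub M a b"] 0 sub_closed[OF a b] by (auto simp: hsub_def)
    have "hadd M (hscale M (-1) b) b = hscale M (-1 + 1) b"
      using H.scale_add_left[OF b, of "-1" 1] H.scale_one[OF b] by simp
    also have "\<dots> = hzero M"
      using b by (intro H.inner_zero) (auto simp: ip_simps)
    finally have inv: "hadd M (hscale M (-1) b) b = hzero M" .
    have "a = hadd M a (hadd M (hscale M (-1) b) b)"
      unfolding inv using G.r_one a by simp
    also have "\<dots> = hadd M (hadd M a (hscale M (-1) b)) b"
      using G.m_assoc[of a "hscale M (-1) b" b] a b by (simp add: closed)
    also have "\<dots> = b" unfolding sub using G.l_one b by simp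
    finally show "a = b" .
  qed
qed

lemma hilbert_complete:
  assumes "hilbert_module X M" "\<And>n. s n \<in> carrier M" "hcauchy M s"
  obtains a where "a \<in> carrier M" "hconv M s a"
proof -
  interpret separated_module X M by (rule hilbert_separated[OF assms(1)])
  show ?thesis using hilbert_module.complete[OF assms(1)] assms(2,3) that
    by (auto simp: mcomplete_iff)
qed

lemma hilbert_submodule:
  assumes "hilbert_module X M" and sub: "W \<subseteq> carrier M" "hzero M \<in> W"
    and "\<And>a b. a \<in> W \<Longrightarrow> b \<in> W \<Longrightarrow> hadd M a b \<in> W"
    and "\<And>c a. a \<in> W \<Longrightarrow> hscale M c a \<in> W"
    and "\<And>f a. f \<in> C0 X \<Longrightarrow> a \<in> W \<Longrightarrow> hact M f a \<in> W"
    and lim: "\<And>a. a \<in> carrier M \<Longrightarrow> (\<And>e. e > 0 \<Longrightarrow> \<exists>b\<in>W. near M e b a) \<Longrightarrow> a \<in> W"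
  shows "hilbert_module X (M\<lparr>carrier := W\<rparr>)"
proof -
  interpret separated_module X M by (rule hilbert_separated[OF assms(1)])
  have near: "near (M\<lparr>carrier := W\<rparr>) = near M" 
    by (intro ext) (simp add: near_def ptnorm_def hsub_def)
  have W: "a \<in> carrier M" if "a \<in> W" for a using sub that by blast
  show ?thesis
  proof (rule hilbert_moduleI)
    show "separated_module X (M\<lparr>carrier := W\<rparr>)"
      by standard (auto simp: assms W ip_C0 ip_simps ip_adj ip_nonneg hsub_def intro!: definite)
    fix s
    assume s: "\<And>n. s n \<in> carrier (M\<lparr>carrier := W\<rparr>)" "hcauchy (M\<lparr>carrier := W\<rparr>) s"
    then have "s n \<in> carrier M" "hcauchy M s" for n
      using W by (auto simp: hcauchy_def near)
    then obtain a where a: "a \<in> carrier M" "hconv M s a"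
      using hilbert_complete[OF assms(1)] by blast
    have "a \<in> W"
    proof (rule lim[OF a(1)])
      show "\<exists>b\<in>W. near M e b a" if "e > 0" for e
        using hconvD[OF a(2) that] s(1) by simp metis
    qed
    then show "\<exists>a\<in>carrier (M\<lparr>carrier := W\<rparr>). hconv (M\<lparr>carrier := W\<rparr>) s a"
      using a(2) by (auto simp: hconv_def near)
  qed
qed

section \<open>Morphisms\<close>

lemma hhomD:
  assumes "F \<in> hhom X A B"
  shows "hdom F = A" "hcod F = B"
    and "a \<in> carrier A \<Longrightarrow> hmap F a \<in> carrier B"
    and "a \<in> carrier A \<Longrightarrow> b \<in> carrier A \<Longrightarrow> hmap F (hadd A a b) = hadd B (hmap F a) (hmap F b)"
    and "a \<in> carrier A \<Longrightarrow> hmap F (hscale A c a) = hscale B c (hmap F a)"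
    and "f \<in> C0 X \<Longrightarrow> a \<in> carrier A \<Longrightarrow> hmap F (hact A f a) = hact B f (hmap F a)"
    and "a \<in> carrier A \<Longrightarrow> hnorm B (hmap F a) \<le> hnorm A a"
    and "a \<notin> carrier A \<Longrightarrow> hmap F a = undefined"
  using assms by (auto simp: hhom_def PiE_iff extensional_def)

lemma hhom_eqI:
  assumes F: "F \<in> hhom X A B" and G: "G \<in> hhom X A B"
    and eq: "\<And>a. a \<in> carrier A \<Longrightarrow> hmap F a = hmap G a"
  shows "F = G"
proof -
  have "hmap F = hmap G"
  proof
    show "hmap F a = hmap G a" for a
      using eq hhomD(8)[OF F] hhomD(8)[OF G] by (cases "a \<in> carrier A") auto
  qed
  then show ?thesis using hhomD(1,2)[OF F] hhomD(1,2)[OF G] by simp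
qed

text \<open>If \<open>\<bar>F a\<bar>\<close> exceeded \<open>\<bar>a\<bar>\<close> at \<open>x\<^sub>0\<close>, then \<open>F\<close> would increase the supremum norm of \<open>f a\<close> for a
  function \<open>f\<close> concentrated where \<open>\<bar>a\<bar>\<close> and \<open>\<bar>F a\<bar>\<close> are close to their values at \<open>x\<^sub>0\<close>. Such an \<open>f\<close> is a
  continuous function of \<open>\<bar>a\<bar>\<close> and \<open>\<bar>F a\<bar>\<close> that vanishes where both do.\<close>

theorem hhom_ptnorm_le:
  assumes "hilbert_module X A" "hilbert_module X B" and F: "F \<in> hhom X A B"
    and a: "a \<in> carrier A"
  shows "ptnorm B (hmap F a) x0 \<le> ptnorm A a x0"
proof (rule ccontr)
  interpret A: separated_module X A by (rule hilbert_separated) fact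
  interpret B: separated_module X B by (rule hilbert_separated) fact
  note Fa = hhomD(3)[OF F a]
  define u where "u x = cmod (hinner B (hmap F a) (hmap F a) x)" for x
  define v where "v x = cmod (hinner A a a x)" for x
  have u: "u x = ptnorm B (hmap F a) x ^ 2" for x by (simp add: u_def B.ip_self[OF Fa] norm_power)
  have v: "v x = ptnorm A a x ^ 2" for x by (simp add: v_def A.ip_self[OF a] norm_power)
  assume "\<not> ?thesis"
  then have "v x0 < u x0"
    unfolding u v using A.ptnorm_nonneg[OF a, of x0] by (intro power_strict_mono) auto
  define d where "d = (u x0 - v x0) / 2"
  have d: "d > 0" using \<open>v x0 < u x0\<close> by (simp add: d_def)
  have d2: "u x0 \<ge> 2 * d" by (simp add: d_def v_def)
  define f where
    "f x = complex_of_real (max 0 (1 - \<bar>u x - u x0\<bar> / d - \<bar>v x - v x0\<bar> / d))" for x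
  have "(\<lambda>x. complex_of_real (max 0 (1 - \<bar>cmod (hinner B (hmap F a) (hmap F a) x) - u x0\<bar> / d
      - \<bar>cmod (hinner A a a x) - v x0\<bar> / d))) \<in> C0 X"
  proof (rule C0_binary[where C = "1 / d" and \<phi> =
        "\<lambda>z w. complex_of_real (max 0 (1 - \<bar>cmod z - u x0\<bar> / d - \<bar>cmod w - v x0\<bar> / d))"])
    show "continuous_on UNIV (\<lambda>p. complex_of_real
        (max 0 (1 - \<bar>cmod (fst p) - u x0\<bar> / d - \<bar>cmod (snd p) - v x0\<bar> / d)))"
      by (intro continuous_intros) (use d in auto)
    fix z w :: complex
    have "max 0 (1 - \<bar>cmod z - u x0\<bar> / d - \<bar>cmod w - v x0\<bar> / d) \<le> (cmod z + cmod w) / d"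
    proof (cases "cmod z \<ge> d")
      case True
      have "0 \<le> \<bar>cmod z - u x0\<bar> / d" "0 \<le> \<bar>cmod w - v x0\<bar> / d" using d by simp_all
      then have "max 0 (1 - \<bar>cmod z - u x0\<bar> / d - \<bar>cmod w - v x0\<bar> / d) \<le> 1" by linarith
      also have "\<dots> \<le> (cmod z + cmod w) / d" using True d by (simp add: add_increasing2)
      finally show ?thesis .
    next
      case False
      then have "d \<le> \<bar>cmod z - u x0\<bar>" using d2 by linarith
      then have "1 \<le> \<bar>cmod z - u x0\<bar> / d" using d by simp
      moreover have "0 \<le> \<bar>cmod w - v x0\<bar> / d" using d by simp
      ultimately have "max 0 (1 - \<bar>cmod z - u x0\<bar> / d - \<bar>cmod w - v x0\<bar> / d) = 0" by linarith
      then show ?thesis using d by simp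
    qed
    then show "cmod (complex_of_real (max 0 (1 - \<bar>cmod z - u x0\<bar> / d - \<bar>cmod w - v x0\<bar> / d)))
        \<le> 1 / d * (cmod z + cmod w)"
      by (simp only: norm_of_real) simp
  qed (rule A.ip_C0 B.ip_C0 Fa a)+
  then have f: "f \<in> C0 X" by (simp add: f_def[abs_def] u_def v_def)
  have f_le: "cmod (f x) \<le> 1" for x
  proof -
    have "0 \<le> \<bar>u x - u x0\<bar> / d" "0 \<le> \<bar>v x - v x0\<bar> / d" using d by simp_all
    then show ?thesis unfolding f_def norm_of_real by linarith
  qed
  \<comment> \<open>The support of \<open>f\<close> avoids the region where \<open>\<bar>a\<bar>\<^sup>2\<close> exceeds the midpoint \<open>v x0 + d\<close> of \<open>v x0\<close> and \<open>u x0\<close>.\<close>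
  have f_supp: "v x \<le> v x0 + d" if "f x \<noteq> 0" for x
  proof (rule ccontr)
    assume "\<not> v x \<le> v x0 + d"
    then have "1 \<le> \<bar>v x - v x0\<bar> / d" using d by simp
    moreover have "0 \<le> \<bar>u x - u x0\<bar> / d" using d by simp
    ultimately have "f x = 0" by (simp add: f_def)
    then show False using that by simp
  qed
  have "hnorm A (hact A f a) \<le> sqrt (v x0 + d)"
  proof (subst A.hnorm_le_iff)
    show "\<forall>x. ptnorm A (hact A f a) x \<le> sqrt (v x0 + d)"
    proof
      fix x
      have "cmod (f x) * ptnorm A a x \<le> 1 * sqrt (v x0 + d)" if "f x \<noteq> 0"
      proof (rule mult_mono)
        show "ptnorm A a x \<le> sqrt (v x0 + d)"
          using f_supp[OF that] unfolding v[of x] by (rule real_le_rsqrt)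
      qed (use f_le A.ptnorm_nonneg[OF a] in auto)
      then show "ptnorm A (hact A f a) x \<le> sqrt (v x0 + d)"
        using d by (cases "f x = 0") (auto simp: A.ptnorm_act[OF f a] v)
    qed
  qed (use d f a A.closed in \<open>auto simp: v\<close>)
  moreover have "sqrt (u x0) \<le> hnorm B (hmap F (hact A f a))"
    using B.ptnorm_le_hnorm[of "hact B f (hmap F a)" x0] B.ptnorm_nonneg[OF Fa] f Fa
    by (simp add: hhomD(6)[OF F f a] B.ptnorm_act B.closed) (simp add: f_def u)
  moreover have "hnorm B (hmap F (hact A f a)) \<le> hnorm A (hact A f a)"
    using hhomD(7)[OF F] f a A.closed by blast
  ultimately have "u x0 \<le> v x0 + d" by (meson order_trans real_sqrt_le_iff)
  moreover have "u x0 = v x0 + 2 * d" by (simp add: d_def field_simps)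
  ultimately show False using d by linarith
qed

lemma hhomI:
  assumes "hilbert_module X A" "hilbert_module X B"
    and "\<And>a. a \<in> carrier A \<Longrightarrow> h a \<in> carrier B"
    and "\<And>a b. a \<in> carrier A \<Longrightarrow> b \<in> carrier A \<Longrightarrow> h (hadd A a b) = hadd B (h a) (h b)"
    and "\<And>c a. a \<in> carrier A \<Longrightarrow> h (hscale A c a) = hscale B c (h a)"
    and "\<And>f a. f \<in> C0 X \<Longrightarrow> a \<in> carrier A \<Longrightarrow> h (hact A f a) = hact B f (h a)"
    and "\<And>a x. a \<in> carrier A \<Longrightarrow> ptnorm B (h a) x \<le> ptnorm A a x"
  shows "\<lparr>hdom = A, hcod = B, hmap = restrict h (carrier A)\<rparr> \<in> hhom X A B"
proof -
  interpret A: separated_module X A by (rule hilbert_separated) fact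
  interpret B: separated_module X B by (rule hilbert_separated) fact
  have "hnorm B (h a) \<le> hnorm A a" if a: "a \<in> carrier A" for a
    using assms(3,7)[OF a] A.ptnorm_le_hnorm[OF a] A.hnorm_nonneg[OF a]
    by (subst B.hnorm_le_iff) (auto intro: order_trans)
  then show ?thesis using assms by (auto simp: hhom_def A.closed)
qed

text \<open>The closure of a contractive submodule \<open>R\<close> of \<open>A \<times> Z\<close> is the graph of a function, and its domain is
  closed because \<open>Z\<close> is complete. Tensor products of morphisms, the structure maps and the mediating
  morphisms of colimits are all obtained in this way.\<close>

theorem hhom_extension:
  assumes A: "hilbert_module X A" and Z: "hilbert_module X Z"
    and sub: "\<And>a z. (a, z) \<in> R \<Longrightarrow> a \<in> carrier A \<and> z \<in> carrier Z"
    and add: "\<And>a z a' z'. (a, z) \<in> R \<Longrightarrow> (a', z') \<in> R \<Longrightarrow> (hadd A a a', hadd Z z z') \<in> R"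
    and scale: "\<And>c a z. (a, z) \<in> R \<Longrightarrow> (hscale A c a, hscale Z c z) \<in> R"
    and act: "\<And>f a z. f \<in> C0 X \<Longrightarrow> (a, z) \<in> R \<Longrightarrow> (hact A f a, hact Z f z) \<in> R"
    and le: "\<And>a z x. (a, z) \<in> R \<Longrightarrow> ptnorm Z z x \<le> ptnorm A a x"
    and dense: "\<And>a e. a \<in> carrier A \<Longrightarrow> e > 0 \<Longrightarrow> \<exists>(a', z')\<in>R. near A e a a'"
  shows "\<exists>F\<in>hhom X A Z. \<forall>(a, z)\<in>R. hmap F a = z"
proof -
  interpret A: separated_module X A by (rule hilbert_separated) fact
  interpret Z: separated_module X Z by (rule hilbert_separated) fact
  define S where "S a z \<longleftrightarrow> a \<in> carrier A \<and> z \<in> carrier Z \<and>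
      (\<forall>e>0. \<exists>(a', z')\<in>R. near A e a a' \<and> near Z e z z')" for a z
  have SD: "\<exists>a' z'. (a', z') \<in> R \<and> a' \<in> carrier A \<and> z' \<in> carrier Z \<and> near A e a a' \<and> near Z e z z'"
    if "S a z" "e > 0" for a z e
    using that sub unfolding S_def by fast
  have R_S: "S a z" if "(a, z) \<in> R" for a z
    using that sub[OF that] unfolding S_def
    by (auto intro!: bexI[of _ "(a, z)"] A.near_refl Z.near_refl)
  have S_add: "S (hadd A a b) (hadd Z z w)" if s: "S a z" "S b w" for a b z w
    unfolding S_def
  proof (intro conjI allI impI)
    fix e :: real assume "e > 0"
    then have e: "e / 2 > 0" by simp
    obtain a' z' where 1: "(a', z') \<in> R" "a' \<in> carrier A" "z' \<in> carrier Z" "near A (e/2) a a'" "near Z (e/2) z z'"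
      using SD[OF s(1) e] by blast
    obtain b' w' where 2: "(b', w') \<in> R" "b' \<in> carrier A" "w' \<in> carrier Z" "near A (e/2) b b'" "near Z (e/2) w w'"
      using SD[OF s(2) e] by blast
    have "near A e (hadd A a b) (hadd A a' b')" "near Z e (hadd Z z w) (hadd Z z' w')"
      using A.near_add[of a a' b b' "e/2" "e/2"] Z.near_add[of z z' w w' "e/2" "e/2"] 1 2 s
      by (auto simp: S_def)
    then show "\<exists>(a', z')\<in>R. near A e (hadd A a b) a' \<and> near Z e (hadd Z z w) z'"
      using add[OF 1(1) 2(1)] by blast
  qed (use s in \<open>auto simp: S_def A.closed Z.closed\<close>)
  have S_scale: "S (hscale A c a) (hscale Z c z)" if s: "S a z" for a c z
    unfolding S_def
  proof (intro conjI allI impI)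
    fix e :: real assume "e > 0"
    define k where "k = e / (cmod c + 1)"
    have c: "cmod c + 1 > 0" by (simp add: add_nonneg_pos)
    have k: "k > 0" using \<open>e > 0\<close> c by (simp add: k_def)
    have ke: "cmod c * k \<le> e" using \<open>e > 0\<close> c by (simp add: k_def field_simps)
    obtain a' z' where 1: "(a', z') \<in> R" "a' \<in> carrier A" "z' \<in> carrier Z" "near A k a a'" "near Z k z z'"
      using SD[OF s k] by blast
    have "near A e (hscale A c a) (hscale A c a')" "near Z e (hscale Z c z) (hscale Z c z')"
      using A.near_scale[of a a' k c] Z.near_scale[of z z' k c] 1 s ke
      by (auto simp: S_def intro: A.near_mono Z.near_mono)
    then show "\<exists>(a', z')\<in>R. near A e (hscale A c a) a' \<and> near Z e (hscale Z c z) z'"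
      using scale[OF 1(1)] by blast
  qed (use s in \<open>auto simp: S_def A.closed Z.closed\<close>)
  have S_act: "S (hact A f a) (hact Z f z)" if s: "S a z" and f: "f \<in> C0 X" for a f z
    unfolding S_def
  proof (intro conjI allI impI)
    fix e :: real assume "e > 0"
    obtain B where B: "B \<ge> 0" "\<And>x. cmod (f x) \<le> B" using C0_bounded[OF f] by blast
    define k where "k = e / (B + 1)"
    have k: "k > 0" using \<open>e > 0\<close> B by (simp add: k_def)
    have ke: "B * k \<le> e" using \<open>e > 0\<close> B by (simp add: k_def field_simps)
    obtain a' z' where 1: "(a', z') \<in> R" "a' \<in> carrier A" "z' \<in> carrier Z" "near A k a a'" "near Z k z z'"
      using SD[OF s k] by blast
    have "near A e (hact A f a) (hact A f a')" "near Z e (hact Z f z) (hact Z f z')"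
      using A.near_act[of a a' k f B] Z.near_act[of z z' k f B] 1 s ke f B(2)
      by (auto simp: S_def intro: A.near_mono Z.near_mono)
    then show "\<exists>(a', z')\<in>R. near A e (hact A f a) a' \<and> near Z e (hact Z f z) z'"
      using act[OF f 1(1)] by blast
  qed (use s f in \<open>auto simp: S_def A.closed Z.closed\<close>)
  have S_le: "ptnorm Z z x \<le> ptnorm A a x" if s: "S a z" for a x z
  proof (rule field_le_epsilon)
    fix e :: real assume "e > 0"
    then have e: "e / 2 > 0" by simp
    obtain a' z' where 1: "(a', z') \<in> R" "a' \<in> carrier A" "z' \<in> carrier Z" "near A (e/2) a a'" "near Z (e/2) z z'"
      using SD[OF s e] by blast
    have "ptnorm Z z x \<le> ptnorm Z z' x + e / 2"
      using 1 s by (intro Z.near_ptnorm) (auto simp: S_def)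
    moreover have "ptnorm A a' x \<le> ptnorm A a x + e / 2"
      using 1 s A.near_sym[of a a' "e/2"] by (intro A.near_ptnorm) (auto simp: S_def)
    ultimately show "ptnorm Z z x \<le> ptnorm A a x + e" using le[OF 1(1), of x] by linarith
  qed
  have S_unique: "z = w" if s: "S a z" "S a w" for a z w
  proof (rule Z.eq_if_near)
    have a: "a \<in> carrier A" using s by (simp add: S_def)
    show "z \<in> carrier Z" "w \<in> carrier Z" using s by (auto simp: S_def)
    have "S (hsub A a a) (hsub Z z w)" unfolding hsub_def by (intro S_add S_scale s)
    then have "ptnorm Z (hsub Z z w) x \<le> 0" for x using S_le[of "hsub A a a" _ x] A.ptnorm_sub_self[OF a, of x] by simp
    then show "near Z e z w" if "e > 0" for e using that unfolding near_def by (meson less_imp_le order_trans)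
  qed
  have S_total: "\<exists>z. S a z" if a: "a \<in> carrier A" for a
  proof -
    have "\<exists>p. p \<in> R \<and> near A (1 / real (Suc n)) a (fst p)" for n
      using dense[OF a, of "1 / real (Suc n)"] by force
    then obtain p where p: "\<And>n. p n \<in> R" "\<And>n. near A (1 / real (Suc n)) a (fst (p n))" by metis
    define b z where "b n = fst (p n)" and "z n = snd (p n)" for n
    have bz: "(b n, z n) \<in> R" "b n \<in> carrier A" "z n \<in> carrier Z" "near A (1 / real (Suc n)) a (b n)" for n
      using p sub[of "b n" "z n"] by (auto simp: b_def z_def)
    have zz: "near Z (1 / real (Suc m) + 1 / real (Suc n)) (z m) (z n)" for m n
      unfolding near_def
    proof
      fix x
      have "(hsub A (b m) (b n), hsub Z (z m) (z n)) \<in> R" unfolding hsub_def by (intro add scale bz)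
      then have "ptnorm Z (hsub Z (z m) (z n)) x \<le> ptnorm A (hsub A (b m) (b n)) x" by (rule le)
      also have "\<dots> \<le> 1 / real (Suc m) + 1 / real (Suc n)"
        using A.near_trans[OF bz(2) a bz(2) A.near_sym[OF a bz(2) bz(4)] bz(4)] by (simp add: near_def)
      finally show "ptnorm Z (hsub Z (z m) (z n)) x \<le> 1 / real (Suc m) + 1 / real (Suc n)" .
    qed
    have "hcauchy Z z"
      unfolding hcauchy_def
    proof (intro allI impI)
      fix e :: real assume "e > 0"
      then have "e / 2 > 0" by simp
      then obtain N where N: "\<And>n. n \<ge> N \<Longrightarrow> 1 / real (Suc n) < e / 2" by (rule inverse_Suc_small) blast
      have "near Z e (z m) (z n)" if "m \<ge> N" "n \<ge> N" for m n
        using zz[of m n] by (rule Z.near_mono) (use N[OF that(1)] N[OF that(2)] in linarith)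
      then show "\<exists>N. \<forall>m\<ge>N. \<forall>n\<ge>N. near Z e (z m) (z n)" by blast
    qed
    then obtain w where w: "w \<in> carrier Z" "hconv Z z w" using hilbert_complete[OF Z] bz(3) by metis
    have "S a w"
      unfolding S_def
    proof (intro conjI allI impI)
      fix e :: real assume e: "e > 0"
      obtain N where N: "\<And>n. n \<ge> N \<Longrightarrow> 1 / real (Suc n) < e" by (rule inverse_Suc_small[OF e]) blast
      obtain N' where N': "\<And>n. n \<ge> N' \<Longrightarrow> near Z e (z n) w"
        using w(2) e unfolding hconv_def by blast
      define n where "n = max N N'"
      have "near A e a (b n)" using bz(4)[of n] by (rule A.near_mono) (rule less_imp_le, rule N, simp add: n_def)
      moreover have "near Z e w (z n)" using N'[of n] w(1) bz(3) by (intro Z.near_sym[of "z n" w]) (auto simp: n_def)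
      ultimately show "\<exists>(a', z')\<in>R. near A e a a' \<and> near Z e w z'" using bz(1)[of n] by blast
    qed (use a w in auto)
    then show ?thesis by blast
  qed
  define h where "h a = (SOME z. S a z)" for a
  have h: "S a (h a)" if "a \<in> carrier A" for a
    unfolding h_def using S_total[OF that] by (rule someI_ex)
  have h_eq: "h a = z" if "S a z" for a z
    using S_unique[OF h that] that by (simp add: S_def)
  let ?F = "\<lparr>hdom = A, hcod = Z, hmap = restrict h (carrier A)\<rparr>"
  have "?F \<in> hhom X A Z"
  proof (rule hhomI[OF A Z])
    show "h a \<in> carrier Z" if "a \<in> carrier A" for a using h[OF that] by (simp add: S_def)
  qed (auto intro: h_eq S_add S_scale S_act S_le h)
  moreover have "\<forall>(a, z)\<in>R. hmap ?F a = z" using R_S h_eq sub by fastforce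
  ultimately show ?thesis by blast
qed

section \<open>Schur's product theorem\<close>

definition psd :: "'i set \<Rightarrow> ('i \<Rightarrow> 'i \<Rightarrow> complex) \<Rightarrow> bool" where
  "psd I N \<longleftrightarrow> (\<forall>i\<in>I. \<forall>j\<in>I. cnj (N i j) = N j i) \<and>
     (\<forall>c. (\<Sum>i\<in>I. \<Sum>j\<in>I. cnj (c i) * c j * N i j) \<in> \<real>\<^sub>\<ge>\<^sub>0)"

lemma psd_quadratic: "psd I N \<Longrightarrow> (\<Sum>i\<in>I. \<Sum>j\<in>I. cnj (c i) * c j * N i j) \<in> \<real>\<^sub>\<ge>\<^sub>0"
  by (simp add: psd_def)

lemma psd_adj: "psd I N \<Longrightarrow> i \<in> I \<Longrightarrow> j \<in> I \<Longrightarrow> cnj (N i j) = N j i"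
  by (simp add: psd_def)

lemma double_sum_insert:
  fixes f :: "'i \<Rightarrow> 'i \<Rightarrow> complex"
  assumes "finite I" "p \<notin> I"
  shows "(\<Sum>i\<in>insert p I. \<Sum>j\<in>insert p I. f i j)
    = (\<Sum>i\<in>I. \<Sum>j\<in>I. f i j) + (\<Sum>j\<in>I. f p j) + (\<Sum>i\<in>I. f i p) + f p p"
  using assms by (simp add: sum.distrib algebra_simps)

lemma psd_subset:
  assumes "psd (insert p I) N" "finite I" "p \<notin> I"
  shows "psd I N"
  unfolding psd_def
proof (intro conjI allI ballI)
  fix c :: "'a \<Rightarrow> complex"
  have "(\<Sum>i\<in>insert p I. \<Sum>j\<in>insert p I. cnj ((c(p := 0)) i) * (c(p := 0)) j * N i j) \<in> \<real>\<^sub>\<ge>\<^sub>0"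
    by (rule psd_quadratic) fact
  also have "(\<Sum>i\<in>insert p I. \<Sum>j\<in>insert p I. cnj ((c(p := 0)) i) * (c(p := 0)) j * N i j)
      = (\<Sum>i\<in>I. \<Sum>j\<in>I. cnj ((c(p := 0)) i) * (c(p := 0)) j * N i j)"
    by (subst double_sum_insert) (use assms in auto)
  also have "\<dots> = (\<Sum>i\<in>I. \<Sum>j\<in>I. cnj (c i) * c j * N i j)"
    using assms(3) by (intro sum.cong refl) (auto simp: fun_upd_def)
  finally show "(\<Sum>i\<in>I. \<Sum>j\<in>I. cnj (c i) * c j * N i j) \<in> \<real>\<^sub>\<ge>\<^sub>0" .
qed (use assms in \<open>auto simp: psd_def\<close>)

lemma psd_diag:
  assumes "psd I N" "finite I" "p \<in> I"
  shows "N p p \<in> \<real>\<^sub>\<ge>\<^sub>0"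
proof -
  have "(\<Sum>i\<in>I. \<Sum>j\<in>I. cnj (if i = p then 1 else 0) * (if j = p then 1 else 0) * N i j) \<in> \<real>\<^sub>\<ge>\<^sub>0"
    by (rule psd_quadratic) fact
  also have "(\<Sum>i\<in>I. \<Sum>j\<in>I. cnj (if i = p then 1 else 0) * (if j = p then 1 else 0) * N i j)
      = (\<Sum>i\<in>I. \<Sum>j\<in>I. if i = p then if j = p then N i j else 0 else 0)"
    by (intro sum.cong refl) auto
  also have "\<dots> = (\<Sum>i\<in>I. if i = p then N i p else 0)"
    using assms by (intro sum.cong refl) (auto simp: sum.delta)
  also have "\<dots> = N p p" using assms by (simp add: sum.delta)
  finally show ?thesis .
qed

text \<open>Otherwise the form takes the value \<open>N\<^sub>i\<^sub>i - 2 s \<bar>N\<^sub>p\<^sub>i\<bar>\<^sup>2\<close> at the vector with entries \<open>- s N\<^sub>p\<^sub>i\<close> at \<open>p\<close> and \<open>1\<close> at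
  \<open>i\<close>, which is negative for large \<open>s\<close>.\<close>

lemma psd_zero_diag:
  assumes "psd (insert p I) N" "finite I" "p \<notin> I" "N p p = 0" "i \<in> I"
  shows "N p i = 0"
proof (rule ccontr)
  assume "N p i \<noteq> 0"
  define k where "k = (cmod (N p i))^2"
  have k: "k > 0" using \<open>N p i \<noteq> 0\<close> by (simp add: k_def)
  define r where "r = Re (N i i)"
  define s where "s = (\<bar>r\<bar> + 1) / k"
  define c where "c j = (if j = p then - of_real s * N p i else if j = i then 1 else 0)" for j
  have ip: "i \<noteq> p" using assms by auto
  have c: "c p = - of_real s * N p i" "c i = 1" by (auto simp: c_def ip)
  have adj: "N i p = cnj (N p i)" using assms by (simp add: psd_adj)
  have J: "finite (I - {i})" "insert i (I - {i}) = I" "i \<notin> I - {i}" using assms by auto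
  have c0: "c j = 0" if "j \<in> I - {i}" for j using that assms by (auto simp: c_def)
  have single: "(\<Sum>j\<in>I. g j) = g i" if "\<And>j. j \<in> I - {i} \<Longrightarrow> g j = 0" for g :: "_ \<Rightarrow> complex"
    using sum.insert[OF J(1) J(3), of g] that J(2) by simp
  have "(\<Sum>i\<in>insert p I. \<Sum>j\<in>insert p I. cnj (c i) * c j * N i j) \<in> \<real>\<^sub>\<ge>\<^sub>0"
    by (rule psd_quadratic) fact
  also have "(\<Sum>i\<in>insert p I. \<Sum>j\<in>insert p I. cnj (c i) * c j * N i j)
      = N i i - of_real s * (cnj (N p i) * N p i) - of_real s * (cnj (N p i) * N p i)"
  proof -
    have "(\<Sum>k\<in>I. \<Sum>j\<in>I. cnj (c k) * c j * N k j) = (\<Sum>j\<in>I. cnj (c i) * c j * N i j)"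
      by (rule single) (simp add: c0)
    also have "\<dots> = cnj (c i) * c i * N i i" by (rule single) (simp add: c0)
    finally have 1: "(\<Sum>k\<in>I. \<Sum>j\<in>I. cnj (c k) * c j * N k j) = N i i" by (simp add: c)
    have 2: "(\<Sum>j\<in>I. cnj (c p) * c j * N p j) = cnj (c p) * c i * N p i"
      by (rule single) (simp add: c0)
    have 3: "(\<Sum>k\<in>I. cnj (c k) * c p * N k p) = cnj (c i) * c p * N i p"
      by (rule single) (simp add: c0)
    show ?thesis
      by (simp only: double_sum_insert[OF assms(2,3)] 1 2 3) (simp add: c adj assms(4))
  qed
  also have "cnj (N p i) * N p i = of_real k"
    unfolding k_def by (subst mult.commute) (rule complex_norm_square[symmetric])
  finally have "0 \<le> r - 2 * (s * k)" by (simp add: complex_nonneg_Reals_iff r_def mult.commute)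
  also have "s * k = \<bar>r\<bar> + 1" using k by (simp add: s_def)
  finally show False by (simp add: abs_if split: if_splits)
qed

text \<open>Eliminating the row and column of \<open>p\<close> from \<open>N\<close> leaves a positive semidefinite Schur complement and a
  rank one matrix. The entry sum of the entrywise product of \<open>M\<close> with the latter is a value of the
  quadratic form \<open>M\<close>; the Schur complement is treated by induction.\<close>

theorem Schur_product:
  assumes "finite I" "psd I M" "psd I N"
  shows "(\<Sum>i\<in>I. \<Sum>j\<in>I. M i j * N i j) \<in> \<real>\<^sub>\<ge>\<^sub>0"
  using assms
proof (induction I arbitrary: N rule: finite_induct)
  case (insert p I)
  note I = insert.hyps and psd = insert.prems
  obtain d where d: "N p p = of_real d" "d \<ge> 0"
    using psd_diag[OF psd(2), of p] I by (auto simp: nonneg_Reals_def)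
  define N' where "N' i j = N i j - N i p * N p j / of_real d" for i j
  have adj: "cnj (N i j) = N j i" if "i \<in> insert p I" "j \<in> insert p I" for i j
    using psd_adj[OF psd(2) that] .
  have zero: "N p i = 0" "N i p = 0" if "d = 0" "i \<in> I" for i
    using psd_zero_diag[OF psd(2) I] that d(1) adj[of p i] by auto
  have row: "N' p j = 0" "N' j p = 0" if "j \<in> insert p I" for j
    using that zero[of j] d by (auto simp: N'_def)
  have "psd I N'"
    unfolding psd_def
  proof (intro conjI allI ballI)
    fix c :: "'a \<Rightarrow> complex"
    define S where "S = (\<Sum>j\<in>I. N p j * c j)"
    have S': "cnj S = (\<Sum>i\<in>I. cnj (c i) * N i p)"
      unfolding S_def by (simp add: adj mult.commute)
    \<comment> \<open>This choice of the entry at \<open>p\<close> minimizes the form.\<close>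
    define b where "b = c(p := - S / of_real d)"
    have b: "b p = - S / of_real d" "\<And>i. i \<in> I \<Longrightarrow> b i = c i" using I by (auto simp: b_def)
    have S0: "S = 0" if "d = 0" using zero that by (simp add: S_def)
    have "(\<Sum>i\<in>insert p I. \<Sum>j\<in>insert p I. cnj (b i) * b j * N i j) \<in> \<real>\<^sub>\<ge>\<^sub>0"
      by (rule psd_quadratic) (rule psd)
    also have "(\<Sum>i\<in>insert p I. \<Sum>j\<in>insert p I. cnj (b i) * b j * N i j)
      = (\<Sum>i\<in>I. \<Sum>j\<in>I. cnj (c i) * c j * N i j) + cnj (b p) * S + b p * cnj S
        + cnj (b p) * b p * of_real d"
    proof -
      have 1: "(\<Sum>i\<in>I. \<Sum>j\<in>I. cnj (b i) * b j * N i j) = (\<Sum>i\<in>I. \<Sum>j\<in>I. cnj (c i) * c j * N i j)"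
        by (intro sum.cong refl) (simp add: b)
      have 2: "(\<Sum>j\<in>I. cnj (b p) * b j * N p j) = cnj (b p) * S"
        unfolding S_def sum_distrib_left by (intro sum.cong refl) (simp add: b)
      have 3: "(\<Sum>i\<in>I. cnj (b i) * b p * N i p) = b p * cnj S"
        unfolding S' sum_distrib_left by (intro sum.cong refl) (simp add: b)
      show ?thesis by (simp only: double_sum_insert[OF I] 1 2 3 d(1))
    qed
    also have "\<dots> = (\<Sum>i\<in>I. \<Sum>j\<in>I. cnj (c i) * c j * N i j) - cnj S * S / of_real d"
      using S0 by (cases "d = 0") (auto simp: b field_simps)
    also have "\<dots> = (\<Sum>i\<in>I. \<Sum>j\<in>I. cnj (c i) * c j * N' i j)"
    proof -
      have "cnj S * S / of_real d = (\<Sum>i\<in>I. \<Sum>j\<in>I. cnj (c i) * c j * (N i p * N p j / of_real d))"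
        unfolding S' unfolding S_def sum_product sum_divide_distrib by (intro sum.cong refl) (simp add: mult_ac)
      then show ?thesis by (simp add: N'_def right_diff_distrib sum_subtractf)
    qed
    finally show "(\<Sum>i\<in>I. \<Sum>j\<in>I. cnj (c i) * c j * N' i j) \<in> \<real>\<^sub>\<ge>\<^sub>0" .
  next
    show "cnj (N' i j) = N' j i" if "i \<in> I" "j \<in> I" for i j
      using that by (simp add: N'_def adj mult.commute)
  qed
  then have IH: "(\<Sum>i\<in>I. \<Sum>j\<in>I. M i j * N' i j) \<in> \<real>\<^sub>\<ge>\<^sub>0"
    using insert.IH[OF psd_subset[OF psd(1) I]] by blast
  define w where "w i = N p i / of_real (sqrt d)" for i
  have w: "N i p * N p j / of_real d = cnj (w i) * w j" if "i \<in> insert p I" "j \<in> insert p I" for i j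
  proof -
    have "of_real d = (of_real (sqrt d) * of_real (sqrt d) :: complex)"
      using d(2) by (metis of_real_mult real_sqrt_mult_self abs_of_nonneg)
    then show ?thesis using that adj[of p i] by (simp add: w_def)
  qed
  have "(\<Sum>i\<in>insert p I. \<Sum>j\<in>insert p I. M i j * N i j)
      = (\<Sum>i\<in>insert p I. \<Sum>j\<in>insert p I. M i j * N' i j + cnj (w i) * w j * M i j)"
  proof (intro sum.cong refl)
    fix i j assume "i \<in> insert p I" "j \<in> insert p I"
    then have "N i j = N' i j + cnj (w i) * w j" by (simp only: N'_def w[symmetric]) simp
    then show "M i j * N i j = M i j * N' i j + cnj (w i) * w j * M i j" by (simp add: algebra_simps)
  qed
  also have "\<dots> = (\<Sum>i\<in>insert p I. \<Sum>j\<in>insert p I. M i j * N' i j)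
      + (\<Sum>i\<in>insert p I. \<Sum>j\<in>insert p I. cnj (w i) * w j * M i j)"
    by (simp add: sum.distrib del: sum.insert)
  also have "(\<Sum>i\<in>insert p I. \<Sum>j\<in>insert p I. M i j * N' i j) = (\<Sum>i\<in>I. \<Sum>j\<in>I. M i j * N' i j)"
    using row by (subst double_sum_insert[OF I]) simp
  finally show ?case
    using IH psd_quadratic[OF psd(1), of w] by (simp only: nonneg_Reals_add_I)
qed simp

section \<open>Formal sums\<close>

definition hsum :: "('a, 'x) hmod \<Rightarrow> 'a list \<Rightarrow> 'a" where
  "hsum M l = foldr (hadd M) l (hzero M)"

lemma hsum_simps [simp]: "hsum M [] = hzero M" "hsum M (a # l) = hadd M a (hsum M l)"
  by (simp_all add: hsum_def)

context premodule
begin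

lemma hsum_closed: "set l \<subseteq> carrier M \<Longrightarrow> hsum M l \<in> carrier M"
  by (induction l) (auto simp: closed)

lemma ip_hsum: "set l \<subseteq> carrier M \<Longrightarrow> a \<in> carrier M \<Longrightarrow> hinner M a (hsum M l) x = (\<Sum>b\<leftarrow>l. hinner M a b x)"
  by (induction l) (auto simp: ip_simps hsum_closed)

lemma ip_hsum_left: "set l \<subseteq> carrier M \<Longrightarrow> a \<in> carrier M \<Longrightarrow> hinner M (hsum M l) a x = (\<Sum>b\<leftarrow>l. hinner M b a x)"
  by (induction l) (auto simp: ip_simps hsum_closed)

text \<open>The quadratic form of a Gram matrix is the square norm of a linear combination.\<close>

lemma gram_quadratic:
  fixes a :: "nat \<Rightarrow> _"
  assumes "\<And>i. i < n \<Longrightarrow> a i \<in> carrier M"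
  defines "v \<equiv> \<lambda>c. hsum M (map (\<lambda>i. hscale M (c i) (a i)) [0..<n])"
  shows "v c \<in> carrier M"
    and "(\<Sum>i<n. \<Sum>j<n. cnj (c i) * c j * hinner M (a i) (a j) x) = hinner M (v c) (v c) x"
proof -
  have sub: "set (map (\<lambda>i. hscale M (c i) (a i)) [0..<n]) \<subseteq> carrier M"
    using assms by (auto simp: closed)
  then show v: "v c \<in> carrier M" unfolding v_def by (rule hsum_closed)
  have "hinner M (v c) (v c) x = (\<Sum>i\<leftarrow>[0..<n]. hinner M (hscale M (c i) (a i)) (v c) x)"
    using ip_hsum_left[OF sub v, of x] by (simp add: v_def o_def)
  also have "\<dots> = (\<Sum>i<n. hinner M (hscale M (c i) (a i)) (v c) x)"
    by (simp add: interv_sum_list_conv_sum_set_nat atLeast0LessThan)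
  also have "\<dots> = (\<Sum>i<n. \<Sum>j<n. cnj (c i) * c j * hinner M (a i) (a j) x)"
  proof (intro sum.cong refl)
    fix i assume "i \<in> {..<n}"
    then have i: "a i \<in> carrier M" using assms by simp
    have "hinner M (hscale M (c i) (a i)) (v c) x
        = (\<Sum>j\<leftarrow>[0..<n]. hinner M (hscale M (c i) (a i)) (hscale M (c j) (a j)) x)"
      using ip_hsum[OF sub, of "hscale M (c i) (a i)" x] i by (simp add: v_def o_def closed)
    also have "\<dots> = (\<Sum>j<n. hinner M (hscale M (c i) (a i)) (hscale M (c j) (a j)) x)"
      by (simp add: interv_sum_list_conv_sum_set_nat atLeast0LessThan)
    also have "\<dots> = (\<Sum>j<n. cnj (c i) * c j * hinner M (a i) (a j) x)"
      using i assms by (intro sum.cong refl) (simp add: ip_simps)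
    finally show "hinner M (hscale M (c i) (a i)) (v c) x
        = (\<Sum>j<n. cnj (c i) * c j * hinner M (a i) (a j) x)" .
  qed
  finally show "(\<Sum>i<n. \<Sum>j<n. cnj (c i) * c j * hinner M (a i) (a j) x) = hinner M (v c) (v c) x"
    by simp
qed

lemma psd_gram:
  fixes a :: "nat \<Rightarrow> _"
  assumes "\<And>i. i < n \<Longrightarrow> a i \<in> carrier M"
  shows "psd {..<n} (\<lambda>i j. hinner M (a i) (a j) x)"
  unfolding psd_def
  using gram_quadratic[OF assms] by (auto simp: ip_nonneg ip_adj assms)

end

text \<open>Formal sums get the record structure of a module, so that the pointwise norm and convergence are
  defined for them as well.\<close>

definition formal :: "('a, 'x) hmod \<Rightarrow> ('b, 'x) hmod \<Rightarrow> (('a \<times> 'b) list, 'x) hmod" where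
  "formal A B = \<lparr>carrier = fsums A B, hzero = [], hadd = (@), hscale = fscale A, hact = fact_on A,
     hinner = finner A B\<rparr>"

lemma formal_simps [simp]:
  "carrier (formal A B) = fsums A B" "hzero (formal A B) = []" "hadd (formal A B) = (@)"
  "hscale (formal A B) = fscale A" "hact (formal A B) = fact_on A" "hinner (formal A B) = finner A B"
  by (simp_all add: formal_def)

lemma finner_alt: "finner A B u v x =
  (\<Sum>p\<leftarrow>u. \<Sum>q\<leftarrow>v. hinner A (fst p) (fst q) x * hinner B (snd p) (snd q) x)"
  by (simp add: finner_def case_prod_unfold)

lemma finner_Nil [simp]: "finner A B [] v x = 0" "finner A B v [] x = 0"
  by (simp_all add: finner_alt)

lemma finner_Cons_right: "finner A B u (q # v) x
  = (\<Sum>p\<leftarrow>u. hinner A (fst p) (fst q) x * hinner B (snd p) (snd q) x) + finner A B u v x"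
  by (simp add: finner_alt sum_list_addf)

lemma finner_append: "finner A B u (v @ w) x = finner A B u v x + finner A B u w x"
  by (simp add: finner_alt sum_list_addf)

lemma finner_nth: "finner A B u v x = (\<Sum>i<length u. \<Sum>j<length v.
   hinner A (fst (u ! i)) (fst (v ! j)) x * hinner B (snd (u ! i)) (snd (v ! j)) x)"
  by (simp add: finner_alt sum_list_sum_nth atLeast0LessThan)

lemma fsums_iff: "u \<in> fsums A B \<longleftrightarrow> (\<forall>p\<in>set u. fst p \<in> carrier A \<and> snd p \<in> carrier B)"
  by (auto simp: fsums_def in_lists_conv_set)

locale module_pair = A: separated_module X A + B: separated_module X B
  for X :: "'x topology" and A :: "('a, 'x) hmod" and B :: "('b, 'x) hmod"
begin

lemma finner_scale:
  assumes "u \<in> fsums A B" "v \<in> fsums A B"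
  shows "finner A B u (fscale A c v) x = c * finner A B u v x"
  using assms(2)
proof (induction v)
  case (Cons q v)
  have "(\<Sum>p\<leftarrow>u. hinner A (fst p) (hscale A c (fst q)) x * hinner B (snd p) (snd q) x)
      = (\<Sum>p\<leftarrow>u. c * (hinner A (fst p) (fst q) x * hinner B (snd p) (snd q) x))"
    using assms(1) Cons.prems by (intro arg_cong[of _ _ sum_list] map_cong refl) (auto simp: fsums_iff A.ip_simps)
  then show ?case using Cons
    by (simp add: fscale_def finner_Cons_right split_beta algebra_simps sum_list_const_mult fsums_iff)
qed (simp add: fscale_def)

lemma finner_act:
  assumes "u \<in> fsums A B" "v \<in> fsums A B" "f \<in> C0 X"
  shows "finner A B u (fact_on A f v) x = f x * finner A B u v x"
  using assms(2)
proof (induction v)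
  case (Cons q v)
  have "(\<Sum>p\<leftarrow>u. hinner A (fst p) (hact A f (fst q)) x * hinner B (snd p) (snd q) x)
      = (\<Sum>p\<leftarrow>u. f x * (hinner A (fst p) (fst q) x * hinner B (snd p) (snd q) x))"
    using assms Cons.prems by (intro arg_cong[of _ _ sum_list] map_cong refl) (auto simp: fsums_iff A.ip_simps)
  then show ?case using Cons
    by (simp add: fact_on_def finner_Cons_right split_beta algebra_simps sum_list_const_mult fsums_iff)
qed (simp add: fact_on_def)

lemma finner_adj:
  assumes "u \<in> fsums A B" "v \<in> fsums A B"
  shows "cnj (finner A B u v x) = finner A B v u x"
  unfolding finner_nth cnj_sum complex_cnj_mult
  by (subst sum.swap) (use assms in \<open>auto simp: fsums_iff A.ip_adj B.ip_adj intro!: sum.cong\<close>)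

lemma finner_C0:
  assumes "u \<in> fsums A B" "v \<in> fsums A B"
  shows "finner A B u v \<in> C0 X"
proof -
  have "(\<lambda>x. \<Sum>p\<leftarrow>u. \<Sum>q\<leftarrow>v. hinner A (fst p) (fst q) x * hinner B (snd p) (snd q) x) \<in> C0 X"
    using assms by (intro C0_sum_list C0_mult A.ip_C0 B.ip_C0) (auto simp: fsums_iff)
  then show ?thesis by (simp add: finner_alt[abs_def])
qed

text \<open>An entry sum of the entrywise product of the Gram matrices of the first and of the second
  components.\<close>

lemma finner_nonneg:
  assumes "u \<in> fsums A B"
  shows "finner A B u u x \<in> \<real>\<^sub>\<ge>\<^sub>0"
  unfolding finner_nth
  by (intro Schur_product A.psd_gram B.psd_gram) (use assms in \<open>auto simp: fsums_iff\<close>)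

sublocale F: premodule X "formal A B"
  by standard
    (auto simp: finner_scale finner_act finner_adj finner_C0 finner_nonneg finner_append,
     auto simp: fsums_iff fscale_def fact_on_def A.closed)

end

section \<open>The tensor product is a Hilbert module\<close>

definition asymptotic :: "('a, 'x) hmod \<Rightarrow> (nat \<Rightarrow> 'a) \<Rightarrow> (nat \<Rightarrow> 'a) \<Rightarrow> bool" where
  "asymptotic M p q \<longleftrightarrow> (\<forall>e>0. \<exists>N. \<forall>n\<ge>N. near M e (p n) (q n))"

context premodule
begin

lemma asymptotic_refl: "(\<And>n. p n \<in> carrier M) \<Longrightarrow> asymptotic M p p"
  unfolding asymptotic_def by (meson near_refl less_imp_le)

lemma asymptotic_sym:
  assumes "\<And>n. p n \<in> carrier M" "\<And>n. q n \<in> carrier M" "asymptotic M p q"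
  shows "asymptotic M q p"
  using assms near_sym unfolding asymptotic_def by meson

lemma asymptotic_trans:
  assumes "\<And>n. p n \<in> carrier M" "\<And>n. q n \<in> carrier M" "\<And>n. r n \<in> carrier M"
    and "asymptotic M p q" "asymptotic M q r"
  shows "asymptotic M p r"
  unfolding asymptotic_def
proof (intro allI impI)
  fix e :: real assume "e > 0"
  then have e: "e / 2 > 0" by simp
  obtain N where N: "\<And>n. n \<ge> N \<Longrightarrow> near M (e/2) (p n) (q n)" using assms(4) e unfolding asymptotic_def by blast
  obtain N' where N': "\<And>n. n \<ge> N' \<Longrightarrow> near M (e/2) (q n) (r n)" using assms(5) e unfolding asymptotic_def by blast
  have "near M e (p n) (r n)" if "n \<ge> max N N'" for n
    using near_trans[of "p n" "q n" "r n" "e/2" "e/2"] assms(1,2,3) N N' that by simp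
  then show "\<exists>N. \<forall>n\<ge>N. near M e (p n) (r n)" by blast
qed

lemma asymptotic_hdist:
  assumes "\<And>n. p n \<in> carrier M" "\<And>n. q n \<in> carrier M"
  shows "asymptotic M p q \<longleftrightarrow> (\<lambda>n. hdist M (p n) (q n)) \<longlonglongrightarrow> 0"
proof
  assume L: "asymptotic M p q"
  show "(\<lambda>n. hdist M (p n) (q n)) \<longlonglongrightarrow> 0"
  proof (rule LIMSEQ_I)
    fix e :: real assume e: "e > 0"
    then obtain N where N: "\<And>n. n \<ge> N \<Longrightarrow> near M (e/2) (p n) (q n)"
      using L half_gt_zero unfolding asymptotic_def by blast
    have "norm (hdist M (p n) (q n) - 0) < e" if "n \<ge> N" for n
    proof -
      have "hdist M (p n) (q n) \<le> e/2"
        using N[OF that] e by (intro hdist_le_iff[THEN iffD2] assms) auto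
      then show ?thesis using e hdist_nonneg[of "p n" "q n"] by simp
    qed
    then show "\<exists>N. \<forall>n\<ge>N. norm (hdist M (p n) (q n) - 0) < e" by blast
  qed
next
  assume R: "(\<lambda>n. hdist M (p n) (q n)) \<longlonglongrightarrow> 0"
  show "asymptotic M p q"
    unfolding asymptotic_def
  proof (intro allI impI)
    fix e :: real assume e: "e > 0"
    obtain N where N: "\<And>n. n \<ge> N \<Longrightarrow> norm (hdist M (p n) (q n) - 0) < e"
      using LIMSEQ_D[OF R e] by blast
    have "near M e (p n) (q n)" if "n \<ge> N" for n
      using near_mono[OF near_hdist[of "p n" "q n"], of e] assms N[OF that] by simp
    then show "\<exists>N. \<forall>n\<ge>N. near M e (p n) (q n)" by blast
  qed
qed

lemma asymptotic_hcauchy: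
  assumes "\<And>n. p n \<in> carrier M" "\<And>n. q n \<in> carrier M" "asymptotic M p q" "hcauchy M p"
  shows "hcauchy M q"
  unfolding hcauchy_def
proof (intro allI impI)
  fix e :: real assume "e > 0"
  then have e: "e / 3 > 0" by simp
  obtain N where N: "\<And>n. n \<ge> N \<Longrightarrow> near M (e/3) (p n) (q n)" using assms(3) e unfolding asymptotic_def by blast
  obtain N' where N': "\<And>m n. m \<ge> N' \<Longrightarrow> n \<ge> N' \<Longrightarrow> near M (e/3) (p m) (p n)"
    using assms(4) e unfolding hcauchy_def by blast
  have "near M e (q m) (q n)" if "m \<ge> max N N'" "n \<ge> max N N'" for m n
  proof -
    have 1: "near M (e/3) (q m) (p m)" using near_sym[OF assms(1) assms(2) N[of m]] that by simp
    have 2: "near M (e/3) (p m) (p n)" using N' that by simp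
    have 3: "near M (e/3) (p n) (q n)" using N that by simp
    have "near M (e/3 + (e/3 + e/3)) (q m) (q n)"
      by (rule near_trans[OF assms(2) assms(1) assms(2) 1 near_trans[OF assms(1) assms(1) assms(2) 2 3]])
    then show ?thesis by simp
  qed
  then show "\<exists>N. \<forall>m\<ge>N. \<forall>n\<ge>N. near M e (q m) (q n)" by blast
qed

lemma hcauchy_bounded:
  assumes "\<And>n. p n \<in> carrier M" "hcauchy M p"
  obtains N B where "B > 0" "\<And>n x. n \<ge> N \<Longrightarrow> ptnorm M (p n) x \<le> B"
proof -
  obtain N where N: "\<And>m n. m \<ge> N \<Longrightarrow> n \<ge> N \<Longrightarrow> near M 1 (p m) (p n)"
    using assms(2) unfolding hcauchy_def by (meson zero_less_one)
  obtain B where B: "B \<ge> 0" "\<And>x. ptnorm M (p N) x \<le> B" using bounded_ptnorm[OF assms(1), of N] by blast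
  have *: "ptnorm M (p n) x \<le> B + 1" if "n \<ge> N" for n x
    using near_ptnorm[of "p n" "p N" 1 x] assms(1) N[OF that order_refl] B(2)[of x] by simp
  show ?thesis
    by (rule that[of "B + 1" N, OF _ *]) (use B(1) in linarith)
qed

lemma ip_asymptotic:
  assumes "\<And>n. p n \<in> carrier M" "\<And>n. p' n \<in> carrier M" "\<And>n. q n \<in> carrier M" "\<And>n. q' n \<in> carrier M"
    and "hcauchy M p'" "hcauchy M q" "asymptotic M p p'" "asymptotic M q q'" "e > 0"
  shows "\<exists>N. \<forall>n\<ge>N. \<forall>x. cmod (hinner M (p n) (q n) x - hinner M (p' n) (q' n) x) \<le> e"
proof -
  obtain B1 N1 where 1: "B1 > 0" "\<And>n x. n \<ge> N1 \<Longrightarrow> ptnorm M (p' n) x \<le> B1"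
    using hcauchy_bounded[OF assms(2,5)] by metis
  obtain B2 N2 where 2: "B2 > 0" "\<And>n x. n \<ge> N2 \<Longrightarrow> ptnorm M (q n) x \<le> B2"
    using hcauchy_bounded[OF assms(3,6)] by metis
  define d where "d = e / (B1 + B2)"
  have d: "d > 0" using 1 2 \<open>e > 0\<close> by (simp add: d_def)
  obtain N3 where 3: "\<And>n. n \<ge> N3 \<Longrightarrow> near M d (p n) (p' n)" using assms(7) d unfolding asymptotic_def by blast
  obtain N4 where 4: "\<And>n. n \<ge> N4 \<Longrightarrow> near M d (q n) (q' n)" using assms(8) d unfolding asymptotic_def by blast
  have "cmod (hinner M (p n) (q n) x - hinner M (p' n) (q' n) x) \<le> e"
    if "n \<ge> max (max N1 N2) (max N3 N4)" for n x
  proof -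
    have "cmod (hinner M (p n) (q n) x - hinner M (p' n) (q' n) x)
        \<le> ptnorm M (q n) x * d + ptnorm M (p' n) x * d"
      using 3 4 that by (intro near_ip_both assms) auto
    also have "\<dots> \<le> B2 * d + B1 * d"
      using 1(2)[of n x] 2(2)[of n x] that d by (intro add_mono mult_right_mono) auto
    also have "\<dots> = (B1 + B2) * d" by (simp add: algebra_simps)
    also have "\<dots> = e" using 1(1) 2(1) by (simp add: d_def)
    finally show ?thesis .
  qed
  then show ?thesis by blast
qed

lemma ip_cauchy:
  assumes "\<And>n. p n \<in> carrier M" "\<And>n. q n \<in> carrier M" "hcauchy M p" "hcauchy M q" "e > 0"
  shows "\<exists>N. \<forall>m\<ge>N. \<forall>n\<ge>N. \<forall>x. cmod (hinner M (p m) (q m) x - hinner M (p n) (q n) x) \<le> e"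
proof -
  obtain B1 N1 where 1: "B1 > 0" "\<And>n x. n \<ge> N1 \<Longrightarrow> ptnorm M (p n) x \<le> B1"
    using hcauchy_bounded[OF assms(1,3)] by metis
  obtain B2 N2 where 2: "B2 > 0" "\<And>n x. n \<ge> N2 \<Longrightarrow> ptnorm M (q n) x \<le> B2"
    using hcauchy_bounded[OF assms(2,4)] by metis
  define d where "d = e / (B1 + B2)"
  have d: "d > 0" using 1 2 \<open>e > 0\<close> by (simp add: d_def)
  obtain N3 where 3: "\<And>m n. m \<ge> N3 \<Longrightarrow> n \<ge> N3 \<Longrightarrow> near M d (p m) (p n)" using assms(3) d unfolding hcauchy_def by blast
  obtain N4 where 4: "\<And>m n. m \<ge> N4 \<Longrightarrow> n \<ge> N4 \<Longrightarrow> near M d (q m) (q n)" using assms(4) d unfolding hcauchy_def by blast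
  have "cmod (hinner M (p m) (q m) x - hinner M (p n) (q n) x) \<le> e"
    if "m \<ge> max (max N1 N2) (max N3 N4)" "n \<ge> max (max N1 N2) (max N3 N4)" for m n x
  proof -
    have "cmod (hinner M (p m) (q m) x - hinner M (p n) (q n) x)
        \<le> ptnorm M (q m) x * d + ptnorm M (p n) x * d"
      using 3 4 that by (intro near_ip_both assms) auto
    also have "\<dots> \<le> B2 * d + B1 * d"
      using 1(2)[of n x] 2(2)[of m x] that d by (intro add_mono mult_right_mono) auto
    also have "\<dots> = (B1 + B2) * d" by (simp add: algebra_simps)
    also have "\<dots> = e" using 1(1) 2(1) by (simp add: d_def)
    finally show ?thesis .
  qed
  then show ?thesis by blast
qed

lemma hcauchy_add:
  assumes "\<And>n. p n \<in> carrier M" "\<And>n. q n \<in> carrier M" "hcauchy M p" "hcauchy M q"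
  shows "hcauchy M (\<lambda>n. hadd M (p n) (q n))"
  unfolding hcauchy_def
proof (intro allI impI)
  fix e :: real assume "e > 0"
  then have e: "e / 2 > 0" by simp
  obtain N where N: "\<And>m n. m \<ge> N \<Longrightarrow> n \<ge> N \<Longrightarrow> near M (e/2) (p m) (p n)" using assms(3) e unfolding hcauchy_def by blast
  obtain N' where N': "\<And>m n. m \<ge> N' \<Longrightarrow> n \<ge> N' \<Longrightarrow> near M (e/2) (q m) (q n)" using assms(4) e unfolding hcauchy_def by blast
  have "near M e (hadd M (p m) (q m)) (hadd M (p n) (q n))" if "m \<ge> max N N'" "n \<ge> max N N'" for m n
    using near_add[of "p m" "p n" "q m" "q n" "e/2" "e/2"] assms N N' that by simp
  then show "\<exists>N. \<forall>m\<ge>N. \<forall>n\<ge>N. near M e (hadd M (p m) (q m)) (hadd M (p n) (q n))" by blast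
qed

lemma asymptotic_add:
  assumes "\<And>n. p n \<in> carrier M" "\<And>n. q n \<in> carrier M" "\<And>n. p' n \<in> carrier M" "\<And>n. q' n \<in> carrier M"
    and "asymptotic M p p'" "asymptotic M q q'"
  shows "asymptotic M (\<lambda>n. hadd M (p n) (q n)) (\<lambda>n. hadd M (p' n) (q' n))"
  unfolding asymptotic_def
proof (intro allI impI)
  fix e :: real assume "e > 0"
  then have e: "e / 2 > 0" by simp
  obtain N where N: "\<And>n. n \<ge> N \<Longrightarrow> near M (e/2) (p n) (p' n)" using assms(5) e unfolding asymptotic_def by blast
  obtain N' where N': "\<And>n. n \<ge> N' \<Longrightarrow> near M (e/2) (q n) (q' n)" using assms(6) e unfolding asymptotic_def by blast
  have "near M e (hadd M (p n) (q n)) (hadd M (p' n) (q' n))" if "n \<ge> max N N'" for n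
    using near_add[of "p n" "p' n" "q n" "q' n" "e/2" "e/2"] assms N N' that by simp
  then show "\<exists>N. \<forall>n\<ge>N. near M e (hadd M (p n) (q n)) (hadd M (p' n) (q' n))" by blast
qed

text \<open>Scalars and functions of \<open>C\<^sub>0(X)\<close> act by Lipschitz maps.\<close>

lemma hcauchy_Lipschitz:
  assumes "B \<ge> 0" "\<And>e a b. a \<in> carrier M \<Longrightarrow> b \<in> carrier M \<Longrightarrow> near M e a b \<Longrightarrow> near M (B * e) (g a) (g b)"
    and "\<And>n. p n \<in> carrier M" "hcauchy M p"
  shows "hcauchy M (\<lambda>n. g (p n))"
  unfolding hcauchy_def
proof (intro allI impI)
  fix e :: real assume "e > 0"
  define k where "k = e / (B + 1)"
  have k: "k > 0" using \<open>e > 0\<close> assms(1) by (simp add: k_def)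
  have ke: "B * k \<le> e" using \<open>e > 0\<close> assms(1) by (simp add: k_def field_simps)
  obtain N where N: "\<And>m n. m \<ge> N \<Longrightarrow> n \<ge> N \<Longrightarrow> near M k (p m) (p n)" using assms(4) k unfolding hcauchy_def by blast
  have "near M e (g (p m)) (g (p n))" if "m \<ge> N" "n \<ge> N" for m n
    using near_mono[OF assms(2)[OF assms(3) assms(3) N[OF that]] ke] .
  then show "\<exists>N. \<forall>m\<ge>N. \<forall>n\<ge>N. near M e (g (p m)) (g (p n))" by blast
qed

lemma asymptotic_Lipschitz:
  assumes "B \<ge> 0" "\<And>e a b. a \<in> carrier M \<Longrightarrow> b \<in> carrier M \<Longrightarrow> near M e a b \<Longrightarrow> near M (B * e) (g a) (g b)"
    and "\<And>n. p n \<in> carrier M" "\<And>n. q n \<in> carrier M" "asymptotic M p q"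
  shows "asymptotic M (\<lambda>n. g (p n)) (\<lambda>n. g (q n))"
  unfolding asymptotic_def
proof (intro allI impI)
  fix e :: real assume "e > 0"
  define k where "k = e / (B + 1)"
  have k: "k > 0" using \<open>e > 0\<close> assms(1) by (simp add: k_def)
  have ke: "B * k \<le> e" using \<open>e > 0\<close> assms(1) by (simp add: k_def field_simps)
  obtain N where N: "\<And>n. n \<ge> N \<Longrightarrow> near M k (p n) (q n)" using assms(5) k unfolding asymptotic_def by blast
  have "near M e (g (p n)) (g (q n))" if "n \<ge> N" for n
    using near_mono[OF assms(2)[OF assms(3) assms(4) N[OF that]] ke] .
  then show "\<exists>N. \<forall>n\<ge>N. near M e (g (p n)) (g (q n))" by blast
qed

lemma hcauchy_scale:
  "(\<And>n. p n \<in> carrier M) \<Longrightarrow> hcauchy M p \<Longrightarrow> hcauchy M (\<lambda>n. hscale M c (p n))"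
  by (rule hcauchy_Lipschitz[OF norm_ge_zero near_scale])

lemma asymptotic_scale:
  "(\<And>n. p n \<in> carrier M) \<Longrightarrow> (\<And>n. q n \<in> carrier M) \<Longrightarrow> asymptotic M p q
   \<Longrightarrow> asymptotic M (\<lambda>n. hscale M c (p n)) (\<lambda>n. hscale M c (q n))"
  by (rule asymptotic_Lipschitz[OF norm_ge_zero near_scale])

lemma hcauchy_act:
  assumes "f \<in> C0 X" "\<And>n. p n \<in> carrier M" "hcauchy M p"
  shows "hcauchy M (\<lambda>n. hact M f (p n))"
proof -
  obtain B where B: "B \<ge> 0" "\<And>x. cmod (f x) \<le> B" using C0_bounded[OF assms(1)] by blast
  show ?thesis by (rule hcauchy_Lipschitz[OF B(1)]) (auto intro: near_act assms B)
qed

lemma asymptotic_act: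
  assumes "f \<in> C0 X" "\<And>n. p n \<in> carrier M" "\<And>n. q n \<in> carrier M" "asymptotic M p q"
  shows "asymptotic M (\<lambda>n. hact M f (p n)) (\<lambda>n. hact M f (q n))"
proof -
  obtain B where B: "B \<ge> 0" "\<And>x. cmod (f x) \<le> B" using C0_bounded[OF assms(1)] by blast
  show ?thesis by (rule asymptotic_Lipschitz[OF B(1)]) (auto intro: near_act assms B)
qed

end

lemma hcauchy_const: "premodule X M \<Longrightarrow> a \<in> carrier M \<Longrightarrow> hcauchy M (\<lambda>n. a)"
  by (auto simp: hcauchy_def intro: premodule.near_refl)

definition tclass :: "('v, 'x) hobj \<Rightarrow> ('v, 'x) hobj \<Rightarrow> (nat \<Rightarrow> (('v, 'x) elt \<times> ('v, 'x) elt) list) \<Rightarrow> ('v, 'x) elt" where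
  "tclass A B p = Seq (fcanon A B p)"

locale tensor_pair = module_pair X A B for X :: "'x topology" and A B :: "('v, 'x) hobj"
begin

abbreviation "M \<equiv> formal A B"
abbreviation "T \<equiv> tensor A B"

lemma fdist_eq: "u \<in> fsums A B \<Longrightarrow> v \<in> fsums A B \<Longrightarrow> fdist A B u v = hdist M u v"
  by (simp add: hdist_def hnorm_def fdist_def Let_def)

lemma fcauchy_iff: "p \<in> fcauchy A B \<longleftrightarrow> (\<forall>n. p n \<in> fsums A B) \<and> hcauchy M p"
  using F.hcauchy_hdist[of p] by (auto simp: fcauchy_def fdist_eq)

lemma fcanon:
  assumes "p \<in> fcauchy A B"
  shows "fcanon A B p \<in> fcauchy A B" "asymptotic M p (fcanon A B p)"
proof -
  have *: "(\<lambda>n. fdist A B (p n) (q n)) \<longlonglongrightarrow> 0 \<longleftrightarrow> asymptotic M p q" if "q \<in> fcauchy A B" for q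
    using assms that by (subst F.asymptotic_hdist) (auto simp: fcauchy_iff fdist_eq)
  have "p \<in> fcauchy A B \<and> (\<lambda>n. fdist A B (p n) (p n)) \<longlonglongrightarrow> 0"
    using assms * F.asymptotic_refl[of p] by (auto simp: fcauchy_iff)
  then have "fcanon A B p \<in> fcauchy A B \<and> (\<lambda>n. fdist A B (p n) (fcanon A B p n)) \<longlonglongrightarrow> 0"
    unfolding fcanon_def
    by (rule someI[where P = "\<lambda>q. q \<in> fcauchy A B \<and> (\<lambda>n. fdist A B (p n) (q n)) \<longlonglongrightarrow> 0"])
  then show "fcanon A B p \<in> fcauchy A B" "asymptotic M p (fcanon A B p)" using * by auto
qed

lemma tclass_eq_iff:
  assumes p: "p \<in> fcauchy A B" and q: "q \<in> fcauchy A B"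
  shows "tclass A B p = tclass A B q \<longleftrightarrow> asymptotic M p q"
proof
  note c = fcanon[OF p] fcanon[OF q]
  assume "tclass A B p = tclass A B q"
  then have eq: "fcanon A B p = fcanon A B q" by (simp add: tclass_def)
  have "asymptotic M (fcanon A B q) q"
    using c q by (intro F.asymptotic_sym[of q]) (auto simp: fcauchy_iff)
  then show "asymptotic M p q"
    using c p q eq by (intro F.asymptotic_trans[of p "fcanon A B p" q]) (auto simp: fcauchy_iff)
next
  assume pq: "asymptotic M p q"
  then have qp: "asymptotic M q p" using p q by (intro F.asymptotic_sym[of p]) (auto simp: fcauchy_iff)
  have "(\<lambda>n. fdist A B (p n) (r n)) \<longlonglongrightarrow> 0 \<longleftrightarrow> (\<lambda>n. fdist A B (q n) (r n)) \<longlonglongrightarrow> 0"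
    if r: "r \<in> fcauchy A B" for r
  proof -
    have "(\<lambda>n. fdist A B (p n) (r n)) \<longlonglongrightarrow> 0 \<longleftrightarrow> asymptotic M p r"
      using p r by (subst F.asymptotic_hdist) (auto simp: fcauchy_iff fdist_eq)
    moreover have "(\<lambda>n. fdist A B (q n) (r n)) \<longlonglongrightarrow> 0 \<longleftrightarrow> asymptotic M q r"
      using q r by (subst F.asymptotic_hdist) (auto simp: fcauchy_iff fdist_eq)
    moreover have "asymptotic M p r \<longleftrightarrow> asymptotic M q r"
      using F.asymptotic_trans[of p q r] F.asymptotic_trans[of q p r] p q r pq qp
      by (auto simp: fcauchy_iff)
    ultimately show ?thesis by simp
  qed
  then have "fcanon A B p = fcanon A B q" unfolding fcanon_def by (metis (no_types, lifting))
  then show "tclass A B p = tclass A B q" by (simp add: tclass_def)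
qed

lemma carrier_tensor: "carrier T = tclass A B ` fcauchy A B"
  by (auto simp: tensor_def tclass_def)

lemma tclass_closed: "p \<in> fcauchy A B \<Longrightarrow> tclass A B p \<in> carrier T"
  by (simp add: carrier_tensor)

lemma fcauchy_add: "p \<in> fcauchy A B \<Longrightarrow> q \<in> fcauchy A B \<Longrightarrow> (\<lambda>n. p n @ q n) \<in> fcauchy A B"
  using F.hcauchy_add[of p q] F.add_closed by (auto simp: fcauchy_iff)

lemma fcauchy_scale: "p \<in> fcauchy A B \<Longrightarrow> (\<lambda>n. fscale A c (p n)) \<in> fcauchy A B"
  using F.hcauchy_scale[of p c] F.scale_closed by (auto simp: fcauchy_iff)

lemma fcauchy_act: "f \<in> C0 X \<Longrightarrow> p \<in> fcauchy A B \<Longrightarrow> (\<lambda>n. fact_on A f (p n)) \<in> fcauchy A B"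
  using F.hcauchy_act[of f p] F.act_closed by (auto simp: fcauchy_iff)

lemma fcauchy_const: "u \<in> fsums A B \<Longrightarrow> (\<lambda>n. u) \<in> fcauchy A B"
  using hcauchy_const[OF F.premodule_axioms] by (auto simp: fcauchy_iff)

lemma fcanon_asymptotic:
  assumes "p \<in> fcauchy A B" shows "asymptotic M (fcanon A B p) p"
  using assms fcanon[OF assms] by (intro F.asymptotic_sym[of p]) (auto simp: fcauchy_iff)

lemma hadd_tclass:
  assumes p: "p \<in> fcauchy A B" and q: "q \<in> fcauchy A B"
  shows "hadd T (tclass A B p) (tclass A B q) = tclass A B (\<lambda>n. p n @ q n)"
proof -
  note c = fcanon[OF p] fcanon[OF q]
  have "tclass A B (\<lambda>n. fcanon A B p n @ fcanon A B q n) = tclass A B (\<lambda>n. p n @ q n)"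
    using F.asymptotic_add[of "fcanon A B p" "fcanon A B q" p q] p q c fcanon_asymptotic[OF p] fcanon_asymptotic[OF q]
    by (intro tclass_eq_iff[THEN iffD2] fcauchy_add) (auto simp: fcauchy_iff)
  then show ?thesis by (simp add: tensor_def tclass_def)
qed

lemma hscale_tclass:
  assumes p: "p \<in> fcauchy A B"
  shows "hscale T c (tclass A B p) = tclass A B (\<lambda>n. fscale A c (p n))"
proof -
  have "tclass A B (\<lambda>n. fscale A c (fcanon A B p n)) = tclass A B (\<lambda>n. fscale A c (p n))"
    using p fcanon[OF p] fcanon_asymptotic[OF p] F.asymptotic_scale[of "fcanon A B p" p c]
    by (intro tclass_eq_iff[THEN iffD2] fcauchy_scale) (auto simp: fcauchy_iff)
  then show ?thesis by (simp add: tensor_def tclass_def)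
qed

lemma hact_tclass:
  assumes f: "f \<in> C0 X" and p: "p \<in> fcauchy A B"
  shows "hact T f (tclass A B p) = tclass A B (\<lambda>n. fact_on A f (p n))"
proof -
  have "tclass A B (\<lambda>n. fact_on A f (fcanon A B p n)) = tclass A B (\<lambda>n. fact_on A f (p n))"
    using f p fcanon[OF p] fcanon_asymptotic[OF p] F.asymptotic_act[of f "fcanon A B p" p]
    by (intro tclass_eq_iff[THEN iffD2] fcauchy_act) (auto simp: fcauchy_iff)
  then show ?thesis by (simp add: tensor_def tclass_def)
qed

text \<open>The convergence is uniform on the space, which keeps the limit in \<open>C\<^sub>0(X)\<close> and lets inner products
  control the distance.\<close>

lemma finner_uniform_limit:
  assumes p: "p \<in> fcauchy A B" and q: "q \<in> fcauchy A B" and e: "e > 0"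
  shows "\<exists>N. \<forall>n\<ge>N. \<forall>x. cmod (finner A B (p n) (q n) x - hinner T (tclass A B p) (tclass A B q) x) \<le> e"
proof -
  define p' q' where "p' = fcanon A B p" and "q' = fcanon A B q"
  have c: "p' \<in> fcauchy A B" "q' \<in> fcauchy A B" "asymptotic M p p'" "asymptotic M q q'"
    using fcanon[OF p] fcanon[OF q] by (simp_all add: p'_def q'_def)
  have inner: "hinner T (tclass A B p) (tclass A B q) x = lim (\<lambda>n. finner A B (p' n) (q' n) x)" for x
    by (simp add: tensor_def tclass_def p'_def q'_def)
  have "Cauchy (\<lambda>n. finner A B (p' n) (q' n) x)" for x
  proof (rule metric_CauchyI)
    fix e :: real assume "e > 0"
    then obtain N where N: "\<forall>m\<ge>N. \<forall>n\<ge>N. \<forall>x. cmod (finner A B (p' m) (q' m) x - finner A B (p' n) (q' n) x) \<le> e / 2"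
      using F.ip_cauchy[of p' q' "e / 2"] c by (auto simp: fcauchy_iff)
    have "dist (finner A B (p' m) (q' m) x) (finner A B (p' n) (q' n) x) < e" if "m \<ge> N" "n \<ge> N" for m n
      using N[rule_format, OF that, of x] \<open>e > 0\<close> by (simp add: dist_norm)
    then show "\<exists>N. \<forall>m\<ge>N. \<forall>n\<ge>N. dist (finner A B (p' m) (q' m) x) (finner A B (p' n) (q' n) x) < e" by blast
  qed
  then have L: "(\<lambda>n. finner A B (p' n) (q' n) x) \<longlonglongrightarrow> hinner T (tclass A B p) (tclass A B q) x" for x
    unfolding inner by (simp add: Cauchy_convergent_iff convergent_LIMSEQ_iff)
  \<comment> \<open>The pointwise limits inherit the uniform Cauchy estimate.\<close>
  obtain N1 where N1: "\<And>m n x. m \<ge> N1 \<Longrightarrow> n \<ge> N1 \<Longrightarrow>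
      cmod (finner A B (p' m) (q' m) x - finner A B (p' n) (q' n) x) \<le> e / 2"
    using F.ip_cauchy[of p' q' "e / 2"] c e by (auto simp: fcauchy_iff)
  obtain N2 where N2: "\<And>n x. n \<ge> N2 \<Longrightarrow> cmod (finner A B (p n) (q n) x - finner A B (p' n) (q' n) x) \<le> e / 2"
    using F.ip_asymptotic[of p p' q q' "e / 2"] c e p q by (auto simp: fcauchy_iff)
  have "cmod (finner A B (p n) (q n) x - hinner T (tclass A B p) (tclass A B q) x) \<le> e"
    if n: "n \<ge> max N1 N2" for n x
  proof -
    have "(\<lambda>m. cmod (finner A B (p' n) (q' n) x - finner A B (p' m) (q' m) x))
        \<longlonglongrightarrow> cmod (finner A B (p' n) (q' n) x - hinner T (tclass A B p) (tclass A B q) x)"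
      by (intro tendsto_intros L)
    then have "cmod (finner A B (p' n) (q' n) x - hinner T (tclass A B p) (tclass A B q) x) \<le> e / 2"
      by (rule LIMSEQ_le_const2) (use N1 n in auto)
    then show ?thesis
      using N2[of n x] n norm_triangle_ineq[of "finner A B (p n) (q n) x - finner A B (p' n) (q' n) x"
        "finner A B (p' n) (q' n) x - hinner T (tclass A B p) (tclass A B q) x"] by simp
  qed
  then show ?thesis by blast
qed

lemma finner_tendsto:
  assumes p: "p \<in> fcauchy A B" and q: "q \<in> fcauchy A B"
  shows "(\<lambda>n. finner A B (p n) (q n) x) \<longlonglongrightarrow> hinner T (tclass A B p) (tclass A B q) x"
proof (rule LIMSEQ_I)
  fix e :: real assume e: "e > 0"
  then obtain N where "\<forall>n\<ge>N. \<forall>x. cmod (finner A B (p n) (q n) x - hinner T (tclass A B p) (tclass A B q) x) \<le> e / 2"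
    using finner_uniform_limit[OF p q, of "e / 2"] by auto
  then show "\<exists>N. \<forall>n\<ge>N. norm (finner A B (p n) (q n) x - hinner T (tclass A B p) (tclass A B q) x) < e"
    using e by (intro exI[of _ N]) (smt (verit, best) field_sum_of_halves)
qed

lemma tensor_elim:
  assumes "z \<in> carrier T"
  obtains p where "p \<in> fcauchy A B" "z = tclass A B p"
  using assms by (auto simp: carrier_tensor)

lemma hzero_tensor: "hzero T = tclass A B (\<lambda>n. [])"
  by (simp add: tensor_def tclass_def)

lemma Nil_fsums: "[] \<in> fsums A B" by (simp add: fsums_iff)

text \<open>All axioms pass from formal sums to the limit.\<close>

sublocale T: premodule X T
proof
  note ops = hadd_tclass hscale_tclass hact_tclass fcauchy_add fcauchy_scale fcauchy_act
    fcauchy_const[OF Nil_fsums] hzero_tensor tclass_closed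
  show "hzero T \<in> carrier T" by (simp add: ops)
  fix a b assume a: "a \<in> carrier T" and b: "b \<in> carrier T"
  obtain p where p: "p \<in> fcauchy A B" "a = tclass A B p" by (rule tensor_elim[OF a])
  obtain q where q: "q \<in> fcauchy A B" "b = tclass A B q" by (rule tensor_elim[OF b])
  have pq: "p n \<in> carrier M" "q n \<in> carrier M" for n using p q by (auto simp: fcauchy_iff)
  note lims = finner_tendsto[OF p(1) q(1)]
  show "hadd T a b \<in> carrier T" using p q by (simp add: ops)
  show "hscale T c a \<in> carrier T" for c using p by (simp add: ops)
  show "hact T f a \<in> carrier T" if "f \<in> C0 X" for f using p that by (simp add: ops)
  show "hinner T a b \<in> C0 X"
  proof (rule C0_uniform_limit)
    fix e :: real assume "e > 0"
    then obtain N where "\<forall>x. cmod (finner A B (p N) (q N) x - hinner T a b x) \<le> e"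
      using finner_uniform_limit[OF p(1) q(1)] p q by (metis order_refl)
    then show "\<exists>f\<in>C0 X. \<forall>x. cmod (f x - hinner T a b x) \<le> e"
      using pq by (intro bexI[of _ "finner A B (p N) (q N)"] finner_C0) auto
  qed
  show "cnj (hinner T a b x) = hinner T b a x" for x
  proof (rule LIMSEQ_unique)
    show "(\<lambda>n. cnj (finner A B (p n) (q n) x)) \<longlonglongrightarrow> cnj (hinner T a b x)"
      unfolding p q by (intro tendsto_intros lims)
    show "(\<lambda>n. cnj (finner A B (p n) (q n) x)) \<longlonglongrightarrow> hinner T b a x"
      using pq finner_tendsto[OF q(1) p(1)] by (simp add: finner_adj p(2) q(2))
  qed
  show "hinner T a (hzero T) x = 0" for x
    using finner_tendsto[OF p(1) fcauchy_const[OF Nil_fsums], of x]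
    by (simp add: ops p(2) LIMSEQ_const_iff)
  show "hinner T a (hscale T c b) x = c * hinner T a b x" for c x
  proof (rule LIMSEQ_unique)
    show "(\<lambda>n. finner A B (p n) (fscale A c (q n)) x) \<longlonglongrightarrow> hinner T a (hscale T c b) x"
      using finner_tendsto[OF p(1) fcauchy_scale[OF q(1)]] p q by (simp add: ops)
    show "(\<lambda>n. finner A B (p n) (fscale A c (q n)) x) \<longlonglongrightarrow> c * hinner T a b x"
      using pq unfolding p q by (simp add: finner_scale) (intro tendsto_intros lims)
  qed
  show "hinner T a (hact T f b) x = f x * hinner T a b x" if f: "f \<in> C0 X" for f x
  proof (rule LIMSEQ_unique)
    show "(\<lambda>n. finner A B (p n) (fact_on A f (q n)) x) \<longlonglongrightarrow> hinner T a (hact T f b) x"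
      using finner_tendsto[OF p(1) fcauchy_act[OF f q(1)]] p q f by (simp add: ops)
    show "(\<lambda>n. finner A B (p n) (fact_on A f (q n)) x) \<longlonglongrightarrow> f x * hinner T a b x"
      using pq f unfolding p q by (simp add: finner_act) (intro tendsto_intros lims)
  qed
  show "hinner T a a x \<in> \<real>\<^sub>\<ge>\<^sub>0" for x
    using closed_sequentially[OF closed_nonneg_Reals_complex _ finner_tendsto[OF p(1) p(1), of x]]
      pq finner_nonneg p by simp
  fix c assume c: "c \<in> carrier T"
  obtain r where r: "r \<in> fcauchy A B" "c = tclass A B r" by (rule tensor_elim[OF c])
  show "hinner T a (hadd T b c) x = hinner T a b x + hinner T a c x" for x
  proof (rule LIMSEQ_unique)
    show "(\<lambda>n. finner A B (p n) (q n @ r n) x) \<longlonglongrightarrow> hinner T a (hadd T b c) x"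
      using finner_tendsto[OF p(1) fcauchy_add[OF q(1) r(1)]] p q r by (simp add: ops)
    show "(\<lambda>n. finner A B (p n) (q n @ r n) x) \<longlonglongrightarrow> hinner T a b x + hinner T a c x"
      unfolding p q r finner_append by (intro tendsto_intros lims finner_tendsto p q r)
  qed
qed

lemma hsub_tclass:
  assumes "p \<in> fcauchy A B" "q \<in> fcauchy A B"
  shows "hsub T (tclass A B p) (tclass A B q) = tclass A B (\<lambda>n. hsub M (p n) (q n))"
  using assms by (simp add: hsub_def hadd_tclass hscale_tclass fcauchy_scale)

lemma ptnorm_tclass_lim:
  assumes "p \<in> fcauchy A B" "q \<in> fcauchy A B"
  shows "(\<lambda>n. ptnorm M (hsub M (p n) (q n)) x) \<longlonglongrightarrow> ptnorm T (hsub T (tclass A B p) (tclass A B q)) x"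
proof -
  have "(\<lambda>n. hsub M (p n) (q n)) \<in> fcauchy A B"
    using assms by (simp add: hsub_def fcauchy_add fcauchy_scale)
  from finner_tendsto[OF this this] show ?thesis
    unfolding ptnorm_def hsub_tclass[OF assms] formal_simps by (intro tendsto_intros)
qed

lemma near_tclass:
  assumes "p \<in> fcauchy A B" "q \<in> fcauchy A B" "\<And>n. n \<ge> N \<Longrightarrow> near M e (p n) (q n)"
  shows "near T e (tclass A B p) (tclass A B q)"
  unfolding near_def
proof
  fix x
  show "ptnorm T (hsub T (tclass A B p) (tclass A B q)) x \<le> e"
    by (rule LIMSEQ_le_const2[OF ptnorm_tclass_lim[OF assms(1,2)]]) (use assms(3) in \<open>auto simp: near_def\<close>)
qed

sublocale T: separated_module X T
proof
  fix a b assume a: "a \<in> carrier T" and b: "b \<in> carrier T"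
    and 0: "\<And>x. hinner T (hsub T a b) (hsub T a b) x = 0"
  obtain p where p: "p \<in> fcauchy A B" "a = tclass A B p" by (rule tensor_elim[OF a])
  obtain q where q: "q \<in> fcauchy A B" "b = tclass A B q" by (rule tensor_elim[OF b])
  define d where "d n = hsub M (p n) (q n)" for n
  have d: "d \<in> fcauchy A B"
    using p q by (simp add: d_def[abs_def] hsub_def fcauchy_add fcauchy_scale)
  have 0: "hinner T (tclass A B d) (tclass A B d) x = 0" for x
    using 0[of x] p q by (simp add: hsub_tclass d_def[abs_def])
  have "asymptotic M p q"
    unfolding asymptotic_def
  proof (intro allI impI)
    fix e :: real assume e: "e > 0"
    then obtain N where N: "\<And>n x. n \<ge> N \<Longrightarrow> cmod (finner A B (d n) (d n) x) \<le> e^2"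
      using finner_uniform_limit[OF d d, of "e^2"] by (auto simp: 0)
    have "near M e (p n) (q n)" if "n \<ge> N" for n
      unfolding near_def d_def[symmetric]
    proof
      fix x
      show "ptnorm M (d n) x \<le> e"
        using d N[OF that, of x] e complex_Re_le_cmod[of "finner A B (d n) (d n) x"]
        by (intro F.ptnorm_leI) (auto simp: fcauchy_iff)
    qed
    then show "\<exists>N. \<forall>n\<ge>N. near M e (p n) (q n)" by blast
  qed
  then show "a = b" using p q by (simp add: tclass_eq_iff)
qed

definition emb :: "(('v, 'x) elt \<times> ('v, 'x) elt) list \<Rightarrow> ('v, 'x) elt" where
  "emb u = tclass A B (\<lambda>n. u)"

lemma emb_closed: "u \<in> fsums A B \<Longrightarrow> emb u \<in> carrier T"
  by (simp add: emb_def tclass_closed fcauchy_const)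

lemma hinner_emb: "u \<in> fsums A B \<Longrightarrow> v \<in> fsums A B \<Longrightarrow> hinner T (emb u) (emb v) x = finner A B u v x"
  using finner_tendsto[OF fcauchy_const fcauchy_const, of u v x] by (simp add: emb_def LIMSEQ_const_iff)

lemma near_emb:
  assumes "u \<in> fsums A B" "v \<in> fsums A B"
  shows "near T e (emb u) (emb v) \<longleftrightarrow> near M e u v"
  using ptnorm_tclass_lim[OF fcauchy_const fcauchy_const, of u v] assms
  by (simp add: near_def emb_def LIMSEQ_const_iff)

lemma approx_formal_sum:
  assumes "z \<in> carrier T" "e > 0"
  obtains u where "u \<in> fsums A B" "near T e z (emb u)"
proof -
  obtain p where p: "p \<in> fcauchy A B" "z = tclass A B p" by (rule tensor_elim[OF assms(1)])
  obtain N where "\<And>m n. m \<ge> N \<Longrightarrow> n \<ge> N \<Longrightarrow> near M e (p m) (p n)"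
    using p(1) assms(2) unfolding fcauchy_iff hcauchy_def by blast
  then have "near T e z (emb (p N))"
    unfolding p(2) emb_def using p(1)
    by (intro near_tclass[where N = N] fcauchy_const) (auto simp: fcauchy_iff)
  then show ?thesis using that[of "p N"] p(1) by (auto simp: fcauchy_iff)
qed

text \<open>Replace the \<open>n\<close>-th member of a Cauchy sequence by a formal sum at distance at most \<open>1 / (n + 1)\<close>. These
  formal sums are a Cauchy sequence, and its class is the limit.\<close>

theorem hilbert_tensor: "hilbert_module X T"
proof (rule hilbert_moduleI[OF T.separated_module_axioms])
  fix s assume s: "\<And>n. s n \<in> carrier T" "hcauchy T s"
  have "\<exists>u. u \<in> fsums A B \<and> near T (1 / real (Suc n)) (s n) (emb u)" for n
    using approx_formal_sum[OF s(1), of "1 / real (Suc n)" n] by (metis of_nat_0_less_iff zero_less_Suc zero_less_divide_1_iff)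
  then obtain r where r: "\<And>n. r n \<in> fsums A B" "\<And>n. near T (1 / real (Suc n)) (s n) (emb (r n))" by metis
  have close: "asymptotic T s (\<lambda>n. emb (r n))"
    unfolding asymptotic_def
  proof (intro allI impI)
    fix e :: real assume "e > 0"
    then obtain N where N: "\<And>n. n \<ge> N \<Longrightarrow> 1 / real (Suc n) < e" by (rule inverse_Suc_small) blast
    have "near T e (s n) (emb (r n))" if "n \<ge> N" for n
      by (rule T.near_mono[OF r(2) less_imp_le[OF N[OF that]]])
    then show "\<exists>N. \<forall>n\<ge>N. near T e (s n) (emb (r n))" by blast
  qed
  have "hcauchy T (\<lambda>n. emb (r n))"
    using T.asymptotic_hcauchy[OF _ _ close] s r emb_closed by simp
  then have "hcauchy M r" using r(1) by (simp add: hcauchy_def near_emb)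
  then have rc: "r \<in> fcauchy A B" using r(1) by (simp add: fcauchy_iff)
  have "asymptotic T (\<lambda>n. emb (r n)) (\<lambda>n. tclass A B r)"
    unfolding asymptotic_def
  proof (intro allI impI)
    fix e :: real assume "e > 0"
    then obtain N where N: "\<And>m n. m \<ge> N \<Longrightarrow> n \<ge> N \<Longrightarrow> near M e (r m) (r n)"
      using \<open>hcauchy M r\<close> unfolding hcauchy_def by blast
    have "near T e (emb (r n)) (tclass A B r)" if "n \<ge> N" for n
      unfolding emb_def by (rule near_tclass[where N = N]) (use N that rc r in \<open>auto intro: fcauchy_const\<close>)
    then show "\<exists>N. \<forall>n\<ge>N. near T e (emb (r n)) (tclass A B r)" by blast
  qed
  with close have "asymptotic T s (\<lambda>n. tclass A B r)"
    by (rule T.asymptotic_trans[rotated 3]) (use s r emb_closed tclass_closed[OF rc] in auto)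
  then show "\<exists>a\<in>carrier T. hconv T s a"
    using tclass_closed[OF rc] by (auto simp: hconv_def asymptotic_def)
qed

section \<open>Pure tensors\<close>

lemma pure_emb: "pure A B a b = emb [(a, b)]"
  by (simp add: pure_def emb_def tclass_def)

lemma pure_closed: "a \<in> carrier A \<Longrightarrow> b \<in> carrier B \<Longrightarrow> pure A B a b \<in> carrier T"
  by (simp add: pure_emb emb_closed fsums_iff)

lemma hinner_pure:
  "\<lbrakk>a \<in> carrier A; b \<in> carrier B; a' \<in> carrier A; b' \<in> carrier B\<rbrakk>
   \<Longrightarrow> hinner T (pure A B a b) (pure A B a' b') x = hinner A a a' x * hinner B b b' x"
  by (simp add: pure_emb hinner_emb fsums_iff finner_alt)

lemma ptnorm_pure:
  assumes "a \<in> carrier A" "b \<in> carrier B"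
  shows "ptnorm T (pure A B a b) x = ptnorm A a x * ptnorm B b x"
proof -
  have "hinner T (pure A B a b) (pure A B a b) x = of_real ((ptnorm A a x * ptnorm B b x)^2)"
    using assms by (simp add: hinner_pure A.ip_self B.ip_self power_mult_distrib)
  then show ?thesis using A.ptnorm_nonneg[OF assms(1)] B.ptnorm_nonneg[OF assms(2)]
    by (simp only: ptnorm_def) (simp del: of_real_power)
qed

text \<open>Bilinearity of \<open>\<otimes>\<close>: the difference of both sides has square norm zero, by expansion into inner
  products of pure tensors.\<close>

lemma pure_add_left:
  "\<lbrakk>a \<in> carrier A; a' \<in> carrier A; b \<in> carrier B\<rbrakk>
   \<Longrightarrow> pure A B (hadd A a a') b = hadd T (pure A B a b) (pure A B a' b)"
  by (intro T.definite) (simp_all add: T.ip_simps A.closed pure_closed hinner_pure A.ip_simps algebra_simps)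

lemma pure_add_right:
  "\<lbrakk>a \<in> carrier A; b \<in> carrier B; b' \<in> carrier B\<rbrakk>
   \<Longrightarrow> pure A B a (hadd B b b') = hadd T (pure A B a b) (pure A B a b')"
  by (intro T.definite) (simp_all add: T.ip_simps B.closed pure_closed hinner_pure B.ip_simps algebra_simps)

lemma pure_sub_left:
  "\<lbrakk>a \<in> carrier A; a' \<in> carrier A; b \<in> carrier B\<rbrakk>
   \<Longrightarrow> pure A B (hsub A a a') b = hsub T (pure A B a b) (pure A B a' b)"
  by (intro T.definite) (simp_all add: T.ip_simps A.closed pure_closed hinner_pure A.ip_simps algebra_simps)

lemma pure_sub_right:
  "\<lbrakk>a \<in> carrier A; b \<in> carrier B; b' \<in> carrier B\<rbrakk>
   \<Longrightarrow> pure A B a (hsub B b b') = hsub T (pure A B a b) (pure A B a b')"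
  by (intro T.definite) (simp_all add: T.ip_simps B.closed pure_closed hinner_pure B.ip_simps algebra_simps)

lemma pure_scale_left:
  "\<lbrakk>a \<in> carrier A; b \<in> carrier B\<rbrakk> \<Longrightarrow> pure A B (hscale A c a) b = hscale T c (pure A B a b)"
  by (intro T.definite) (simp_all add: T.ip_simps A.closed pure_closed hinner_pure A.ip_simps algebra_simps)

lemma pure_act_left:
  "\<lbrakk>f \<in> C0 X; a \<in> carrier A; b \<in> carrier B\<rbrakk> \<Longrightarrow> pure A B (hact A f a) b = hact T f (pure A B a b)"
  by (intro T.definite) (simp_all add: T.ip_simps A.closed pure_closed hinner_pure A.ip_simps algebra_simps)

lemma pure_act_right:
  "\<lbrakk>f \<in> C0 X; a \<in> carrier A; b \<in> carrier B\<rbrakk> \<Longrightarrow> pure A B a (hact B f b) = hact T f (pure A B a b)"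
  by (intro T.definite) (simp_all add: T.ip_simps B.closed pure_closed hinner_pure B.ip_simps algebra_simps)

lemma pure_zero_left: "b \<in> carrier B \<Longrightarrow> pure A B (hzero A) b = hzero T"
  by (intro T.definite) (simp_all add: T.ip_simps A.closed pure_closed hinner_pure A.ip_simps)

lemma pure_zero_right: "a \<in> carrier A \<Longrightarrow> pure A B a (hzero B) = hzero T"
  by (intro T.definite) (simp_all add: T.ip_simps B.closed pure_closed hinner_pure B.ip_simps)

lemma emb_Nil: "emb [] = hzero T"
  by (simp add: emb_def hzero_tensor)

lemma emb_Cons: "p \<in> carrier A \<times> carrier B \<Longrightarrow> u \<in> fsums A B \<Longrightarrow>
  emb (p # u) = hadd T (pure A B (fst p) (snd p)) (emb u)"
  using hadd_tclass[OF fcauchy_const fcauchy_const, of "[p]" u]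
  by (auto simp: emb_def pure_emb fsums_iff)

text \<open>Scalar multiples of pure tensors are pure, so sums and limits suffice.\<close>

theorem tensor_induct [consumes 1, case_names pure zero add limit]:
  assumes z: "z \<in> carrier T"
    and pure: "\<And>a b. a \<in> carrier A \<Longrightarrow> b \<in> carrier B \<Longrightarrow> P (pure A B a b)"
    and zero: "P (hzero T)"
    and add: "\<And>z w. z \<in> carrier T \<Longrightarrow> w \<in> carrier T \<Longrightarrow> P z \<Longrightarrow> P w \<Longrightarrow> P (hadd T z w)"
    and limit: "\<And>z. z \<in> carrier T \<Longrightarrow> (\<And>e. e > 0 \<Longrightarrow> \<exists>w\<in>carrier T. P w \<and> near T e z w) \<Longrightarrow> P z"
  shows "P z"
proof (rule limit[OF z])
  fix e :: real assume "e > 0"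
  then obtain u where u: "u \<in> fsums A B" "near T e z (emb u)" using approx_formal_sum[OF z] by blast
  have "P (emb u)" using u(1)
  proof (induction u)
    case (Cons p u)
    then show ?case
      by (subst emb_Cons) (auto simp: fsums_iff mem_Times_iff intro!: add pure pure_closed emb_closed)
  qed (simp add: emb_Nil zero)
  then show "\<exists>w\<in>carrier T. P w \<and> near T e z w" using u emb_closed by blast
qed

end

lemma tensor_pairI: "hilbert_module X A \<Longrightarrow> hilbert_module X B \<Longrightarrow> tensor_pair X A B"
  by (simp add: tensor_pair_def module_pair_def hilbert_separated)

section \<open>Generating sets\<close>

text \<open>The closed additive span. Scalars are left out because the generating sets that occur are closed under
  them.\<close>

definition cspan :: "('a, 'x) hmod \<Rightarrow> 'a set \<Rightarrow> 'a set" where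
  "cspan A D = {a \<in> carrier A. \<forall>e>0. \<exists>l\<in>lists D. near A e a (hsum A l)}"

definition generates :: "('a, 'x) hmod \<Rightarrow> 'a set \<Rightarrow> bool" where
  "generates A D \<longleftrightarrow> D \<subseteq> carrier A \<and> carrier A \<subseteq> cspan A D"

lemma lists_subset: "l \<in> lists D \<Longrightarrow> D \<subseteq> S \<Longrightarrow> set l \<subseteq> S"
  by auto

context separated_module
begin

lemma hsum_append:
  "set l \<subseteq> carrier M \<Longrightarrow> set l' \<subseteq> carrier M \<Longrightarrow> hsum M (l @ l') = hadd M (hsum M l) (hsum M l')"
  by (rule weak_eqI) (auto simp: ip_hsum ip_simps hsum_closed)

lemma hsum_scale:
  "set l \<subseteq> carrier M \<Longrightarrow> hscale M c (hsum M l) = hsum M (map (hscale M c) l)"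
proof (induction l)
  case Nil
  show ?case by (rule weak_eqI) (auto simp: ip_simps)
next
  case (Cons a l)
  have "hscale M c (hsum M (a # l)) = hadd M (hscale M c a) (hscale M c (hsum M l))"
    using Cons.prems by (intro weak_eqI) (auto simp: ip_simps hsum_closed algebra_simps)
  with Cons show ?case by simp
qed

lemma hsum_act:
  assumes "f \<in> C0 X"
  shows "set l \<subseteq> carrier M \<Longrightarrow> hact M f (hsum M l) = hsum M (map (hact M f) l)"
proof (induction l)
  case Nil
  show ?case using assms by (intro weak_eqI) (auto simp: ip_simps)
next
  case (Cons a l)
  have "hact M f (hsum M (a # l)) = hadd M (hact M f a) (hact M f (hsum M l))"
    using assms Cons.prems by (intro weak_eqI) (auto simp: ip_simps hsum_closed algebra_simps)
  with Cons show ?case by simp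
qed

lemma hsum_single: "a \<in> carrier M \<Longrightarrow> hsum M [a] = a"
  by (rule weak_eqI) (auto simp: ip_simps)

lemma scale_zero: "a \<in> carrier M \<Longrightarrow> hscale M 0 a = hzero M"
  by (rule weak_eqI) (auto simp: ip_simps)

lemma act_zero: "f \<in> C0 X \<Longrightarrow> hact M f (hzero M) = hzero M"
  by (rule weak_eqI) (auto simp: ip_simps)

lemma cspan_base: "D \<subseteq> carrier M \<Longrightarrow> a \<in> D \<Longrightarrow> a \<in> cspan M D"
  by (auto simp: cspan_def subset_iff hsum_single near_refl simp del: hsum_simps intro!: bexI[of _ "[a]"])

lemma cspan_zero: "hzero M \<in> cspan M D"
  by (auto simp: cspan_def closed near_refl intro!: bexI[of _ "[]"])

lemma cspan_carrier: "a \<in> cspan M D \<Longrightarrow> a \<in> carrier M"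
  by (simp add: cspan_def)

lemma cspanE:
  assumes "a \<in> cspan M D" "e > 0"
  obtains l where "l \<in> lists D" "near M e a (hsum M l)"
  using assms unfolding cspan_def by blast

lemma cspan_add:
  assumes "D \<subseteq> carrier M" "a \<in> cspan M D" "b \<in> cspan M D"
  shows "hadd M a b \<in> cspan M D"
  unfolding cspan_def
proof (intro CollectI conjI allI impI)
  fix e :: real assume "e > 0"
  then have e: "e / 2 > 0" by simp
  obtain l where l: "l \<in> lists D" "near M (e/2) a (hsum M l)" using cspanE[OF assms(2) e] by blast
  obtain l' where l': "l' \<in> lists D" "near M (e/2) b (hsum M l')" using cspanE[OF assms(3) e] by blast
  have s: "set l \<subseteq> carrier M" "set l' \<subseteq> carrier M"
    using lists_subset[OF l(1) assms(1)] lists_subset[OF l'(1) assms(1)] by auto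
  have "near M e (hadd M a b) (hsum M (l @ l'))"
    using near_add[of a "hsum M l" b "hsum M l'" "e/2" "e/2"] l(2) l'(2) s assms(2,3)
    by (simp add: hsum_append hsum_closed cspan_carrier)
  then show "\<exists>l\<in>lists D. near M e (hadd M a b) (hsum M l)"
    using l(1) l'(1) by (intro bexI[of _ "l @ l'"]) auto
qed (use assms in \<open>auto simp: cspan_def closed\<close>)

lemma cspan_limit:
  assumes D: "D \<subseteq> carrier M" and a: "a \<in> carrier M"
    and lim: "\<And>e. e > 0 \<Longrightarrow> \<exists>b\<in>cspan M D. near M e a b"
  shows "a \<in> cspan M D"
  unfolding cspan_def
proof (intro CollectI conjI allI impI)
  fix e :: real assume "e > 0"
  then have e: "e / 2 > 0" by simp
  obtain b where b: "b \<in> cspan M D" "near M (e/2) a b" using lim[OF e] by blast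
  obtain l where l: "l \<in> lists D" "near M (e/2) b (hsum M l)" using cspanE[OF b(1) e] by blast
  have "near M (e/2 + e/2) a (hsum M l)"
    using near_trans[OF a cspan_carrier[OF b(1)] hsum_closed b(2) l(2)] lists_subset[OF l(1) D] by blast
  then show "\<exists>l\<in>lists D. near M e a (hsum M l)" using l(1) by auto
qed (rule a)

lemma generates_induct [consumes 2, case_names base zero add limit]:
  assumes gen: "generates M D" and a: "a \<in> carrier M"
    and base: "\<And>a. a \<in> D \<Longrightarrow> P a"
    and zero: "P (hzero M)"
    and add: "\<And>a b. a \<in> carrier M \<Longrightarrow> b \<in> carrier M \<Longrightarrow> P a \<Longrightarrow> P b \<Longrightarrow> P (hadd M a b)"
    and limit: "\<And>a. a \<in> carrier M \<Longrightarrow> (\<And>e. e > 0 \<Longrightarrow> \<exists>b\<in>carrier M. P b \<and> near M e a b) \<Longrightarrow> P a"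
  shows "P a"
proof (rule limit[OF a])
  fix e :: real assume "e > 0"
  then obtain l where l: "l \<in> lists D" "near M e a (hsum M l)"
    using gen a cspanE[of a D e] unfolding generates_def by blast
  have D: "D \<subseteq> carrier M" using gen by (simp add: generates_def)
  have "hsum M l \<in> carrier M \<and> P (hsum M l)"
    using l(1) D by (induction l) (auto simp: closed intro: zero add base)
  then show "\<exists>b\<in>carrier M. P b \<and> near M e a b" using l(2) by blast
qed

end

section \<open>Constructing and comparing morphisms on generating sets\<close>

lemma hhom_zero:
  assumes "hilbert_module X A" "hilbert_module X B" "F \<in> hhom X A B"
  shows "hmap F (hzero A) = hzero B"
proof -
  interpret A: separated_module X A by (rule hilbert_separated) fact
  interpret B: separated_module X B by (rule hilbert_separated) fact
  have "hmap F (hscale A 0 (hzero A)) = hscale B 0 (hmap F (hzero A))"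
    by (rule hhomD(5)[OF assms(3) A.zero_closed])
  then show ?thesis using hhomD(3)[OF assms(3) A.zero_closed] A.zero_closed
    by (simp add: A.scale_zero B.scale_zero)
qed

lemma hhom_sub:
  assumes "hilbert_module X A" "hilbert_module X B" "F \<in> hhom X A B" "a \<in> carrier A" "b \<in> carrier A"
  shows "hmap F (hsub A a b) = hsub B (hmap F a) (hmap F b)"
proof -
  interpret A: separated_module X A by (rule hilbert_separated) fact
  show ?thesis using assms(4,5)
    by (simp add: hsub_def hhomD(4,5)[OF assms(3)] A.closed)
qed

lemma hhom_near:
  assumes "hilbert_module X A" "hilbert_module X B" "F \<in> hhom X A B" "a \<in> carrier A" "b \<in> carrier A"
    and "near A e a b"
  shows "near B e (hmap F a) (hmap F b)"
proof -
  interpret A: separated_module X A by (rule hilbert_separated) fact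
  show ?thesis
    unfolding near_def hhom_sub[OF assms(1-5), symmetric]
    using hhom_ptnorm_le[OF assms(1-3) A.sub_closed[OF assms(4,5)]] assms(6) order_trans
    unfolding near_def by blast
qed

lemma hhom_eq_on_generators:
  assumes A: "hilbert_module X A" and B: "hilbert_module X B"
    and F: "F \<in> hhom X A B" and G: "G \<in> hhom X A B"
    and gen: "generates A D" and eq: "\<And>a. a \<in> D \<Longrightarrow> hmap F a = hmap G a"
  shows "F = G"
proof (rule hhom_eqI[OF F G])
  interpret A: separated_module X A by (rule hilbert_separated) fact
  interpret B: separated_module X B by (rule hilbert_separated) fact
  fix a assume "a \<in> carrier A"
  with gen show "hmap F a = hmap G a"
  proof (induction rule: A.generates_induct)
    case (limit a)
    show ?case
    proof (rule B.eq_if_near)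
      fix e :: real assume "e > 0"
      then have "e / 2 > 0" by simp
      from limit(2)[OF this] obtain b where b: "b \<in> carrier A" "hmap F b = hmap G b" "near A (e/2) a b" by blast
      have 1: "near B (e/2) (hmap F a) (hmap F b)" by (rule hhom_near[OF A B F limit(1) b(1,3)])
      have 2: "near B (e/2) (hmap G b) (hmap G a)"
        by (rule hhom_near[OF A B G b(1) limit(1)]) (rule A.near_sym[OF limit(1) b(1,3)])
      have "near B (e/2 + e/2) (hmap F a) (hmap G a)"
        using 1 2 b limit(1) hhomD(3)[OF F] hhomD(3)[OF G] by (intro B.near_trans[of _ "hmap F b"]) auto
      then show "near B e (hmap F a) (hmap G a)" by simp
    qed (use limit hhomD(3)[OF F] hhomD(3)[OF G] in auto)
  qed (use eq hhom_zero[OF A B F] hhom_zero[OF A B G] hhomD(4)[OF F] hhomD(4)[OF G] in auto)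
qed

text \<open>Polarization: the norms of \<open>a + b\<close> and \<open>a + \<i> b\<close> determine the inner product.\<close>

lemma ip_eq_if_ptnorm_eq:
  assumes A: "hilbert_module X A" and B: "hilbert_module X B" and F: "F \<in> hhom X A B"
    and eq: "\<And>a. a \<in> carrier A \<Longrightarrow> ptnorm B (hmap F a) x = ptnorm A a x"
    and a: "a \<in> carrier A" and b: "b \<in> carrier A"
  shows "hinner B (hmap F a) (hmap F b) x = hinner A a b x"
proof -
  interpret A: separated_module X A by (rule hilbert_separated) fact
  interpret B: separated_module X B by (rule hilbert_separated) fact
  have self: "hinner B (hmap F c) (hmap F c) x = hinner A c c x" if "c \<in> carrier A" for c
    using eq[OF that] that hhomD(3)[OF F that] by (simp add: A.ip_self B.ip_self)
  note Fc = hhomD(3)[OF F]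
  have sum: "hinner B (hmap F a) (hmap F c) x + hinner B (hmap F c) (hmap F a) x
      = hinner A a c x + hinner A c a x" if c: "c \<in> carrier A" for c
    using self[OF A.add_closed[OF a c]] self[OF a] self[OF c] a c Fc[OF a] Fc[OF c]
    by (simp add: hhomD(4)[OF F] A.ip_simps B.ip_simps algebra_simps)
  have "\<i> * hinner B (hmap F a) (hmap F b) x - \<i> * hinner B (hmap F b) (hmap F a) x
      = \<i> * hinner A a b x - \<i> * hinner A b a x"
    using sum[of "hscale A \<i> b"] a b Fc[OF a] Fc[OF b]
    by (simp add: hhomD(5)[OF F] A.ip_simps B.ip_simps)
  then have "\<i> * (hinner B (hmap F a) (hmap F b) x - hinner B (hmap F b) (hmap F a) x)
      = \<i> * (hinner A a b x - hinner A b a x)" by (simp add: right_diff_distrib)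
  then have "hinner B (hmap F a) (hmap F b) x - hinner B (hmap F b) (hmap F a) x
      = hinner A a b x - hinner A b a x" by simp
  then have "(hinner B (hmap F a) (hmap F b) x + hinner B (hmap F b) (hmap F a) x)
      + (hinner B (hmap F a) (hmap F b) x - hinner B (hmap F b) (hmap F a) x)
      = (hinner A a b x + hinner A b a x) + (hinner A a b x - hinner A b a x)"
    by (simp only: sum[OF b])
  then show ?thesis by simp
qed

lemma ip_hsum_hsum:
  assumes "premodule X A" "set l \<subseteq> carrier A"
  shows "hinner A (hsum A l) (hsum A l) x = (\<Sum>a\<leftarrow>l. \<Sum>b\<leftarrow>l. hinner A a b x)"
proof -
  interpret premodule X A by fact
  have "hinner A (hsum A l) (hsum A l) x = (\<Sum>a\<leftarrow>l. hinner A a (hsum A l) x)"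
    using assms(2) by (simp add: ip_hsum_left hsum_closed)
  also have "\<dots> = (\<Sum>a\<leftarrow>l. \<Sum>b\<leftarrow>l. hinner A a b x)"
    using assms(2) by (intro arg_cong[of _ _ sum_list] map_cong refl ip_hsum) auto
  finally show ?thesis .
qed

text \<open>The sums of pairs from \<open>G\<close> are a contractive submodule of \<open>A \<times> Z\<close> with dense domain.\<close>

lemma hhom_on_contractive_generators:
  assumes A: "hilbert_module X A" and Z: "hilbert_module X Z"
    and sub: "G \<subseteq> carrier A \<times> carrier Z"
    and scale: "\<And>c a z. (a, z) \<in> G \<Longrightarrow> (hscale A c a, hscale Z c z) \<in> G"
    and act: "\<And>f a z. f \<in> C0 X \<Longrightarrow> (a, z) \<in> G \<Longrightarrow> (hact A f a, hact Z f z) \<in> G"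
    and le: "\<And>l x. l \<in> lists G \<Longrightarrow> ptnorm Z (hsum Z (map snd l)) x \<le> ptnorm A (hsum A (map fst l)) x"
    and gen: "generates A (fst ` G)"
  obtains F where "F \<in> hhom X A Z" "\<And>a z. (a, z) \<in> G \<Longrightarrow> hmap F a = z"
proof -
  interpret A: separated_module X A by (rule hilbert_separated) fact
  interpret Z: separated_module X Z by (rule hilbert_separated) fact
  define R where "R = (\<lambda>l. (hsum A (map fst l), hsum Z (map snd l))) ` lists G"
  have car: "set (map fst l) \<subseteq> carrier A" "set (map snd l) \<subseteq> carrier Z" if "l \<in> lists G" for l
    using that sub by (auto simp: in_lists_conv_set subset_iff mem_Times_iff)
  have RI: "(hsum A (map fst l), hsum Z (map snd l)) \<in> R" if "l \<in> lists G" for l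
    using that by (auto simp: R_def)
  have RE: "\<exists>l\<in>lists G. a = hsum A (map fst l) \<and> z = hsum Z (map snd l)" if "(a, z) \<in> R" for a z
    using that by (auto simp: R_def)
  have "\<exists>F\<in>hhom X A Z. \<forall>(a, z)\<in>R. hmap F a = z"
  proof (rule hhom_extension[OF A Z])
    fix a z assume az: "(a, z) \<in> R"
    then obtain l where l: "l \<in> lists G" "a = hsum A (map fst l)" "z = hsum Z (map snd l)"
      using RE by blast
    show "a \<in> carrier A \<and> z \<in> carrier Z"
      using l car[OF l(1)] by (simp add: A.hsum_closed Z.hsum_closed)
    show "ptnorm Z z x \<le> ptnorm A a x" for x
      unfolding l(2,3) by (rule le[OF l(1)])
    show "(hscale A c a, hscale Z c z) \<in> R" for c
    proof -
      have "map (\<lambda>(a, z). (hscale A c a, hscale Z c z)) l \<in> lists G"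
        using l(1) scale by (auto simp: in_lists_conv_set)
      from RI[OF this] show ?thesis
        by (simp add: l(2,3) A.hsum_scale[OF car(1)[OF l(1)]] Z.hsum_scale[OF car(2)[OF l(1)]] o_def split_beta)
    qed
    show "(hact A f a, hact Z f z) \<in> R" if f: "f \<in> C0 X" for f
    proof -
      have "map (\<lambda>(a, z). (hact A f a, hact Z f z)) l \<in> lists G"
        using l(1) act[OF f] by (auto simp: in_lists_conv_set)
      from RI[OF this] show ?thesis
        by (simp add: l(2,3) A.hsum_act[OF f car(1)[OF l(1)]] Z.hsum_act[OF f car(2)[OF l(1)]] o_def split_beta)
    qed
    fix a' z' assume "(a', z') \<in> R"
    then obtain l' where l': "l' \<in> lists G" "a' = hsum A (map fst l')" "z' = hsum Z (map snd l')"
      using RE by blast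
    have "l @ l' \<in> lists G" using l l' by auto
    from RI[OF this] show "(hadd A a a', hadd Z z z') \<in> R"
      by (simp add: l(2,3) l'(2,3) A.hsum_append[OF car(1)[OF l(1)] car(1)[OF l'(1)], unfolded]
        Z.hsum_append[OF car(2)[OF l(1)] car(2)[OF l'(1)]])
  next
    fix a and e :: real assume "a \<in> carrier A" "e > 0"
    then obtain k where k: "k \<in> lists (fst ` G)" "near A e a (hsum A k)"
      using gen A.cspanE[of a "fst ` G" e] unfolding generates_def by blast
    then obtain l where l: "l \<in> lists G" "k = map fst l"
      by (auto simp: lists_image)
    then show "\<exists>(a', z')\<in>R. near A e a a'" using k(2) RI[OF l(1)] by auto
  qed
  then obtain F where F: "F \<in> hhom X A Z" "\<forall>(a, z)\<in>R. hmap F a = z" by blast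
  show ?thesis
  proof (rule that[OF F(1)])
    fix a z assume az: "(a, z) \<in> G"
    then have "(a, z) \<in> R" using RI[of "[(a, z)]"] sub
      by (auto simp: A.hsum_single Z.hsum_single simp del: hsum_simps)
    then show "hmap F a = z" using F(2) by auto
  qed
qed

text \<open>The pointwise norm of a finite sum only depends on the inner products of its terms.\<close>

lemma hhom_on_generators:
  assumes A: "hilbert_module X A" and Z: "hilbert_module X Z"
    and sub: "G \<subseteq> carrier A \<times> carrier Z"
    and scale: "\<And>c a z. (a, z) \<in> G \<Longrightarrow> (hscale A c a, hscale Z c z) \<in> G"
    and act: "\<And>f a z. f \<in> C0 X \<Longrightarrow> (a, z) \<in> G \<Longrightarrow> (hact A f a, hact Z f z) \<in> G"
    and ip: "\<And>a z a' z' x. (a, z) \<in> G \<Longrightarrow> (a', z') \<in> G \<Longrightarrow> hinner Z z z' x = hinner A a a' x"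
    and gen: "generates A (fst ` G)"
  obtains F where "F \<in> hhom X A Z" "\<And>a z. (a, z) \<in> G \<Longrightarrow> hmap F a = z"
proof (rule hhom_on_contractive_generators[OF A Z sub scale act _ gen])
  interpret A: separated_module X A by (rule hilbert_separated) fact
  interpret Z: separated_module X Z by (rule hilbert_separated) fact
  fix l x assume l: "l \<in> lists G"
  then have car: "set (map fst l) \<subseteq> carrier A" "set (map snd l) \<subseteq> carrier Z"
    using sub by (auto simp: in_lists_conv_set subset_iff mem_Times_iff)
  have "hinner Z (hsum Z (map snd l)) (hsum Z (map snd l)) x = (\<Sum>p\<leftarrow>l. \<Sum>q\<leftarrow>l. hinner Z (snd p) (snd q) x)"
    unfolding ip_hsum_hsum[OF Z.premodule_axioms car(2)] by (simp add: o_def)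
  also have "\<dots> = (\<Sum>p\<leftarrow>l. \<Sum>q\<leftarrow>l. hinner A (fst p) (fst q) x)"
    using l by (intro arg_cong[of _ _ sum_list] map_cong refl ip) (auto simp: in_lists_conv_set)
  also have "\<dots> = hinner A (hsum A (map fst l)) (hsum A (map fst l)) x"
    unfolding ip_hsum_hsum[OF A.premodule_axioms car(1)] by (simp add: o_def)
  finally show "ptnorm Z (hsum Z (map snd l)) x \<le> ptnorm A (hsum A (map fst l)) x"
    by (simp add: ptnorm_def)
qed blast+

definition inverse_homs :: "'x topology \<Rightarrow> ('v, 'x) hobj \<Rightarrow> ('v, 'x) hobj \<Rightarrow> ('v, 'x) harr \<Rightarrow> ('v, 'x) harr \<Rightarrow> bool" where
  "inverse_homs X A B F F' \<longleftrightarrow> F \<in> hhom X A B \<and> F' \<in> hhom X B A \<and>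
     (\<forall>a\<in>carrier A. hmap F' (hmap F a) = a) \<and> (\<forall>b\<in>carrier B. hmap F (hmap F' b) = b)"

lemma hhom_id: 
  assumes "hilbert_module X A"
  shows "\<lparr>hdom = A, hcod = A, hmap = restrict (\<lambda>a. a) (carrier A)\<rparr> \<in> hhom X A A"
  by (rule hhomI[OF assms assms]) auto

lemma hhom_compose:
  assumes "hilbert_module X A" "hilbert_module X B" "hilbert_module X D"
    and F: "F \<in> hhom X A B" and G: "G \<in> hhom X B D"
  shows "\<lparr>hdom = A, hcod = D, hmap = compose (carrier A) (hmap G) (hmap F)\<rparr> \<in> hhom X A D"
  unfolding compose_def
  by (rule hhomI[OF assms(1,3)])
    (auto simp: hhomD(3-6)[OF F] hhomD(3-6)[OF G]
      intro: order_trans[OF hhom_ptnorm_le[OF assms(2,3) G] hhom_ptnorm_le[OF assms(1,2) F]])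

text \<open>The hypotheses are symmetric in \<open>A\<close> and \<open>Z\<close>, so that the converse of \<open>G\<close> yields the inverse.\<close>

theorem iso_on_generators:
  fixes A Z :: "('v, 'x) hobj"
  assumes A: "hilbert_module X A" and Z: "hilbert_module X Z"
    and sub: "G \<subseteq> carrier A \<times> carrier Z"
    and scale: "\<And>c a z. (a, z) \<in> G \<Longrightarrow> (hscale A c a, hscale Z c z) \<in> G"
    and act: "\<And>f a z. f \<in> C0 X \<Longrightarrow> (a, z) \<in> G \<Longrightarrow> (hact A f a, hact Z f z) \<in> G"
    and ip: "\<And>a z a' z' x. (a, z) \<in> G \<Longrightarrow> (a', z') \<in> G \<Longrightarrow> hinner Z z z' x = hinner A a a' x"
    and genA: "generates A (fst ` G)" and genZ: "generates Z (snd ` G)"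
  obtains F F' where "inverse_homs X A Z F F'" "\<And>a z. (a, z) \<in> G \<Longrightarrow> hmap F a = z"
proof -
  obtain F where F: "F \<in> hhom X A Z" "\<And>a z. (a, z) \<in> G \<Longrightarrow> hmap F a = z"
    by (rule hhom_on_generators[OF A Z sub scale act ip genA]) blast+
  obtain F' where F': "F' \<in> hhom X Z A" "\<And>a z. (z, a) \<in> G\<inverse> \<Longrightarrow> hmap F' z = a"
  proof (rule hhom_on_generators[OF Z A, of "G\<inverse>"])
    have "fst ` (G\<inverse>) = snd ` G" by force
    then show "generates Z (fst ` (G\<inverse>))" using genZ by simp
  qed (use sub scale act ip in auto)
  have 1: "hmap F' (hmap F a) = a" if "a \<in> carrier A" for a
  proof -
    have "\<lparr>hdom = A, hcod = A, hmap = compose (carrier A) (hmap F') (hmap F)\<rparr>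
        = \<lparr>hdom = A, hcod = A, hmap = restrict (\<lambda>a. a) (carrier A)\<rparr>"
    proof (rule hhom_eq_on_generators[OF A A _ _ genA])
      show "hmap \<lparr>hdom = A, hcod = A, hmap = compose (carrier A) (hmap F') (hmap F)\<rparr> a
        = hmap \<lparr>hdom = A, hcod = A, hmap = restrict (\<lambda>a. a) (carrier A)\<rparr> a" if "a \<in> fst ` G" for a
        using that sub F(2) F'(2) by (auto simp: compose_def)
    qed (rule hhom_compose[OF A Z A F(1) F'(1)] hhom_id[OF A])+
    then show ?thesis using that by (auto dest!: fun_cong[of _ _ a] simp: compose_def)
  qed
  have 2: "hmap F (hmap F' z) = z" if "z \<in> carrier Z" for z
  proof -
    have "\<lparr>hdom = Z, hcod = Z, hmap = compose (carrier Z) (hmap F) (hmap F')\<rparr>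
        = \<lparr>hdom = Z, hcod = Z, hmap = restrict (\<lambda>a. a) (carrier Z)\<rparr>"
    proof (rule hhom_eq_on_generators[OF Z Z _ _ genZ])
      show "hmap \<lparr>hdom = Z, hcod = Z, hmap = compose (carrier Z) (hmap F) (hmap F')\<rparr> a
        = hmap \<lparr>hdom = Z, hcod = Z, hmap = restrict (\<lambda>a. a) (carrier Z)\<rparr> a" if "a \<in> snd ` G" for a
        using that sub F(2) F'(2) by (auto simp: compose_def)
    qed (rule hhom_compose[OF Z A Z F'(1) F(1)] hhom_id[OF Z])+
    then show ?thesis using that by (auto dest!: fun_cong[of _ _ z] simp: compose_def)
  qed
  show ?thesis using that[of F F'] F F' 1 2 by (auto simp: inverse_homs_def)
qed

section \<open>Generators of tensor products\<close>

context tensor_pair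
begin

lemma near_pure_left:
  assumes "a \<in> carrier A" "a' \<in> carrier A" "b \<in> carrier B" "near A e a a'" "\<And>x. ptnorm B b x \<le> K" "e \<ge> 0"
  shows "near T (e * K) (pure A B a b) (pure A B a' b)"
  unfolding near_def
proof
  fix x
  show "ptnorm T (hsub T (pure A B a b) (pure A B a' b)) x \<le> e * K"
    unfolding pure_sub_left[OF assms(1-3), symmetric] ptnorm_pure[OF A.sub_closed[OF assms(1,2)] assms(3)]
    using assms by (intro mult_mono) (auto simp: near_def B.ptnorm_nonneg)
qed

lemma near_pure_right:
  assumes "a \<in> carrier A" "b \<in> carrier B" "b' \<in> carrier B" "near B e b b'" "\<And>x. ptnorm A a x \<le> K" "K \<ge> 0"
  shows "near T (K * e) (pure A B a b) (pure A B a b')"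
  unfolding near_def
proof
  fix x
  show "ptnorm T (hsub T (pure A B a b) (pure A B a b')) x \<le> K * e"
    unfolding pure_sub_right[OF assms(1-3), symmetric] ptnorm_pure[OF assms(1) B.sub_closed[OF assms(2,3)]]
    using assms B.ptnorm_nonneg[of "hsub B b b'" x]
    by (intro mult_mono) (auto simp: near_def B.closed)
qed

text \<open>Since \<open>\<otimes>\<close> is additive and continuous in each variable, the pure tensors with factors from \<open>D\<close> and \<open>E\<close> span
  first those with one arbitrary factor, and then all pure tensors.\<close>

theorem generates_tensor:
  assumes D: "generates A D" and E: "generates B E"
  shows "generates T {pure A B a b | a b. a \<in> D \<and> b \<in> E}" (is "generates T ?P")
proof -
  have DE: "D \<subseteq> carrier A" "E \<subseteq> carrier B" using D E by (auto simp: generates_def)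
  have P: "?P \<subseteq> carrier T" using DE by (auto intro!: pure_closed)
  have right: "pure A B a b \<in> cspan T ?P" if a: "a \<in> D" and b: "b \<in> carrier B" for a b
    using E b
  proof (induction rule: B.generates_induct)
    case (base b)
    then show ?case using a by (intro T.cspan_base[OF P]) auto
  next
    case (limit b)
    obtain K where K: "K \<ge> 0" "\<And>x. ptnorm A a x \<le> K" using A.bounded_ptnorm[of a] a DE by blast
    show ?case
    proof (rule T.cspan_limit[OF P pure_closed])
      fix e :: real assume e: "e > 0"
      have "e / (K + 1) > 0" using e K by simp
      then obtain b' where b': "b' \<in> carrier B" "pure A B a b' \<in> cspan T ?P" "near B (e / (K + 1)) b b'"
        using limit(2) by blast
      have "near T (K * (e / (K + 1))) (pure A B a b) (pure A B a b')"
        using a DE by (intro near_pure_right limit b' K) auto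
      then have "near T e (pure A B a b) (pure A B a b')"
        by (rule T.near_mono) (use e K in \<open>simp add: field_simps\<close>)
      then show "\<exists>z\<in>cspan T ?P. near T e (pure A B a b) z" using b' by blast
    qed (use a limit DE in auto)
  next
    case zero
    have "a \<in> carrier A" using a DE by blast
    then show ?case by (simp add: pure_zero_right T.cspan_zero)
  next
    case (add b b')
    have "a \<in> carrier A" using a DE by blast
    then show ?case using add by (simp add: pure_add_right T.cspan_add[OF P])
  qed
  have left: "pure A B a b \<in> cspan T ?P" if a: "a \<in> carrier A" and b: "b \<in> carrier B" for a b
    using D a
  proof (induction rule: A.generates_induct)
    case (base a)
    then show ?case using b by (rule right)
  next
    case (limit a)
    obtain K where K: "K \<ge> 0" "\<And>x. ptnorm B b x \<le> K" using B.bounded_ptnorm[of b] b by blast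
    show ?case
    proof (rule T.cspan_limit[OF P pure_closed])
      fix e :: real assume e: "e > 0"
      have "e / (K + 1) > 0" using e K by simp
      then obtain a' where a': "a' \<in> carrier A" "pure A B a' b \<in> cspan T ?P" "near A (e / (K + 1)) a a'"
        using limit(2) by blast
      have "near T (e / (K + 1) * K) (pure A B a b) (pure A B a' b)"
        using b e K(1) by (intro near_pure_left limit a' K) auto
      then have "near T e (pure A B a b) (pure A B a' b)"
        by (rule T.near_mono) (use e K in \<open>simp add: field_simps\<close>)
      then show "\<exists>z\<in>cspan T ?P. near T e (pure A B a b) z" using a' by blast
    qed (use b limit in auto)
  next
    case zero
    show ?case using b by (simp add: pure_zero_left T.cspan_zero)
  next
    case (add a a')
    then show ?case using b by (simp add: pure_add_left T.cspan_add[OF P])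
  qed
  have "z \<in> cspan T ?P" if "z \<in> carrier T" for z
    using that
  proof (induction rule: tensor_induct)
    case (limit z)
    show ?case by (rule T.cspan_limit[OF P limit(1)]) (use limit(2) in blast)
  qed (auto intro: left T.cspan_zero T.cspan_add[OF P])
  then show ?thesis using P by (auto simp: generates_def)
qed

end

lemma generates_carrier: "hilbert_module X A \<Longrightarrow> generates A (carrier A)"
  using separated_module.cspan_base[OF hilbert_separated] by (fastforce simp: generates_def)

section \<open>The tensor unit\<close>

lemma unit_simps [simp]:
  "carrier (tensor_unit X) = Fun ` C0 X" "hzero (tensor_unit X) = Fun (\<lambda>x. 0)"
  "hadd (tensor_unit X) z w = Fun (\<lambda>x. fun_of z x + fun_of w x)"
  "hscale (tensor_unit X) c z = Fun (\<lambda>x. c * fun_of z x)"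
  "hact (tensor_unit X) h z = Fun (\<lambda>x. h x * fun_of z x)"
  "hinner (tensor_unit X) z w x = cnj (fun_of z x) * fun_of w x"
  by (simp_all add: tensor_unit_def)

lemma hsub_unit: "hsub (tensor_unit X) z w = Fun (\<lambda>x. fun_of z x - fun_of w x)"
  by (simp add: hsub_def)

lemma ptnorm_unit: "ptnorm (tensor_unit X) z x = cmod (fun_of z x)"
proof -
  have "cnj (fun_of z x) * fun_of z x = of_real ((cmod (fun_of z x))^2)"
    by (subst mult.commute) (rule complex_norm_square[symmetric])
  then show ?thesis by (simp add: ptnorm_def del: of_real_power)
qed

lemma near_unit: "near (tensor_unit X) e z w \<longleftrightarrow> (\<forall>x. cmod (fun_of z x - fun_of w x) \<le> e)"
  by (simp add: near_def hsub_unit ptnorm_unit)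

lemma premodule_unit:
  fixes X :: "'x topology"
  shows "premodule X (tensor_unit X :: ('v, 'x) hobj)"
proof
  fix a b :: "('v, 'x) elt" assume "a \<in> carrier (tensor_unit X)" "b \<in> carrier (tensor_unit X)"
  then obtain f g where fg: "a = Fun f" "b = Fun g" "f \<in> C0 X" "g \<in> C0 X" by auto
  show "hinner (tensor_unit X) a b \<in> C0 X"
    using C0_mult[OF C0_cnj[OF fg(3)] fg(4)] by (simp add: fg tensor_unit_def)
  show "hinner (tensor_unit X) a a x \<in> \<real>\<^sub>\<ge>\<^sub>0" for x
  proof -
    have "cnj (f x) * f x = of_real ((cmod (f x))^2)"
      by (subst mult.commute) (rule complex_norm_square[symmetric])
    then show ?thesis by (simp add: fg del: of_real_power)
  qed
qed (auto simp: C0_zero C0_add C0_cmult C0_mult algebra_simps)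

theorem hilbert_unit:
  fixes X :: "'x topology"
  shows "hilbert_module X (tensor_unit X :: ('v, 'x) hobj)" (is "hilbert_module X ?I")
proof (rule hilbert_moduleI)
  interpret premodule X ?I by (rule premodule_unit)
  show "separated_module X ?I"
  proof
    fix a b :: "('v, 'x) elt" assume "a \<in> carrier ?I" "b \<in> carrier ?I"
      and 0: "\<And>x. hinner ?I (hsub ?I a b) (hsub ?I a b) x = 0"
    then obtain f g where "a = Fun f" "b = Fun g" by auto
    then show "a = b" using 0 by (auto simp: hsub_unit fun_eq_iff)
  qed
  fix s assume s: "\<And>n. s n \<in> carrier ?I" "hcauchy ?I s"
  define f where "f n = fun_of (s n)" for n
  have f: "f n \<in> C0 X" "s n = Fun (f n)" for n using s(1)[of n] by (auto simp: f_def)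
  have C: "\<exists>N. \<forall>m\<ge>N. \<forall>n\<ge>N. \<forall>x. cmod (f m x - f n x) \<le> e" if "e > 0" for e
    using s(2) that by (auto simp: hcauchy_def near_unit f_def)
  have "Cauchy (\<lambda>n. f n x)" for x
  proof (rule metric_CauchyI)
    fix e :: real assume "e > 0"
    then obtain N where N: "\<forall>m\<ge>N. \<forall>n\<ge>N. \<forall>x. cmod (f m x - f n x) \<le> e / 2" using C[of "e / 2"] by auto
    have "dist (f m x) (f n x) < e" if "m \<ge> N" "n \<ge> N" for m n
      using N[rule_format, OF that, of x] \<open>e > 0\<close> by (simp add: dist_norm)
    then show "\<exists>N. \<forall>m\<ge>N. \<forall>n\<ge>N. dist (f m x) (f n x) < e" by blast
  qed
  then have "\<exists>l. (\<lambda>n. f n x) \<longlonglongrightarrow> l" for x by (simp add: Cauchy_convergent_iff convergent_def)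
  then obtain g where g: "\<And>x. (\<lambda>n. f n x) \<longlonglongrightarrow> g x" by metis
  have unif: "\<exists>N. \<forall>n\<ge>N. \<forall>x. cmod (f n x - g x) \<le> e" if e: "e > 0" for e
  proof -
    obtain N where N: "\<And>m n x. m \<ge> N \<Longrightarrow> n \<ge> N \<Longrightarrow> cmod (f m x - f n x) \<le> e" using C[OF e] by blast
    have "cmod (f n x - g x) \<le> e" if "n \<ge> N" for n x
    proof (rule LIMSEQ_le_const2)
      show "(\<lambda>m. cmod (f n x - f m x)) \<longlonglongrightarrow> cmod (f n x - g x)" by (intro tendsto_intros g)
      show "\<exists>N'. \<forall>m\<ge>N'. cmod (f n x - f m x) \<le> e" using N[OF that] by blast
    qed
    then show ?thesis by blast
  qed
  have "g \<in> C0 X"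
  proof (rule C0_uniform_limit)
    show "\<exists>f\<in>C0 X. \<forall>x. cmod (f x - g x) \<le> e" if "e > 0" for e
      using unif[OF that] f(1) by (meson order_refl)
  qed
  then show "\<exists>a\<in>carrier ?I. hconv ?I s a"
    using unif by (intro bexI[of _ "Fun g"]) (auto simp: hconv_def near_unit f(2))
qed

text \<open>The action of \<open>C\<^sub>0(X)\<close> is nondegenerate: for \<open>v = \<langle>a, a\<rangle>\<close> the elements \<open>v / (v + d) a\<close> tend to \<open>a\<close>, because
  the square norm of the difference is \<open>(1 - v / (v + d))\<^sup>2 v \<le> d\<close>.\<close>

lemma soft_support_act:
  assumes "premodule X A" "a \<in> carrier A" "e > 0"
  shows "near A e a (hact A (soft_support (e^2) (hinner A a a)) a)"
  unfolding near_def
proof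
  interpret premodule X A by fact
  fix x
  let ?s = "soft_support (e^2) (hinner A a a)"
  have s: "?s \<in> C0 X" using assms by (intro soft_support_C0 ip_C0) auto
  have "hinner A (hsub A a (hact A ?s a)) (hsub A a (hact A ?s a)) x
      = (1 - ?s x) * cnj (1 - ?s x) * hinner A a a x"
    using assms s by (simp add: ip_simps algebra_simps)
  also have "\<dots> = of_real ((cmod (1 - ?s x))^2 * (ptnorm A a x)^2)"
    by (simp only: ip_self[OF assms(2)] complex_norm_square[symmetric]) simp
  finally have eq: "hinner A (hsub A a (hact A ?s a)) (hsub A a (hact A ?s a)) x
      = of_real ((cmod (1 - ?s x))^2 * (ptnorm A a x)^2)" .
  have "cmod (hinner A a a x) = (ptnorm A a x)^2" by (simp add: ip_self[OF assms(2)] norm_power)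
  then have "(cmod (1 - ?s x))^2 * (ptnorm A a x)^2 \<le> e^2"
    using soft_support_small[of "e^2" "hinner A a a" x] assms(3) by simp
  then show "ptnorm A (hsub A a (hact A ?s a)) x \<le> e"
    using assms s by (intro ptnorm_leI) (simp_all add: closed eq del: of_real_mult of_real_power)
qed

lemma generates_act:
  assumes "hilbert_module X A"
  shows "generates A {hact A f a | f a. f \<in> C0 X \<and> a \<in> carrier A}" (is "generates A ?D")
proof -
  interpret separated_module X A by (rule hilbert_separated) fact
  have D: "?D \<subseteq> carrier A" by (auto simp: closed)
  have "a \<in> cspan A ?D" if a: "a \<in> carrier A" for a
  proof (rule cspan_limit[OF D a])
    fix e :: real assume e: "e > 0"
    have "soft_support (e^2) (hinner A a a) \<in> C0 X"
      using a e by (intro soft_support_C0 ip_C0) auto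
    then show "\<exists>b\<in>cspan A ?D. near A e a b"
      using soft_support_act[OF premodule_axioms a e] a
      by (intro bexI[of _ "hact A (soft_support (e^2) (hinner A a a)) a"] cspan_base[OF D]) auto
  qed
  then show ?thesis using D by (auto simp: generates_def)
qed

section \<open>Tensor products of contractions\<close>

lemma hhom_hsum:
  assumes A: "hilbert_module X A" and B: "hilbert_module X B" and F: "F \<in> hhom X A B"
  shows "set l \<subseteq> carrier A \<Longrightarrow> hmap F (hsum A l) = hsum B (map (hmap F) l)"
proof (induction l)
  case Nil
  show ?case by (simp add: hhom_zero[OF A B F])
next
  case (Cons a l)
  interpret A: separated_module X A by (rule hilbert_separated) fact
  show ?case using Cons by (simp add: hhomD(4)[OF F] A.hsum_closed)
qed

text \<open>For a linear combination \<open>v\<close> of the \<open>a\<^sub>i\<close>, the value of this form is \<open>\<bar>v\<bar>\<^sup>2 - \<bar>F v\<bar>\<^sup>2\<close>, which is nonnegative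
  because \<open>F\<close> is contractive at every point.\<close>

lemma psd_gram_diff:
  fixes a :: "nat \<Rightarrow> _"
  assumes A: "hilbert_module X A" and B: "hilbert_module X B" and F: "F \<in> hhom X A B"
    and a: "\<And>i. i < n \<Longrightarrow> a i \<in> carrier A"
  shows "psd {..<n} (\<lambda>i j. hinner A (a i) (a j) x - hinner B (hmap F (a i)) (hmap F (a j)) x)"
  unfolding psd_def
proof (intro conjI allI ballI)
  interpret A: separated_module X A by (rule hilbert_separated) fact
  interpret B: separated_module X B by (rule hilbert_separated) fact
  note Fa = hhomD(3)[OF F a]
  show "cnj (hinner A (a i) (a j) x - hinner B (hmap F (a i)) (hmap F (a j)) x)
      = hinner A (a j) (a i) x - hinner B (hmap F (a j)) (hmap F (a i)) x"
    if "i \<in> {..<n}" "j \<in> {..<n}" for i j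
    using that by (simp add: A.ip_adj B.ip_adj a Fa)
  fix c :: "nat \<Rightarrow> complex"
  define v where "v = hsum A (map (\<lambda>i. hscale A (c i) (a i)) [0..<n])"
  have v: "v \<in> carrier A"
    "(\<Sum>i<n. \<Sum>j<n. cnj (c i) * c j * hinner A (a i) (a j) x) = hinner A v v x"
    using A.gram_quadratic[of n a, OF a] by (simp_all add: v_def)
  have "hmap F v = hsum B (map (hmap F) (map (\<lambda>i. hscale A (c i) (a i)) [0..<n]))"
    unfolding v_def by (rule hhom_hsum[OF A B F]) (auto simp: A.closed a)
  also have "\<dots> = hsum B (map (\<lambda>i. hscale B (c i) (hmap F (a i))) [0..<n])"
    by (intro arg_cong[of _ _ "hsum B"]) (auto simp: hhomD(5)[OF F a])
  finally have Fv: "(\<Sum>i<n. \<Sum>j<n. cnj (c i) * c j * hinner B (hmap F (a i)) (hmap F (a j)) x)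
      = hinner B (hmap F v) (hmap F v) x"
    using B.gram_quadratic(2)[of n "\<lambda>i. hmap F (a i)" c x, OF Fa] by simp
  have "ptnorm B (hmap F v) x ^ 2 \<le> ptnorm A v x ^ 2"
    by (intro power_mono hhom_ptnorm_le[OF A B F] B.ptnorm_nonneg hhomD(3)[OF F] v)
  moreover have "hinner A v v x - hinner B (hmap F v) (hmap F v) x
      = of_real (ptnorm A v x ^ 2 - ptnorm B (hmap F v) x ^ 2)"
    using v hhomD(3)[OF F] by (simp add: A.ip_self B.ip_self)
  ultimately have "hinner A v v x - hinner B (hmap F v) (hmap F v) x \<in> \<real>\<^sub>\<ge>\<^sub>0"
    by (simp del: of_real_diff of_real_power)
  then show "(\<Sum>i<n. \<Sum>j<n. cnj (c i) * c j *
      (hinner A (a i) (a j) x - hinner B (hmap F (a i)) (hmap F (a j)) x)) \<in> \<real>\<^sub>\<ge>\<^sub>0"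
    by (simp add: right_diff_distrib sum_subtractf v(2) Fv)
qed

definition fmap :: "('a \<Rightarrow> 'c) \<Rightarrow> ('b \<Rightarrow> 'd) \<Rightarrow> ('a \<times> 'b) list \<Rightarrow> ('c \<times> 'd) list" where
  "fmap f g u = map (\<lambda>(a, b). (f a, g b)) u"

lemma fmap_fsums:
  assumes "u \<in> fsums A B" "\<And>a. a \<in> carrier A \<Longrightarrow> f a \<in> carrier A'" "\<And>b. b \<in> carrier B \<Longrightarrow> g b \<in> carrier B'"
  shows "fmap f g u \<in> fsums A' B'"
  using assms by (auto simp: fmap_def fsums_iff split_beta)

text \<open>Apply first \<open>F\<close> and then \<open>G\<close>. Each step decreases one of the two Gram matrices by a positive
  semidefinite matrix, so Schur's theorem applies to the product of the difference with the other one.\<close>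

lemma finner_fmap_le:
  assumes A: "hilbert_module X A" "hilbert_module X A'" and B: "hilbert_module X B" "hilbert_module X B'"
    and F: "F \<in> hhom X A A'" and G: "G \<in> hhom X B B'" and u: "u \<in> fsums A B"
  shows "Re (finner A' B' (fmap (hmap F) (hmap G) u) (fmap (hmap F) (hmap G) u) x) \<le> Re (finner A B u u x)"
proof -
  interpret A': separated_module X A' by (rule hilbert_separated) fact
  interpret B: separated_module X B by (rule hilbert_separated) fact
  define n a b where "n = length u" and "a i = fst (u ! i)" and "b i = snd (u ! i)" for i
  have ab: "a i \<in> carrier A" "b i \<in> carrier B" if "i < n" for i
    using u that by (auto simp: fsums_iff a_def b_def n_def)
  note Fa = hhomD(3)[OF F ab(1)]
  let ?M = "\<lambda>i j. hinner A (a i) (a j) x" and ?M' = "\<lambda>i j. hinner A' (hmap F (a i)) (hmap F (a j)) x"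
  let ?N = "\<lambda>i j. hinner B (b i) (b j) x" and ?N' = "\<lambda>i j. hinner B' (hmap G (b i)) (hmap G (b j)) x"
  have 1: "(\<Sum>i<n. \<Sum>j<n. (?M i j - ?M' i j) * ?N i j) \<in> \<real>\<^sub>\<ge>\<^sub>0"
    by (intro Schur_product psd_gram_diff[OF A F] B.psd_gram) (auto simp: ab)
  have 2: "(\<Sum>i<n. \<Sum>j<n. ?M' i j * (?N i j - ?N' i j)) \<in> \<real>\<^sub>\<ge>\<^sub>0"
    by (intro Schur_product psd_gram_diff[OF B G] A'.psd_gram) (auto simp: ab Fa)
  have "finner A B u u x - finner A' B' (fmap (hmap F) (hmap G) u) (fmap (hmap F) (hmap G) u) x
      = (\<Sum>i<n. \<Sum>j<n. ?M i j * ?N i j) - (\<Sum>i<n. \<Sum>j<n. ?M' i j * ?N' i j)"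
    by (simp add: finner_nth fmap_def n_def a_def b_def split_beta)
  also have "\<dots> = (\<Sum>i<n. \<Sum>j<n. (?M i j - ?M' i j) * ?N i j) + (\<Sum>i<n. \<Sum>j<n. ?M' i j * (?N i j - ?N' i j))"
    by (simp add: sum_subtractf[symmetric] sum.distrib[symmetric] algebra_simps)
  also have "\<dots> \<in> \<real>\<^sub>\<ge>\<^sub>0" using 1 2 by (rule nonneg_Reals_add_I)
  finally show ?thesis by (simp add: complex_nonneg_Reals_iff)
qed

lemma tensor_hom_exists:
  assumes A: "hilbert_module X A" "hilbert_module X A'" and B: "hilbert_module X B" "hilbert_module X B'"
    and F: "F \<in> hhom X A A'" and G: "G \<in> hhom X B B'"
  obtains H where "H \<in> hhom X (tensor A B) (tensor A' B')"
    and "\<And>a b. a \<in> carrier A \<Longrightarrow> b \<in> carrier B \<Longrightarrow> hmap H (pure A B a b) = pure A' B' (hmap F a) (hmap G b)"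
proof -
  interpret P: tensor_pair X A B using A B by (simp add: tensor_pairI)
  interpret Q: tensor_pair X A' B' using A B by (simp add: tensor_pairI)
  let ?h = "fmap (hmap F) (hmap G)"
  have h: "?h u \<in> fsums A' B'" if "u \<in> fsums A B" for u
    using that hhomD(3)[OF F] hhomD(3)[OF G] by (rule fmap_fsums)
  define R where "R = (\<lambda>u. (P.emb u, Q.emb (?h u))) ` fsums A B"
  have RI: "(P.emb u, Q.emb (?h u)) \<in> R" if "u \<in> fsums A B" for u using that by (simp add: R_def)
  have "\<exists>H\<in>hhom X (tensor A B) (tensor A' B'). \<forall>(a, z)\<in>R. hmap H a = z"
  proof (rule hhom_extension[OF P.hilbert_tensor Q.hilbert_tensor])
    fix a z assume "(a, z) \<in> R"
    then obtain u where u: "u \<in> fsums A B" "a = P.emb u" "z = Q.emb (?h u)" by (auto simp: R_def)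
    show "a \<in> carrier (tensor A B) \<and> z \<in> carrier (tensor A' B')"
      using u h by (simp add: P.emb_closed Q.emb_closed)
    show "ptnorm (tensor A' B') z x \<le> ptnorm (tensor A B) a x" for x
      using finner_fmap_le[OF A B F G u(1), of x]
      by (simp add: ptnorm_def u P.hinner_emb Q.hinner_emb h)
    show "(hscale (tensor A B) c a, hscale (tensor A' B') c z) \<in> R" for c
    proof -
      have "?h (fscale A c u) = fscale A' c (?h u)"
        using u(1) hhomD(5)[OF F] by (auto simp: fmap_def fscale_def split_beta fsums_iff)
      moreover have "hscale (tensor A B) c a = P.emb (fscale A c u)"
        by (simp add: u P.emb_def P.hscale_tclass P.fcauchy_const)
      moreover have "hscale (tensor A' B') c z = Q.emb (fscale A' c (?h u))"
        by (simp add: u h Q.emb_def Q.hscale_tclass Q.fcauchy_const)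
      ultimately show ?thesis using RI[of "fscale A c u"] P.F.scale_closed[of u c] u by simp
    qed
    show "(hact (tensor A B) f a, hact (tensor A' B') f z) \<in> R" if f: "f \<in> C0 X" for f
    proof -
      have "?h (fact_on A f u) = fact_on A' f (?h u)"
        using u(1) hhomD(6)[OF F f] by (auto simp: fmap_def fact_on_def split_beta fsums_iff)
      moreover have "hact (tensor A B) f a = P.emb (fact_on A f u)"
        by (simp add: u P.emb_def P.hact_tclass P.fcauchy_const f)
      moreover have "hact (tensor A' B') f z = Q.emb (fact_on A' f (?h u))"
        by (simp add: u h Q.emb_def Q.hact_tclass Q.fcauchy_const f)
      ultimately show ?thesis using RI[of "fact_on A f u"] P.F.act_closed[of f u] u f by simp
    qed
    fix a' z' assume "(a', z') \<in> R"
    then obtain v where v: "v \<in> fsums A B" "a' = P.emb v" "z' = Q.emb (?h v)" by (auto simp: R_def)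
    have "hadd (tensor A B) a a' = P.emb (u @ v)"
      using u v by (simp add: P.emb_def P.hadd_tclass P.fcauchy_const)
    moreover have "hadd (tensor A' B') z z' = Q.emb (?h (u @ v))"
      using u v h by (simp add: Q.emb_def Q.hadd_tclass Q.fcauchy_const fmap_def)
    ultimately show "(hadd (tensor A B) a a', hadd (tensor A' B') z z') \<in> R"
      using RI[of "u @ v"] P.F.add_closed[of u v] u v by simp
  next
    fix z and e :: real assume "z \<in> carrier (tensor A B)" "e > 0"
    then obtain u where "u \<in> fsums A B" "near (tensor A B) e z (P.emb u)" by (rule P.approx_formal_sum)
    then show "\<exists>(a', z')\<in>R. near (tensor A B) e z a'" using RI by auto
  qed
  then obtain H where H: "H \<in> hhom X (tensor A B) (tensor A' B')" "\<forall>(a, z)\<in>R. hmap H a = z" by blast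
  show ?thesis
  proof (rule that[OF H(1)])
    fix a b assume "a \<in> carrier A" "b \<in> carrier B"
    then have "(pure A B a b, pure A' B' (hmap F a) (hmap G b)) \<in> R"
      using RI[of "[(a, b)]"] by (simp add: P.pure_emb Q.pure_emb fmap_def fsums_iff)
    then show "hmap H (pure A B a b) = pure A' B' (hmap F a) (hmap G b)" using H(2) by auto
  qed
qed

section \<open>The structure maps\<close>

text \<open>The structure maps of the category are definite descriptions; a morphism with the prescribed values
  on generators is the described one.\<close>

lemma the_hhom:
  assumes A: "hilbert_module X A" "hilbert_module X Z" and gen: "generates A D"
    and F: "F \<in> hhom X A Z" "P F" and eq: "\<And>G a. P G \<Longrightarrow> a \<in> D \<Longrightarrow> hmap G a = hmap F a"
  shows "(THE H. H \<in> hhom X A Z \<and> P H) = F"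
proof (rule the_equality)
  show "G = F" if "G \<in> hhom X A Z \<and> P G" for G
    using hhom_eq_on_generators[OF A _ F(1) gen] eq that by blast
qed (use F in blast)

lemma homs_Hilb: "F \<in> homs (Hilb X) A B \<longleftrightarrow> F \<in> hhom X A B \<and> hilbert_module X A \<and> hilbert_module X B"
  by (auto simp: homs_def Hilb_def hhomD)

lemma Hilb_simps [simp]:
  "A \<in> Obj (Hilb X) \<longleftrightarrow> hilbert_module X A" "Dom (Hilb X) = hdom" "Cod (Hilb X) = hcod"
  "TenO (Hilb X) = tensor" "Unit (Hilb X) = tensor_unit X"
  by (simp_all add: Hilb_def)

locale function_space =
  fixes X :: "'x topology"
begin

abbreviation "hil \<equiv> hilbert_module X"
abbreviation "C \<equiv> Hilb X"
abbreviation "I \<equiv> tensor_unit X"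
abbreviation "arr F \<equiv> F \<in> Arr (Hilb X)"
notation tensor  (infixr "\<otimes>\<^sub>h" 70)
abbreviation comp  (infixr "\<circ>\<^sub>h" 55) where "G \<circ>\<^sub>h F \<equiv> Comp (Hilb X) G F"

lemma arr_iff: "arr F \<longleftrightarrow> hil (hdom F) \<and> hil (hcod F) \<and> F \<in> hhom X (hdom F) (hcod F)"
  by (simp add: Hilb_def)

lemma homs_arr: "F \<in> homs C A B \<longleftrightarrow> arr F \<and> hdom F = A \<and> hcod F = B"
  by (simp add: homs_def)

lemma arr_hhom: "arr F \<Longrightarrow> F \<in> hhom X (hdom F) (hcod F)" by (simp add: arr_iff)

lemma arrI: "F \<in> hhom X A B \<Longrightarrow> hil A \<Longrightarrow> hil B \<Longrightarrow> arr F \<and> hdom F = A \<and> hcod F = B"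
  by (simp add: homs_arr[symmetric] homs_Hilb)

lemma arr_obj: "arr F \<Longrightarrow> hil (hdom F)" "arr F \<Longrightarrow> hil (hcod F)" by (simp_all add: arr_iff)

lemma hmap_closed: "arr F \<Longrightarrow> hcod F = B \<Longrightarrow> a \<in> carrier (hdom F) \<Longrightarrow> hmap F a \<in> carrier B"
  using hhomD(3)[OF arr_hhom] by blast

lemma Id_arr: "hil A \<Longrightarrow> arr (Id C A)" "hdom (Id C A) = A" "hcod (Id C A) = A"
  "a \<in> carrier A \<Longrightarrow> hmap (Id C A) a = a"
proof -
  have eq: "Id C A = \<lparr>hdom = A, hcod = A, hmap = restrict (\<lambda>a. a) (carrier A)\<rparr>" by (simp add: Hilb_def)
  show "arr (Id C A)" if "hil A" using arrI[OF hhom_id[OF that] that that] by (simp add: eq)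
  show "hdom (Id C A) = A" "hcod (Id C A) = A" by (simp_all add: eq)
  show "a \<in> carrier A \<Longrightarrow> hmap (Id C A) a = a" by (simp add: eq)
qed

lemma Comp_arr:
  "arr F \<Longrightarrow> arr G \<Longrightarrow> hcod F = hdom G \<Longrightarrow> arr (G \<circ>\<^sub>h F)"
  "hdom (G \<circ>\<^sub>h F) = hdom F" "hcod (G \<circ>\<^sub>h F) = hcod G"
  "a \<in> carrier (hdom F) \<Longrightarrow> hmap (G \<circ>\<^sub>h F) a = hmap G (hmap F a)"
proof -
  have eq: "G \<circ>\<^sub>h F = \<lparr>hdom = hdom F, hcod = hcod G, hmap = compose (carrier (hdom F)) (hmap G) (hmap F)\<rparr>"
    by (simp add: Hilb_def)
  show "arr (G \<circ>\<^sub>h F)" if "arr F" "arr G" "hcod F = hdom G"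
    using that hhom_compose[of X "hdom F" "hcod F" "hcod G" F G] by (simp add: arr_iff eq)
  show "hdom (G \<circ>\<^sub>h F) = hdom F" "hcod (G \<circ>\<^sub>h F) = hcod G" by (simp_all add: eq)
  show "a \<in> carrier (hdom F) \<Longrightarrow> hmap (G \<circ>\<^sub>h F) a = hmap G (hmap F a)" by (simp add: eq compose_def)
qed

lemma tensor_obj: "hil A \<Longrightarrow> hil B \<Longrightarrow> hil (A \<otimes>\<^sub>h B)"
  using tensor_pair.hilbert_tensor[OF tensor_pairI] .

lemma pure_in: "hil A \<Longrightarrow> hil B \<Longrightarrow> a \<in> carrier A \<Longrightarrow> b \<in> carrier B \<Longrightarrow> pure A B a b \<in> carrier (A \<otimes>\<^sub>h B)"
  using tensor_pair.pure_closed[OF tensor_pairI] .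

lemma pures_generate: "hil A \<Longrightarrow> hil B \<Longrightarrow> generates (A \<otimes>\<^sub>h B) {pure A B a b | a b. a \<in> carrier A \<and> b \<in> carrier B}"
  by (intro tensor_pair.generates_tensor[OF tensor_pairI] generates_carrier)

lemma gen_carrier: "hil A \<Longrightarrow> generates A (carrier A)"
  by (rule generates_carrier)

lemma generates_ten:
  "\<lbrakk>hil A; hil B; generates A D; generates B E\<rbrakk> \<Longrightarrow> generates (A \<otimes>\<^sub>h B) {pure A B a b | a b. a \<in> D \<and> b \<in> E}"
  by (intro tensor_pair.generates_tensor[OF tensor_pairI])

lemma arr_eqI:
  assumes "arr F" "arr G" "hdom F = A" "hdom G = A" "hcod F = hcod G" "generates A D"
    and "\<And>a. a \<in> D \<Longrightarrow> hmap F a = hmap G a"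
  shows "F = G"
  using hhom_eq_on_generators[of X A "hcod F" F G D] assms by (auto simp: arr_iff)

lemma arr_eqI1:
  assumes "arr F" "arr G" "hdom F = A" "hdom G = A" "hcod F = hcod G"
    and "\<And>a. a \<in> carrier A \<Longrightarrow> hmap F a = hmap G a"
  shows "F = G"
  using arr_eqI[OF assms(1-5) gen_carrier] assms arr_obj by blast

text \<open>The coherence laws are verified on pure tensors, bracketed as in the domain of the arrows.\<close>

lemma arr_eqI2:
  assumes "arr F" "arr G" "hdom F = A \<otimes>\<^sub>h B" "hdom G = A \<otimes>\<^sub>h B" "hcod F = hcod G" "hil A" "hil B"
    and "\<And>a b. a \<in> carrier A \<Longrightarrow> b \<in> carrier B \<Longrightarrow> hmap F (pure A B a b) = hmap G (pure A B a b)"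
  shows "F = G"
  by (rule arr_eqI[OF assms(1-5) pures_generate[OF assms(6,7)]]) (use assms(8) in auto)

lemma arr_eqI3:
  assumes "arr F" "arr G" "hdom F = (A \<otimes>\<^sub>h B) \<otimes>\<^sub>h D" "hdom G = (A \<otimes>\<^sub>h B) \<otimes>\<^sub>h D" "hcod F = hcod G"
    and "hil A" "hil B" "hil D"
    and "\<And>a b d. a \<in> carrier A \<Longrightarrow> b \<in> carrier B \<Longrightarrow> d \<in> carrier D
      \<Longrightarrow> hmap F (pure (A \<otimes>\<^sub>h B) D (pure A B a b) d) = hmap G (pure (A \<otimes>\<^sub>h B) D (pure A B a b) d)"
  shows "F = G"
  by (rule arr_eqI[OF assms(1-5) tensor_pair.generates_tensor[OF tensor_pairI[OF tensor_obj[OF assms(6,7)] assms(8)]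
      pures_generate[OF assms(6,7)] gen_carrier[OF assms(8)]]]) (use assms(9) in auto)

lemma arr_eqI3':
  assumes "arr F" "arr G" "hdom F = A \<otimes>\<^sub>h (B \<otimes>\<^sub>h D)" "hdom G = A \<otimes>\<^sub>h (B \<otimes>\<^sub>h D)" "hcod F = hcod G"
    and "hil A" "hil B" "hil D"
    and "\<And>a b d. a \<in> carrier A \<Longrightarrow> b \<in> carrier B \<Longrightarrow> d \<in> carrier D
      \<Longrightarrow> hmap F (pure A (B \<otimes>\<^sub>h D) a (pure B D b d)) = hmap G (pure A (B \<otimes>\<^sub>h D) a (pure B D b d))"
  shows "F = G"
  by (rule arr_eqI[OF assms(1-5) tensor_pair.generates_tensor[OF tensor_pairI[OF assms(6) tensor_obj[OF assms(7,8)]]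
      gen_carrier[OF assms(6)] pures_generate[OF assms(7,8)]]]) (use assms(9) in auto)

lemma arr_eqI4:
  assumes "arr F" "arr G" "hdom F = ((A \<otimes>\<^sub>h B) \<otimes>\<^sub>h D) \<otimes>\<^sub>h E" "hdom G = ((A \<otimes>\<^sub>h B) \<otimes>\<^sub>h D) \<otimes>\<^sub>h E"
    "hcod F = hcod G" and "hil A" "hil B" "hil D" "hil E"
    and "\<And>a b d e. a \<in> carrier A \<Longrightarrow> b \<in> carrier B \<Longrightarrow> d \<in> carrier D \<Longrightarrow> e \<in> carrier E
      \<Longrightarrow> hmap F (pure ((A \<otimes>\<^sub>h B) \<otimes>\<^sub>h D) E (pure (A \<otimes>\<^sub>h B) D (pure A B a b) d) e)
        = hmap G (pure ((A \<otimes>\<^sub>h B) \<otimes>\<^sub>h D) E (pure (A \<otimes>\<^sub>h B) D (pure A B a b) d) e)"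
  shows "F = G"
proof (rule arr_eqI[OF assms(1-5)])
  have "generates ((A \<otimes>\<^sub>h B) \<otimes>\<^sub>h D) {pure (A \<otimes>\<^sub>h B) D z d | z d.
      z \<in> {pure A B a b | a b. a \<in> carrier A \<and> b \<in> carrier B} \<and> d \<in> carrier D}"
    by (intro generates_ten tensor_obj pures_generate gen_carrier assms)
  then show "generates (((A \<otimes>\<^sub>h B) \<otimes>\<^sub>h D) \<otimes>\<^sub>h E) {pure ((A \<otimes>\<^sub>h B) \<otimes>\<^sub>h D) E w e | w e.
      w \<in> {pure (A \<otimes>\<^sub>h B) D z d | z d. z \<in> {pure A B a b | a b. a \<in> carrier A \<and> b \<in> carrier B} \<and> d \<in> carrier D}
      \<and> e \<in> carrier E}"
    by (intro generates_ten tensor_obj gen_carrier assms)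
qed (use assms(10) in auto)

lemma TenA:
  assumes F: "arr F" and G: "arr G"
  shows "arr (TenA C F G)" "hdom (TenA C F G) = hdom F \<otimes>\<^sub>h hdom G" "hcod (TenA C F G) = hcod F \<otimes>\<^sub>h hcod G"
    and "\<lbrakk>hdom F = A; hdom G = B; a \<in> carrier A; b \<in> carrier B\<rbrakk>
      \<Longrightarrow> hmap (TenA C F G) (pure A B a b) = pure (hcod F) (hcod G) (hmap F a) (hmap G b)"
proof -
  note ob = arr_obj[OF F] arr_obj[OF G]
  obtain H where H: "H \<in> hhom X (hdom F \<otimes>\<^sub>h hdom G) (hcod F \<otimes>\<^sub>h hcod G)"
    "\<And>a b. a \<in> carrier (hdom F) \<Longrightarrow> b \<in> carrier (hdom G) \<Longrightarrow>
      hmap H (pure (hdom F) (hdom G) a b) = pure (hcod F) (hcod G) (hmap F a) (hmap G b)"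
    by (rule tensor_hom_exists[OF ob arr_hhom[OF F] arr_hhom[OF G]]) blast
  have "TenA C F G = (THE H. H \<in> hhom X (hdom F \<otimes>\<^sub>h hdom G) (hcod F \<otimes>\<^sub>h hcod G) \<and>
       (\<forall>a\<in>carrier (hdom F). \<forall>b\<in>carrier (hdom G).
          hmap H (pure (hdom F) (hdom G) a b) = pure (hcod F) (hcod G) (hmap F a) (hmap G b)))"
    by (simp add: Hilb_def)
  also have "\<dots> = H"
    by (rule the_hhom[OF _ _ pures_generate[OF ob(1,3)] H(1)]) (use H(2) tensor_obj ob in auto)
  finally have eq: "TenA C F G = H" .
  show "arr (TenA C F G)" "hdom (TenA C F G) = hdom F \<otimes>\<^sub>h hdom G" "hcod (TenA C F G) = hcod F \<otimes>\<^sub>h hcod G"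
    using arrI[OF H(1)] tensor_obj ob by (auto simp: eq)
  show "\<lbrakk>hdom F = A; hdom G = B; a \<in> carrier A; b \<in> carrier B\<rbrakk>
      \<Longrightarrow> hmap (TenA C F G) (pure A B a b) = pure (hcod F) (hcod G) (hmap F a) (hmap G b)"
    using H(2) by (auto simp: eq)
qed

lemma inverse_homs_iso:
  assumes "hil A" "hil B" "inverse_homs X A B F F'"
  shows "arr F" "hdom F = A" "hcod F = B" "is_iso C F" "Inv C F = F'"
    and "arr F'" "hdom F' = B" "hcod F' = A"
    and "a \<in> carrier A \<Longrightarrow> hmap F' (hmap F a) = a" "b \<in> carrier B \<Longrightarrow> hmap F (hmap F' b) = b"
proof -
  have hh: "F \<in> hhom X A B" "F' \<in> hhom X B A"
    and inv: "\<And>a. a \<in> carrier A \<Longrightarrow> hmap F' (hmap F a) = a" "\<And>b. b \<in> carrier B \<Longrightarrow> hmap F (hmap F' b) = b"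
    using assms(3) by (auto simp: inverse_homs_def)
  note 1 = arrI[OF hh(1) assms(1,2)] and 2 = arrI[OF hh(2) assms(2,1)]
  show "arr F" "hdom F = A" "hcod F = B" "arr F'" "hdom F' = B" "hcod F' = A" using 1 2 by auto
  show "a \<in> carrier A \<Longrightarrow> hmap F' (hmap F a) = a" "b \<in> carrier B \<Longrightarrow> hmap F (hmap F' b) = b" using inv by auto
  have "F' \<circ>\<^sub>h F = Id C A"
    by (rule arr_eqI1[where A = A]) (use 1 2 assms inv in \<open>auto simp: Comp_arr Id_arr\<close>)
  moreover have "F \<circ>\<^sub>h F' = Id C B"
    by (rule arr_eqI1[where A = B]) (use 1 2 assms inv in \<open>auto simp: Comp_arr Id_arr\<close>)
  ultimately have inverse: "is_inverse C F F'"
    using 1 2 by (auto simp: is_inverse_def homs_arr)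
  then show "is_iso C F" using 1 by (auto simp: is_iso_def)
  have uniq: "G = F'" if "is_inverse C F G" for G
  proof -
    have G: "arr G" "hdom G = B" "hcod G = A" "G \<circ>\<^sub>h F = Id C A"
      using that 1 by (auto simp: is_inverse_def homs_arr)
    have "hmap G b = hmap F' b" if b: "b \<in> carrier B" for b
    proof -
      have F'b: "hmap F' b \<in> carrier A" using 2 b by (intro hmap_closed) auto
      have "hmap (G \<circ>\<^sub>h F) (hmap F' b) = hmap F' b" using F'b by (simp add: G(4) Id_arr)
      then show ?thesis using F'b 1 inv(2)[OF b] by (simp add: Comp_arr)
    qed
    then show ?thesis using G 2 by (intro arr_eqI1[where A = B]) auto
  qed
  show "Inv C F = F'" unfolding Inv_def by (rule the_equality, rule inverse, rule uniq)
qed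

lemma hilbert_unit_obj: "hil I" by (rule hilbert_unit)

text \<open>Both \<open>f \<otimes> a\<close> and \<open>f a\<close> have inner products \<open>f\<^sup>* f' \<langle>a, a'\<rangle>\<close>, and the elements \<open>f a\<close> generate \<open>A\<close>.\<close>

lemma LUnit_iso:
  assumes A: "hil A"
  obtains L where "inverse_homs X (I \<otimes>\<^sub>h A) A (LUnit C A) L"
    and "\<And>f a. f \<in> C0 X \<Longrightarrow> a \<in> carrier A \<Longrightarrow> hmap (LUnit C A) (pure I A (Fun f) a) = hact A f a"
proof -
  interpret P: tensor_pair X I A by (rule tensor_pairI[OF hilbert_unit_obj A])
  let ?G = "{(pure I A (Fun f) a, hact A f a) | f a. f \<in> C0 X \<and> a \<in> carrier A}"
  have fst: "fst ` ?G = {pure I A z a | z a. z \<in> carrier I \<and> a \<in> carrier A}" by (auto simp: image_def; blast)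
  have snd: "snd ` ?G = {hact A f a | f a. f \<in> C0 X \<and> a \<in> carrier A}" by (auto simp: image_def; blast)
  obtain F L where FL: "inverse_homs X (I \<otimes>\<^sub>h A) A F L" "\<And>a z. (a, z) \<in> ?G \<Longrightarrow> hmap F a = z"
  proof (rule iso_on_generators[OF P.hilbert_tensor A, of ?G])
    show "?G \<subseteq> carrier (I \<otimes>\<^sub>h A) \<times> carrier A" by (auto simp: P.pure_closed P.B.closed)
    show "(hscale (I \<otimes>\<^sub>h A) c z, hscale A c a) \<in> ?G" if za: "(z, a) \<in> ?G" for c z a
    proof -
      obtain f b where fb: "z = pure I A (Fun f) b" "a = hact A f b" "f \<in> C0 X" "b \<in> carrier A" using za by auto
      have "hscale (I \<otimes>\<^sub>h A) c z = pure I A (Fun (\<lambda>x. c * f x)) b"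
        using P.pure_scale_left[of "Fun f" b c] fb by simp
      moreover have "hscale A c a = hact A (\<lambda>x. c * f x) b"
        using fb by (intro P.B.weak_eqI) (auto simp: P.B.ip_simps C0_cmult)
      ultimately show ?thesis using fb C0_cmult[of f X c] by auto
    qed
    show "(hact (I \<otimes>\<^sub>h A) g z, hact A g a) \<in> ?G" if g: "g \<in> C0 X" and za: "(z, a) \<in> ?G" for g z a
    proof -
      obtain f b where fb: "z = pure I A (Fun f) b" "a = hact A f b" "f \<in> C0 X" "b \<in> carrier A" using za by auto
      have "hact (I \<otimes>\<^sub>h A) g z = pure I A (Fun (\<lambda>x. g x * f x)) b"
        using P.pure_act_left[of g "Fun f" b] fb g by simp
      moreover have "hact A g a = hact A (\<lambda>x. g x * f x) b"
        using fb g by (intro P.B.weak_eqI) (auto simp: P.B.ip_simps C0_mult)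
      ultimately show ?thesis using fb C0_mult[OF g, of f] by auto
    qed
    show "generates (I \<otimes>\<^sub>h A) (fst ` ?G)" unfolding fst by (rule pures_generate[OF hilbert_unit_obj A])
    show "generates A (snd ` ?G)" unfolding snd by (rule generates_act[OF A])
    show "hinner A w w' x = hinner (I \<otimes>\<^sub>h A) z z' x" if "(z, w) \<in> ?G" "(z', w') \<in> ?G" for z w z' w' x
      using that by (auto simp: P.hinner_pure P.B.ip_simps)
  qed blast
  have "LUnit C A = (THE H. H \<in> hhom X (I \<otimes>\<^sub>h A) A \<and>
       (\<forall>f\<in>C0 X. \<forall>a\<in>carrier A. hmap H (pure I A (Fun f) a) = hact A f a))"
    by (simp add: Hilb_def)
  also have "\<dots> = F"
  proof (rule the_hhom[OF P.hilbert_tensor A pures_generate[OF hilbert_unit_obj A]])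
    show "F \<in> hhom X (I \<otimes>\<^sub>h A) A" using FL(1) by (simp add: inverse_homs_def)
    have F: "hmap F (pure I A (Fun f) a) = hact A f a" if "f \<in> C0 X" "a \<in> carrier A" for f a
      using that by (intro FL(2)) auto
    then show "\<forall>f\<in>C0 X. \<forall>a\<in>carrier A. hmap F (pure I A (Fun f) a) = hact A f a" by blast
    show "hmap G z = hmap F z" if "\<forall>f\<in>C0 X. \<forall>a\<in>carrier A. hmap G (pure I A (Fun f) a) = hact A f a"
      "z \<in> {pure I A w a | w a. w \<in> carrier I \<and> a \<in> carrier A}" for G z
      using that F by auto
  qed
  finally have "LUnit C A = F" .
  show ?thesis by (rule that[of L]) (use FL \<open>LUnit C A = F\<close> in auto)
qed

lemma Braid_iso:
  assumes A: "hil A" and B: "hil B"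
  obtains L where "inverse_homs X (A \<otimes>\<^sub>h B) (B \<otimes>\<^sub>h A) (Braid C A B) L"
    and "\<And>a b. a \<in> carrier A \<Longrightarrow> b \<in> carrier B \<Longrightarrow> hmap (Braid C A B) (pure A B a b) = pure B A b a"
proof -
  interpret P: tensor_pair X A B by (rule tensor_pairI[OF A B])
  interpret Q: tensor_pair X B A by (rule tensor_pairI[OF B A])
  let ?G = "{(pure A B a b, pure B A b a) | a b. a \<in> carrier A \<and> b \<in> carrier B}"
  have fst: "fst ` ?G = {pure A B a b | a b. a \<in> carrier A \<and> b \<in> carrier B}" by (auto simp: image_def; blast)
  have snd: "snd ` ?G = {pure B A b a | b a. b \<in> carrier B \<and> a \<in> carrier A}" by (auto simp: image_def; blast)
  obtain F L where FL: "inverse_homs X (A \<otimes>\<^sub>h B) (B \<otimes>\<^sub>h A) F L" "\<And>a z. (a, z) \<in> ?G \<Longrightarrow> hmap F a = z"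
  proof (rule iso_on_generators[OF P.hilbert_tensor Q.hilbert_tensor, of ?G])
    show "?G \<subseteq> carrier (A \<otimes>\<^sub>h B) \<times> carrier (B \<otimes>\<^sub>h A)" by (auto simp: P.pure_closed Q.pure_closed)
    show "(hscale (A \<otimes>\<^sub>h B) c z, hscale (B \<otimes>\<^sub>h A) c w) \<in> ?G" if zw: "(z, w) \<in> ?G" for c z w
    proof -
      obtain a b where ab: "z = pure A B a b" "w = pure B A b a" "a \<in> carrier A" "b \<in> carrier B" using zw by auto
      have "hscale (B \<otimes>\<^sub>h A) c w = pure B A b (hscale A c a)"
        using ab by (intro Q.T.definite)
          (simp_all add: Q.T.ip_simps Q.pure_closed Q.hinner_pure P.A.ip_simps algebra_simps)
      moreover have "hscale (A \<otimes>\<^sub>h B) c z = pure A B (hscale A c a) b"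
        using ab by (simp add: P.pure_scale_left)
      ultimately show ?thesis using ab P.A.scale_closed[of a c] by auto
    qed
    show "(hact (A \<otimes>\<^sub>h B) g z, hact (B \<otimes>\<^sub>h A) g w) \<in> ?G" if g: "g \<in> C0 X" and zw: "(z, w) \<in> ?G" for g z w
    proof -
      obtain a b where ab: "z = pure A B a b" "w = pure B A b a" "a \<in> carrier A" "b \<in> carrier B" using zw by auto
      have "hact (A \<otimes>\<^sub>h B) g z = pure A B (hact A g a) b" using ab g by (simp add: P.pure_act_left)
      moreover have "hact (B \<otimes>\<^sub>h A) g w = pure B A b (hact A g a)" using ab g by (simp add: Q.pure_act_right)
      ultimately show ?thesis using ab P.A.act_closed[OF g, of a] by auto
    qed
    show "generates (A \<otimes>\<^sub>h B) (fst ` ?G)" unfolding fst by (rule pures_generate[OF A B])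
    show "generates (B \<otimes>\<^sub>h A) (snd ` ?G)" unfolding snd by (rule pures_generate[OF B A])
    show "hinner (B \<otimes>\<^sub>h A) w w' x = hinner (A \<otimes>\<^sub>h B) z z' x" if "(z, w) \<in> ?G" "(z', w') \<in> ?G" for z w z' w' x
      using that by (auto simp: P.hinner_pure Q.hinner_pure)
  qed blast
  have "Braid C A B = (THE H. H \<in> hhom X (A \<otimes>\<^sub>h B) (B \<otimes>\<^sub>h A) \<and>
       (\<forall>a\<in>carrier A. \<forall>b\<in>carrier B. hmap H (pure A B a b) = pure B A b a))"
    by (simp add: Hilb_def)
  also have "\<dots> = F"
  proof (rule the_hhom[OF P.hilbert_tensor Q.hilbert_tensor pures_generate[OF A B]])
    show "F \<in> hhom X (A \<otimes>\<^sub>h B) (B \<otimes>\<^sub>h A)" using FL(1) by (simp add: inverse_homs_def)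
    have F: "hmap F (pure A B a b) = pure B A b a" if "a \<in> carrier A" "b \<in> carrier B" for a b
      using that by (intro FL(2)) auto
    then show "\<forall>a\<in>carrier A. \<forall>b\<in>carrier B. hmap F (pure A B a b) = pure B A b a" by blast
    show "hmap G z = hmap F z" if "\<forall>a\<in>carrier A. \<forall>b\<in>carrier B. hmap G (pure A B a b) = pure B A b a"
      "z \<in> {pure A B a b | a b. a \<in> carrier A \<and> b \<in> carrier B}" for G z
      using that F by auto
  qed
  finally have "Braid C A B = F" .
  show ?thesis by (rule that[of L]) (use FL \<open>Braid C A B = F\<close> in auto)
qed

lemma inverse_homs_comp:
  assumes ob: "hil A" "hil B" "hil D" and FG: "inverse_homs X A B F F'" "inverse_homs X B D G G'"
  shows "inverse_homs X A D (G \<circ>\<^sub>h F) (F' \<circ>\<^sub>h G')"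
proof -
  note F = inverse_homs_iso[OF ob(1,2) FG(1)] and G = inverse_homs_iso[OF ob(2,3) FG(2)]
  have "arr (G \<circ>\<^sub>h F)" "arr (F' \<circ>\<^sub>h G')" using F(1-8) G(1-8) by (simp_all add: Comp_arr)
  then have "G \<circ>\<^sub>h F \<in> hhom X A D" "F' \<circ>\<^sub>h G' \<in> hhom X D A"
    using arr_hhom[of "G \<circ>\<^sub>h F"] arr_hhom[of "F' \<circ>\<^sub>h G'"] F(1-8) G(1-8) by (simp_all add: Comp_arr)
  moreover have "hmap (F' \<circ>\<^sub>h G') (hmap (G \<circ>\<^sub>h F) a) = a" if a: "a \<in> carrier A" for a
  proof -
    have b: "hmap F a \<in> carrier B" by (rule hmap_closed) (use F(1-3) a in auto)
    have "hmap G (hmap F a) \<in> carrier D" by (rule hmap_closed) (use G(1-3) b in auto)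
    then have "hmap (F' \<circ>\<^sub>h G') (hmap G (hmap F a)) = hmap F' (hmap G' (hmap G (hmap F a)))"
      using G(7) by (intro Comp_arr(4)) simp
    moreover have "hmap (G \<circ>\<^sub>h F) a = hmap G (hmap F a)" using F(2) a by (intro Comp_arr(4)) simp
    ultimately show ?thesis using F(9)[OF a] G(9)[OF b] by simp
  qed
  moreover have "hmap (G \<circ>\<^sub>h F) (hmap (F' \<circ>\<^sub>h G') d) = d" if d: "d \<in> carrier D" for d
  proof -
    have b: "hmap G' d \<in> carrier B" by (rule hmap_closed) (use G(6-8) d in auto)
    have "hmap F' (hmap G' d) \<in> carrier A" by (rule hmap_closed) (use F(6-8) b in auto)
    then have "hmap (G \<circ>\<^sub>h F) (hmap F' (hmap G' d)) = hmap G (hmap F (hmap F' (hmap G' d)))"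
      using F(2) by (intro Comp_arr(4)) simp
    moreover have "hmap (F' \<circ>\<^sub>h G') d = hmap F' (hmap G' d)" using G(7) d by (intro Comp_arr(4)) simp
    ultimately show ?thesis using F(10)[OF b] G(10)[OF d] by simp
  qed
  ultimately show ?thesis by (simp add: inverse_homs_def)
qed

text \<open>The right unitor is the left one after the braiding.\<close>

lemma RUnit_iso:
  assumes A: "hil A"
  obtains L where "inverse_homs X (A \<otimes>\<^sub>h I) A (RUnit C A) L"
    and "\<And>f a. f \<in> C0 X \<Longrightarrow> a \<in> carrier A \<Longrightarrow> hmap (RUnit C A) (pure A I a (Fun f)) = hact A f a"
proof -
  note ob = tensor_obj[OF A hilbert_unit_obj] tensor_obj[OF hilbert_unit_obj A]
  obtain L where L: "inverse_homs X (I \<otimes>\<^sub>h A) A (LUnit C A) L"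
    "\<And>f a. f \<in> C0 X \<Longrightarrow> a \<in> carrier A \<Longrightarrow> hmap (LUnit C A) (pure I A (Fun f) a) = hact A f a"
    using LUnit_iso[OF A] by blast
  obtain B where B: "inverse_homs X (A \<otimes>\<^sub>h I) (I \<otimes>\<^sub>h A) (Braid C A I) B"
    "\<And>a z. a \<in> carrier A \<Longrightarrow> z \<in> carrier I \<Longrightarrow> hmap (Braid C A I) (pure A I a z) = pure I A z a"
    using Braid_iso[OF A hilbert_unit_obj] by blast
  let ?F = "LUnit C A \<circ>\<^sub>h Braid C A I"
  note inv = inverse_homs_comp[OF ob A B(1) L(1)]
  have F: "hmap ?F (pure A I a (Fun f)) = hact A f a" if "f \<in> C0 X" "a \<in> carrier A" for f a
    using that inverse_homs_iso(2)[OF ob B(1)] by (simp add: Comp_arr pure_in A hilbert_unit_obj B(2) L(2))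
  have "RUnit C A = (THE H. H \<in> hhom X (A \<otimes>\<^sub>h I) A \<and>
       (\<forall>a\<in>carrier A. \<forall>f\<in>C0 X. hmap H (pure A I a (Fun f)) = hact A f a))"
    by (simp add: Hilb_def)
  also have "\<dots> = ?F"
  proof (rule the_hhom[OF ob(1) A pures_generate[OF A hilbert_unit_obj]])
    show "?F \<in> hhom X (A \<otimes>\<^sub>h I) A" using inv by (simp add: inverse_homs_def)
    show "\<forall>a\<in>carrier A. \<forall>f\<in>C0 X. hmap ?F (pure A I a (Fun f)) = hact A f a" using F by blast
    show "hmap G z = hmap ?F z" if "\<forall>a\<in>carrier A. \<forall>f\<in>C0 X. hmap G (pure A I a (Fun f)) = hact A f a"
      "z \<in> {pure A I a w | a w. a \<in> carrier A \<and> w \<in> carrier I}" for G z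
      using that F by auto
  qed
  finally have eq: "RUnit C A = ?F" .
  show ?thesis by (rule that[of "B \<circ>\<^sub>h L"]) (use inv F eq in auto)
qed

lemma Assoc_iso:
  assumes A: "hil A" and B: "hil B" and D: "hil D"
  obtains L where "inverse_homs X ((A \<otimes>\<^sub>h B) \<otimes>\<^sub>h D) (A \<otimes>\<^sub>h (B \<otimes>\<^sub>h D)) (Assoc C A B D) L"
    and "\<And>a b d. a \<in> carrier A \<Longrightarrow> b \<in> carrier B \<Longrightarrow> d \<in> carrier D \<Longrightarrow>
      hmap (Assoc C A B D) (pure (A \<otimes>\<^sub>h B) D (pure A B a b) d) = pure A (B \<otimes>\<^sub>h D) a (pure B D b d)"
proof -
  note AB = tensor_obj[OF A B] and BD = tensor_obj[OF B D]
  interpret ab: tensor_pair X A B by (rule tensor_pairI[OF A B])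
  interpret bd: tensor_pair X B D by (rule tensor_pairI[OF B D])
  interpret P: tensor_pair X "A \<otimes>\<^sub>h B" D by (rule tensor_pairI[OF AB D])
  interpret Q: tensor_pair X A "B \<otimes>\<^sub>h D" by (rule tensor_pairI[OF A BD])
  let ?l = "\<lambda>a b d. pure (A \<otimes>\<^sub>h B) D (pure A B a b) d" and ?r = "\<lambda>a b d. pure A (B \<otimes>\<^sub>h D) a (pure B D b d)"
  let ?G = "{(?l a b d, ?r a b d) | a b d. a \<in> carrier A \<and> b \<in> carrier B \<and> d \<in> carrier D}"
  have fst: "fst ` ?G = {pure (A \<otimes>\<^sub>h B) D z d | z d.
      z \<in> {pure A B a b | a b. a \<in> carrier A \<and> b \<in> carrier B} \<and> d \<in> carrier D}" by (auto simp: image_def; blast)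
  have snd: "snd ` ?G = {pure A (B \<otimes>\<^sub>h D) a z | a z.
      a \<in> carrier A \<and> z \<in> {pure B D b d | b d. b \<in> carrier B \<and> d \<in> carrier D}}" by (auto simp: image_def; blast)
  have genl: "generates ((A \<otimes>\<^sub>h B) \<otimes>\<^sub>h D) (fst ` ?G)"
    unfolding fst by (intro P.generates_tensor pures_generate gen_carrier A B D)
  have genr: "generates (A \<otimes>\<^sub>h (B \<otimes>\<^sub>h D)) (snd ` ?G)"
    unfolding snd by (intro Q.generates_tensor pures_generate gen_carrier A B D)
  obtain F L where FL: "inverse_homs X ((A \<otimes>\<^sub>h B) \<otimes>\<^sub>h D) (A \<otimes>\<^sub>h (B \<otimes>\<^sub>h D)) F L" "\<And>a z. (a, z) \<in> ?G \<Longrightarrow> hmap F a = z"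
  proof (rule iso_on_generators[OF P.hilbert_tensor Q.hilbert_tensor, of ?G])
    show "?G \<subseteq> carrier ((A \<otimes>\<^sub>h B) \<otimes>\<^sub>h D) \<times> carrier (A \<otimes>\<^sub>h (B \<otimes>\<^sub>h D))"
      by (auto simp: P.pure_closed Q.pure_closed ab.pure_closed bd.pure_closed)
    show "(hscale ((A \<otimes>\<^sub>h B) \<otimes>\<^sub>h D) c z, hscale (A \<otimes>\<^sub>h (B \<otimes>\<^sub>h D)) c w) \<in> ?G" if zw: "(z, w) \<in> ?G" for c z w
    proof -
      obtain a b d where abd: "z = ?l a b d" "w = ?r a b d" "a \<in> carrier A" "b \<in> carrier B" "d \<in> carrier D"
        using zw by auto
      have "hscale ((A \<otimes>\<^sub>h B) \<otimes>\<^sub>h D) c z = ?l (hscale A c a) b d"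
        using abd by (simp add: P.pure_scale_left[symmetric] ab.pure_scale_left ab.pure_closed)
      moreover have "hscale (A \<otimes>\<^sub>h (B \<otimes>\<^sub>h D)) c w = ?r (hscale A c a) b d"
        using abd by (simp add: Q.pure_scale_left bd.pure_closed)
      ultimately show ?thesis using abd ab.A.scale_closed[of a c] by auto
    qed
    show "(hact ((A \<otimes>\<^sub>h B) \<otimes>\<^sub>h D) g z, hact (A \<otimes>\<^sub>h (B \<otimes>\<^sub>h D)) g w) \<in> ?G"
      if g: "g \<in> C0 X" and zw: "(z, w) \<in> ?G" for g z w
    proof -
      obtain a b d where abd: "z = ?l a b d" "w = ?r a b d" "a \<in> carrier A" "b \<in> carrier B" "d \<in> carrier D"
        using zw by auto
      have "hact ((A \<otimes>\<^sub>h B) \<otimes>\<^sub>h D) g z = ?l (hact A g a) b d"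
        using abd g by (simp add: P.pure_act_left[symmetric] ab.pure_act_left ab.pure_closed)
      moreover have "hact (A \<otimes>\<^sub>h (B \<otimes>\<^sub>h D)) g w = ?r (hact A g a) b d"
        using abd g by (simp add: Q.pure_act_left bd.pure_closed)
      ultimately show ?thesis using abd ab.A.act_closed[OF g, of a] by auto
    qed
    show "hinner (A \<otimes>\<^sub>h (B \<otimes>\<^sub>h D)) w w' x = hinner ((A \<otimes>\<^sub>h B) \<otimes>\<^sub>h D) z z' x"
      if zw: "(z, w) \<in> ?G" "(z', w') \<in> ?G" for z w z' w' x
      using zw by (auto simp: P.hinner_pure Q.hinner_pure ab.hinner_pure bd.hinner_pure
          ab.pure_closed bd.pure_closed)
  qed (rule genl genr | blast)+
  have "Assoc C A B D = (THE H. H \<in> hhom X ((A \<otimes>\<^sub>h B) \<otimes>\<^sub>h D) (A \<otimes>\<^sub>h (B \<otimes>\<^sub>h D)) \<and>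
       (\<forall>a\<in>carrier A. \<forall>b\<in>carrier B. \<forall>d\<in>carrier D. hmap H (?l a b d) = ?r a b d))"
    by (simp add: Hilb_def)
  also have "\<dots> = F"
  proof (rule the_hhom[OF P.hilbert_tensor Q.hilbert_tensor genl])
    show "F \<in> hhom X ((A \<otimes>\<^sub>h B) \<otimes>\<^sub>h D) (A \<otimes>\<^sub>h (B \<otimes>\<^sub>h D))" using FL(1) by (simp add: inverse_homs_def)
    have F: "hmap F (?l a b d) = ?r a b d" if "a \<in> carrier A" "b \<in> carrier B" "d \<in> carrier D" for a b d
      using that by (intro FL(2)) auto
    then show "\<forall>a\<in>carrier A. \<forall>b\<in>carrier B. \<forall>d\<in>carrier D. hmap F (?l a b d) = ?r a b d" by blast
    show "hmap G z = hmap F z" if "\<forall>a\<in>carrier A. \<forall>b\<in>carrier B. \<forall>d\<in>carrier D. hmap G (?l a b d) = ?r a b d"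
      "z \<in> fst ` ?G" for G z
      using that F by auto
  qed
  finally have eq: "Assoc C A B D = F" .
  show ?thesis
  proof (rule that[of L])
    show "inverse_homs X ((A \<otimes>\<^sub>h B) \<otimes>\<^sub>h D) (A \<otimes>\<^sub>h (B \<otimes>\<^sub>h D)) (Assoc C A B D) L" using FL(1) eq by simp
    show "hmap (Assoc C A B D) (?l a b d) = ?r a b d" if "a \<in> carrier A" "b \<in> carrier B" "d \<in> carrier D" for a b d
      using that unfolding eq by (intro FL(2)) auto
  qed
qed

section \<open>The symmetric monoidal category of Hilbert modules\<close>

lemma LUnit:
  assumes "hil A"
  shows "arr (LUnit C A)" "hdom (LUnit C A) = I \<otimes>\<^sub>h A" "hcod (LUnit C A) = A" "is_iso C (LUnit C A)"
    and "\<lbrakk>z \<in> carrier I; a \<in> carrier A\<rbrakk> \<Longrightarrow> hmap (LUnit C A) (pure I A z a) = hact A (fun_of z) a"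
proof -
  obtain L where L: "inverse_homs X (I \<otimes>\<^sub>h A) A (LUnit C A) L"
    "\<And>f a. f \<in> C0 X \<Longrightarrow> a \<in> carrier A \<Longrightarrow> hmap (LUnit C A) (pure I A (Fun f) a) = hact A f a"
    using LUnit_iso[OF assms] by blast
  show "arr (LUnit C A)" "hdom (LUnit C A) = I \<otimes>\<^sub>h A" "hcod (LUnit C A) = A" "is_iso C (LUnit C A)"
    using inverse_homs_iso[OF tensor_obj[OF hilbert_unit_obj assms] assms L(1)] by blast+
  show "\<lbrakk>z \<in> carrier I; a \<in> carrier A\<rbrakk> \<Longrightarrow> hmap (LUnit C A) (pure I A z a) = hact A (fun_of z) a"
    using L(2) by auto
qed

lemma RUnit:
  assumes "hil A"
  shows "arr (RUnit C A)" "hdom (RUnit C A) = A \<otimes>\<^sub>h I" "hcod (RUnit C A) = A" "is_iso C (RUnit C A)"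
    and "\<lbrakk>z \<in> carrier I; a \<in> carrier A\<rbrakk> \<Longrightarrow> hmap (RUnit C A) (pure A I a z) = hact A (fun_of z) a"
proof -
  obtain L where L: "inverse_homs X (A \<otimes>\<^sub>h I) A (RUnit C A) L"
    "\<And>f a. f \<in> C0 X \<Longrightarrow> a \<in> carrier A \<Longrightarrow> hmap (RUnit C A) (pure A I a (Fun f)) = hact A f a"
    using RUnit_iso[OF assms] by blast
  show "arr (RUnit C A)" "hdom (RUnit C A) = A \<otimes>\<^sub>h I" "hcod (RUnit C A) = A" "is_iso C (RUnit C A)"
    using inverse_homs_iso[OF tensor_obj[OF assms hilbert_unit_obj] assms L(1)] by blast+
  show "\<lbrakk>z \<in> carrier I; a \<in> carrier A\<rbrakk> \<Longrightarrow> hmap (RUnit C A) (pure A I a z) = hact A (fun_of z) a"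
    using L(2) by auto
qed

lemma Braid:
  assumes "hil A" "hil B"
  shows "arr (Braid C A B)" "hdom (Braid C A B) = A \<otimes>\<^sub>h B" "hcod (Braid C A B) = B \<otimes>\<^sub>h A" "is_iso C (Braid C A B)"
    and "\<lbrakk>a \<in> carrier A; b \<in> carrier B\<rbrakk> \<Longrightarrow> hmap (Braid C A B) (pure A B a b) = pure B A b a"
proof -
  obtain L where L: "inverse_homs X (A \<otimes>\<^sub>h B) (B \<otimes>\<^sub>h A) (Braid C A B) L"
    "\<And>a b. a \<in> carrier A \<Longrightarrow> b \<in> carrier B \<Longrightarrow> hmap (Braid C A B) (pure A B a b) = pure B A b a"
    using Braid_iso[OF assms] by blast
  show "arr (Braid C A B)" "hdom (Braid C A B) = A \<otimes>\<^sub>h B" "hcod (Braid C A B) = B \<otimes>\<^sub>h A" "is_iso C (Braid C A B)"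
    using inverse_homs_iso[OF tensor_obj[OF assms] tensor_obj[OF assms(2,1)] L(1)] by blast+
  show "\<lbrakk>a \<in> carrier A; b \<in> carrier B\<rbrakk> \<Longrightarrow> hmap (Braid C A B) (pure A B a b) = pure B A b a"
    using L(2) by auto
qed

lemma Assoc:
  assumes "hil A" "hil B" "hil D"
  shows "arr (Assoc C A B D)" "hdom (Assoc C A B D) = (A \<otimes>\<^sub>h B) \<otimes>\<^sub>h D"
    "hcod (Assoc C A B D) = A \<otimes>\<^sub>h (B \<otimes>\<^sub>h D)" "is_iso C (Assoc C A B D)"
    and "\<lbrakk>a \<in> carrier A; b \<in> carrier B; d \<in> carrier D\<rbrakk> \<Longrightarrow>
      hmap (Assoc C A B D) (pure (A \<otimes>\<^sub>h B) D (pure A B a b) d) = pure A (B \<otimes>\<^sub>h D) a (pure B D b d)"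
    and "arr (Inv C (Assoc C A B D))" "hcod (Inv C (Assoc C A B D)) = (A \<otimes>\<^sub>h B) \<otimes>\<^sub>h D"
    "hdom (Inv C (Assoc C A B D)) = A \<otimes>\<^sub>h (B \<otimes>\<^sub>h D)"
    and "\<lbrakk>a \<in> carrier A; b \<in> carrier B; d \<in> carrier D\<rbrakk> \<Longrightarrow>
      hmap (Inv C (Assoc C A B D)) (pure A (B \<otimes>\<^sub>h D) a (pure B D b d)) = pure (A \<otimes>\<^sub>h B) D (pure A B a b) d"
proof -
  obtain L where L: "inverse_homs X ((A \<otimes>\<^sub>h B) \<otimes>\<^sub>h D) (A \<otimes>\<^sub>h (B \<otimes>\<^sub>h D)) (Assoc C A B D) L"
    "\<And>a b d. a \<in> carrier A \<Longrightarrow> b \<in> carrier B \<Longrightarrow> d \<in> carrier D \<Longrightarrow>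
      hmap (Assoc C A B D) (pure (A \<otimes>\<^sub>h B) D (pure A B a b) d) = pure A (B \<otimes>\<^sub>h D) a (pure B D b d)"
    using Assoc_iso[OF assms] by blast
  note ob = tensor_obj[OF tensor_obj[OF assms(1,2)] assms(3)] tensor_obj[OF assms(1) tensor_obj[OF assms(2,3)]]
  note iso = inverse_homs_iso[OF ob L(1)]
  show "arr (Assoc C A B D)" "hdom (Assoc C A B D) = (A \<otimes>\<^sub>h B) \<otimes>\<^sub>h D"
    "hcod (Assoc C A B D) = A \<otimes>\<^sub>h (B \<otimes>\<^sub>h D)" "is_iso C (Assoc C A B D)"
    "arr (Inv C (Assoc C A B D))" "hcod (Inv C (Assoc C A B D)) = (A \<otimes>\<^sub>h B) \<otimes>\<^sub>h D"
    "hdom (Inv C (Assoc C A B D)) = A \<otimes>\<^sub>h (B \<otimes>\<^sub>h D)"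
    using iso(1-8) by simp_all
  show val: "\<lbrakk>a \<in> carrier A; b \<in> carrier B; d \<in> carrier D\<rbrakk> \<Longrightarrow>
      hmap (Assoc C A B D) (pure (A \<otimes>\<^sub>h B) D (pure A B a b) d) = pure A (B \<otimes>\<^sub>h D) a (pure B D b d)"
    for a b d by (rule L(2))
  show "hmap (Inv C (Assoc C A B D)) (pure A (B \<otimes>\<^sub>h D) a (pure B D b d)) = pure (A \<otimes>\<^sub>h B) D (pure A B a b) d"
    if abd: "a \<in> carrier A" "b \<in> carrier B" "d \<in> carrier D"
    using iso(9)[of "pure (A \<otimes>\<^sub>h B) D (pure A B a b) d"] abd assms
    by (simp add: iso(5) val pure_in tensor_obj)
qed

lemma hmap_act: "arr F \<Longrightarrow> f \<in> C0 X \<Longrightarrow> a \<in> carrier (hdom F) \<Longrightarrow> hmap F (hact (hdom F) f a) = hact (hcod F) f (hmap F a)"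
  using hhomD(6)[OF arr_hhom] .

lemma act_in: "hil A \<Longrightarrow> f \<in> C0 X \<Longrightarrow> a \<in> carrier A \<Longrightarrow> hact A f a \<in> carrier A"
  by (rule hilbert_module.act_closed)

lemma pure_act:
  assumes "hil A" "hil B" "f \<in> C0 X" "a \<in> carrier A" "b \<in> carrier B"
  shows "pure A B (hact A f a) b = pure A B a (hact B f b)"
proof -
  interpret P: tensor_pair X A B by (rule tensor_pairI[OF assms(1,2)])
  show ?thesis using assms by (simp add: P.pure_act_left P.pure_act_right)
qed

lemmas arr_simps = Comp_arr Id_arr TenA LUnit RUnit Braid Assoc hmap_closed pure_in tensor_obj arr_obj
  hilbert_unit_obj homs_arr hmap_act act_in

lemma category_Hilb: "category (C :: (('v, 'x) hobj, ('v, 'x) harr) braided_cat)"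
proof
  show "Dom C f \<in> Obj C \<and> Cod C f \<in> Obj C" if "arr f" for f
    using that by (simp add: arr_obj)
  show "Id C A \<in> homs C A A" if "A \<in> Obj C" for A
    using that by (simp add: arr_simps)
  show "g \<circ>\<^sub>h f \<in> homs C A D" if "f \<in> homs C A B" "g \<in> homs C B D" for f g A B D
    using that by (simp add: arr_simps)
  show "Id C B \<circ>\<^sub>h f = f" if "f \<in> homs C A B" for f A B
    by (rule arr_eqI1[where A = A]) (use that in \<open>auto simp: arr_simps\<close>)
  show "f \<circ>\<^sub>h Id C A = f" if "f \<in> homs C A B" for f A B
    by (rule arr_eqI1[where A = A]) (use that in \<open>auto simp: arr_simps\<close>)
  show "(h \<circ>\<^sub>h g) \<circ>\<^sub>h f = h \<circ>\<^sub>h (g \<circ>\<^sub>h f)" if "f \<in> homs C A B" "g \<in> homs C B D" "h \<in> homs C D E" for f g h A B D E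
    by (rule arr_eqI1[where A = A]) (use that in \<open>auto simp: arr_simps\<close>)
qed

lemma monoidal_Hilb: "monoidal_category (C :: (('v, 'x) hobj, ('v, 'x) harr) braided_cat)"
proof (intro monoidal_category.intro monoidal_category_axioms.intro category_Hilb)
  show "Unit C \<in> Obj C" by (simp add: arr_simps)
  fix A :: "('v, 'x) hobj" assume "A \<in> Obj C" then have A: "hil A" by simp
  show "LUnit C A \<in> homs C (TenO C (Unit C) A) A \<and> is_iso C (LUnit C A)"
    using A by (simp add: arr_simps)
  show "RUnit C A \<in> homs C (TenO C A (Unit C)) A \<and> is_iso C (RUnit C A)"
    using A by (simp add: arr_simps)
  fix B :: "('v, 'x) hobj" assume "B \<in> Obj C" then have B: "hil B" by simp
  show "TenO C A B \<in> Obj C" using A B by (simp add: arr_simps)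
  show "TenA C (Id C A) (Id C B) = Id C (TenO C A B)"
    by (rule arr_eqI2[where A = A and B = B]) (use A B in \<open>simp_all add: arr_simps\<close>)
  show "TenA C (Id C A) (LUnit C B) \<circ>\<^sub>h Assoc C A (Unit C) B = TenA C (RUnit C A) (Id C B)"
    by (rule arr_eqI3[where A = A and B = I and D = B])
      (use A B in \<open>simp_all add: arr_simps del: unit_simps\<close>, auto simp: pure_act)
  fix D :: "('v, 'x) hobj" assume "D \<in> Obj C" then have D: "hil D" by simp
  show "Assoc C A B D \<in> homs C (TenO C (TenO C A B) D) (TenO C A (TenO C B D)) \<and> is_iso C (Assoc C A B D)"
    using A B D by (simp add: arr_simps)
  fix E :: "('v, 'x) hobj" assume "E \<in> Obj C" then have E: "hil E" by simp
  show "Assoc C A B (TenO C D E) \<circ>\<^sub>h Assoc C (TenO C A B) D E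
      = TenA C (Id C A) (Assoc C B D E) \<circ>\<^sub>h Assoc C A (TenO C B D) E \<circ>\<^sub>h TenA C (Assoc C A B D) (Id C E)"
    by (rule arr_eqI4[where A = A and B = B and D = D and E = E]) (use A B D E in \<open>simp_all add: arr_simps\<close>)
next
  fix f :: "('v, 'x) harr" and A A' :: "('v, 'x) hobj" assume f: "f \<in> homs C A A'"
  then have A: "hil A" "hil A'" by (auto simp: homs_arr arr_iff)
  show "LUnit C A' \<circ>\<^sub>h TenA C (Id C (Unit C)) f = f \<circ>\<^sub>h LUnit C A"
    by (rule arr_eqI2[where A = I and B = A]) (use f A in \<open>auto simp: arr_simps\<close>)
  show "RUnit C A' \<circ>\<^sub>h TenA C f (Id C (Unit C)) = f \<circ>\<^sub>h RUnit C A"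
    by (rule arr_eqI2[where A = A and B = I]) (use f A in \<open>auto simp: arr_simps\<close>)
  fix g :: "('v, 'x) harr" and B B' :: "('v, 'x) hobj" assume g: "g \<in> homs C B B'"
  then have B: "hil B" "hil B'" by (auto simp: homs_arr arr_iff)
  show "TenA C f g \<in> homs C (TenO C A B) (TenO C A' B')" using f g by (simp add: arr_simps)
  fix h :: "('v, 'x) harr" and D D' :: "('v, 'x) hobj" assume h: "h \<in> homs C D D'"
  then have D: "hil D" "hil D'" by (auto simp: homs_arr arr_iff)
  show "Assoc C A' B' D' \<circ>\<^sub>h TenA C (TenA C f g) h = TenA C f (TenA C g h) \<circ>\<^sub>h Assoc C A B D"
    by (rule arr_eqI3[where A = A and B = B and D = D]) (use f g h A B D in \<open>auto simp: arr_simps\<close>)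
next
  fix f f' g g' :: "('v, 'x) harr" and A A' A'' B B' B'' :: "('v, 'x) hobj"
  assume fg: "f \<in> homs C A A'" "f' \<in> homs C A' A''" "g \<in> homs C B B'" "g' \<in> homs C B' B''"
  then have ob: "hil A" "hil B" by (auto simp: homs_arr arr_iff)
  show "TenA C (f' \<circ>\<^sub>h f) (g' \<circ>\<^sub>h g) = TenA C f' g' \<circ>\<^sub>h TenA C f g"
    by (rule arr_eqI2[where A = A and B = B]) (use fg ob in \<open>auto simp: arr_simps\<close>)
qed

lemma braided_Hilb: "braided_monoidal_category (C :: (('v, 'x) hobj, ('v, 'x) harr) braided_cat)"
proof (intro braided_monoidal_category.intro braided_monoidal_category_axioms.intro monoidal_Hilb)
  fix A B :: "('v, 'x) hobj" assume "A \<in> Obj C" "B \<in> Obj C" then have AB: "hil A" "hil B" by simp_all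
  show "Braid C A B \<in> homs C (TenO C A B) (TenO C B A) \<and> is_iso C (Braid C A B)"
    using AB by (simp add: arr_simps)
  fix D :: "('v, 'x) hobj" assume "D \<in> Obj C" then have D: "hil D" by simp
  show "Assoc C B D A \<circ>\<^sub>h Braid C A (TenO C B D) \<circ>\<^sub>h Assoc C A B D
      = TenA C (Id C B) (Braid C A D) \<circ>\<^sub>h Assoc C B A D \<circ>\<^sub>h TenA C (Braid C A B) (Id C D)"
    by (rule arr_eqI3[where A = A and B = B and D = D]) (use AB D in \<open>simp_all add: arr_simps\<close>)
  show "Inv C (Assoc C D A B) \<circ>\<^sub>h Braid C (TenO C A B) D \<circ>\<^sub>h Inv C (Assoc C A B D)
      = TenA C (Braid C A D) (Id C B) \<circ>\<^sub>h Inv C (Assoc C A D B) \<circ>\<^sub>h TenA C (Id C A) (Braid C B D)"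
    by (rule arr_eqI3'[where A = A and B = B and D = D]) (use AB D in \<open>simp_all add: arr_simps\<close>)
next
  fix f g :: "('v, 'x) harr" and A A' B B' :: "('v, 'x) hobj" assume fg: "f \<in> homs C A A'" "g \<in> homs C B B'"
  then have ob: "hil A" "hil B" "hil A'" "hil B'" by (auto simp: homs_arr arr_iff)
  show "Braid C A' B' \<circ>\<^sub>h TenA C f g = TenA C g f \<circ>\<^sub>h Braid C A B"
    by (rule arr_eqI2[where A = A and B = B]) (use fg ob in \<open>auto simp: arr_simps\<close>)
qed

theorem symmetric_Hilb: "symmetric_monoidal_category (C :: (('v, 'x) hobj, ('v, 'x) harr) braided_cat)"
proof (intro symmetric_monoidal_category.intro symmetric_monoidal_category_axioms.intro braided_Hilb)
  fix A B :: "('v, 'x) hobj" assume "A \<in> Obj C" "B \<in> Obj C" then have AB: "hil A" "hil B" by simp_all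
  show "Braid C B A \<circ>\<^sub>h Braid C A B = Id C (TenO C A B)"
    by (rule arr_eqI2[where A = A and B = B]) (use AB in \<open>simp_all add: arr_simps\<close>)
qed

section \<open>Isometric morphisms\<close>

definition isom :: "('v, 'x) harr \<Rightarrow> bool" where
  "isom F \<longleftrightarrow> arr F \<and> (\<forall>a\<in>carrier (hdom F). \<forall>x. ptnorm (hcod F) (hmap F a) x = ptnorm (hdom F) a x)"

definition img :: "('v, 'x) harr \<Rightarrow> ('v, 'x) elt set" where
  "img F = hmap F ` carrier (hdom F)"

lemma isom_arr: "isom F \<Longrightarrow> arr F" by (simp add: isom_def)

lemma isom_ptnorm: "isom F \<Longrightarrow> a \<in> carrier (hdom F) \<Longrightarrow> ptnorm (hcod F) (hmap F a) x = ptnorm (hdom F) a x"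
  by (simp add: isom_def)

lemma arr_ptnorm_le: "arr F \<Longrightarrow> a \<in> carrier (hdom F) \<Longrightarrow> ptnorm (hcod F) (hmap F a) x \<le> ptnorm (hdom F) a x"
  by (rule hhom_ptnorm_le[OF arr_obj arr_hhom])

lemma isom_ip:
  "isom F \<Longrightarrow> a \<in> carrier (hdom F) \<Longrightarrow> b \<in> carrier (hdom F)
   \<Longrightarrow> hinner (hcod F) (hmap F a) (hmap F b) x = hinner (hdom F) a b x"
  using ip_eq_if_ptnorm_eq[of X "hdom F" "hcod F" F x a b] by (simp add: isom_def arr_iff)

lemma arr_sub: "arr F \<Longrightarrow> a \<in> carrier (hdom F) \<Longrightarrow> b \<in> carrier (hdom F)
   \<Longrightarrow> hmap F (hsub (hdom F) a b) = hsub (hcod F) (hmap F a) (hmap F b)"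
  by (rule hhom_sub[OF arr_obj arr_hhom])

lemma separated: "hil A \<Longrightarrow> separated_module X A" by (rule hilbert_separated)

lemma isom_near:
  assumes "isom F" "a \<in> carrier (hdom F)" "b \<in> carrier (hdom F)"
  shows "near (hcod F) e (hmap F a) (hmap F b) \<longleftrightarrow> near (hdom F) e a b"
proof -
  interpret S: separated_module X "hdom F" using assms(1) by (intro separated arr_obj isom_arr)
  show ?thesis
    using assms by (simp add: near_def arr_sub[symmetric] isom_arr isom_ptnorm S.sub_closed)
qed

lemma isom_inj:
  assumes F: "isom F" and a: "a \<in> carrier (hdom F)" "b \<in> carrier (hdom F)" and eq: "hmap F a = hmap F b"
  shows "a = b"
proof -
  interpret S: separated_module X "hdom F" using F by (intro separated arr_obj isom_arr)
  interpret T: separated_module X "hcod F" using F by (intro separated arr_obj isom_arr)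
  have "hmap F b \<in> carrier (hcod F)" using F a by (intro hmap_closed isom_arr) auto
  then have "near (hcod F) e (hmap F a) (hmap F b)" if "e > 0" for e
    unfolding eq using that by (intro T.near_refl) auto
  then show ?thesis using isom_near[OF F a] by (intro S.eq_if_near a) auto
qed

lemma inj_mono:
  assumes F: "arr F" and inj: "\<And>a b. a \<in> carrier (hdom F) \<Longrightarrow> b \<in> carrier (hdom F) \<Longrightarrow> hmap F a = hmap F b \<Longrightarrow> a = b"
  shows "is_mono C F"
  unfolding is_mono_def
proof (intro conjI ballI impI F)
  fix Z g h assume "g \<in> homs C Z (Dom C F)" "h \<in> homs C Z (Dom C F)" and eq: "F \<circ>\<^sub>h g = F \<circ>\<^sub>h h"
  then have gh: "arr g" "arr h" "hdom g = Z" "hdom h = Z" "hcod g = hdom F" "hcod h = hdom F" by (auto simp: homs_arr)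
  show "g = h"
  proof (rule arr_eqI1[where A = Z])
    fix a assume a: "a \<in> carrier Z"
    have "hmap (F \<circ>\<^sub>h g) a = hmap (F \<circ>\<^sub>h h) a" by (simp add: eq)
    then have "hmap F (hmap g a) = hmap F (hmap h a)" using gh a by (simp add: Comp_arr)
    then show "hmap g a = hmap h a" by (rule inj[rotated 2]) (use gh a in \<open>auto intro: hmap_closed\<close>)
  qed (use gh in auto)
qed

lemma isom_mono: "isom F \<Longrightarrow> is_mono C F"
  by (rule inj_mono[OF isom_arr isom_inj])

text \<open>An isomorphism and its inverse are both contractive at every point.\<close>

lemma iso_isom:
  assumes "is_iso C F"
  shows "isom F" "img F = carrier (hcod F)"
proof -
  obtain G where F: "arr F" and G: "arr G" "hdom G = hcod F" "hcod G = hdom F"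
    and inv: "G \<circ>\<^sub>h F = Id C (hdom F)" "F \<circ>\<^sub>h G = Id C (hcod F)"
    using assms by (auto simp: is_iso_def is_inverse_def homs_arr)
  have GF: "hmap G (hmap F a) = a" if "a \<in> carrier (hdom F)" for a
    using arg_cong[OF inv(1), of "\<lambda>H. hmap H a"] that by (simp add: arr_simps)
  have FG: "hmap F (hmap G b) = b" if "b \<in> carrier (hcod F)" for b
    using arg_cong[OF inv(2), of "\<lambda>H. hmap H b"] that G by (simp add: arr_simps)
  show "isom F"
    unfolding isom_def
  proof (intro conjI F ballI allI antisym)
    fix a x assume a: "a \<in> carrier (hdom F)"
    show "ptnorm (hcod F) (hmap F a) x \<le> ptnorm (hdom F) a x" using F a by (rule arr_ptnorm_le)
    show "ptnorm (hdom F) a x \<le> ptnorm (hcod F) (hmap F a) x"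
      using arr_ptnorm_le[OF G(1), of "hmap F a" x] G GF[OF a] hmap_closed[OF F refl a] by simp
  qed
  show "img F = carrier (hcod F)"
  proof
    show "img F \<subseteq> carrier (hcod F)" using F by (auto simp: img_def intro: hmap_closed)
    show "carrier (hcod F) \<subseteq> img F"
    proof
      fix b assume b: "b \<in> carrier (hcod F)"
      have "hmap G b \<in> carrier (hdom F)" using G b by (intro hmap_closed) auto
      then show "b \<in> img F" using FG[OF b] by (auto simp: img_def intro: image_eqI[where x = "hmap G b"])
    qed
  qed
qed

text \<open>The inverse of an isometry on its image is contractive, so a morphism into the image factors through
  the isometry.\<close>

lemma factor_isom:
  assumes M: "isom M" and F: "arr F" and cod: "hcod F = hcod M" and sub: "img F \<subseteq> img M"
  obtains H where "arr H" "hdom H = hdom F" "hcod H = hdom M" "M \<circ>\<^sub>h H = F"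
    "\<And>a. a \<in> carrier (hdom F) \<Longrightarrow> hmap M (hmap H a) = hmap F a"
proof -
  interpret S: separated_module X "hdom M" using M by (intro separated arr_obj isom_arr)
  note aM = isom_arr[OF M] and hM = arr_hhom[OF isom_arr[OF M]] and hF = arr_hhom[OF F]
  define h where "h a = (SOME b. b \<in> carrier (hdom M) \<and> hmap M b = hmap F a)" for a
  have h: "h a \<in> carrier (hdom M) \<and> hmap M (h a) = hmap F a" if "a \<in> carrier (hdom F)" for a
    unfolding h_def
  proof (rule someI_ex)
    have "hmap F a \<in> img M" using sub that by (auto simp: img_def)
    then show "\<exists>b. b \<in> carrier (hdom M) \<and> hmap M b = hmap F a" by (auto simp: img_def)
  qed
  have h_eq: "h a = b" if "a \<in> carrier (hdom F)" "b \<in> carrier (hdom M)" "hmap M b = hmap F a" for a b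
    using isom_inj[OF M, of "h a" b] h[OF that(1)] that by simp
  interpret D: separated_module X "hdom F" using F by (intro separated arr_obj)
  let ?H = "\<lparr>hdom = hdom F, hcod = hdom M, hmap = restrict h (carrier (hdom F))\<rparr>"
  have H: "?H \<in> hhom X (hdom F) (hdom M)"
  proof (rule hhomI[OF arr_obj(1)[OF F] arr_obj(1)[OF aM]])
    fix a x assume a: "a \<in> carrier (hdom F)"
    show "h a \<in> carrier (hdom M)" using h[OF a] by blast
    show "ptnorm (hdom M) (h a) x \<le> ptnorm (hdom F) a x"
      using isom_ptnorm[OF M, of "h a" x] h[OF a] arr_ptnorm_le[OF F a, of x] cod by simp
  next
    fix a b assume "a \<in> carrier (hdom F)" "b \<in> carrier (hdom F)"
    then show "h (hadd (hdom F) a b) = hadd (hdom M) (h a) (h b)"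
      using h hhomD(4)[OF hM] hhomD(4)[OF hF] cod by (intro h_eq) (auto simp: D.closed S.closed)
  next
    fix c a assume "a \<in> carrier (hdom F)"
    then show "h (hscale (hdom F) c a) = hscale (hdom M) c (h a)"
      using h hhomD(5)[OF hM] hhomD(5)[OF hF] cod by (intro h_eq) (auto simp: D.closed S.closed)
  next
    fix f a assume "f \<in> C0 X" "a \<in> carrier (hdom F)"
    then show "h (hact (hdom F) f a) = hact (hdom M) f (h a)"
      using h hhomD(6)[OF hM] hhomD(6)[OF hF] cod by (intro h_eq) (auto simp: D.closed S.closed)
  qed
  have aH: "arr ?H" using arrI[OF H arr_obj(1)[OF F] arr_obj(1)[OF aM]] by simp
  have MH: "hmap M (hmap ?H a) = hmap F a" if "a \<in> carrier (hdom F)" for a using h[OF that] that by simp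
  have comp: "M \<circ>\<^sub>h ?H = F"
    by (rule arr_eqI1[where A = "hdom F"]) (use aH aM F cod MH in \<open>auto simp: Comp_arr simp del: restrict_apply\<close>)
  show ?thesis by (rule that[OF aH _ _ comp MH]) simp_all
qed

lemma isom_iso:
  assumes F: "isom F" and surj: "img F = carrier (hcod F)"
  shows "is_iso C F"
proof -
  let ?I = "Id C (hcod F)"
  have aF: "arr F" using F by (rule isom_arr)
  have I: "arr ?I" "hdom ?I = hcod F" "hcod ?I = hcod F" using aF by (auto simp: arr_simps)
  have "img ?I \<subseteq> img F" using I by (auto simp: img_def[of ?I] surj Id_arr)
  then obtain G where G: "arr G" "hdom G = hcod F" "hcod G = hdom F" "F \<circ>\<^sub>h G = ?I"
    "\<And>b. b \<in> carrier (hcod F) \<Longrightarrow> hmap F (hmap G b) = hmap ?I b"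
    using factor_isom[OF F I(1)] I by metis
  have "G \<circ>\<^sub>h F = Id C (hdom F)"
  proof (rule arr_eqI1[where A = "hdom F"])
    fix a assume a: "a \<in> carrier (hdom F)"
    have Fa: "hmap F a \<in> carrier (hcod F)" using aF a by (auto intro: hmap_closed)
    have "hmap G (hmap F a) = a"
      by (rule isom_inj[OF F]) (use G(5)[OF Fa] Fa a G(1-3) in \<open>auto simp: Id_arr intro: hmap_closed\<close>)
    then show "hmap (G \<circ>\<^sub>h F) a = hmap (Id C (hdom F)) a" using a by (simp add: arr_simps)
  qed (use aF G in \<open>auto simp: arr_simps\<close>)
  then show ?thesis using aF G by (auto simp: is_iso_def is_inverse_def homs_arr intro!: exI[of _ G])
qed

text \<open>Preimages of a convergent sequence in the image form a Cauchy sequence.\<close>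

lemma img_closed:
  assumes F: "isom F" and b: "b \<in> carrier (hcod F)"
    and lim: "\<And>e. e > 0 \<Longrightarrow> \<exists>c\<in>img F. near (hcod F) e b c"
  shows "b \<in> img F"
proof -
  interpret S: separated_module X "hdom F" using F by (intro separated arr_obj isom_arr)
  interpret T: separated_module X "hcod F" using F by (intro separated arr_obj isom_arr)
  have aF: "arr F" using F by (rule isom_arr)
  have "\<exists>a. a \<in> carrier (hdom F) \<and> near (hcod F) (1 / real (Suc n)) b (hmap F a)" for n
    using lim[of "1 / real (Suc n)"] by (auto simp: img_def)
  then obtain s where s: "\<And>n. s n \<in> carrier (hdom F)" "\<And>n. near (hcod F) (1 / real (Suc n)) b (hmap F (s n))"
    by metis
  have Fs: "hmap F (s n) \<in> carrier (hcod F)" for n using aF s(1) by (auto intro: hmap_closed)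
  have asym: "asymptotic (hcod F) (\<lambda>n. b) (\<lambda>n. hmap F (s n))"
    unfolding asymptotic_def
  proof (intro allI impI)
    fix e :: real assume "e > 0"
    then obtain N where N: "\<And>n. n \<ge> N \<Longrightarrow> 1 / real (Suc n) < e" by (rule inverse_Suc_small) blast
    have "near (hcod F) e b (hmap F (s n))" if "n \<ge> N" for n
      by (rule T.near_mono[OF s(2) less_imp_le[OF N[OF that]]])
    then show "\<exists>N. \<forall>n\<ge>N. near (hcod F) e b (hmap F (s n))" by blast
  qed
  have "hcauchy (hcod F) (\<lambda>n. b)" using hcauchy_const[OF T.premodule_axioms b] .
  then have "hcauchy (hcod F) (\<lambda>n. hmap F (s n))" by (rule T.asymptotic_hcauchy[OF b Fs asym])
  then have "hcauchy (hdom F) s" by (simp add: hcauchy_def isom_near[OF F s(1) s(1)])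
  then obtain a where a: "a \<in> carrier (hdom F)" "hconv (hdom F) s a"
    using hilbert_complete[OF arr_obj(1)[OF aF]] s(1) by metis
  have Fa: "hmap F a \<in> carrier (hcod F)" using aF a(1) by (auto intro: hmap_closed)
  have "asymptotic (hcod F) (\<lambda>n. hmap F (s n)) (\<lambda>n. hmap F a)"
    using a(2) by (simp add: asymptotic_def hconv_def isom_near[OF F s(1) a(1)])
  with asym have "asymptotic (hcod F) (\<lambda>n. b) (\<lambda>n. hmap F a)"
    by (rule T.asymptotic_trans[OF b Fs Fa])
  then have "b = hmap F a" by (intro T.eq_if_near[OF b Fa]) (auto simp: asymptotic_def)
  then show ?thesis using a(1) by (auto simp: img_def)
qed

text \<open>Preservation of inner products can be checked on generators, one argument at a time.\<close>

lemma isom_on_generators: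
  assumes F: "arr F" and gen: "generates (hdom F) D"
    and ip: "\<And>a b x. a \<in> D \<Longrightarrow> b \<in> D \<Longrightarrow> hinner (hcod F) (hmap F a) (hmap F b) x = hinner (hdom F) a b x"
  shows "isom F"
proof -
  let ?A = "hdom F" and ?Z = "hcod F"
  interpret S: separated_module X ?A using F by (intro separated arr_obj)
  interpret T: separated_module X ?Z using F by (intro separated arr_obj)
  have Fin: "hmap F a \<in> carrier ?Z" if "a \<in> carrier ?A" for a using F that by (auto intro: hmap_closed)
  note h = arr_hhom[OF F] and near = hhom_near[OF arr_obj[OF F] arr_hhom[OF F]]
  have ind: "\<forall>x. hinner ?Z (hmap F b) (hmap F a) x = hinner ?A b a x"
    if b: "b \<in> carrier ?A" and base: "\<And>a. a \<in> D \<Longrightarrow> \<forall>x. hinner ?Z (hmap F b) (hmap F a) x = hinner ?A b a x"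
      and a: "a \<in> carrier ?A" for a b
    using gen a
  proof (induction rule: S.generates_induct)
    case (base a)
    then show ?case by (rule that(2))
  next
    case zero
    show ?case using b Fin by (simp add: hhom_zero[OF arr_obj[OF F] h] S.ip_simps T.ip_simps)
  next
    case (add a a')
    then show ?case using b Fin by (simp add: hhomD(4)[OF h] S.ip_simps T.ip_simps)
  next
    case (limit a)
    show ?case
    proof
      fix x
      have le: "cmod (hinner ?Z (hmap F b) (hmap F a) x - hinner ?A b a x) \<le> 0 + e" if e: "e > 0" for e
      proof -
        define K where "K = 2 * ptnorm ?A b x + 1"
        have K: "K > 0" using S.ptnorm_nonneg[OF b, of x] by (simp add: K_def)
        obtain c where c: "c \<in> carrier ?A" "near ?A (e / K) a c"
            "\<forall>x. hinner ?Z (hmap F b) (hmap F c) x = hinner ?A b c x"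
          using limit(2)[of "e / K"] e K by auto
        have "cmod (hinner ?Z (hmap F b) (hmap F a) x - hinner ?Z (hmap F b) (hmap F c) x)
            \<le> ptnorm ?Z (hmap F b) x * (e / K)"
          using limit(1) b c Fin by (intro T.near_ip near) auto
        also have "\<dots> \<le> ptnorm ?A b x * (e / K)"
          using arr_ptnorm_le[OF F b, of x] e K by (intro mult_right_mono) auto
        finally have 1: "cmod (hinner ?Z (hmap F b) (hmap F a) x - hinner ?Z (hmap F b) (hmap F c) x)
            \<le> ptnorm ?A b x * (e / K)" .
        have 2: "cmod (hinner ?A b a x - hinner ?A b c x) \<le> ptnorm ?A b x * (e / K)"
          using limit(1) b c by (intro S.near_ip) auto
        have eq: "hinner ?Z (hmap F b) (hmap F c) x = hinner ?A b c x" using c(3) by blast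
        have "cmod (hinner ?Z (hmap F b) (hmap F a) x - hinner ?A b a x) \<le>
            ptnorm ?A b x * (e / K) + ptnorm ?A b x * (e / K)"
        proof -
          have "cmod (hinner ?Z (hmap F b) (hmap F a) x - hinner ?A b a x)
              \<le> cmod (hinner ?Z (hmap F b) (hmap F a) x - hinner ?A b c x)
                + cmod (hinner ?A b a x - hinner ?A b c x)"
            using norm_triangle_ineq4[of "hinner ?Z (hmap F b) (hmap F a) x - hinner ?A b c x"
                "hinner ?A b a x - hinner ?A b c x"] by simp
          then show ?thesis using 1 2 unfolding eq by linarith
        qed
        also have "\<dots> = (2 * ptnorm ?A b x) * (e / K)" by simp
        also have "\<dots> \<le> K * (e / K)" using e K by (intro mult_right_mono) (auto simp: K_def)
        also have "\<dots> = e" using K by simp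
        finally show ?thesis by simp
      qed
      have "cmod (hinner ?Z (hmap F b) (hmap F a) x - hinner ?A b a x) \<le> 0"
        by (rule field_le_epsilon) (rule le)
      then show "hinner ?Z (hmap F b) (hmap F a) x = hinner ?A b a x" by simp
    qed
  qed
  have D: "D \<subseteq> carrier ?A" using gen by (simp add: generates_def)
  have 1: "hinner ?Z (hmap F b) (hmap F a) x = hinner ?A b a x" if "b \<in> D" "a \<in> carrier ?A" for a b x
    using ind[of b a] ip that D by blast
  have 2: "hinner ?Z (hmap F b) (hmap F a) x = hinner ?A b a x" if a: "a \<in> D" and b: "b \<in> carrier ?A" for a b x
  proof -
    have a': "a \<in> carrier ?A" using a D by blast
    have "hinner ?Z (hmap F b) (hmap F a) x = cnj (hinner ?Z (hmap F a) (hmap F b) x)"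
      by (rule T.ip_adj[OF Fin[OF a'] Fin[OF b], symmetric])
    also have "\<dots> = cnj (hinner ?A a b x)" by (simp only: 1[OF a b])
    also have "\<dots> = hinner ?A b a x" by (rule S.ip_adj[OF a' b])
    finally show ?thesis .
  qed
  have "hinner ?Z (hmap F a) (hmap F a) x = hinner ?A a a x" if "a \<in> carrier ?A" for a x
    using ind[of a a] 2 that by blast
  then show ?thesis using F by (auto simp: isom_def ptnorm_def)
qed

lemma isom_comp:
  assumes "isom F" "isom G" "hcod F = hdom G"
  shows "isom (G \<circ>\<^sub>h F)"
  using assms hmap_closed[OF isom_arr[OF assms(1)]]
  by (auto simp: isom_def Comp_arr)

lemma isom_cancel:
  assumes "isom (G \<circ>\<^sub>h F)" "arr F" "arr G" "hcod F = hdom G"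
  shows "isom F"
  unfolding isom_def
proof (intro conjI assms(2) ballI allI antisym)
  fix a x assume a: "a \<in> carrier (hdom F)"
  show "ptnorm (hcod F) (hmap F a) x \<le> ptnorm (hdom F) a x" by (rule arr_ptnorm_le[OF assms(2) a])
  have "ptnorm (hcod G) (hmap G (hmap F a)) x = ptnorm (hdom F) a x"
    using isom_ptnorm[OF assms(1), of a x] a by (simp add: Comp_arr)
  moreover have "ptnorm (hcod G) (hmap G (hmap F a)) x \<le> ptnorm (hcod F) (hmap F a) x"
    using arr_ptnorm_le[OF assms(3), of "hmap F a" x] hmap_closed[OF assms(2) refl a] assms(4) by simp
  ultimately show "ptnorm (hdom F) a x \<le> ptnorm (hcod F) (hmap F a) x" by simp
qed

section \<open>Closed ideals\<close>

definition closed_ideal :: "('x \<Rightarrow> complex) set \<Rightarrow> bool" where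
  "closed_ideal J \<longleftrightarrow> J \<subseteq> C0 X \<and> (\<lambda>x. 0) \<in> J \<and> (\<forall>f\<in>J. \<forall>g\<in>J. (\<lambda>x. f x + g x) \<in> J) \<and>
     (\<forall>c. \<forall>f\<in>J. (\<lambda>x. c * f x) \<in> J) \<and> (\<forall>g\<in>C0 X. \<forall>f\<in>J. (\<lambda>x. g x * f x) \<in> J) \<and>
     (\<forall>g\<in>C0 X. (\<forall>e>0. \<exists>f\<in>J. \<forall>x. cmod (g x - f x) \<le> e) \<longrightarrow> g \<in> J)"

lemma closed_idealD:
  assumes "closed_ideal J"
  shows "J \<subseteq> C0 X" "f \<in> J \<Longrightarrow> f \<in> C0 X" "(\<lambda>x. 0) \<in> J" "f \<in> J \<Longrightarrow> g \<in> J \<Longrightarrow> (\<lambda>x. f x + g x) \<in> J"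
    "f \<in> J \<Longrightarrow> (\<lambda>x. c * f x) \<in> J" "g \<in> C0 X \<Longrightarrow> f \<in> J \<Longrightarrow> (\<lambda>x. g x * f x) \<in> J"
    "g \<in> C0 X \<Longrightarrow> (\<And>e. e > 0 \<Longrightarrow> \<exists>f\<in>J. \<forall>x. cmod (g x - f x) \<le> e) \<Longrightarrow> g \<in> J"
  using assms unfolding closed_ideal_def by blast+

lemma soft_support_ideal:
  assumes J: "closed_ideal J" and v: "v \<in> J" "\<And>x. v x \<in> \<real>\<^sub>\<ge>\<^sub>0" and d: "d > 0"
  shows "soft_support d v \<in> J"
proof -
  \<comment> \<open>\<open>v / (v + d) = 1/d (v - v / (v + d) v)\<close>\<close>
  have s: "soft_support d v \<in> C0 X" using d closed_idealD(2)[OF J v(1)] by (rule soft_support_C0)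
  have "(\<lambda>x. (1 / of_real d) * (v x + (- 1) * (soft_support d v x * v x))) \<in> J"
    by (intro closed_idealD(4,5,6)[OF J] v s)
  moreover have "(1 / of_real d) * (v x + (- 1) * (soft_support d v x * v x)) = soft_support d v x" for x
  proof -
    obtain r where r: "v x = of_real r" "r \<ge> 0" using v(2)[of x] by (auto simp: nonneg_Reals_def)
    have "r + d \<noteq> 0" using r d by simp
    then have "(1 / d) * (r + (- 1) * (r / (r + d) * r)) = r / (r + d)" using d by (simp add: field_simps)
    from arg_cong[OF this, of complex_of_real] show ?thesis using r by (simp add: soft_support_def)
  qed
  ultimately show ?thesis by simp
qed

lemma square_nonneg: "cnj z * z \<in> \<real>\<^sub>\<ge>\<^sub>0"
proof -
  have "cnj z * z = of_real ((cmod z)^2)" by (subst mult.commute) (rule complex_norm_square[symmetric])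
  then show ?thesis by (simp del: of_real_power)
qed

lemma soft_support_mult:
  assumes "e > 0"
  shows "cmod (f x - f x * soft_support (e^2) (\<lambda>x. cnj (f x) * f x) x) \<le> e"
proof -
  let ?s = "soft_support (e^2) (\<lambda>x. cnj (f x) * f x) x"
  have "f x - f x * ?s = f x * (1 - ?s)" by (simp add: algebra_simps)
  then have "cmod (f x - f x * ?s) = cmod (f x) * cmod (1 - ?s)" by (simp only: norm_mult)
  then have "(cmod (f x - f x * ?s))^2 = (cmod (1 - ?s))^2 * cmod (cnj (f x) * f x)"
    by (simp add: norm_mult power2_eq_square)
  also have "\<dots> \<le> e^2" using assms by (intro soft_support_small) simp
  finally show ?thesis by (rule power2_le_imp_le) (use assms in simp)
qed

text \<open>With \<open>v = \<bar>f\<bar>\<^sup>2\<close>, the function \<open>f\<close> is the limit of \<open>f v / (v + d)\<close>.\<close>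

lemma ideal_square:
  assumes J: "closed_ideal J" and f: "f \<in> C0 X" and sq: "(\<lambda>x. cnj (f x) * f x) \<in> J"
  shows "f \<in> J"
proof (rule closed_idealD(7)[OF J f])
  fix e :: real assume e: "e > 0"
  have "soft_support (e^2) (\<lambda>x. cnj (f x) * f x) \<in> J"
    using e by (intro soft_support_ideal[OF J sq] square_nonneg) auto
  then have "(\<lambda>x. f x * soft_support (e^2) (\<lambda>x. cnj (f x) * f x) x) \<in> J" by (rule closed_idealD(6)[OF J f])
  then show "\<exists>g\<in>J. \<forall>x. cmod (f x - g x) \<le> e" using soft_support_mult[OF e, of f]
    by (intro bexI[of _ "\<lambda>x. f x * soft_support (e^2) (\<lambda>x. cnj (f x) * f x) x"]) auto
qed

definition ideal_of :: "('v, 'x) harr \<Rightarrow> ('x \<Rightarrow> complex) set" where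
  "ideal_of s = fun_of ` img s"

lemma ideal_of_iff:
  assumes "arr s" "hcod s = I"
  shows "f \<in> ideal_of s \<longleftrightarrow> Fun f \<in> img s"
proof -
  have "z \<in> Fun ` C0 X" if "z \<in> img s" for z
    using that assms hmap_closed[OF assms(1,2)] by (auto simp: img_def)
  then show ?thesis by (force simp: ideal_of_def)
qed

lemma closed_ideal_of:
  fixes s :: "('v, 'x) harr"
  assumes s: "isom s" and cod: "hcod s = I"
  shows "closed_ideal (ideal_of s)"
proof -
  note a = isom_arr[OF s] and iff = ideal_of_iff[OF isom_arr[OF s] cod]
  interpret S: separated_module X "hdom s" by (intro separated arr_obj a)
  note h = arr_hhom[OF a, unfolded cod]
  have C0: "f \<in> C0 X" if f: "f \<in> ideal_of s" for f
  proof -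
    obtain \<sigma> where "\<sigma> \<in> carrier (hdom s)" "Fun f = hmap s \<sigma>" using f unfolding iff by (auto simp: img_def)
    then have "Fun f \<in> carrier (I :: ('v, 'x) hobj)" using hmap_closed[OF a cod] by metis
    then show ?thesis by auto
  qed
  have im: "\<exists>\<sigma>\<in>carrier (hdom s). hmap s \<sigma> = Fun f" if "f \<in> ideal_of s" for f
    using that unfolding iff by (auto simp: img_def)
  have memI: "f \<in> ideal_of s" if "\<sigma> \<in> carrier (hdom s)" "hmap s \<sigma> = Fun f" for f \<sigma>
    using that unfolding iff img_def by (metis imageI)
  show ?thesis
    unfolding closed_ideal_def
  proof (intro conjI ballI allI impI)
    show "ideal_of s \<subseteq> C0 X" using C0 by blast
    show "(\<lambda>x. 0) \<in> ideal_of s"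
      using hhom_zero[OF arr_obj(1)[OF a] hilbert_unit_obj h] by (intro memI[OF S.zero_closed]) simp
    fix f assume f: "f \<in> ideal_of s"
    obtain \<sigma> where \<sigma>: "\<sigma> \<in> carrier (hdom s)" "hmap s \<sigma> = Fun f" using im[OF f] by blast
    show "(\<lambda>x. c * f x) \<in> ideal_of s" for c
      by (rule memI[of "hscale (hdom s) c \<sigma>"]) (simp_all add: S.closed \<sigma> hhomD(5)[OF h])
    show "(\<lambda>x. g x * f x) \<in> ideal_of s" if "g \<in> C0 X" for g
      by (rule memI[of "hact (hdom s) g \<sigma>"]) (simp_all add: S.closed \<sigma> hhomD(6)[OF h] that)
    fix g assume g: "g \<in> ideal_of s"
    obtain \<tau> where \<tau>: "\<tau> \<in> carrier (hdom s)" "hmap s \<tau> = Fun g" using im[OF g] by blast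
    show "(\<lambda>x. f x + g x) \<in> ideal_of s"
      by (rule memI[of "hadd (hdom s) \<sigma> \<tau>"]) (simp_all add: S.closed \<sigma> \<tau> hhomD(4)[OF h])
  next
    fix g assume g: "g \<in> C0 X" "\<forall>e>0. \<exists>f\<in>ideal_of s. \<forall>x. cmod (g x - f x) \<le> e"
    show "g \<in> ideal_of s"
      unfolding iff
    proof (rule img_closed[OF s])
      show "Fun g \<in> carrier (hcod s)" using g(1) cod by simp
      show "\<exists>c\<in>img s. near (hcod s) e (Fun g) c" if e: "e > 0" for e
      proof -
        obtain f where "f \<in> ideal_of s" "\<forall>x. cmod (g x - f x) \<le> e" using g(2) e by blast
        then show ?thesis unfolding iff by (intro bexI[of _ "Fun f"]) (auto simp: cod near_unit)
      qed
    qed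
  qed
qed

definition ideal_module :: "('x \<Rightarrow> complex) set \<Rightarrow> ('v, 'x) hobj" where
  "ideal_module J = (tensor_unit X)\<lparr>carrier := Fun ` J\<rparr>"

definition ideal_incl :: "('x \<Rightarrow> complex) set \<Rightarrow> ('v, 'x) harr" where
  "ideal_incl J = \<lparr>hdom = ideal_module J, hcod = tensor_unit X, hmap = restrict (\<lambda>a. a) (Fun ` J)\<rparr>"

lemma ideal_incl:
  assumes J: "closed_ideal J"
  shows "isom (ideal_incl J :: ('v, 'x) harr)" "hcod (ideal_incl J :: ('v, 'x) harr) = I"
    "ideal_of (ideal_incl J :: ('v, 'x) harr) = J"
proof -
  let ?M = "ideal_module J :: ('v, 'x) hobj"
  have M: "hil ?M"
    unfolding ideal_module_def
  proof (rule hilbert_submodule[OF hilbert_unit_obj])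
    show "Fun ` J \<subseteq> carrier (I :: ('v, 'x) hobj)" using closed_idealD(2)[OF J] by auto
    fix a :: "('v, 'x) elt" assume "a \<in> carrier I" and lim: "\<And>e. e > 0 \<Longrightarrow> \<exists>b\<in>Fun ` J. near I e b a"
    then obtain g where g: "g \<in> C0 X" "a = Fun g" by auto
    have "g \<in> J"
    proof (rule closed_idealD(7)[OF J g(1)])
      fix e :: real assume "e > 0"
      from lim[OF this] show "\<exists>f\<in>J. \<forall>x. cmod (g x - f x) \<le> e"
        by (auto simp: near_unit g(2) norm_minus_commute)
    qed
    then show "a \<in> Fun ` J" using g by simp
  qed (auto simp: closed_idealD[OF J])
  have fields: "carrier ?M = Fun ` J" "hadd ?M = hadd I" "hscale ?M = hscale I" "hact ?M = hact I" "hinner ?M = hinner I"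
    by (simp_all add: ideal_module_def)
  have h: "(ideal_incl J :: ('v, 'x) harr) \<in> hhom X ?M I"
    unfolding ideal_incl_def
    using hhomI[OF M hilbert_unit_obj, of "\<lambda>a. a"] closed_idealD(2)[OF J] by (auto simp: fields ptnorm_def)
  have a: "arr (ideal_incl J :: ('v, 'x) harr)" "hdom (ideal_incl J :: ('v, 'x) harr) = ?M" "hcod (ideal_incl J :: ('v, 'x) harr) = I"
    using arrI[OF h M hilbert_unit_obj] by auto
  show "hcod (ideal_incl J :: ('v, 'x) harr) = I" by (rule a)
  show "isom (ideal_incl J :: ('v, 'x) harr)"
    using a unfolding isom_def by (auto simp: fields ideal_incl_def ptnorm_def)
  show "ideal_of (ideal_incl J :: ('v, 'x) harr) = J"
    by (auto simp: ideal_of_def img_def a fields) (auto simp: ideal_incl_def image_def)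
qed

section \<open>Restriction to subunits\<close>

lemma restr_arr:
  assumes s: "arr s" "hcod s = I" and A: "hil A"
  shows "arr (restr C s A)" "hdom (restr C s A) = hdom s \<otimes>\<^sub>h A" "hcod (restr C s A) = A"
    and "\<lbrakk>\<sigma> \<in> carrier (hdom s); a \<in> carrier A\<rbrakk>
      \<Longrightarrow> hmap (restr C s A) (pure (hdom s) A \<sigma> a) = hact A (fun_of (hmap s \<sigma>)) a"
proof -
  show "arr (restr C s A)" "hdom (restr C s A) = hdom s \<otimes>\<^sub>h A" "hcod (restr C s A) = A"
    using assms by (simp_all add: restr_def arr_simps)
  show "\<lbrakk>\<sigma> \<in> carrier (hdom s); a \<in> carrier A\<rbrakk>
      \<Longrightarrow> hmap (restr C s A) (pure (hdom s) A \<sigma> a) = hact A (fun_of (hmap s \<sigma>)) a"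
    using assms hmap_closed[OF s, of \<sigma>] by (simp add: restr_def arr_simps del: unit_simps)
qed

lemma unit_mem: "z \<in> carrier I \<Longrightarrow> fun_of z \<in> C0 X" by auto

lemma restr_isom:
  assumes s: "isom s" "hcod s = I" and A: "hil A"
  shows "isom (restr C s A)"
proof -
  note a = isom_arr[OF s(1)]
  note r = restr_arr[OF a s(2) A]
  interpret P: tensor_pair X "hdom s" A by (rule tensor_pairI[OF arr_obj(1)[OF a] A])
  show ?thesis
  proof (rule isom_on_generators[OF r(1)])
    show "generates (hdom (restr C s A)) {pure (hdom s) A \<sigma> a | \<sigma> a. \<sigma> \<in> carrier (hdom s) \<and> a \<in> carrier A}"
      unfolding r(2) by (rule pures_generate[OF arr_obj(1)[OF a] A])
    fix z w x
    assume "z \<in> {pure (hdom s) A \<sigma> a | \<sigma> a. \<sigma> \<in> carrier (hdom s) \<and> a \<in> carrier A}"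
      and "w \<in> {pure (hdom s) A \<sigma> a | \<sigma> a. \<sigma> \<in> carrier (hdom s) \<and> a \<in> carrier A}"
    then obtain \<sigma> b \<tau> c where zw: "z = pure (hdom s) A \<sigma> b" "w = pure (hdom s) A \<tau> c"
      and car: "\<sigma> \<in> carrier (hdom s)" "b \<in> carrier A" "\<tau> \<in> carrier (hdom s)" "c \<in> carrier A" by blast
    have C0: "fun_of (hmap s \<sigma>) \<in> C0 X" "fun_of (hmap s \<tau>) \<in> C0 X"
      using hmap_closed[OF a s(2)] car by (auto intro!: unit_mem simp del: unit_simps)
    have "hinner A (hmap (restr C s A) z) (hmap (restr C s A) w) x
        = hinner I (hmap s \<sigma>) (hmap s \<tau>) x * hinner A b c x"
      using car C0 by (simp add: zw r(4) P.B.ip_simps)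
    also have "\<dots> = hinner (hdom s \<otimes>\<^sub>h A) z w x"
      using car isom_ip[OF s(1) car(1,3), of x] by (simp add: zw P.hinner_pure s(2))
    finally show "hinner (hcod (restr C s A)) (hmap (restr C s A) z) (hmap (restr C s A) w) x
        = hinner (hdom (restr C s A)) z w x" by (simp only: r(2,3))
  qed
qed

text \<open>The inner product of any \<open>b\<close> with an element of the image lies in the ideal, which is clear for pure
  tensors and passes to sums and limits. Conversely, if \<open>v = \<langle>a, a\<rangle>\<close> is in the ideal, then so is \<open>v / (v + d)\<close>, and
  \<open>a\<close> is the limit of the elements \<open>v / (v + d) a\<close> of the closed image.\<close>

theorem img_restr:
  assumes s: "isom s" "hcod s = I" and A: "hil A"
  shows "img (restr C s A) = {a \<in> carrier A. hinner A a a \<in> ideal_of s}"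
proof
  note a = isom_arr[OF s(1)]
  note r = restr_arr[OF a s(2) A]
  note J = closed_ideal_of[OF s]
  interpret P: tensor_pair X "hdom s" A by (rule tensor_pairI[OF arr_obj(1)[OF a] A])
  have rin: "hmap (restr C s A) z \<in> carrier A" if "z \<in> carrier (hdom s \<otimes>\<^sub>h A)" for z
    using that r by (intro hmap_closed) auto
  note h = arr_hhom[OF r(1), unfolded r(2,3)]
  have mem: "fun_of (hmap s \<sigma>) \<in> ideal_of s" if "\<sigma> \<in> carrier (hdom s)" for \<sigma>
    using that by (auto simp: ideal_of_def img_def)
  have "\<forall>b\<in>carrier A. hinner A b (hmap (restr C s A) z) \<in> ideal_of s" if "z \<in> carrier (hdom s \<otimes>\<^sub>h A)" for z
    using that
  proof (induction rule: P.tensor_induct)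
    case (pure \<sigma> c)
    show ?case
    proof
      fix b assume b: "b \<in> carrier A"
      have "hinner A b (hmap (restr C s A) (pure (hdom s) A \<sigma> c)) = (\<lambda>x. hinner A b c x * fun_of (hmap s \<sigma>) x)"
        using pure b closed_idealD(2)[OF J mem] by (auto simp: r(4) P.B.ip_simps)
      then show "hinner A b (hmap (restr C s A) (pure (hdom s) A \<sigma> c)) \<in> ideal_of s"
        using closed_idealD(6)[OF J P.B.ip_C0[OF b pure(2)] mem[OF pure(1)]] by simp
    qed
  next
    case zero
    then show ?case
    proof (intro ballI)
      fix b assume "b \<in> carrier A"
      then have "hinner A b (hmap (restr C s A) (hzero (hdom s \<otimes>\<^sub>h A))) = (\<lambda>x. 0)"
        by (auto simp: hhom_zero[OF P.hilbert_tensor A h] P.B.ip_simps)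
      then show "hinner A b (hmap (restr C s A) (hzero (hdom s \<otimes>\<^sub>h A))) \<in> ideal_of s"
        using closed_idealD(3)[OF J] by simp
    qed
  next
    case (add z w)
    show ?case
    proof
      fix b assume b: "b \<in> carrier A"
      have "hinner A b (hmap (restr C s A) (hadd (hdom s \<otimes>\<^sub>h A) z w))
          = (\<lambda>x. hinner A b (hmap (restr C s A) z) x + hinner A b (hmap (restr C s A) w) x)"
        using add(1,2) b rin by (auto simp: hhomD(4)[OF h] P.B.ip_simps)
      then show "hinner A b (hmap (restr C s A) (hadd (hdom s \<otimes>\<^sub>h A) z w)) \<in> ideal_of s"
        using closed_idealD(4)[OF J] add(3,4) b by simp
    qed
  next
    case (limit z)
    show ?case
    proof
      fix b assume b: "b \<in> carrier A"
      obtain K where K: "K \<ge> 0" "\<And>x. ptnorm A b x \<le> K" using P.B.bounded_ptnorm[OF b] by blast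
      show "hinner A b (hmap (restr C s A) z) \<in> ideal_of s"
      proof (rule closed_idealD(7)[OF J P.B.ip_C0[OF b rin[OF limit(1)]]])
        fix e :: real assume e: "e > 0"
        then have "e / (K + 1) > 0" using K by simp
        from limit(2)[OF this] obtain w where w: "w \<in> carrier (hdom s \<otimes>\<^sub>h A)"
            "\<forall>b\<in>carrier A. hinner A b (hmap (restr C s A) w) \<in> ideal_of s"
            "near (hdom s \<otimes>\<^sub>h A) (e / (K + 1)) z w" by blast
        have "cmod (hinner A b (hmap (restr C s A) z) x - hinner A b (hmap (restr C s A) w) x) \<le> e" for x
        proof -
          have "cmod (hinner A b (hmap (restr C s A) z) x - hinner A b (hmap (restr C s A) w) x)
              \<le> ptnorm A b x * (e / (K + 1))"
            using limit(1) w b rin by (intro P.B.near_ip hhom_near[OF P.hilbert_tensor A h]) auto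
          also have "\<dots> \<le> (K + 1) * (e / (K + 1))"
            using K(1) K(2)[of x] e by (intro mult_right_mono) auto
          also have "\<dots> = e" using K(1) by simp
          finally show ?thesis .
        qed
        then show "\<exists>f\<in>ideal_of s. \<forall>x. cmod (hinner A b (hmap (restr C s A) z) x - f x) \<le> e" using w b by blast
      qed
    qed
  qed
  then show "img (restr C s A) \<subseteq> {a \<in> carrier A. hinner A a a \<in> ideal_of s}"
    using rin by (auto simp: img_def r(2))
  show "{a \<in> carrier A. hinner A a a \<in> ideal_of s} \<subseteq> img (restr C s A)"
  proof
    fix c assume "c \<in> {a \<in> carrier A. hinner A a a \<in> ideal_of s}"
    then have c: "c \<in> carrier A" "hinner A c c \<in> ideal_of s" by auto
    show "c \<in> img (restr C s A)"
    proof (rule img_closed[OF restr_isom[OF s A]])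
      show "c \<in> carrier (hcod (restr C s A))" using c r(3) by simp
      fix e :: real assume e: "e > 0"
      have "soft_support (e^2) (hinner A c c) \<in> ideal_of s"
        using e c by (intro soft_support_ideal[OF J] P.B.ip_nonneg) auto
      then obtain \<sigma> where \<sigma>: "\<sigma> \<in> carrier (hdom s)" "soft_support (e^2) (hinner A c c) = fun_of (hmap s \<sigma>)"
        by (auto simp: ideal_of_def img_def)
      have "hact A (soft_support (e^2) (hinner A c c)) c = hmap (restr C s A) (pure (hdom s) A \<sigma> c)"
        using \<sigma> c by (simp add: r(4))
      moreover have "pure (hdom s) A \<sigma> c \<in> carrier (hdom (restr C s A))"
        using \<sigma> c by (simp add: r(2) P.pure_closed)
      ultimately have "hact A (soft_support (e^2) (hinner A c c)) c \<in> img (restr C s A)"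
        by (auto simp: img_def)
      then show "\<exists>d\<in>img (restr C s A). near (hcod (restr C s A)) e c d"
        using soft_support_act[OF P.B.premodule_axioms c(1) e] r(3) by auto
    qed
  qed
qed

text \<open>If \<open>s \<otimes> S\<close> is an isomorphism, it preserves the norm of \<open>a \<otimes> a\<close>; so \<open>\<bar>s(a)\<bar> \<bar>a\<bar> = \<bar>a\<bar>\<^sup>2\<close> and \<open>s\<close> is isometric
  where \<open>\<bar>a\<bar> \<noteq> 0\<close>, and elsewhere by contractivity. Conversely, if \<open>s\<close> is isometric then
  \<open>\<langle>a, a\<rangle> = s(a)\<^sup>* s(a)\<close> is in the ideal of \<open>s\<close> for all \<open>a\<close>, so the image of \<open>S \<otimes> S\<close> in \<open>S\<close> is everything.\<close>

theorem subunit_iff: "subunit C s \<longleftrightarrow> isom s \<and> hcod s = I"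
proof
  assume s: "isom s \<and> hcod s = I"
  note a = isom_arr[of s] 
  have ar: "arr s" using s a by blast
  let ?S = "hdom s" and ?T = "TenA C s (Id C (hdom s))"
  have S: "hil ?S" using ar by (rule arr_obj)
  have T: "arr ?T" "hdom ?T = ?S \<otimes>\<^sub>h ?S" "hcod ?T = I \<otimes>\<^sub>h ?S" using ar S s by (simp_all add: arr_simps)
  have comp: "restr C s ?S = LUnit C ?S \<circ>\<^sub>h ?T" using ar by (simp add: restr_def)
  have L: "arr (LUnit C ?S)" "hdom (LUnit C ?S) = I \<otimes>\<^sub>h ?S" "hcod (LUnit C ?S) = ?S" "isom (LUnit C ?S)"
    using LUnit[OF S] iso_isom(1) by auto
  have "isom (restr C s ?S)" using s S by (intro restr_isom) auto
  then have isoT: "isom ?T" unfolding comp by (rule isom_cancel) (use T L in auto)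
  interpret SS: separated_module X ?S by (intro separated S)
  have all: "img (restr C s ?S) = carrier ?S"
  proof -
    have "hinner ?S a a \<in> ideal_of s" if a: "a \<in> carrier ?S" for a
    proof -
      have "hmap s a \<in> carrier I" using ar s a by (intro hmap_closed) auto
      then have C0: "fun_of (hmap s a) \<in> C0 X" by (rule unit_mem)
      have "hinner ?S a a = (\<lambda>x. cnj (fun_of (hmap s a) x) * fun_of (hmap s a) x)"
        using isom_ip[of s a a] s a by (auto simp: fun_eq_iff)
      moreover have "fun_of (hmap s a) \<in> ideal_of s" using a by (auto simp: ideal_of_def img_def)
      ultimately show ?thesis
        using closed_idealD(6)[OF closed_ideal_of C0_cnj[OF C0]] s by auto
    qed
    then show ?thesis using img_restr[of s ?S] s S by auto
  qed
  have "img ?T = carrier (hcod ?T)"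
  proof
    show "img ?T \<subseteq> carrier (hcod ?T)" using T by (auto simp: img_def intro: hmap_closed)
    show "carrier (hcod ?T) \<subseteq> img ?T"
    proof
      fix w assume w: "w \<in> carrier (hcod ?T)"
      then have "hmap (LUnit C ?S) w \<in> carrier ?S" using L T by (intro hmap_closed) auto
      then obtain z where z: "z \<in> carrier (hdom ?T)" "hmap (LUnit C ?S) w = hmap (LUnit C ?S \<circ>\<^sub>h ?T) z"
        unfolding all[symmetric] comp by (auto simp: img_def Comp_arr)
      have "w = hmap ?T z"
        by (rule isom_inj[OF L(4)]) (use z w T L hmap_closed[OF T(1) refl z(1)] in \<open>auto simp: Comp_arr\<close>)
      then show "w \<in> img ?T" using z(1) by (auto simp: img_def)
    qed
  qed
  then have "is_iso C ?T" by (rule isom_iso[OF isoT])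
  then show "subunit C s" using s isom_mono[of s] by (simp add: subunit_def)
next
  assume s: "subunit C s"
  let ?S = "hdom s" and ?T = "TenA C s (Id C (hdom s))"
  have ar: "arr s" and cod: "hcod s = I" and iso: "is_iso C ?T"
    using s by (auto simp: subunit_def is_mono_def)
  have S: "hil ?S" using ar by (rule arr_obj)
  have T: "arr ?T" "hdom ?T = ?S \<otimes>\<^sub>h ?S" "hcod ?T = I \<otimes>\<^sub>h ?S" using ar S cod by (simp_all add: arr_simps)
  interpret P: tensor_pair X ?S ?S by (rule tensor_pairI[OF S S])
  interpret Q: tensor_pair X I ?S by (rule tensor_pairI[OF hilbert_unit_obj S])
  have "ptnorm (hcod s) (hmap s a) x = ptnorm ?S a x" if a: "a \<in> carrier ?S" for a x
  proof -
    have sa: "hmap s a \<in> carrier I" using ar cod a by (intro hmap_closed) auto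
    have "hmap ?T (pure ?S ?S a a) = pure I ?S (hmap s a) a"
      using ar S cod a by (simp add: arr_simps)
    then have "ptnorm I (hmap s a) x * ptnorm ?S a x = ptnorm ?S a x * ptnorm ?S a x"
      using isom_ptnorm[OF iso_isom(1)[OF iso], of "pure ?S ?S a a" x] T a sa
      by (simp add: P.pure_closed P.ptnorm_pure Q.ptnorm_pure del: unit_simps)
    moreover have "ptnorm I (hmap s a) x \<le> ptnorm ?S a x"
      using arr_ptnorm_le[OF ar a, of x] cod by simp
    moreover have "0 \<le> ptnorm I (hmap s a) x" using sa by (rule Q.A.ptnorm_nonneg)
    ultimately show ?thesis using cod by auto
  qed
  then show "isom s \<and> hcod s = I" using ar cod by (simp add: isom_def)
qed

lemma restr_nat:
  assumes s: "arr s" "hcod s = I" and F: "arr F"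
  shows "restr C s (hcod F) \<circ>\<^sub>h TenA C (Id C (hdom s)) F = F \<circ>\<^sub>h restr C s (hdom F)"
proof (rule arr_eqI2[where A = "hdom s" and B = "hdom F"])
  note ob = arr_obj[OF F] arr_obj(1)[OF s(1)]
  show "arr (restr C s (hcod F) \<circ>\<^sub>h TenA C (Id C (hdom s)) F)" "arr (F \<circ>\<^sub>h restr C s (hdom F))"
    "hdom (restr C s (hcod F) \<circ>\<^sub>h TenA C (Id C (hdom s)) F) = hdom s \<otimes>\<^sub>h hdom F"
    "hdom (F \<circ>\<^sub>h restr C s (hdom F)) = hdom s \<otimes>\<^sub>h hdom F"
    "hcod (restr C s (hcod F) \<circ>\<^sub>h TenA C (Id C (hdom s)) F) = hcod (F \<circ>\<^sub>h restr C s (hdom F))"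
    using s F ob by (simp_all add: restr_arr arr_simps)
  fix \<sigma> a assume a: "\<sigma> \<in> carrier (hdom s)" "a \<in> carrier (hdom F)"
  have "fun_of (hmap s \<sigma>) \<in> C0 X" using hmap_closed[OF s a(1)] by (rule unit_mem)
  then show "hmap (restr C s (hcod F) \<circ>\<^sub>h TenA C (Id C (hdom s)) F) (pure (hdom s) (hdom F) \<sigma> a)
      = hmap (F \<circ>\<^sub>h restr C s (hdom F)) (pure (hdom s) (hdom F) \<sigma> a)"
    using s F ob a by (simp add: restr_arr arr_simps)
qed (use F s in \<open>auto intro: arr_obj\<close>)

lemma restr_comp:
  assumes t: "arr t" "hcod t = I" and m: "arr m" "hcod m = hdom t" and A: "hil A"
  shows "restr C t A \<circ>\<^sub>h TenA C m (Id C A) = restr C (t \<circ>\<^sub>h m) A"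
proof (rule arr_eqI2[where A = "hdom m" and B = A])
  have tm: "arr (t \<circ>\<^sub>h m)" "hcod (t \<circ>\<^sub>h m) = I" "hdom (t \<circ>\<^sub>h m) = hdom m" using assms by (simp_all add: arr_simps)
  note ob = arr_obj(1)[OF m(1)]
  note r = restr_arr[OF tm(1,2) A, unfolded tm(3)] restr_arr[OF t A]
  show "arr (restr C t A \<circ>\<^sub>h TenA C m (Id C A))" "arr (restr C (t \<circ>\<^sub>h m) A)"
    "hdom (restr C t A \<circ>\<^sub>h TenA C m (Id C A)) = hdom m \<otimes>\<^sub>h A"
    "hdom (restr C (t \<circ>\<^sub>h m) A) = hdom m \<otimes>\<^sub>h A"
    "hcod (restr C t A \<circ>\<^sub>h TenA C m (Id C A)) = hcod (restr C (t \<circ>\<^sub>h m) A)"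
    using assms ob by (simp_all add: r arr_simps)
  fix \<sigma> a assume a: "\<sigma> \<in> carrier (hdom m)" "a \<in> carrier A"
  have "hmap m \<sigma> \<in> carrier (hdom t)" using m a by (intro hmap_closed) auto
  then show "hmap (restr C t A \<circ>\<^sub>h TenA C m (Id C A)) (pure (hdom m) A \<sigma> a) = hmap (restr C (t \<circ>\<^sub>h m) A) (pure (hdom m) A \<sigma> a)"
    using assms ob a by (simp add: r arr_simps)
qed (use m A in \<open>auto intro: arr_obj\<close>)

text \<open>Let \<open>u : Z \<rightarrow> T \<otimes> A\<close> and \<open>v : Z \<rightarrow> S \<otimes> A\<close> agree in \<open>A\<close>. As all maps of the square are isometric, \<open>\<langle>u z, u z\<rangle>\<close> is the inner product
  of the common image with itself. It belongs to the ideal of \<open>s\<close>, hence \<open>u z\<close> is in the image of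
  \<open>S \<otimes> T \<otimes> A\<close>, and \<open>u\<close> factors through the isometry on top.\<close>

theorem stiff_Hilb: "stiff (C :: (('v, 'x) hobj, ('v, 'x) harr) braided_cat)"
  unfolding stiff_def Let_def
proof (intro ballI allI impI)
  fix A :: "('v, 'x) hobj" and s t :: "('v, 'x) harr"
  assume "A \<in> Obj C" "subunit C s" "subunit C t"
  then have A: "hil A" and s: "isom s" "hcod s = I" and t: "isom t" "hcod t = I" by (auto simp: subunit_iff)
  note as = isom_arr[OF s(1)] and at = isom_arr[OF t(1)]
  have TA: "hil (hdom t \<otimes>\<^sub>h A)" by (intro tensor_obj arr_obj at A)
  let ?p = "restr C s (hdom t \<otimes>\<^sub>h A)" and ?q = "TenA C (Id C (hdom s)) (restr C t A)"
  let ?f = "restr C t A" and ?g = "restr C s A"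
  note p = restr_arr(1-3)[OF as s(2) TA] and f = restr_arr(1-3)[OF at t(2) A] and g = restr_arr(1-3)[OF as s(2) A]
  have q: "arr ?q" "hdom ?q = hdom s \<otimes>\<^sub>h (hdom t \<otimes>\<^sub>h A)" "hcod ?q = hdom s \<otimes>\<^sub>h A"
    using f as arr_obj(1)[OF as] by (simp_all add: arr_simps)
  note isom = restr_isom[OF s TA] restr_isom[OF t A] restr_isom[OF s A]
  have comm: "?g \<circ>\<^sub>h ?q = ?f \<circ>\<^sub>h ?p" using restr_nat[OF as s(2) f(1)] by (simp add: f)
  have "isom (?f \<circ>\<^sub>h ?p)" by (rule isom_comp[OF isom(1,2)]) (simp add: p f)
  then have isoq: "isom ?q" unfolding comm[symmetric] by (rule isom_cancel) (use q g in auto)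
  have "is_pullback C ?p ?q ?f ?g"
    unfolding is_pullback_def
  proof (intro conjI ballI impI)
    show "?p \<in> homs C (Dom C ?q) (Dom C ?f)" "?q \<in> homs C (Dom C ?p) (Dom C ?g)"
      "?f \<in> homs C (Cod C ?p) (Cod C ?g)" "?g \<in> homs C (Cod C ?q) (Cod C ?f)"
      using p q f g by (simp_all add: homs_arr)
    show "?f \<circ>\<^sub>h ?p = ?g \<circ>\<^sub>h ?q" using comm by simp
    fix Z u v assume "u \<in> homs C Z (Dom C ?f)" "v \<in> homs C Z (Dom C ?g)" and eq: "?f \<circ>\<^sub>h u = ?g \<circ>\<^sub>h v"
    then have u: "arr u" "hdom u = Z" "hcod u = hdom t \<otimes>\<^sub>h A" and v: "arr v" "hdom v = Z" "hcod v = hdom s \<otimes>\<^sub>h A"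
      by (auto simp: homs_arr f g)
    have "img u \<subseteq> img ?p"
    proof
      fix w assume "w \<in> img u"
      then obtain z where z: "z \<in> carrier Z" "w = hmap u z" by (auto simp: img_def u)
      have w: "w \<in> carrier (hdom t \<otimes>\<^sub>h A)" using u z by (auto intro: hmap_closed)
      have vz: "hmap v z \<in> carrier (hdom s \<otimes>\<^sub>h A)" using v z by (auto intro: hmap_closed)
      have "hmap (?f \<circ>\<^sub>h u) z = hmap (?g \<circ>\<^sub>h v) z" by (simp add: eq)
      then have fg: "hmap ?f w = hmap ?g (hmap v z)" using z u v by (simp add: Comp_arr)
      have "hmap ?g (hmap v z) \<in> img ?g" using vz g by (auto simp: img_def)
      then have "hinner A (hmap ?f w) (hmap ?f w) \<in> ideal_of s" unfolding fg img_restr[OF s A] by blast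
      moreover have "hinner A (hmap ?f w) (hmap ?f w) = hinner (hdom t \<otimes>\<^sub>h A) w w"
        using isom_ip[OF isom(2), of w w] w by (auto simp: f)
      ultimately show "w \<in> img ?p" unfolding img_restr[OF s TA] using w by simp
    qed
    then obtain h where h: "arr h" "hdom h = Z" "hcod h = hdom ?p" "?p \<circ>\<^sub>h h = u"
      using factor_isom[OF isom(1) u(1)] u p by metis
    have "?g \<circ>\<^sub>h (?q \<circ>\<^sub>h h) = (?g \<circ>\<^sub>h ?q) \<circ>\<^sub>h h"
      using category.comp_assoc[OF category_Hilb, of h Z "hdom ?q" ?q "hdom ?g" ?g A] h p q g
      by (simp add: homs_arr)
    also have "\<dots> = ?f \<circ>\<^sub>h (?p \<circ>\<^sub>h h)"
      unfolding comm using category.comp_assoc[OF category_Hilb, of h Z "hdom ?p" ?p "hdom ?f" ?f A] h p f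
      by (simp add: homs_arr)
    also have "\<dots> = ?g \<circ>\<^sub>h v" by (simp add: h eq)
    finally have gq: "?g \<circ>\<^sub>h (?q \<circ>\<^sub>h h) = ?g \<circ>\<^sub>h v" .
    have Z: "Z \<in> Obj C" using u arr_obj by auto
    have qh: "?q \<circ>\<^sub>h h = v"
    proof -
      have "?q \<circ>\<^sub>h h \<in> homs C Z (Dom C ?g)" "v \<in> homs C Z (Dom C ?g)"
        using h q v g p by (simp_all add: homs_arr Comp_arr)
      then show ?thesis using isom_mono[OF isom(3)] gq Z unfolding is_mono_def by blast
    qed
    show "\<exists>!h. h \<in> homs C Z (Dom C ?p) \<and> ?p \<circ>\<^sub>h h = u \<and> ?q \<circ>\<^sub>h h = v"
    proof (rule ex1I[of _ h])
      show "h \<in> homs C Z (Dom C ?p) \<and> ?p \<circ>\<^sub>h h = u \<and> ?q \<circ>\<^sub>h h = v" using h qh by (simp add: homs_arr)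
      fix k assume k: "k \<in> homs C Z (Dom C ?p) \<and> ?p \<circ>\<^sub>h k = u \<and> ?q \<circ>\<^sub>h k = v"
      then have "?p \<circ>\<^sub>h k = ?p \<circ>\<^sub>h h" "h \<in> homs C Z (Dom C ?p)" using h by (simp_all add: homs_arr)
      then show "k = h" using isom_mono[OF isom(1)] k Z unfolding is_mono_def by blast
    qed
  qed
  then show "is_mono C (restr C s (TenO C (Dom C t) A)) \<and> is_mono C (TenA C (Id C (Dom C s)) ?f) \<and>
      is_mono C ?f \<and> is_mono C ?g \<and>
      is_pullback C (restr C s (TenO C (Dom C t) A)) (TenA C (Id C (Dom C s)) ?f) ?f ?g"
    using isom isoq by (simp add: isom_mono)
qed

section \<open>The frame of subunits is the frame of closed ideals\<close>

lemma img_ideal: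
  assumes "arr s" "hcod s = I"
  shows "img s = Fun ` ideal_of s"
proof -
  have "z \<in> Fun ` C0 X" if "z \<in> img s" for z
    using that assms hmap_closed[OF assms(1,2)] by (auto simp: img_def)
  then show ?thesis by (force simp: ideal_of_def)
qed

lemma sub_le_iff:
  assumes s: "arr s" "hcod s = I" and t: "isom t" "hcod t = I"
  shows "sub_le C s t \<longleftrightarrow> ideal_of s \<subseteq> ideal_of t"
proof
  assume "sub_le C s t"
  then obtain m where m: "arr m" "hdom m = hdom s" "hcod m = hdom t" "t \<circ>\<^sub>h m = s"
    by (auto simp: sub_le_def homs_arr)
  have "img s \<subseteq> img t"
  proof
    fix z assume "z \<in> img s"
    then obtain a where a: "a \<in> carrier (hdom m)" "z = hmap (t \<circ>\<^sub>h m) a" using m by (auto simp: img_def)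
    then show "z \<in> img t" using hmap_closed[OF m(1,3) a(1)] by (simp add: Comp_arr img_def)
  qed
  then show "ideal_of s \<subseteq> ideal_of t" by (auto simp: ideal_of_def)
next
  assume "ideal_of s \<subseteq> ideal_of t"
  then have "img s \<subseteq> img t" using s t by (auto simp: img_ideal isom_arr)
  then obtain m where "arr m" "hdom m = hdom s" "hcod m = hdom t" "t \<circ>\<^sub>h m = s"
    using factor_isom[OF t(1) s(1)] s t by metis
  then show "sub_le C s t" by (auto simp: sub_le_def homs_arr)
qed

text \<open>Monomorphisms that factor through each other differ by mutually inverse contractions, so a monomorphism
  equivalent to an isometry is an isometry.\<close>

lemma subobject_mem:
  assumes s: "isom s" "hcod s = I"
  shows "t \<in> subobject C s \<longleftrightarrow> isom t \<and> hcod t = I \<and> ideal_of t = ideal_of s"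
proof
  assume t: "isom t \<and> hcod t = I \<and> ideal_of t = ideal_of s"
  then show "t \<in> subobject C s"
    using s sub_le_iff[of s t] sub_le_iff[of t s] by (auto simp: subobject_def isom_mono isom_arr)
next
  assume "t \<in> subobject C s"
  then have mono: "is_mono C t" and cod: "hcod t = I" and st: "sub_le C s t" and ts: "sub_le C t s"
    using s by (auto simp: subobject_def)
  have at: "arr t" using mono by (simp add: is_mono_def)
  obtain m where m: "arr m" "hdom m = hdom s" "hcod m = hdom t" "t \<circ>\<^sub>h m = s"
    using st by (auto simp: sub_le_def homs_arr)
  obtain n where n: "arr n" "hdom n = hdom t" "hcod n = hdom s" "s \<circ>\<^sub>h n = t"
    using ts by (auto simp: sub_le_def homs_arr)
  have mn: "arr (m \<circ>\<^sub>h n)" "hdom (m \<circ>\<^sub>h n) = hdom t" "hcod (m \<circ>\<^sub>h n) = hdom t" using m n by (simp_all add: Comp_arr)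
  have "t \<circ>\<^sub>h (m \<circ>\<^sub>h n) = (t \<circ>\<^sub>h m) \<circ>\<^sub>h n"
    using category.comp_assoc[OF category_Hilb, of n "hdom t" "hdom s" m "hdom t" t I] m n at cod
    by (simp add: homs_arr)
  also have "\<dots> = t \<circ>\<^sub>h Id C (hdom t)"
    using m n category.id_right[OF category_Hilb, of t "hdom t" I] at cod by (simp add: homs_arr)
  finally have "t \<circ>\<^sub>h (m \<circ>\<^sub>h n) = t \<circ>\<^sub>h Id C (hdom t)" .
  moreover have "m \<circ>\<^sub>h n \<in> homs C (hdom t) (Dom C t)" "Id C (hdom t) \<in> homs C (hdom t) (Dom C t)"
    using mn at by (simp_all add: homs_arr Id_arr arr_obj)
  ultimately have id: "m \<circ>\<^sub>h n = Id C (hdom t)"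
    using mono arr_obj(1)[OF at] unfolding is_mono_def by (metis Hilb_simps(1))
  have "ptnorm (hcod t) (hmap t a) x = ptnorm (hdom t) a x" if a: "a \<in> carrier (hdom t)" for a x
  proof (rule antisym[OF arr_ptnorm_le[OF at a]])
    have na: "hmap n a \<in> carrier (hdom s)" using n a by (intro hmap_closed) auto
    have "hmap m (hmap n a) = a" using arg_cong[OF id, of "\<lambda>H. hmap H a"] a n by (simp add: Comp_arr Id_arr)
    then have "ptnorm (hdom t) a x \<le> ptnorm (hdom s) (hmap n a) x"
      using arr_ptnorm_le[OF m(1), of "hmap n a" x] m na by simp
    also have "\<dots> = ptnorm I (hmap s (hmap n a)) x" using isom_ptnorm[OF s(1) na, of x] s by simp
    also have "hmap s (hmap n a) = hmap t a"
      using Comp_arr(4)[of a n s] a n by simp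
    finally show "ptnorm (hdom t) a x \<le> ptnorm (hcod t) (hmap t a) x" using cod by simp
  qed
  then have t: "isom t" using at by (simp add: isom_def)
  then show "isom t \<and> hcod t = I \<and> ideal_of t = ideal_of s"
    using st ts sub_le_iff[of s t] sub_le_iff[of t s] s cod isom_arr by auto
qed

definition idl :: "('v, 'x) harr set \<Rightarrow> ('x \<Rightarrow> complex) set" where
  "idl P = ideal_of (rep P)"

definition of_ideal :: "('x \<Rightarrow> complex) set \<Rightarrow> ('v, 'x) harr set" where
  "of_ideal J = subobject C (ideal_incl J)"

lemma subobject_ISub:
  assumes s: "isom s" "hcod s = I"
  shows "subobject C s \<in> ISub C" "idl (subobject C s) = ideal_of s"
    "isom (rep (subobject C s))" "hcod (rep (subobject C s)) = I"
proof -
  show "subobject C s \<in> ISub C" using s by (auto simp: ISub_def subunit_iff)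
  have "s \<in> subobject C s" using s by (simp add: subobject_mem)
  then have "rep (subobject C s) \<in> subobject C s" unfolding rep_def by (rule someI[of "\<lambda>t. t \<in> subobject C s"])
  then show "idl (subobject C s) = ideal_of s" "isom (rep (subobject C s))" "hcod (rep (subobject C s)) = I"
    using s by (auto simp: subobject_mem idl_def)
qed

lemma ISubE:
  assumes "P \<in> ISub C"
  obtains s where "isom s" "hcod s = I" "P = subobject C s"
  using assms by (auto simp: ISub_def subunit_iff)

lemma rep_ISub:
  assumes "P \<in> ISub C"
  shows "isom (rep P)" "arr (rep P)" "hcod (rep P) = I" "closed_ideal (idl P)"
proof -
  obtain s where s: "isom s" "hcod s = I" "P = subobject C s" by (rule ISubE[OF assms])
  show "isom (rep P)" "arr (rep P)" "hcod (rep P) = I" using subobject_ISub[OF s(1,2)] s(3) isom_arr by auto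
  then show "closed_ideal (idl P)" unfolding idl_def by (intro closed_ideal_of)
qed

lemma ISub_eqI:
  assumes P: "P \<in> ISub C" and Q: "Q \<in> ISub C" and eq: "idl P = idl Q"
  shows "P = Q"
proof -
  obtain s where s: "isom s" "hcod s = I" "P = subobject C s" by (rule ISubE[OF P])
  obtain t where t: "isom t" "hcod t = I" "Q = subobject C t" by (rule ISubE[OF Q])
  have "ideal_of s = ideal_of t" using eq s t by (simp add: subobject_ISub)
  then show ?thesis using s t by (auto simp: subobject_mem)
qed

lemma of_ideal:
  assumes "closed_ideal J"
  shows "(of_ideal J :: ('v, 'x) harr set) \<in> ISub C" "idl (of_ideal J :: ('v, 'x) harr set) = J"
  by (simp_all add: of_ideal_def subobject_ISub ideal_incl assms)

lemma ISub_le: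
  assumes "P \<in> ISub C" "Q \<in> ISub C"
  shows "sub_le C (rep P) (rep Q) \<longleftrightarrow> idl P \<subseteq> idl Q"
  unfolding idl_def using assms by (intro sub_le_iff) (auto simp: rep_ISub)

lemma closed_ideal_Inter:
  assumes "\<And>J. J \<in> \<J> \<Longrightarrow> closed_ideal J" "\<J> \<noteq> {}"
  shows "closed_ideal (\<Inter>\<J>)"
  unfolding closed_ideal_def
proof (intro conjI ballI allI impI)
  show "\<Inter>\<J> \<subseteq> C0 X" using assms closed_idealD(1) by blast
  show "(\<lambda>x. 0) \<in> \<Inter>\<J>" using assms(1) closed_idealD(3) by blast
  show "(\<lambda>x. f x + g x) \<in> \<Inter>\<J>" if "f \<in> \<Inter>\<J>" "g \<in> \<Inter>\<J>" for f g
    using that assms(1) closed_idealD(4) by blast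
  show "(\<lambda>x. c * f x) \<in> \<Inter>\<J>" if "f \<in> \<Inter>\<J>" for f c
    using that assms(1) closed_idealD(5) by blast
  show "(\<lambda>x. g x * f x) \<in> \<Inter>\<J>" if "g \<in> C0 X" "f \<in> \<Inter>\<J>" for f g
    using that assms(1) closed_idealD(6) by blast
  show "g \<in> \<Inter>\<J>" if g: "g \<in> C0 X" "\<forall>e>0. \<exists>f\<in>\<Inter>\<J>. \<forall>x. cmod (g x - f x) \<le> e" for g
  proof
    fix J assume J: "J \<in> \<J>"
    show "g \<in> J" by (rule closed_idealD(7)[OF assms(1)[OF J] g(1)]) (use g(2) J in blast)
  qed
qed

lemma closed_ideal_C0: "closed_ideal (C0 X)"
  by (auto simp: closed_ideal_def C0_zero C0_add C0_cmult C0_mult)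

lemma closed_ideal_Int: "closed_ideal J \<Longrightarrow> closed_ideal K \<Longrightarrow> closed_ideal (J \<inter> K)"
  using closed_ideal_Inter[of "{J, K}"] by auto

definition join_ideal :: "('x \<Rightarrow> complex) set set \<Rightarrow> ('x \<Rightarrow> complex) set" where
  "join_ideal \<J> = \<Inter>{K. closed_ideal K \<and> \<Union>\<J> \<subseteq> K}"

lemma join_ideal:
  assumes "\<And>J. J \<in> \<J> \<Longrightarrow> closed_ideal J"
  shows "closed_ideal (join_ideal \<J>)"
    and "J \<in> \<J> \<Longrightarrow> J \<subseteq> join_ideal \<J>"
    and "closed_ideal K \<Longrightarrow> (\<And>J. J \<in> \<J> \<Longrightarrow> J \<subseteq> K) \<Longrightarrow> join_ideal \<J> \<subseteq> K"
proof -
  have "\<Union>\<J> \<subseteq> C0 X" using assms closed_idealD(1) by blast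
  then have ne: "{K. closed_ideal K \<and> \<Union>\<J> \<subseteq> K} \<noteq> {}" using closed_ideal_C0 by auto
  show "closed_ideal (join_ideal \<J>)"
    unfolding join_ideal_def by (rule closed_ideal_Inter[OF _ ne]) simp
qed (auto simp: join_ideal_def)

text \<open>The ideal quotient \<open>(K : J)\<close> is the Heyting implication.\<close>

lemma closed_ideal_quotient:
  assumes K: "closed_ideal K" and J: "J \<subseteq> C0 X"
  shows "closed_ideal {f \<in> C0 X. \<forall>g\<in>J. (\<lambda>x. f x * g x) \<in> K}"
  unfolding closed_ideal_def
proof (intro conjI ballI allI impI)
  let ?Q = "{f \<in> C0 X. \<forall>g\<in>J. (\<lambda>x. f x * g x) \<in> K}"
  show "?Q \<subseteq> C0 X" by blast
  show "(\<lambda>x. 0) \<in> ?Q" using C0_zero closed_idealD(3)[OF K] by auto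
  show "(\<lambda>x. f x + g x) \<in> ?Q" if "f \<in> ?Q" "g \<in> ?Q" for f g
    using that closed_idealD(4)[OF K] by (auto simp: C0_add distrib_right)
  show "(\<lambda>x. c * f x) \<in> ?Q" if "f \<in> ?Q" for f c
    using that closed_idealD(5)[OF K] by (auto simp: C0_cmult mult.assoc)
  show "(\<lambda>x. g x * f x) \<in> ?Q" if "g \<in> C0 X" "f \<in> ?Q" for f g
    using that closed_idealD(6)[OF K] by (auto simp: C0_mult mult.assoc)
  fix g assume g: "g \<in> C0 X" "\<forall>e>0. \<exists>f\<in>?Q. \<forall>x. cmod (g x - f x) \<le> e"
  have "(\<lambda>x. g x * h x) \<in> K" if h: "h \<in> J" for h
  proof (rule closed_idealD(7)[OF K])
    have hC: "h \<in> C0 X" using h J by blast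
    show "(\<lambda>x. g x * h x) \<in> C0 X" using g(1) hC by (rule C0_mult)
    obtain B where B: "B \<ge> 0" "\<And>x. cmod (h x) \<le> B" using C0_bounded[OF hC] by blast
    fix e :: real assume e: "e > 0"
    then have "e / (B + 1) > 0" using B by simp
    then obtain f where f: "f \<in> ?Q" "\<forall>x. cmod (g x - f x) \<le> e / (B + 1)" using g(2) by blast
    have "cmod (g x * h x - f x * h x) \<le> e" for x
    proof -
      have "cmod (g x * h x - f x * h x) = cmod (g x - f x) * cmod (h x)"
        by (simp add: left_diff_distrib[symmetric] norm_mult)
      also have "\<dots> \<le> e / (B + 1) * (B + 1)"
        using f(2) B(1) B(2)[of x] e by (intro mult_mono) auto
      also have "\<dots> = e" using B(1) by simp
      finally show ?thesis .
    qed
    then show "\<exists>f\<in>K. \<forall>x. cmod (g x * h x - f x) \<le> e"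
      using f(1) h by (intro bexI[of _ "\<lambda>x. f x * h x"]) auto
  qed
  then show "g \<in> ?Q" using g(1) by blast
qed

text \<open>The quotient \<open>(\<Squnion>(J \<inter> K) : J)\<close> is a closed ideal above all \<open>K\<close>, hence above their join. An element \<open>f\<close> of \<open>J\<close> and of
  the quotient is the limit of the products \<open>f v / (v + d)\<close> with \<open>v = \<bar>f\<bar>\<^sup>2\<close>, whose second factor is in \<open>J\<close>.\<close>

lemma ideal_distrib:
  assumes J: "closed_ideal J" and \<J>: "\<And>K. K \<in> \<J> \<Longrightarrow> closed_ideal K"
  shows "J \<inter> join_ideal \<J> = join_ideal ((\<lambda>K. J \<inter> K) ` \<J>)"
proof
  have cl: "closed_ideal L" if "L \<in> (\<lambda>K. J \<inter> K) ` \<J>" for L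
    using that J \<J> closed_ideal_Int by blast
  let ?L = "join_ideal ((\<lambda>K. J \<inter> K) ` \<J>)"
  have L: "closed_ideal ?L" using cl by (rule join_ideal(1))
  let ?Q = "{f \<in> C0 X. \<forall>g\<in>J. (\<lambda>x. f x * g x) \<in> ?L}"
  have Q: "closed_ideal ?Q" by (rule closed_ideal_quotient[OF L closed_idealD(1)[OF J]])
  have "join_ideal \<J> \<subseteq> ?Q"
  proof (rule join_ideal(3)[OF \<J> Q])
    fix K assume K: "K \<in> \<J>"
    have "(\<lambda>x. f x * g x) \<in> J \<inter> K" if "f \<in> K" "g \<in> J" for f g
      using closed_idealD(6)[OF J closed_idealD(2)[OF \<J>[OF K] that(1)] that(2)]
        closed_idealD(6)[OF \<J>[OF K] closed_idealD(2)[OF J that(2)] that(1)] by (simp add: mult.commute)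
    then show "K \<subseteq> ?Q" using join_ideal(2)[OF cl, where J = "J \<inter> K"] K closed_idealD(2)[OF \<J>[OF K]] by blast
  qed
  show "J \<inter> join_ideal \<J> \<subseteq> ?L"
  proof
    fix f assume f: "f \<in> J \<inter> join_ideal \<J>"
    then have fJ: "f \<in> J" and fQ: "f \<in> ?Q" and fC: "f \<in> C0 X"
      using \<open>join_ideal \<J> \<subseteq> ?Q\<close> closed_idealD(2)[OF J] by blast+
    show "f \<in> ?L"
    proof (rule closed_idealD(7)[OF L fC])
      fix e :: real assume e: "e > 0"
      have "(\<lambda>x. cnj (f x) * f x) \<in> J" by (rule closed_idealD(6)[OF J C0_cnj[OF fC] fJ])
      then have "soft_support (e^2) (\<lambda>x. cnj (f x) * f x) \<in> J"
        using e by (intro soft_support_ideal[OF J] square_nonneg) auto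
      then have "(\<lambda>x. f x * soft_support (e^2) (\<lambda>x. cnj (f x) * f x) x) \<in> ?L" using fQ by blast
      then show "\<exists>g\<in>?L. \<forall>x. cmod (f x - g x) \<le> e"
        using soft_support_mult[OF e, of f]
        by (intro bexI[of _ "\<lambda>x. f x * soft_support (e^2) (\<lambda>x. cnj (f x) * f x) x"]) auto
    qed
  qed
  show "?L \<subseteq> J \<inter> join_ideal \<J>"
  proof (rule join_ideal(3)[OF cl])
    show "closed_ideal (J \<inter> join_ideal \<J>)" by (rule closed_ideal_Int[OF J join_ideal(1)[OF \<J>]])
    show "L \<subseteq> J \<inter> join_ideal \<J>" if "L \<in> (\<lambda>K. J \<inter> K) ` \<J>" for L
      using that join_ideal(2)[OF \<J>] by blast
  qed auto
qed

abbreviation L where "L \<equiv> ISub_order C"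

lemma L_simps [simp]: "carrier L = ISub C" "eq L = (=)"
  by (simp_all add: ISub_order_def)

lemma L_le: "P \<in> ISub C \<Longrightarrow> Q \<in> ISub C \<Longrightarrow> P \<sqsubseteq>\<^bsub>L\<^esub> Q \<longleftrightarrow> idl P \<subseteq> idl Q"
  by (simp add: ISub_order_def ISub_le)

lemma L_partial_order: "partial_order (L :: ('v, 'x) harr set gorder)"
proof unfold_locales
  show "P .=\<^bsub>L\<^esub> Q" if "P \<sqsubseteq>\<^bsub>L\<^esub> Q" "Q \<sqsubseteq>\<^bsub>L\<^esub> P" "P \<in> carrier L" "Q \<in> carrier L"
    for P Q :: "('v, 'x) harr set"
  proof -
    have "P \<in> ISub C" "Q \<in> ISub C" "idl P = idl Q" using that by (simp_all add: L_le subset_antisym)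
    then show ?thesis by (simp add: ISub_eqI)
  qed
  show "P \<sqsubseteq>\<^bsub>L\<^esub> R" if "P \<sqsubseteq>\<^bsub>L\<^esub> Q" "Q \<sqsubseteq>\<^bsub>L\<^esub> R" "P \<in> carrier L" "Q \<in> carrier L" "R \<in> carrier L"
    for P Q R :: "('v, 'x) harr set"
    using that by (auto simp: L_le)
qed (simp_all add: L_le)

lemma idl_closed: "U \<subseteq> ISub C \<Longrightarrow> J \<in> idl ` U \<Longrightarrow> closed_ideal J"
  using rep_ISub(4) by auto

lemma join_idl:
  assumes U: "U \<subseteq> ISub C"
  shows "closed_ideal (join_ideal (idl ` U))"
    and "P \<in> U \<Longrightarrow> idl P \<subseteq> join_ideal (idl ` U)"
    and "closed_ideal K \<Longrightarrow> (\<And>P. P \<in> U \<Longrightarrow> idl P \<subseteq> K) \<Longrightarrow> join_ideal (idl ` U) \<subseteq> K"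
proof -
  have cl: "closed_ideal J" if "J \<in> idl ` U" for J using rep_ISub(4) U that by auto
  show "closed_ideal (join_ideal (idl ` U))" by (rule join_ideal(1)[OF cl])
  show "P \<in> U \<Longrightarrow> idl P \<subseteq> join_ideal (idl ` U)" by (rule join_ideal(2)[OF cl]) auto
  show "closed_ideal K \<Longrightarrow> (\<And>P. P \<in> U \<Longrightarrow> idl P \<subseteq> K) \<Longrightarrow> join_ideal (idl ` U) \<subseteq> K"
    by (rule join_ideal(3)[OF cl]) auto
qed

lemma L_least:
  fixes U :: "('v, 'x) harr set set"
  assumes U: "U \<subseteq> ISub C"
  shows "least L (of_ideal (join_ideal (idl ` U))) (Upper L U)"
proof -
  note J = join_idl[OF U]
  note o = of_ideal[OF J(1)]
  show ?thesis
  proof (rule least_UpperI)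
    show "P \<sqsubseteq>\<^bsub>L\<^esub> of_ideal (join_ideal (idl ` U))" if "P \<in> U" for P
      using o J(2)[OF that] U that by (subst L_le) auto
    show "of_ideal (join_ideal (idl ` U)) \<sqsubseteq>\<^bsub>L\<^esub> Q" if "Q \<in> Upper L U" for Q
    proof -
      have up: "P \<sqsubseteq>\<^bsub>L\<^esub> Q" if "P \<in> U" for P
        using \<open>Q \<in> Upper L U\<close> U that by (auto simp: Upper_def)
      have Q: "Q \<in> ISub C" using \<open>Q \<in> Upper L U\<close> by (simp add: Upper_def)
      have "join_ideal (idl ` U) \<subseteq> idl Q"
        by (rule J(3)[OF rep_ISub(4)[OF Q]]) (use up U Q L_le in blast)
      then show ?thesis using o Q by (subst L_le) auto
    qed
  qed (use U o in auto)
qed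

lemma L_greatest:
  fixes U :: "('v, 'x) harr set set"
  assumes U: "U \<subseteq> ISub C"
  shows "greatest L (of_ideal (\<Inter>(insert (C0 X) (idl ` U)))) (Lower L U)"
proof -
  have J: "closed_ideal (\<Inter>(insert (C0 X) (idl ` U)))"
    using idl_closed[OF U] closed_ideal_C0 by (intro closed_ideal_Inter) auto
  note o = of_ideal[OF J]
  show ?thesis
  proof (rule greatest_LowerI)
    show "of_ideal (\<Inter>(insert (C0 X) (idl ` U))) \<sqsubseteq>\<^bsub>L\<^esub> P" if "P \<in> U" for P
      using o U that by (subst L_le) auto
    show "Q \<sqsubseteq>\<^bsub>L\<^esub> of_ideal (\<Inter>(insert (C0 X) (idl ` U)))" if "Q \<in> Lower L U" for Q
    proof -
      have Q: "Q \<in> ISub C" using that by (simp add: Lower_def)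
      have "idl Q \<subseteq> idl P" if "P \<in> U" for P
        using \<open>Q \<in> Lower L U\<close> U that Q L_le[of Q P] by (auto simp: Lower_def)
      then have "idl Q \<subseteq> \<Inter>(insert (C0 X) (idl ` U))" using closed_idealD(1)[OF rep_ISub(4)[OF Q]] by blast
      then show ?thesis using o Q by (subst L_le) auto
    qed
  qed (use U o in auto)
qed

lemma L_complete: "Complete_Lattice.complete_lattice (L :: ('v, 'x) harr set gorder)"
  using L_partial_order L_least L_greatest
  by (auto simp: Complete_Lattice.complete_lattice_def Complete_Lattice.complete_lattice_axioms_def)

lemma L_sup:
  fixes U :: "('v, 'x) harr set set"
  assumes U: "U \<subseteq> ISub C"
  shows "\<Squnion>\<^bsub>L\<^esub> U \<in> ISub C" "idl (\<Squnion>\<^bsub>L\<^esub> U) = join_ideal (idl ` U)"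
proof -
  interpret L: Complete_Lattice.complete_lattice "L :: ('v, 'x) harr set gorder" by (rule L_complete)
  have "least L (\<Squnion>\<^bsub>L\<^esub> U) (Upper L U)" using U by (intro L.sup_lub) simp
  then have "\<Squnion>\<^bsub>L\<^esub> U = of_ideal (join_ideal (idl ` U))" by (rule L.least_unique[OF _ L_least[OF U]])
  then show "\<Squnion>\<^bsub>L\<^esub> U \<in> ISub C" "idl (\<Squnion>\<^bsub>L\<^esub> U) = join_ideal (idl ` U)"
    using of_ideal[OF join_idl(1)[OF U]] by auto
qed

lemma L_meet:
  fixes P Q :: "('v, 'x) harr set"
  assumes "P \<in> ISub C" "Q \<in> ISub C"
  shows "P \<sqinter>\<^bsub>L\<^esub> Q \<in> ISub C" "idl (P \<sqinter>\<^bsub>L\<^esub> Q) = idl P \<inter> idl Q"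
proof -
  interpret L: Complete_Lattice.complete_lattice "L :: ('v, 'x) harr set gorder" by (rule L_complete)
  have U: "{P, Q} \<subseteq> ISub C" using assms by simp
  have "greatest L (P \<sqinter>\<^bsub>L\<^esub> Q) (Lower L {P, Q})" unfolding meet_def using assms by (intro L.inf_of_two_greatest) simp_all
  then have "P \<sqinter>\<^bsub>L\<^esub> Q = of_ideal (\<Inter>(insert (C0 X) (idl ` {P, Q})))"
    by (rule L.greatest_unique[OF _ L_greatest[OF U]])
  moreover have "\<Inter>(insert (C0 X) (idl ` {P, Q})) = idl P \<inter> idl Q"
    using closed_idealD(1)[OF rep_ISub(4)[OF assms(1)]] by auto
  ultimately show "P \<sqinter>\<^bsub>L\<^esub> Q \<in> ISub C" "idl (P \<sqinter>\<^bsub>L\<^esub> Q) = idl P \<inter> idl Q"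
    using of_ideal[OF closed_ideal_Int[OF rep_ISub(4) rep_ISub(4), OF assms]] by auto
qed

theorem frame_Hilb: "frame (L :: ('v, 'x) harr set gorder)"
  unfolding frame_def
proof (intro conjI ballI allI impI L_complete)
  fix P :: "('v, 'x) harr set" and U :: "('v, 'x) harr set set" assume "P \<in> carrier L" "U \<subseteq> carrier L"
  then have P: "P \<in> ISub C" and U: "U \<subseteq> ISub C" by simp_all
  have PU: "(\<lambda>Q. P \<sqinter>\<^bsub>L\<^esub> Q) ` U \<subseteq> ISub C" using L_meet(1)[OF P] U by blast
  have "idl ` (\<lambda>Q. P \<sqinter>\<^bsub>L\<^esub> Q) ` U = (\<lambda>K. idl P \<inter> K) ` idl ` U"
    unfolding image_image by (rule image_cong[OF refl]) (use L_meet(2)[OF P] U in blast)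
  then show "P \<sqinter>\<^bsub>L\<^esub> (\<Squnion>\<^bsub>L\<^esub> U) = \<Squnion>\<^bsub>L\<^esub> ((\<lambda>Q. P \<sqinter>\<^bsub>L\<^esub> Q) ` U)"
    using L_sup[OF U] L_sup[OF PU] L_meet[OF P L_sup(1)[OF U]]
      ideal_distrib[OF rep_ISub(4)[OF P], of "idl ` U"] idl_closed[OF U]
    by (intro ISub_eqI) simp_all
qed

text \<open>The map \<open>s \<and> t\<close> is \<open>t\<close> after \<open>s \<otimes> T\<close>. So its ideal consists of those \<open>f = t(\<tau>)\<close> for which
  \<open>\<langle>\<tau>, \<tau>\<rangle> = \<bar>f\<bar>\<^sup>2\<close> is in the ideal of \<open>s\<close>, which means that \<open>f\<close> itself is.\<close>

lemma wedge_ISub: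
  assumes P: "P \<in> ISub C" and Q: "Q \<in> ISub C"
  shows "wedge C P Q \<in> ISub C" "idl (wedge C P Q) = idl P \<inter> idl Q"
proof -
  let ?s = "rep P" and ?t = "rep Q"
  note s = rep_ISub(1-3)[OF P] and t = rep_ISub(1-3)[OF Q]
  have T: "hil (hdom ?t)" "hil (hdom ?s)" using s t arr_obj by blast+
  note r = restr_arr[OF s(2,3) T(1)]
  define w where "w = LUnit C I \<circ>\<^sub>h TenA C ?s ?t"
  have "w = ?t \<circ>\<^sub>h restr C ?s (hdom ?t)"
  proof (rule arr_eqI2[where A = "hdom ?s" and B = "hdom ?t"])
    show "arr w" "hdom w = hdom ?s \<otimes>\<^sub>h hdom ?t" "hcod w = hcod (?t \<circ>\<^sub>h restr C ?s (hdom ?t))"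
      using s t by (simp_all add: w_def arr_simps)
    show "arr (?t \<circ>\<^sub>h restr C ?s (hdom ?t))" "hdom (?t \<circ>\<^sub>h restr C ?s (hdom ?t)) = hdom ?s \<otimes>\<^sub>h hdom ?t"
      using r t by (simp_all add: Comp_arr)
    fix \<sigma> \<tau> assume \<sigma>: "\<sigma> \<in> carrier (hdom ?s)" and \<tau>: "\<tau> \<in> carrier (hdom ?t)"
    have in_I: "hmap ?s \<sigma> \<in> carrier I" "hmap ?t \<tau> \<in> carrier I"
      using hmap_closed[OF s(2,3) \<sigma>] hmap_closed[OF t(2,3) \<tau>] by auto
    have "hmap w (pure (hdom ?s) (hdom ?t) \<sigma> \<tau>) = hact I (fun_of (hmap ?s \<sigma>)) (hmap ?t \<tau>)"
      using s t T \<sigma> \<tau> in_I by (simp add: w_def arr_simps del: unit_simps)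
    also have "\<dots> = hmap ?t (hact (hdom ?t) (fun_of (hmap ?s \<sigma>)) \<tau>)"
      using hmap_act[OF t(2) unit_mem[OF in_I(1)] \<tau>] t(3) by simp
    also have "\<dots> = hmap (?t \<circ>\<^sub>h restr C ?s (hdom ?t)) (pure (hdom ?s) (hdom ?t) \<sigma> \<tau>)"
      using \<sigma> \<tau> T by (simp add: r Comp_arr pure_in)
    finally show "hmap w (pure (hdom ?s) (hdom ?t) \<sigma> \<tau>)
        = hmap (?t \<circ>\<^sub>h restr C ?s (hdom ?t)) (pure (hdom ?s) (hdom ?t) \<sigma> \<tau>)" .
  qed (rule T)+
  note w = this
  have isow: "isom w" "hcod w = I"
    unfolding w using isom_comp[OF restr_isom[OF s(1,3) T(1)] t(1)] r t by (simp_all add: Comp_arr)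
  have "ideal_of w = idl P \<inter> idl Q"
  proof -
    have "f \<in> ideal_of w \<longleftrightarrow> f \<in> ideal_of ?s \<and> f \<in> ideal_of ?t" for f
    proof -
      have J: "closed_ideal (ideal_of ?s)" using rep_ISub(4)[OF P] by (simp add: idl_def)
      have img: "img w = hmap ?t ` img (restr C ?s (hdom ?t))"
        unfolding w img_def by (auto simp: Comp_arr image_iff)
      have key: "\<tau> \<in> img (restr C ?s (hdom ?t)) \<longleftrightarrow> f \<in> ideal_of ?s"
        if \<tau>: "\<tau> \<in> carrier (hdom ?t)" "hmap ?t \<tau> = Fun f" for \<tau>
      proof -
        have fC: "f \<in> C0 X" using hmap_closed[OF t(2,3) \<tau>(1)] \<tau>(2) by auto
        have "hinner (hdom ?t) \<tau> \<tau> = (\<lambda>x. cnj (f x) * f x)"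
          using isom_ip[OF t(1) \<tau>(1) \<tau>(1)] \<tau>(2) t(3) by (auto simp: fun_eq_iff)
        then show ?thesis
          unfolding img_restr[OF s(1,3) T(1)]
          using \<tau>(1) ideal_square[OF J fC] closed_idealD(6)[OF J C0_cnj[OF fC]] by auto
      qed
      have "f \<in> ideal_of w \<longleftrightarrow> (\<exists>\<tau>\<in>img (restr C ?s (hdom ?t)). hmap ?t \<tau> = Fun f)"
        unfolding ideal_of_iff[OF isom_arr[OF isow(1)] isow(2)] img by (auto simp: image_iff) metis+
      also have "\<dots> \<longleftrightarrow> (\<exists>\<tau>\<in>carrier (hdom ?t). hmap ?t \<tau> = Fun f \<and> f \<in> ideal_of ?s)"
        using key img_restr[OF s(1,3) T(1)] by blast
      also have "\<dots> \<longleftrightarrow> f \<in> ideal_of ?s \<and> f \<in> ideal_of ?t"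
        unfolding ideal_of_iff[OF t(2,3)] by (auto simp: img_def image_iff) metis+
      finally show ?thesis .
    qed
    then show ?thesis by (auto simp: idl_def)
  qed
  then show "wedge C P Q \<in> ISub C" "idl (wedge C P Q) = idl P \<inter> idl Q"
    using subobject_ISub[OF isow] by (simp_all add: wedge_def w_def)
qed

section \<open>Colimits over idempotent sets of subunits\<close>

lemma restr_rep:
  assumes "P \<in> ISub C" "hil A"
  shows "isom (restr C (rep P) A)" "arr (restr C (rep P) A)" "hdom (restr C (rep P) A) = D_obj C A P"
    "hcod (restr C (rep P) A) = A" "img (restr C (rep P) A) = {a \<in> carrier A. hinner A a a \<in> idl P}"
    "hil (D_obj C A P)"
  using assms by (simp_all add: restr_isom restr_arr img_restr rep_ISub D_obj_def idl_def tensor_obj arr_obj)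

lemma D_arr_iff: "f \<in> D_arr C A P Q \<longleftrightarrow> arr f \<and> hdom f = D_obj C A P \<and> hcod f = D_obj C A Q
   \<and> restr C (rep Q) A \<circ>\<^sub>h f = restr C (rep P) A"
  by (auto simp: D_arr_def homs_arr)

lemma D_arr_exists:
  assumes "P \<in> ISub C" "Q \<in> ISub C" "hil A" "idl P \<subseteq> idl Q"
  obtains f where "f \<in> D_arr C A P Q"
proof -
  have "img (restr C (rep P) A) \<subseteq> img (restr C (rep Q) A)"
    using assms by (auto simp: restr_rep(5))
  moreover have "hcod (restr C (rep P) A) = hcod (restr C (rep Q) A)" using assms by (simp add: restr_rep)
  ultimately obtain f where "arr f" "hdom f = hdom (restr C (rep P) A)" "hcod f = hdom (restr C (rep Q) A)"
      "restr C (rep Q) A \<circ>\<^sub>h f = restr C (rep P) A"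
    using factor_isom[OF restr_rep(1)[OF assms(2,3)] restr_rep(2)[OF assms(1,3)]] by metis
  then have "f \<in> D_arr C A P Q" using assms by (simp add: D_arr_iff restr_rep)
  then show ?thesis by (rule that)
qed

lemma sub_incl:
  assumes P: "P \<in> ISub C" and Q: "Q \<in> ISub C" and le: "idl P \<subseteq> idl Q"
  shows "arr (sub_incl C P Q)" "hdom (sub_incl C P Q) = hdom (rep P)" "hcod (sub_incl C P Q) = hdom (rep Q)"
    "rep Q \<circ>\<^sub>h sub_incl C P Q = rep P"
proof -
  let ?S = "\<lambda>m. m \<in> homs C (Dom C (rep P)) (Dom C (rep Q)) \<and> rep Q \<circ>\<^sub>h m = rep P"
  obtain m where m: "?S m" using ISub_le[OF P Q] le by (auto simp: sub_le_def)
  have "n = m" if "?S n" for n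
  proof -
    have "Dom C (rep P) \<in> Obj C" using rep_ISub(2)[OF P] by (simp add: arr_obj)
    then show ?thesis using isom_mono[OF rep_ISub(1)[OF Q]] m that unfolding is_mono_def by metis
  qed
  then have "sub_incl C P Q = m" unfolding sub_incl_def using m by (rule_tac the_equality) blast+
  then show "arr (sub_incl C P Q)" "hdom (sub_incl C P Q) = hdom (rep P)" "hcod (sub_incl C P Q) = hdom (rep Q)"
    "rep Q \<circ>\<^sub>h sub_incl C P Q = rep P"
    using m by (auto simp: homs_arr)
qed

lemma incl_ten:
  assumes P: "P \<in> ISub C" and Q: "Q \<in> ISub C" and le: "idl P \<subseteq> idl Q" and A: "hil A"
  defines "c \<equiv> TenA C (sub_incl C P Q) (Id C A)"
  shows "arr c" "hdom c = D_obj C A P" "hcod c = D_obj C A Q" "restr C (rep Q) A \<circ>\<^sub>h c = restr C (rep P) A" "isom c"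
proof -
  note m = sub_incl[OF P Q le]
  show c: "arr c" "hdom c = D_obj C A P" "hcod c = D_obj C A Q"
    using m A by (simp_all add: c_def arr_simps D_obj_def)
  show eq: "restr C (rep Q) A \<circ>\<^sub>h c = restr C (rep P) A"
    unfolding c_def using restr_comp[OF rep_ISub(2,3)[OF Q] m(1,3) A] m(4) by simp
  show "isom c"
    by (rule isom_cancel[of "restr C (rep Q) A"]) (use eq c restr_rep[OF P A] restr_rep[OF Q A] in auto)
qed

lemma arr_mono_cancel:
  assumes M: "isom M" and fg: "arr f" "arr g" "hdom f = hdom g" "hcod f = hdom M" "hcod g = hdom M"
    and eq: "M \<circ>\<^sub>h f = M \<circ>\<^sub>h g"
  shows "f = g"
proof -
  have "hdom g \<in> Obj C" using fg by (simp add: arr_obj)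
  then show ?thesis using isom_mono[OF M] fg eq unfolding is_mono_def by (simp add: homs_arr)
qed

lemma comp_assoc_arr:
  assumes "arr f" "arr g" "arr h" "hcod f = hdom g" "hcod g = hdom h"
  shows "(h \<circ>\<^sub>h g) \<circ>\<^sub>h f = h \<circ>\<^sub>h (g \<circ>\<^sub>h f)"
  using category.comp_assoc[OF category_Hilb, of f "hdom f" "hcod f" g "hcod g" h "hcod h"] assms
  by (simp add: homs_arr)

lemma cocone_inclusions:
  fixes U :: "('v, 'x) harr set set"
  assumes U: "U \<subseteq> ISub C" and A: "hil A" and K: "K \<in> ISub C" and le: "\<And>P. P \<in> U \<Longrightarrow> idl P \<subseteq> idl K"
  shows "is_cocone C U (D_obj C A) (D_arr C A) (D_obj C A K) (\<lambda>P. TenA C (sub_incl C P K) (Id C A))"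
  unfolding is_cocone_def
proof (intro conjI ballI)
  note MK = restr_rep[OF K A]
  show "D_obj C A K \<in> Obj C" using MK by simp
  show "TenA C (sub_incl C P K) (Id C A) \<in> homs C (D_obj C A P) (D_obj C A K)" if "P \<in> U" for P
    using incl_ten[OF _ K le A] that U by (auto simp: homs_arr)
  fix P Q f assume PQ: "P \<in> U" "Q \<in> U" and f: "f \<in> D_arr C A P Q"
  note cP = incl_ten[OF subsetD[OF U PQ(1)] K le[OF PQ(1)] A] and cQ = incl_ten[OF subsetD[OF U PQ(2)] K le[OF PQ(2)] A]
  show "TenA C (sub_incl C Q K) (Id C A) \<circ>\<^sub>h f = TenA C (sub_incl C P K) (Id C A)"
  proof (rule arr_mono_cancel[OF MK(1)])
    show "restr C (rep K) A \<circ>\<^sub>h TenA C (sub_incl C Q K) (Id C A) \<circ>\<^sub>h f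
        = restr C (rep K) A \<circ>\<^sub>h TenA C (sub_incl C P K) (Id C A)"
      using comp_assoc_arr[of f "TenA C (sub_incl C Q K) (Id C A)" "restr C (rep K) A"] f cP cQ MK
      by (simp add: D_arr_iff)
  qed (use f cP cQ MK in \<open>auto simp: D_arr_iff Comp_arr\<close>)
qed

text \<open>With \<open>a\<close> the image of \<open>z\<close> in \<open>A\<close>, the element \<open>e a\<close> comes from the object of \<open>P \<and> Q \<in> U\<close>, since
  \<open>\<langle>e a, e a\<rangle> = \<bar>e\<bar>\<^sup>2 \<langle>a, a\<rangle>\<close> is in both ideals. There the components of a cocone at \<open>P\<close> and \<open>Q\<close> agree. The same \<open>y\<close>
  serves for all cocones, in particular for the given one and the candidate colimit.\<close>

lemma common_refinement:
  fixes U :: "('v, 'x) harr set set"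
  assumes U: "U \<subseteq> ISub C" "idem C U" and A: "hil A" and P: "P \<in> U" and Q: "Q \<in> U"
    and e: "e \<in> idl Q" and z: "z \<in> carrier (D_obj C A P)"
  obtains y where "y \<in> carrier (D_obj C A Q)"
    and "\<And>Z b. is_cocone C U (D_obj C A) (D_arr C A) Z b \<Longrightarrow> hmap (b Q) y = hact Z e (hmap (b P) z)"
proof -
  define W where "W = wedge C P Q"
  have W: "W \<in> U" using U(2) P Q unfolding idem_def W_def by blast
  have in_I: "P \<in> ISub C" "Q \<in> ISub C" "W \<in> ISub C" using U P Q W by auto
  have idlW: "idl W = idl P \<inter> idl Q" unfolding W_def by (rule wedge_ISub(2)[OF in_I(1,2)])
  note MP = restr_rep[OF in_I(1) A] and MQ = restr_rep[OF in_I(2) A] and MW = restr_rep[OF in_I(3) A]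
  obtain f where f: "f \<in> D_arr C A W P" by (rule D_arr_exists[OF in_I(3,1) A]) (use idlW in blast)
  obtain g where g: "g \<in> D_arr C A W Q" by (rule D_arr_exists[OF in_I(3,2) A]) (use idlW in blast)
  note JP = rep_ISub(4)[OF in_I(1)] and JQ = rep_ISub(4)[OF in_I(2)]
  have eC: "e \<in> C0 X" using closed_idealD(2)[OF JQ e] .
  interpret DP: separated_module X "D_obj C A P" by (rule separated[OF MP(6)])
  interpret SA: separated_module X A by (rule separated[OF A])
  define a where "a = hmap (restr C (rep P) A) z"
  have z': "z \<in> carrier (hdom (restr C (rep P) A))" using z MP by simp
  have a: "a \<in> carrier A" "hinner A a a \<in> idl P"
    using z' MP(5) by (auto simp: a_def img_def)
  have ea: "hact A e a \<in> img (restr C (rep W) A)"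
  proof -
    have "hinner A (hact A e a) (hact A e a) = (\<lambda>x. (cnj (e x) * e x) * hinner A a a x)"
      using a eC by (auto simp: SA.ip_simps)
    moreover have "(\<lambda>x. (cnj (e x) * e x) * hinner A a a x) \<in> idl P"
      by (rule closed_idealD(6)[OF JP C0_mult[OF C0_cnj[OF eC] eC] a(2)])
    moreover have "(\<lambda>x. (hinner A a a x * cnj (e x)) * e x) \<in> idl Q"
      by (rule closed_idealD(6)[OF JQ C0_mult[OF SA.ip_C0[OF a(1) a(1)] C0_cnj[OF eC]] e])
    moreover have "(\<lambda>x. (hinner A a a x * cnj (e x)) * e x) = (\<lambda>x. (cnj (e x) * e x) * hinner A a a x)"
      by (simp add: mult_ac)
    ultimately show ?thesis using a(1) eC by (simp add: MW(5) idlW SA.closed)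
  qed
  then obtain w where w: "w \<in> carrier (D_obj C A W)" "hmap (restr C (rep W) A) w = hact A e a"
    using MW(3) by (auto simp: img_def)
  have fw: "hmap f w = hact (D_obj C A P) e z"
  proof (rule isom_inj[OF MP(1)])
    have "hmap (restr C (rep P) A) (hmap f w) = hmap (restr C (rep P) A \<circ>\<^sub>h f) w"
      by (rule Comp_arr(4)[symmetric]) (use f w(1) in \<open>simp add: D_arr_iff\<close>)
    also have "\<dots> = hact A e a" using f w by (simp add: D_arr_iff)
    also have "\<dots> = hmap (restr C (rep P) A) (hact (D_obj C A P) e z)"
      using hmap_act[OF MP(2) eC z'] MP by (simp add: a_def)
    finally show "hmap (restr C (rep P) A) (hmap f w) = hmap (restr C (rep P) A) (hact (D_obj C A P) e z)" .
    show "hmap f w \<in> carrier (hdom (restr C (rep P) A))"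
      using f w(1) MP by (intro hmap_closed) (auto simp: D_arr_iff)
  qed (use z eC MP in \<open>simp add: DP.closed\<close>)
  show ?thesis
  proof (rule that)
    show "hmap g w \<in> carrier (D_obj C A Q)" using g w(1) by (intro hmap_closed) (auto simp: D_arr_iff)
    fix Z b assume b: "is_cocone C U (D_obj C A) (D_arr C A) Z b"
    have bf: "b P \<circ>\<^sub>h f = b W" and bg: "b Q \<circ>\<^sub>h g = b W"
      using b W P Q f g by (auto simp: is_cocone_def)
    have bP: "arr (b P)" "hdom (b P) = D_obj C A P" "hcod (b P) = Z" using b P by (auto simp: is_cocone_def homs_arr)
    have "hmap (b Q) (hmap g w) = hmap (b W) w"
      using arg_cong[OF bg, of "\<lambda>h. hmap h w"] g w(1) by (simp add: Comp_arr D_arr_iff)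
    also have "\<dots> = hmap (b P) (hmap f w)"
      using arg_cong[OF bf, of "\<lambda>h. hmap h w"] f w(1) by (simp add: Comp_arr D_arr_iff)
    also have "\<dots> = hact Z e (hmap (b P) z)"
      using hmap_act[OF bP(1) eC, of z] bP z by (simp add: fw)
    finally show "hmap (b Q) (hmap g w) = hact Z e (hmap (b P) z)" .
  qed
qed

text \<open>The functions that multiply \<open>(\<Squnion>U) \<otimes> A\<close> into the closed span of the images form a closed ideal, which contains the
  ideals of all \<open>P \<in> U\<close> and therefore the ideal of \<open>\<Squnion>U\<close>. So it contains \<open>v / (v + d)\<close> for \<open>v = \<langle>y, y\<rangle>\<close>, and \<open>y\<close> is
  the limit of \<open>v / (v + d) y\<close>.\<close>

lemma inclusions_generate:
  fixes U :: "('v, 'x) harr set set"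
  assumes U: "U \<subseteq> ISub C" and A: "hil A" and K: "K \<in> ISub C" "idl K = join_ideal (idl ` U)"
  shows "generates (D_obj C A K)
    {hmap (TenA C (sub_incl C P K) (Id C A)) z | P z. P \<in> U \<and> z \<in> carrier (D_obj C A P)}" (is "generates ?D ?G")
proof -
  have le: "idl P \<subseteq> idl K" if "P \<in> U" for P
    using join_idl(2)[OF U] that K(2) by auto
  note MK = restr_rep[OF K(1) A]
  interpret D: separated_module X ?D by (rule separated[OF MK(6)])
  interpret SA: separated_module X A by (rule separated[OF A])
  have c: "hmap (TenA C (sub_incl C P K) (Id C A)) z \<in> carrier ?D" if "P \<in> U" "z \<in> carrier (D_obj C A P)" for P z
    using incl_ten[OF subsetD[OF U that(1)] K(1) le[OF that(1)] A] that(2) by (intro hmap_closed) auto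
  have G: "?G \<subseteq> carrier ?D" using c by blast
  define N where "N = {f \<in> C0 X. \<forall>y\<in>carrier ?D. hact ?D f y \<in> cspan ?D ?G}"
  have "closed_ideal N"
    unfolding closed_ideal_def
  proof (intro conjI ballI allI impI)
    show "N \<subseteq> C0 X" by (auto simp: N_def)
    have "hact ?D (\<lambda>x. 0) y = hzero ?D" if "y \<in> carrier ?D" for y
      using that C0_zero[of X] by (intro D.weak_eqI) (auto simp: D.ip_simps)
    then show "(\<lambda>x. 0) \<in> N" by (auto simp: N_def C0_zero D.cspan_zero)
    fix f assume f: "f \<in> N"
    then have fC: "f \<in> C0 X" by (simp add: N_def)
    show "(\<lambda>x. c * f x) \<in> N" for c
    proof -
      have "hact ?D (\<lambda>x. c * f x) y = hact ?D f (hscale ?D c y)" if "y \<in> carrier ?D" for y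
        using that fC C0_cmult[OF fC] by (intro D.weak_eqI) (auto simp: D.ip_simps)
      then show ?thesis using f by (auto simp: N_def C0_cmult D.closed)
    qed
    show "(\<lambda>x. g x * f x) \<in> N" if g: "g \<in> C0 X" for g
    proof -
      have "hact ?D (\<lambda>x. g x * f x) y = hact ?D f (hact ?D g y)" if "y \<in> carrier ?D" for y
        using that fC g C0_mult[OF g fC] by (intro D.weak_eqI) (auto simp: D.ip_simps)
      then show ?thesis using f g by (auto simp: N_def C0_mult D.closed)
    qed
    fix g assume g: "g \<in> N"
    then have gC: "g \<in> C0 X" by (simp add: N_def)
    have "hact ?D (\<lambda>x. f x + g x) y = hadd ?D (hact ?D f y) (hact ?D g y)" if "y \<in> carrier ?D" for y
      using that fC gC C0_add[OF fC gC] by (intro D.weak_eqI) (auto simp: D.ip_simps distrib_right)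
    then show "(\<lambda>x. f x + g x) \<in> N" using f g by (auto simp: N_def C0_add intro: D.cspan_add[OF G])
  next
    fix g assume g: "g \<in> C0 X" "\<forall>e>0. \<exists>f\<in>N. \<forall>x. cmod (g x - f x) \<le> e"
    have "hact ?D g y \<in> cspan ?D ?G" if y: "y \<in> carrier ?D" for y
    proof (rule D.cspan_limit[OF G D.act_closed[OF g(1) y]])
      obtain B where B: "B \<ge> 0" "\<And>x. ptnorm ?D y x \<le> B" using D.bounded_ptnorm[OF y] by blast
      fix e :: real assume e: "e > 0"
      then have "e / (B + 1) > 0" using B by simp
      then obtain f where f: "f \<in> N" "\<And>x. cmod (g x - f x) \<le> e / (B + 1)" using g(2) by blast
      have fC: "f \<in> C0 X" using f(1) by (simp add: N_def)
      have "near ?D e (hact ?D g y) (hact ?D f y)"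
        unfolding near_def
      proof
        fix x
        have "hsub ?D (hact ?D g y) (hact ?D f y) = hact ?D (\<lambda>x. g x - f x) y"
          using y fC g(1) C0_diff[OF g(1) fC] by (intro D.weak_eqI) (auto simp: D.ip_simps left_diff_distrib)
        then have "ptnorm ?D (hsub ?D (hact ?D g y) (hact ?D f y)) x = cmod (g x - f x) * ptnorm ?D y x"
          using D.ptnorm_act[OF C0_diff[OF g(1) fC] y] by simp
        also have "\<dots> \<le> e / (B + 1) * (B + 1)"
          using f(2)[of x] B(2)[of x] B(1) e D.ptnorm_nonneg[OF y, of x] by (intro mult_mono) auto
        also have "\<dots> = e" using B(1) by simp
        finally show "ptnorm ?D (hsub ?D (hact ?D g y) (hact ?D f y)) x \<le> e" .
      qed
      then show "\<exists>b\<in>cspan ?D ?G. near ?D e (hact ?D g y) b" using f(1) y by (auto simp: N_def)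
    qed
    then show "g \<in> N" using g(1) by (simp add: N_def)
  qed
  moreover have "idl P \<subseteq> N" if P: "P \<in> U" for P
  proof
    fix f assume f: "f \<in> idl P"
    have PI: "P \<in> ISub C" using U P by blast
    note JP = rep_ISub(4)[OF PI] and MP = restr_rep[OF PI A] and cP = incl_ten[OF PI K(1) le[OF P] A]
    have fC: "f \<in> C0 X" using closed_idealD(2)[OF JP f] .
    have "hact ?D f y \<in> ?G" if y: "y \<in> carrier ?D" for y
    proof -
      have y': "y \<in> carrier (hdom (restr C (rep K) A))" using y MK by simp
      define a where "a = hmap (restr C (rep K) A) y"
      have a: "a \<in> carrier A" using hmap_closed[OF MK(2,4) y'] by (simp add: a_def)
      have "hinner A (hact A f a) (hact A f a) = (\<lambda>x. (hinner A a a x * cnj (f x)) * f x)"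
        using a fC by (auto simp: SA.ip_simps mult_ac)
      moreover have "(\<lambda>x. (hinner A a a x * cnj (f x)) * f x) \<in> idl P"
        by (rule closed_idealD(6)[OF JP C0_mult[OF SA.ip_C0[OF a a] C0_cnj[OF fC]] f])
      ultimately have "hact A f a \<in> img (restr C (rep P) A)" using a fC by (simp add: MP(5) SA.closed)
      then obtain z where z: "z \<in> carrier (D_obj C A P)" "hmap (restr C (rep P) A) z = hact A f a"
        using MP(3) by (auto simp: img_def)
      have "hact ?D f y = hmap (TenA C (sub_incl C P K) (Id C A)) z"
      proof (rule isom_inj[OF MK(1)])
        have "hmap (restr C (rep K) A) (hact ?D f y) = hact A f a"
          using hmap_act[OF MK(2) fC y'] MK by (simp add: a_def)
        also have "\<dots> = hmap (restr C (rep K) A \<circ>\<^sub>h TenA C (sub_incl C P K) (Id C A)) z"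
          using z cP by simp
        also have "\<dots> = hmap (restr C (rep K) A) (hmap (TenA C (sub_incl C P K) (Id C A)) z)"
          by (rule Comp_arr(4)) (use z(1) cP in simp)
        finally show "hmap (restr C (rep K) A) (hact ?D f y)
            = hmap (restr C (rep K) A) (hmap (TenA C (sub_incl C P K) (Id C A)) z)" .
      qed (use y fC MK c[OF P z(1)] in \<open>simp_all add: D.closed\<close>)
      then show ?thesis using P z(1) by blast
    qed
    then show "f \<in> N" using fC D.cspan_base[OF G] by (simp add: N_def)
  qed
  ultimately have KN: "idl K \<subseteq> N" unfolding K(2) by (intro join_idl(3)[OF U])
  have "y \<in> cspan ?D ?G" if y: "y \<in> carrier ?D" for y
  proof (rule D.cspan_limit[OF G y])
    fix e :: real assume e: "e > 0"
    have y': "y \<in> carrier (hdom (restr C (rep K) A))" using y MK by simp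
    have "hmap (restr C (rep K) A) y \<in> img (restr C (rep K) A)" using y' by (simp add: img_def)
    then have "hinner A (hmap (restr C (rep K) A) y) (hmap (restr C (rep K) A) y) \<in> idl K" unfolding MK(5) by blast
    moreover have "hinner A (hmap (restr C (rep K) A) y) (hmap (restr C (rep K) A) y) = hinner ?D y y"
      using isom_ip[OF MK(1) y' y'] MK by (auto simp: fun_eq_iff)
    ultimately have "hinner ?D y y \<in> idl K" by simp
    then have "soft_support (e^2) (hinner ?D y y) \<in> N"
      using soft_support_ideal[OF rep_ISub(4)[OF K(1)]] D.ip_nonneg[OF y] e KN by (simp add: subset_iff)
    then have "hact ?D (soft_support (e^2) (hinner ?D y y)) y \<in> cspan ?D ?G" using y by (simp add: N_def)
    then show "\<exists>b\<in>cspan ?D ?G. near ?D e y b"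
      using soft_support_act[OF D.premodule_axioms y e] by blast
  qed
  then show ?thesis using G by (auto simp: generates_def)
qed

text \<open>The mediating morphism is prescribed on the images of the \<open>S \<otimes> A\<close> in \<open>(\<Squnion>U) \<otimes> A\<close>, which generate. It remains to see that a
  finite sum of elements is at least as large, at each point \<open>x\<close>, as the sum of their values under the cocone. If
  \<open>e(x) \<noteq> 0\<close> for a function \<open>e\<close> in the ideal of some \<open>Q \<in> U\<close>, both sums may be multiplied by \<open>e\<close>, and then they are images
  of one element \<open>y\<close> of the object of \<open>Q\<close>: under an isometry and under a contraction. If there is no such \<open>e\<close>, all values
  vanish at \<open>x\<close>.\<close>

theorem colimit_Hilb:
  fixes U :: "('v, 'x) harr set set"
  assumes U: "U \<subseteq> ISub C" "idem C U" and A: "hil A"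
    and K: "K \<in> ISub C" "idl K = join_ideal (idl ` U)"
  shows "is_colimit C U (D_obj C A) (D_arr C A) (D_obj C A K) (\<lambda>P. TenA C (sub_incl C P K) (Id C A))"
  unfolding is_colimit_def
proof (intro conjI allI impI)
  let ?D = "D_obj C A K" and ?c = "\<lambda>P. TenA C (sub_incl C P K) (Id C A)"
  have le: "idl P \<subseteq> idl K" if "P \<in> U" for P
    using join_idl(2)[OF U(1)] that K(2) by auto
  show coc: "is_cocone C U (D_obj C A) (D_arr C A) ?D ?c"
    by (rule cocone_inclusions[OF U(1) A K(1) le])
  note MK = restr_rep[OF K(1) A] and gen = inclusions_generate[OF U(1) A K]
  note c = incl_ten[OF subsetD[OF U(1)] K(1) le A]
  fix Z b assume b: "is_cocone C U (D_obj C A) (D_arr C A) Z b"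
  have Z: "hil Z" using b by (simp add: is_cocone_def)
  have bP: "arr (b P)" "hdom (b P) = D_obj C A P" "hcod (b P) = Z" if "P \<in> U" for P
    using b that by (auto simp: is_cocone_def homs_arr)
  interpret D: separated_module X ?D by (rule separated[OF MK(6)])
  interpret SZ: separated_module X Z by (rule separated[OF Z])
  define G where "G = {(hmap (?c P) z, hmap (b P) z) | P z. P \<in> U \<and> z \<in> carrier (D_obj C A P)}"
  have GE: "\<exists>P z. P \<in> U \<and> z \<in> carrier (D_obj C A P) \<and> u = hmap (?c P) z \<and> v = hmap (b P) z" if "(u, v) \<in> G" for u v
    using that unfolding G_def by blast
  have GI: "(hmap (?c P) z, hmap (b P) z) \<in> G" if "P \<in> U" "z \<in> carrier (D_obj C A P)" for P z
    using that unfolding G_def by blast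
  have Gsub: "G \<subseteq> carrier ?D \<times> carrier Z"
    unfolding G_def using c bP by (auto intro!: hmap_closed)
  have sets: "set (map fst l) \<subseteq> carrier ?D" "set (map snd l) \<subseteq> carrier Z" if "l \<in> lists G" for l
    using that Gsub by (auto simp: in_lists_conv_set subset_iff mem_Times_iff)
  have fstG: "fst ` G = {hmap (?c P) z | P z. P \<in> U \<and> z \<in> carrier (D_obj C A P)}"
    unfolding G_def by (auto simp: image_def; blast)
  obtain F where F: "F \<in> hhom X ?D Z" "\<And>u v. (u, v) \<in> G \<Longrightarrow> hmap F u = v"
  proof (rule hhom_on_contractive_generators[OF MK(6) Z Gsub])
    show "generates ?D (fst ` G)" unfolding fstG by (rule gen)
    fix u v assume "(u, v) \<in> G"
    then obtain P z where P: "P \<in> U" and z: "z \<in> carrier (D_obj C A P)" and uv: "u = hmap (?c P) z" "v = hmap (b P) z"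
      using GE by blast
    have DP: "hil (D_obj C A P)" using restr_rep(6)[OF subsetD[OF U(1) P] A] .
    note hc = arr_hhom[OF c(1)[OF P P], unfolded c(2,3)[OF P P]] and hb = arr_hhom[OF bP(1)[OF P], unfolded bP(2,3)[OF P]]
    have "hscale (D_obj C A P) k z \<in> carrier (D_obj C A P)" for k
      using DP z by (rule hilbert_module.scale_closed)
    then show "(hscale ?D k u, hscale Z k v) \<in> G" for k
      using GI[OF P] hhomD(5)[OF hc z] hhomD(5)[OF hb z] unfolding uv by metis
    show "(hact ?D f u, hact Z f v) \<in> G" if f: "f \<in> C0 X" for f
      using GI[OF P act_in[OF DP f z]] hhomD(6)[OF hc f z] hhomD(6)[OF hb f z] unfolding uv by simp
  next
    fix l x assume l: "l \<in> lists G"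
    show "ptnorm Z (hsum Z (map snd l)) x \<le> ptnorm ?D (hsum ?D (map fst l)) x"
    proof (cases "\<exists>Q\<in>U. \<exists>e\<in>idl Q. e x \<noteq> 0")
      case True
      then obtain Q e where Q: "Q \<in> U" and e: "e \<in> idl Q" "e x \<noteq> 0" by blast
      have QI: "Q \<in> ISub C" using U Q by blast
      have eC: "e \<in> C0 X" using closed_idealD(2)[OF rep_ISub(4)[OF QI] e(1)] .
      have DQ: "hil (D_obj C A Q)" using restr_rep(6)[OF QI A] .
      interpret DQ: separated_module X "D_obj C A Q" by (rule separated[OF DQ])
      note hc = arr_hhom[OF c(1)[OF Q Q], unfolded c(2,3)[OF Q Q]] and hb = arr_hhom[OF bP(1)[OF Q], unfolded bP(2,3)[OF Q]]
      have "\<exists>y\<in>carrier (D_obj C A Q). hmap (?c Q) y = hact ?D e (hsum ?D (map fst l))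
          \<and> hmap (b Q) y = hact Z e (hsum Z (map snd l))"
        using l
      proof (induction l)
        case Nil
        then show ?case
          using hhom_zero[OF DQ MK(6) hc] hhom_zero[OF DQ Z hb] eC DQ.zero_closed
          by (intro bexI[of _ "hzero (D_obj C A Q)"]) (simp_all add: D.act_zero SZ.act_zero)
      next
        case (Cons p l)
        then have l: "l \<in> lists G" and p: "p \<in> G" by auto
        obtain y where y: "y \<in> carrier (D_obj C A Q)" "hmap (?c Q) y = hact ?D e (hsum ?D (map fst l))"
          "hmap (b Q) y = hact Z e (hsum Z (map snd l))" using Cons.IH l by blast
        obtain P z where P: "P \<in> U" and z: "z \<in> carrier (D_obj C A P)"
          and pz: "fst p = hmap (?c P) z" "snd p = hmap (b P) z"
          using GE[of "fst p" "snd p"] p by auto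
        obtain y' where y': "y' \<in> carrier (D_obj C A Q)"
          "\<And>Z b. is_cocone C U (D_obj C A) (D_arr C A) Z b \<Longrightarrow> hmap (b Q) y' = hact Z e (hmap (b P) z)"
          using common_refinement[OF U A P Q e(1) z] by blast
        have s: "fst p \<in> carrier ?D" "snd p \<in> carrier Z" using Gsub p by (cases p; auto)+
        have "hact ?D e (hadd ?D (fst p) (hsum ?D (map fst l))) = hadd ?D (hact ?D e (fst p)) (hact ?D e (hsum ?D (map fst l)))"
          using s sets[OF l] eC by (intro D.weak_eqI) (auto simp: D.ip_simps D.hsum_closed distrib_left)
        moreover have "hact Z e (hadd Z (snd p) (hsum Z (map snd l))) = hadd Z (hact Z e (snd p)) (hact Z e (hsum Z (map snd l)))"
          using s sets[OF l] eC by (intro SZ.weak_eqI) (auto simp: SZ.ip_simps SZ.hsum_closed distrib_left)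
        ultimately show ?case
          using y y'(1) y'(2)[OF coc] y'(2)[OF b] pz hhomD(4)[OF hc y'(1) y(1)] hhomD(4)[OF hb y'(1) y(1)]
          by (intro bexI[of _ "hadd (D_obj C A Q) y' y"]) (simp_all add: DQ.closed)
      qed
      then obtain y where y: "y \<in> carrier (D_obj C A Q)" "hmap (?c Q) y = hact ?D e (hsum ?D (map fst l))"
        "hmap (b Q) y = hact Z e (hsum Z (map snd l))" by blast
      have "cmod (e x) * ptnorm Z (hsum Z (map snd l)) x = ptnorm Z (hmap (b Q) y) x"
        using y eC sets[OF l] by (simp add: SZ.ptnorm_act SZ.hsum_closed)
      also have "\<dots> \<le> ptnorm (D_obj C A Q) y x"
        using arr_ptnorm_le[OF bP(1)[OF Q], of y x] bP[OF Q] y by simp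
      also have "\<dots> = ptnorm ?D (hmap (?c Q) y) x"
        using isom_ptnorm[OF c(5)[OF Q Q], of y x] c[OF Q Q] y(1) by simp
      also have "\<dots> = cmod (e x) * ptnorm ?D (hsum ?D (map fst l)) x"
        using y eC sets[OF l] by (simp add: D.ptnorm_act D.hsum_closed)
      finally show ?thesis using e(2) by simp
    next
      case False
      have "ptnorm Z (hsum Z (map snd l)) x \<le> 0"
        using l
      proof (induction l)
        case Nil
        then show ?case by (simp add: SZ.ptnorm_zero)
      next
        case (Cons p l)
        then have l: "l \<in> lists G" and p: "p \<in> G" by auto
        obtain P z where P: "P \<in> U" and z: "z \<in> carrier (D_obj C A P)" and pz: "snd p = hmap (b P) z"
          using GE[of "fst p" "snd p"] p by auto
        have PI: "P \<in> ISub C" using U P by blast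
        note MP = restr_rep[OF PI A]
        have z': "z \<in> carrier (hdom (restr C (rep P) A))" using z MP by simp
        have "hmap (restr C (rep P) A) z \<in> img (restr C (rep P) A)" using z' by (simp add: img_def)
        then have "hinner A (hmap (restr C (rep P) A) z) (hmap (restr C (rep P) A) z) \<in> idl P" unfolding MP(5) by blast
        then have "hinner A (hmap (restr C (rep P) A) z) (hmap (restr C (rep P) A) z) x = 0" using False P by blast
        then have "ptnorm (D_obj C A P) z x = 0"
          using isom_ptnorm[OF MP(1) z', of x] MP by (simp add: ptnorm_def)
        then have "ptnorm Z (snd p) x \<le> 0"
          using arr_ptnorm_le[OF bP(1)[OF P], of z x] bP[OF P] z pz by simp
        moreover have "snd p \<in> carrier Z" using Gsub p by (cases p; auto)+
        then have "ptnorm Z (hsum Z (map snd (p # l))) x \<le> ptnorm Z (snd p) x + ptnorm Z (hsum Z (map snd l)) x"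
          using SZ.ptnorm_add[of "snd p" "hsum Z (map snd l)" x] sets[OF l] by (simp add: SZ.hsum_closed)
        ultimately show ?case using Cons.IH l by simp
      qed
      also have "0 \<le> ptnorm ?D (hsum ?D (map fst l)) x"
        using sets[OF l] by (intro D.ptnorm_nonneg D.hsum_closed)
      finally show ?thesis .
    qed
  qed blast
  have aF: "arr F" "hdom F = ?D" "hcod F = Z" using arrI[OF F(1) MK(6) Z] by auto
  show "\<exists>!h. h \<in> homs C ?D Z \<and> (\<forall>P\<in>U. h \<circ>\<^sub>h ?c P = b P)"
  proof (rule ex1I[of _ F])
    have "F \<circ>\<^sub>h ?c P = b P" if P: "P \<in> U" for P
      by (rule arr_eqI1[where A = "D_obj C A P"])
        (use aF c[OF P P] bP[OF P] F(2)[OF GI[OF P]] in \<open>simp_all add: Comp_arr\<close>)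
    then show "F \<in> homs C ?D Z \<and> (\<forall>P\<in>U. F \<circ>\<^sub>h ?c P = b P)" using aF by (simp add: homs_arr)
    fix h assume h: "h \<in> homs C ?D Z \<and> (\<forall>P\<in>U. h \<circ>\<^sub>h ?c P = b P)"
    show "h = F"
    proof (rule arr_eqI[OF _ aF(1) _ aF(2) _ gen])
      fix y assume "y \<in> {hmap (?c P) z | P z. P \<in> U \<and> z \<in> carrier (D_obj C A P)}"
      then obtain P z where P: "P \<in> U" and z: "z \<in> carrier (D_obj C A P)" "y = hmap (?c P) z" by blast
      have "hmap h y = hmap (h \<circ>\<^sub>h ?c P) z" using z c[OF P P] by (simp add: Comp_arr)
      also have "\<dots> = hmap (b P) z" using h P by simp
      also have "\<dots> = hmap F y" using F(2)[OF GI[OF P z(1)]] z(2) by simp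
      finally show "hmap h y = hmap F y" .
    qed (use h aF in \<open>auto simp: homs_arr\<close>)
  qed
qed

theorem locale_based_Hilb: "locale_based (C :: (('v, 'x) hobj, ('v, 'x) harr) braided_cat)"
proof (intro locale_based.intro locale_based_axioms.intro braided_Hilb stiff_Hilb frame_Hilb)
  fix U :: "('v, 'x) harr set set" and A :: "('v, 'x) hobj"
  assume U: "U \<subseteq> ISub C" "idem C U" and "A \<in> Obj C"
  then have A: "hil A" by simp
  show "is_colimit C U (D_obj C A) (D_arr C A) (D_obj C A (\<Squnion>\<^bsub>L\<^esub> U))
      (\<lambda>P. TenA C (sub_incl C P (\<Squnion>\<^bsub>L\<^esub> U)) (Id C A))"
    by (rule colimit_Hilb[OF U A L_sup[OF U(1)]])
qed

end

theorem proposition7p13: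
  fixes X :: "'x topology"
    and H :: "(('v, 'x) hobj, ('v, 'x) harr) braided_cat"
  assumes "locally_compact_space X" and "Hausdorff_space X"
    and "H = Hilb X"
  shows "symmetric_monoidal_category H \<and> locale_based H"
  unfolding assms(3)
  by (simp add: function_space.symmetric_Hilb function_space.locale_based_Hilb)

end
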